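(* Let $F:\mathcal U\times\mathbb T^d\times\Lambda\to\mathbb R\times\mathbb R^m\times\mathbb T^d$ be a real analytic map of the form $$F\begin{pmatrix} x \\ y \\ \theta \\ \lambda \end{pmatrix}=\begin{pmatrix} x-a(\theta,\lambda)x^N+f_N(x,y,\theta,\lambda)+f_{\ge N+1}(x,y,\theta,\lambda) \\ y+x^{N-1}B(\theta,\lambda)y+g_N(x,y,\theta,\lambda)+g_{\ge N+1}(x,y,\theta,\lambda) \\ \theta+\omega+h_P(x,y,\theta,\lambda)+h_{\ge P+1}(x,y,\theta,\lambda) \end{pmatrix}$$ satisfying conditions (i)–(v) of the context. Assume that 1. $P\ge N$; 2. either $\omega$ is Diophantine or the functions $a,B$ do not depend on $\theta$; 3. $\overline a(\lambda)>0$ for $\lambda\in\Lambda$; 4. $\operatorname{Re}\operatorname{Spec}\overline B(\lambda)>0$ for $\lambda\in\Lambda$. Let $Q\ge N$ and assume that for some $\beta_0,\rho_0,\sigma_0>0$ and $\Lambda_{\mathbb C}\subset\mathbb C^p$ there exist analytic maps $K^{\le}:S(\beta_0,\rho_0)\times\mathbb T^d_{\sigma_0}\times\Lambda_{\mathbb C}\to\mathbb C^{1+m}\times\mathbb T^d_{\sigma_0}$ and $R^{\le}:S(\beta_0,\rho_0)\times\mathbb T^d_{\sigma_0}\times\Lambda_{\mathbb C}\to\mathbb C\times\mathbb T^d_{\sigma_0}$ satisfying, for some $C>0$, $$|K^{\le}_x(x,\theta,\lambda)-x|\le C|x|^2,\qquad\|K^{\le}_y(x,\theta,\lambda)\|\le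 C|x|^2,\qquad\|K^{\le}_\theta(x,\theta,\lambda)-\theta\|\le C|x|,$$ $$R^{\le}_x(x,\theta,\lambda)=x-\overline a(\lambda)x^N+\mathcal O(|x|^{N+1}),\qquad R^{\le}_\theta(x,\theta,\lambda)=\theta+\omega,$$ and such that, in the complex domain $S(\beta_0,\rho_0)\times\mathbb T^d_{\sigma_0}\times\Lambda_{\mathbb C}$, $$E^{\le}=(E^{\le}_x,E^{\le}_y,E^{\le}_\theta):=F\circ K^{\le}-K^{\le}\circ R^{\le}=\big(\mathcal O(|x|^{Q+N}),\mathcal O(|x|^{Q+N}),\mathcal O(|x|^{Q+N-1})\big)$$ (where $\beta_0,\rho_0$ are implicitly assumed small enough for the holomorphic extension of $F$ to be defined on the image of $K^{\le}$ and for $K^{\le}\circ R^{\le}$ to be well defined). Then, for any $0<\sigma<\sigma_0$, there exist $\beta,\rho>0$, an open set $\Lambda_{\mathbb C}'\subset\Lambda_{\mathbb C}$ and a unique analytic function $$\Delta=(\Delta_x,\Delta_y,\Delta_\theta):S(\beta,\rho)\times\mathbb T^d_\sigma\times\Lambda_{\mathbb C}'\to\mathbb C^{1+m}\times\mathbb T^d_\sigma$$ satisfying $$\Delta_{x},\Delta_y=\mathcal O(|x|^{Q+1}),\qquad\Delta_\theta=\mathcal O(|x|^{Q}),$$ such that $$F\circ(K^{\le}+\Delta)=(K^{\le}+\Delta)\circ R^{\le}\qquad\text{in }S(\beta,\rho)\times\mathbb T^d_\sigma\times\Lambda_{\mathbb C}'.$$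
   Context: **Notation.** $\mathbb T^d=(\mathbb R/\mathbb Z)^d$; $\mathbb T^d_\sigma=\{\theta\in(\mathbb C/\mathbb Z)^d:|\operatorname{Im}\theta_i|<\sigma\}$; $S(\beta,\rho)=\{re^{i\varphi}\in\mathbb C:0<r<\rho,|\varphi|<\beta/2\}$. $\mathcal U\subset\mathbb R\times\mathbb R^m$ is an open neighbourhood of $(0,0)$, $\Lambda\subset\mathbb R^p$ a parameter set. For a real set $U$, $U_{\mathbb C}$ denotes a complex neighbourhood of $U$. $\overline h(\lambda)$ denotes the average over $\theta\in\mathbb T^d$ of $h(\theta,\lambda)$. Subscripts $x,y,\theta$ on a map denote the corresponding components. Compositions are at fixed parameter: $(h\circ g)(z,\lambda)=h(g(z,\lambda),\lambda)$. $\mathcal O(|x|^l)$ estimates are uniform in the remaining variables. $\omega\in\mathbb R^d$ is Diophantine (for maps) if there are $c>0,\tau\ge d$ with $|\omega\cdot k-l|\ge c|k|^{-\tau}$ for all $k\in\mathbb Z^d\setminus\{0\}$, $l\in\mathbb Z$, $|k|=\sum|k_i|$. Real analytic functions are identified with their holomorphic extensions. **Conditions (i)–(v).** (i) $N,P$ are integers; (ii) $N\ge2$, $P\ge1$; (iii) $\omega\in\mathbb R^d$; (iv) $f_N,g_N$ are homogeneous polynomials of degree $N$ in $(x,y)$ with coefficients depending on $(\theta,\lambda)$, $h_P$ is a homogeneous polynomial of degree $P$ in $(x,y)$ with coefficients depending on $(\theta,\lambda)$, and $f_N(x,0,\theta,\lambda)=0$, $g_N(x,0,\theta,\lambda)=0$,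 $D_yg_N(x,0,\theta,\lambda)=0$; (v) $f_{\ge N+1},g_{\ge N+1}$ vanish together with their $(x,y)$-derivatives up to order $N$ at $(0,0,\theta,\lambda)$, and $h_{\ge P+1}$ vanishes with its $(x,y)$-derivatives up to order $P$ there. Here $a$ is scalar valued and $B$ is $m\times m$ matrix valued. *)

theory Defs
  imports "HOL-Analysis.Analysis"
begin

text \<open>
  Points of the complex torus \<open>(\<complex>/\<int>)\<^sup>d\<close> are represented by vectors in \<open>complex ^ 'd\<close>, taken modulo
  the lattice of integer vectors; a function on the torus is a function of a representative that is
  invariant under integer translations, and an equation between torus points is a congruence.
  A point with an angle and a parameter is a triple \<open>(u, \<theta>, \<mu>)\<close>, where \<open>u\<close> is \<open>x\<close> or the
  pair \<open>(x, y)\<close>; the real torus and the real parameters are embedded by \<open>cvec\<close>.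
\<close>

type_synonym 'm xy = "complex \<times> (complex ^ 'm)"
type_synonym ('d, 'p) angle_param = "(complex ^ 'd) \<times> (complex ^ 'p)"
type_synonym ('m, 'd) xy_angle = "'m xy \<times> (complex ^ 'd)"

class complex_normed_space = real_normed_vector +
  fixes scaleC :: "complex \<Rightarrow> 'a \<Rightarrow> 'a" (infixr "*\<^sub>C" 75)
  assumes scaleC_add_right: "c *\<^sub>C (v + w) = c *\<^sub>C v + c *\<^sub>C w"
    and scaleC_add_left: "(b + c) *\<^sub>C v = b *\<^sub>C v + c *\<^sub>C v"
    and scaleC_scaleC: "b *\<^sub>C c *\<^sub>C v = (b * c) *\<^sub>C v"
    and scaleR_scaleC: "r *\<^sub>R v = complex_of_real r *\<^sub>C v"
    and norm_scaleC: "norm (c *\<^sub>C v) = cmod c * norm v"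

instantiation complex :: complex_normed_space
begin
definition scaleC_complex :: "complex \<Rightarrow> complex \<Rightarrow> complex"
  where "scaleC_complex c z = c * z"
instance
  by standard (simp_all add: scaleC_complex_def algebra_simps norm_mult scaleR_conv_of_real)
end

instantiation prod :: (complex_normed_space, complex_normed_space) complex_normed_space
begin
definition scaleC_prod :: "complex \<Rightarrow> 'a \<times> 'b \<Rightarrow> 'a \<times> 'b"
  where "scaleC_prod c z = (c *\<^sub>C fst z, c *\<^sub>C snd z)"
instance
proof
  fix b c :: complex and v w :: "'a \<times> 'b" and r :: real
  show "c *\<^sub>C (v + w) = c *\<^sub>C v + c *\<^sub>C w" "(b + c) *\<^sub>C v = b *\<^sub>C v + c *\<^sub>C v"
    "b *\<^sub>C c *\<^sub>C v = (b * c) *\<^sub>C v" "r *\<^sub>R v = complex_of_real r *\<^sub>C v"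
    by (simp_all add: scaleC_prod_def prod_eq_iff scaleC_add_right scaleC_add_left
        scaleC_scaleC scaleR_scaleC)
  show "norm (c *\<^sub>C v) = cmod c * norm v"
    by (simp add: scaleC_prod_def norm_prod_def norm_scaleC power_mult_distrib real_sqrt_mult
        flip: distrib_left)
qed
end

instantiation vec :: (complex_normed_space, finite) complex_normed_space
begin
definition scaleC_vec :: "complex \<Rightarrow> ('a, 'b) vec \<Rightarrow> ('a, 'b) vec"
  where "scaleC_vec c v = (\<chi> i. c *\<^sub>C (v $ i))"
instance
proof
  fix b c :: complex and v w :: "('a, 'b) vec" and r :: real
  show "c *\<^sub>C (v + w) = c *\<^sub>C v + c *\<^sub>C w" "(b + c) *\<^sub>C v = b *\<^sub>C v + c *\<^sub>C v"
    "b *\<^sub>C c *\<^sub>C v = (b * c) *\<^sub>C v" "r *\<^sub>R v = complex_of_real r *\<^sub>C v"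
    by (simp_all add: scaleC_vec_def vec_eq_iff scaleC_add_right scaleC_add_left
        scaleC_scaleC scaleR_scaleC)
  show "norm (c *\<^sub>C v) = cmod c * norm v"
    by (simp add: scaleC_vec_def norm_vec_def norm_scaleC L2_set_right_distrib)
qed
end

definition cholomorphic_on ::
  "('a::complex_normed_space \<Rightarrow> 'b::complex_normed_space) \<Rightarrow> 'a set \<Rightarrow> bool"
  (infix "cholomorphic'_on" 50)
  where "f cholomorphic_on D \<longleftrightarrow> open D \<and>
    (\<forall>z\<in>D. \<exists>L. (f has_derivative L) (at z) \<and> (\<forall>c v. L (c *\<^sub>C v) = c *\<^sub>C L v))"

lemma cholomorphic_on_complex_iff:
  fixes f :: "complex \<Rightarrow> complex"
  shows "f cholomorphic_on D \<longleftrightarrow> open D \<and> f holomorphic_on D"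
proof -
  have "(\<exists>L. (f has_derivative L) (at z) \<and> (\<forall>c v. L (c *\<^sub>C v) = c *\<^sub>C L v)) \<longleftrightarrow>
      f field_differentiable (at z)" (is "?A \<longleftrightarrow> ?B") for z
  proof
    assume ?A
    then obtain L where L: "(f has_derivative L) (at z)" and lin: "\<And>c v. L (c * v) = c * L v"
      unfolding scaleC_complex_def by blast
    have "L v = L 1 * v" for v
      using lin[of v 1] by (simp add: mult.commute)
    then have "L = (*) (L 1)"
      by (rule ext)
    with L have "(f has_field_derivative L 1) (at z)"
      unfolding has_field_derivative_def by (rule subst[rotated])
    then show ?B
      unfolding field_differentiable_def by blast
  next
    assume ?B
    then obtain d where d: "(f has_derivative (*) d) (at z)"
      unfolding field_differentiable_def has_field_derivative_def by blast
    have "d * (c * v) = c * (d * v)" for c v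
      by (rule mult.left_commute)
    with d show ?A
      unfolding scaleC_complex_def by blast
  qed
  then show ?thesis
    unfolding cholomorphic_on_def using holomorphic_on_open[of D f]
    unfolding field_differentiable_def by blast
qed

definition cvec :: "real ^ 'n \<Rightarrow> complex ^ 'n"
  where "cvec v = (\<chi> i. complex_of_real (v $ i))"

definition sector :: "real \<Rightarrow> real \<Rightarrow> complex set"
  where "sector \<beta> \<rho> = {complex_of_real r * cis \<phi> | r \<phi>. 0 < r \<and> r < \<rho> \<and> \<bar>\<phi>\<bar> < \<beta> / 2}"

definition strip :: "real \<Rightarrow> (complex ^ 'd) set"
  where "strip \<sigma> = {\<theta>. \<forall>i. \<bar>Im (\<theta> $ i)\<bar> < \<sigma>}"

definition lattice_pts :: "(complex ^ 'd) set"
  where "lattice_pts = {k. \<forall>i. k $ i \<in> \<int>}"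

definition torus_eq :: "complex ^ 'd \<Rightarrow> complex ^ 'd \<Rightarrow> bool" (infix "\<doteq>" 50)
  where "\<theta> \<doteq> \<theta>' \<longleftrightarrow> \<theta> - \<theta>' \<in> lattice_pts"

definition torus_norm :: "complex ^ 'd \<Rightarrow> real"
  where "torus_norm \<theta> = infdist \<theta> lattice_pts"

text \<open>Analytic functions and maps on a domain \<open>D\<close> that is invariant under integer translations of
  \<open>\<theta>\<close>. A torus-valued map is analytic if near every point it agrees modulo the lattice with a
  holomorphic vector-valued map; the chosen representatives need not be continuous.\<close>

definition analytic_coeff ::
  "real \<Rightarrow> (complex ^ 'p) set \<Rightarrow>
   (('d::finite, 'p::finite) angle_param \<Rightarrow> 'b::complex_normed_space) \<Rightarrow> bool"
  where "analytic_coeff \<sigma> L f \<longleftrightarrow> f cholomorphic_on (strip \<sigma> \<times> L) \<and>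
    (\<forall>\<theta>\<in>strip \<sigma>. \<forall>\<mu>\<in>L. \<forall>k\<in>lattice_pts. f (\<theta> + k, \<mu>) = f (\<theta>, \<mu>))"

definition torus_domain ::
  "('a::complex_normed_space \<times> ('d::finite, 'p::finite) angle_param) set \<Rightarrow> bool"
  where "torus_domain D \<longleftrightarrow> open D \<and>
    (\<forall>u \<theta> \<mu>. (u, \<theta>, \<mu>) \<in> D \<longrightarrow> (\<forall>k\<in>lattice_pts. (u, \<theta> + k, \<mu>) \<in> D))"

definition analytic_fun ::
  "('a::complex_normed_space \<times> ('d::finite, 'p::finite) angle_param) set \<Rightarrow>
   ('a \<times> ('d, 'p) angle_param \<Rightarrow> 'b::complex_normed_space) \<Rightarrow> bool"
  where "analytic_fun D f \<longleftrightarrow> torus_domain D \<and> f cholomorphic_on D \<and>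
    (\<forall>u \<theta> \<mu>. (u, \<theta>, \<mu>) \<in> D \<longrightarrow> (\<forall>k\<in>lattice_pts. f (u, \<theta> + k, \<mu>) = f (u, \<theta>, \<mu>)))"

definition analytic_torus_valued ::
  "('a::complex_normed_space \<times> ('d::finite, 'p::finite) angle_param) set \<Rightarrow>
   ('a \<times> ('d, 'p) angle_param \<Rightarrow> complex ^ 'd) \<Rightarrow> bool"
  where "analytic_torus_valued D g \<longleftrightarrow> torus_domain D \<and>
    (\<forall>z\<in>D. \<exists>V h. z \<in> V \<and> V \<subseteq> D \<and> h cholomorphic_on V \<and> (\<forall>w\<in>V. g w \<doteq> h w)) \<and>
    (\<forall>u \<theta> \<mu>. (u, \<theta>, \<mu>) \<in> D \<longrightarrow> (\<forall>k\<in>lattice_pts. g (u, \<theta> + k, \<mu>) \<doteq> g (u, \<theta>, \<mu>)))"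

definition analytic_map ::
  "('a::complex_normed_space \<times> ('d::finite, 'p::finite) angle_param) set \<Rightarrow>
   ('a \<times> ('d, 'p) angle_param \<Rightarrow> 'b::complex_normed_space \<times> (complex ^ 'd)) \<Rightarrow> bool"
  where "analytic_map D G \<longleftrightarrow>
    analytic_fun D (\<lambda>z. fst (G z)) \<and> analytic_torus_valued D (\<lambda>z. snd (G z))"

definition real_points ::
  "(real \<times> (real ^ 'm)) set \<Rightarrow> (real ^ 'p) set \<Rightarrow>
   ('m::finite xy \<times> ('d::finite, 'p::finite) angle_param) set"
  where "real_points U \<Lambda> =
    {((complex_of_real x, cvec y), cvec \<theta>, cvec \<mu>) | x y \<theta> \<mu>. (x, y) \<in> U \<and> \<mu> \<in> \<Lambda>}"

text \<open>A real analytic map on \<open>U \<times> \<bbbT>\<^sup>d \<times> \<Lambda>\<close> is identified with a holomorphic extension \<open>F\<close> to the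
  complex neighbourhood \<open>W\<close>.\<close>

definition real_analytic_map ::
  "(real \<times> (real ^ 'm)) set \<Rightarrow> (real ^ 'p) set \<Rightarrow>
   ('m::finite xy \<times> ('d::finite, 'p::finite) angle_param) set \<Rightarrow>
   ('m xy \<times> ('d, 'p) angle_param \<Rightarrow> ('m, 'd) xy_angle) \<Rightarrow> bool"
  where "real_analytic_map U \<Lambda> W F \<longleftrightarrow>
    real_points U \<Lambda> \<subseteq> W \<and> analytic_map W F \<and>
    (\<forall>z\<in>real_points U \<Lambda>. fst (fst (F z)) \<in> \<real> \<and> (\<forall>i. snd (fst (F z)) $ i \<in> \<real>) \<and>
       (\<forall>i. snd (F z) $ i \<in> \<real>))"

definition homogeneous_poly ::
  "real \<Rightarrow> (complex ^ 'p) set \<Rightarrow> nat \<Rightarrow>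
   ('m::finite xy \<times> ('d::finite, 'p::finite) angle_param \<Rightarrow> 'b::complex_normed_space) \<Rightarrow> bool"
  where "homogeneous_poly \<sigma> L n f \<longleftrightarrow>
    (\<exists>c. (\<forall>j \<alpha>. analytic_coeff \<sigma> L (c j \<alpha>)) \<and>
      (\<forall>x y. \<forall>\<theta>\<in>strip \<sigma>. \<forall>\<mu>\<in>L. f ((x, y), \<theta>, \<mu>) =
        (\<Sum>(j, \<alpha>) | j + (\<Sum>i\<in>UNIV. \<alpha> i) = n.
          (x ^ j * (\<Prod>i\<in>UNIV. (y $ i) ^ \<alpha> i)) *\<^sub>C c j \<alpha> (\<theta>, \<mu>))))"

fun xy_partial ::
  "'m option \<Rightarrow> ('m::finite xy \<times> 'c \<Rightarrow> complex) \<Rightarrow> 'm xy \<times> 'c \<Rightarrow> complex"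
  where
    "xy_partial None f ((x, y), q) = deriv (\<lambda>s. f ((s, y), q)) x"
  | "xy_partial (Some i) f ((x, y), q) =
       deriv (\<lambda>s. f ((x, \<chi> j. if j = i then s else y $ j), q)) (y $ i)"

text \<open>The lists \<open>ds\<close> run through all iterated partial derivatives of order at most \<open>n\<close>, where
  \<open>None\<close> stands for \<open>\<partial>/\<partial>x\<close> and \<open>Some i\<close> for \<open>\<partial>/\<partial>y\<^sub>i\<close>.\<close>

definition vanishes_to_order ::
  "nat \<Rightarrow> ('m::finite xy \<times> 'c \<Rightarrow> complex) \<Rightarrow> 'c \<Rightarrow> bool"
  where "vanishes_to_order n f q \<longleftrightarrow>
    (\<forall>ds. length ds \<le> n \<longrightarrow> foldr xy_partial ds f ((0, 0), q) = 0)"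

definition torus_average ::
  "(('d::finite, 'p::finite) angle_param \<Rightarrow> 'b::real_normed_vector) \<Rightarrow> (complex ^ 'p) \<Rightarrow> 'b"
  where "torus_average f \<mu> = integral (cbox 0 1) (\<lambda>\<theta> :: real ^ 'd. f (cvec \<theta>, \<mu>))"

definition spec :: "complex ^ 'm ^ 'm \<Rightarrow> complex set"
  where "spec A = {\<nu>. \<exists>v. v \<noteq> 0 \<and> A *v v = \<nu> *s v}"

definition diophantine :: "real ^ 'd \<Rightarrow> bool"
  where "diophantine \<omega> \<longleftrightarrow> (\<exists>c>0. \<exists>\<tau>\<ge>real CARD('d). \<forall>k :: int ^ 'd. k \<noteq> 0 \<longrightarrow> (\<forall>l :: int.
    \<bar>(\<Sum>i\<in>UNIV. \<omega> $ i * real_of_int (k $ i)) - real_of_int l\<bar>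
      \<ge> c * (\<Sum>i\<in>UNIV. real_of_int \<bar>k $ i\<bar>) powr (- \<tau>)))"

text \<open>\<open>\<O>(|x|\<^sup>l)\<close> as \<open>x \<rightarrow> 0\<close> in \<open>D\<close>, uniformly in \<open>(\<theta>, \<mu>)\<close>, for the size function \<open>e\<close>
  (a norm, or \<open>torus_norm\<close> for an angle).\<close>

definition order_O ::
  "(complex \<times> ('d::finite, 'p::finite) angle_param) set \<Rightarrow> nat \<Rightarrow>
   (complex \<times> ('d, 'p) angle_param \<Rightarrow> real) \<Rightarrow> bool"
  where "order_O D l e \<longleftrightarrow> (\<exists>C>0. \<exists>r>0. \<forall>x \<theta> \<mu>.
    (x, \<theta>, \<mu>) \<in> D \<longrightarrow> cmod x < r \<longrightarrow> e (x, \<theta>, \<mu>) \<le> C * cmod x ^ l)"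

definition param_comp ::
  "('b \<times> 't \<times> 'l \<Rightarrow> 'c) \<Rightarrow> ('a \<times> 't \<times> 'l \<Rightarrow> 'b \<times> 't) \<Rightarrow> 'a \<times> 't \<times> 'l \<Rightarrow> 'c"
  (infixl "\<circ>\<^sub>\<mu>" 55)
  where "(h \<circ>\<^sub>\<mu> g) = (\<lambda>(u, \<theta>, \<mu>). h (fst (g (u, \<theta>, \<mu>)), snd (g (u, \<theta>, \<mu>)), \<mu>))"

text \<open>\<open>\<Delta>\<close> is an analytic map \<open>D \<rightarrow> \<complex>\<^sup>1\<^sup>+\<^sup>m \<times> \<bbbT>\<^sup>d\<^sub>\<sigma>\<close> of the required order for which
  \<open>F \<circ> (K + \<Delta>)\<close> is defined and equals \<open>(K + \<Delta>) \<circ> R\<close> on \<open>D\<close>.\<close>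

definition correction ::
  "('m::finite xy \<times> ('d::finite, 'p::finite) angle_param) set \<Rightarrow>
   ('m xy \<times> ('d, 'p) angle_param \<Rightarrow> ('m, 'd) xy_angle) \<Rightarrow>
   (complex \<times> ('d, 'p) angle_param \<Rightarrow> ('m, 'd) xy_angle) \<Rightarrow>
   (complex \<times> ('d, 'p) angle_param \<Rightarrow> complex \<times> (complex ^ 'd)) \<Rightarrow>
   nat \<Rightarrow> real \<Rightarrow> (complex \<times> ('d, 'p) angle_param) set \<Rightarrow>
   (complex \<times> ('d, 'p) angle_param \<Rightarrow> ('m, 'd) xy_angle) \<Rightarrow> bool"
  where "correction W F K R Q \<sigma> D \<Delta> \<longleftrightarrow>
    analytic_map D \<Delta> \<and> (\<forall>z\<in>D. snd (\<Delta> z) \<in> strip \<sigma>) \<and>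
    order_O D (Q + 1) (\<lambda>z. cmod (fst (fst (\<Delta> z)))) \<and>
    order_O D (Q + 1) (\<lambda>z. norm (snd (fst (\<Delta> z)))) \<and>
    order_O D Q (\<lambda>z. torus_norm (snd (\<Delta> z))) \<and>
    (\<forall>x \<theta> \<mu>. (x, \<theta>, \<mu>) \<in> D \<longrightarrow>
      (fst (K (x, \<theta>, \<mu>) + \<Delta> (x, \<theta>, \<mu>)), snd (K (x, \<theta>, \<mu>) + \<Delta> (x, \<theta>, \<mu>)), \<mu>) \<in> W) \<and>
    (\<forall>z\<in>D. fst ((F \<circ>\<^sub>\<mu> (\<lambda>w. K w + \<Delta> w)) z) = fst (((\<lambda>w. K w + \<Delta> w) \<circ>\<^sub>\<mu> R) z) \<and>
      snd ((F \<circ>\<^sub>\<mu> (\<lambda>w. K w + \<Delta> w)) z) \<doteq> snd (((\<lambda>w. K w + \<Delta> w) \<circ>\<^sub>\<mu> R) z))"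

end

theory Submission
  imports Defs "HOL-Complex_Analysis.Conformal_Mappings"
    "HOL-Computational_Algebra.Fundamental_Theorem_Algebra"
begin

text \<open>
  With \<open>s = x ^ (N - 1)\<close>, the correction is a fixed point of the quasi-Newton step
  \<open>\<Delta> \<mapsto> \<Delta> - \<Pi> (F \<circ> (K + \<Delta>) - (K + \<Delta>) \<circ> R)\<close> with \<open>\<Pi> = diag (1 + N a s, 1 - s B, 1)\<close>.
  The step is a contraction because \<open>R\<close> shrinks \<open>|x|\<close> by about \<open>1 - Re a s\<close>: in a suitable norm it
  multiplies the weight \<open>|x| ^ q\<close> by at most \<open>1 - c |s|\<close> as soon as \<open>q > N\<close>. The norm absorbs
  the oscillation of \<open>a\<close> and \<open>B\<close> in \<open>\<theta>\<close> through approximate solutions of the cohomological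
  equation, which exist without small divisor estimates because only boundedness is needed, and it is
  adapted to the averaged matrix, whose spectrum lies in the right half-plane. The weight \<open>Q + 1\<close>
  gives the size of the correction, and comparing it with \<open>N + 1/2\<close> gives uniform convergence, although
  the contraction factor tends to 1 at \<open>x = 0\<close>. Torus-valued maps near the identity are lifted to
  periodic vector-valued ones, and uniqueness spreads from small \<open>|x|\<close> by the identity theorem.
\<close>

subsection \<open>Holomorphic maps between complex normed spaces\<close>

text \<open>On lifted increments the derivative of \<open>F\<close> is close to
  \<open>diag (1 - N a s, 1 + s B, 1)\<close>, and \<open>\<Pi>\<close> inverts it up to second
  order in \<open>s\<close>. What remains is \<Delta> at \<open>R z\<close>, multiplied by about
  \<open>1 + N Re A |s|\<close> in \<open>x\<close> and by about 1 in \<open>y\<close>, where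
  \<open>A\<close> is the average of \<open>a\<close>, while \<open>|x| ^ q\<close> shrinks by about
  \<open>1 - q Re A |s|\<close>: this is the origin of the threshold \<open>q > N\<close>. One
  coupling is not small by itself: the terms of \<open>f_N\<close> linear in \<open>y\<close> enter
  the \<open>x\<close> equation at the order of \<open>s\<close>, without a further factor
  \<open>|x|\<close>. A small factor \<open>kp\<close> on the \<open>x\<close> part of the norm
  tames it, and only after \<open>kp\<close> is fixed is the radius chosen, small against it. The
  angle correction is one order larger than those of \<open>x\<close> and \<open>y\<close>, so its
  part of the norm carries the factor \<open>|x|\<close>. On complex parameters the average of
  \<open>a\<close> is only nearly real, so all constants are taken uniform near a compact set of
  real parameters, and the sector is narrow enough to be mapped into itself.\<close>

interpretation scaleC: bounded_bilinear "scaleC :: complex => 'a::complex_normed_space => 'a"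
proof
  fix b c :: complex and v w :: 'a and r :: real
  show "(b + c) *\<^sub>C v = b *\<^sub>C v + c *\<^sub>C v" "c *\<^sub>C (v + w) = c *\<^sub>C v + c *\<^sub>C w"
    by (simp_all add: scaleC_add_left scaleC_add_right)
  show "(r *\<^sub>R b) *\<^sub>C v = r *\<^sub>R b *\<^sub>C v" "b *\<^sub>C r *\<^sub>R v = r *\<^sub>R b *\<^sub>C v"
    by (simp_all add: scaleR_scaleC[where 'a='a] scaleC_scaleC scaleR_conv_of_real mult.commute)
  show "\<exists>K. \<forall>a (b::'a). norm (a *\<^sub>C b) <= norm a * norm b * K"
    by (rule exI[of _ 1]) (simp add: norm_scaleC)
qed

lemma scaleC_one [simp]: "1 *\<^sub>C (v :: 'a::complex_normed_space) = v"
  using scaleR_scaleC[of 1 v] by simp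

definition has_cderivative ::
  "('a::complex_normed_space => 'b::complex_normed_space) => ('a => 'b) => 'a => bool"
  where "has_cderivative f L z \<longleftrightarrow>
    (f has_derivative L) (at z) & (\<forall>c v. L (c *\<^sub>C v) = c *\<^sub>C L v)"

lemma chol_iff:
  "f cholomorphic_on D \<longleftrightarrow> open D & (\<forall>z\<in>D. \<exists>L. has_cderivative f L z)"
  unfolding cholomorphic_on_def has_cderivative_def by simp

lemma chol_open: "f cholomorphic_on D ==> open D"
  by (simp add: chol_iff)

lemma chol_obtain:
  assumes "f cholomorphic_on D" "z \<in> D"
  obtains L where "has_cderivative f L z"
  using assms by (auto simp: chol_iff)

lemma chol_subset:
  "f cholomorphic_on D ==> open E ==> E \<subseteq> D ==> f cholomorphic_on E"
  by (auto simp: chol_iff)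

lemma chol_locally:
  assumes "!!z. z \<in> D ==> \<exists>V. z \<in> V & V \<subseteq> D & f cholomorphic_on V"
  shows "f cholomorphic_on D"
proof -
  have "open D"
    using assms chol_open by (subst open_subopen) blast
  moreover have "\<exists>L. has_cderivative f L z" if "z \<in> D" for z
    using assms[OF that] by (auto simp: chol_iff)
  ultimately show ?thesis
    by (simp add: chol_iff)
qed

lemma chol_imp_continuous_on: "f cholomorphic_on D ==> continuous_on D f"
  unfolding chol_iff has_cderivative_def
  by (intro continuous_at_imp_continuous_on ballI) (auto dest: has_derivative_continuous)

lemma chol_transform:
  assumes "f cholomorphic_on D" "!!z. z \<in> D ==> f z = g z"
  shows "g cholomorphic_on D"
  unfolding chol_iff
proof safe
  show D: "open D" using assms(1) by (simp add: chol_iff)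
  fix z assume z: "z \<in> D"
  obtain L where L: "has_cderivative f L z"
    using assms(1) z by (rule chol_obtain)
  then have "(g has_derivative L) (at z)"
    unfolding has_cderivative_def
    using has_derivative_transform_within_open[OF _ D z, of f L UNIV g] assms(2) by auto
  then show "\<exists>L. has_cderivative g L z"
    using L unfolding has_cderivative_def by blast
qed

lemma chol_compose:
  assumes f: "f cholomorphic_on D" and g: "g cholomorphic_on E" and "f ` D \<subseteq> E"
  shows "(%z. g (f z)) cholomorphic_on D"
  unfolding chol_iff
proof safe
  show "open D" using f by (simp add: chol_iff)
  fix z assume z: "z \<in> D"
  obtain L where L: "has_cderivative f L z"
    using f z by (rule chol_obtain)
  obtain M where M: "has_cderivative g M (f z)"
    using g by (rule chol_obtain) (use assms(3) z in blast)
  have "has_cderivative (%z. g (f z)) (%v. M (L v)) z"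
    using has_derivative_compose[of f L z UNIV g M] L M unfolding has_cderivative_def by auto
  then show "\<exists>L. has_cderivative (%z. g (f z)) L z" by blast
qed

lemma chol_clinear:
  assumes f: "f cholomorphic_on D" and T: "bounded_linear T" "!!c v. T (c *\<^sub>C v) = c *\<^sub>C T v"
  shows "(%z. T (f z)) cholomorphic_on D"
proof (rule chol_compose[OF f])
  show "T cholomorphic_on UNIV"
    using T bounded_linear_imp_has_derivative[OF T(1)]
    by (auto simp: chol_iff has_cderivative_def)
qed auto

lemma chol_const: "open D ==> (%z. c) cholomorphic_on D"
  unfolding chol_iff has_cderivative_def
  by (intro conjI ballI exI[of _ "%_. 0"]) (auto simp: scaleC.zero_right)

lemma chol_ident: "open D ==> (%z. z) cholomorphic_on D"
  unfolding chol_iff has_cderivative_def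
  by (intro conjI ballI exI[of _ "%v. v"]) auto

lemma chol_add:
  assumes "f cholomorphic_on D" "g cholomorphic_on D"
  shows "(%z. f z + g z) cholomorphic_on D"
  unfolding chol_iff
proof safe
  show "open D" using assms by (simp add: chol_iff)
  fix z assume z: "z \<in> D"
  obtain L M where "has_cderivative f L z" "has_cderivative g M z"
    using assms z by (meson chol_obtain)
  then have "has_cderivative (%z. f z + g z) (%v. L v + M v) z"
    unfolding has_cderivative_def by (auto intro: has_derivative_add simp: scaleC_add_right)
  then show "\<exists>L. has_cderivative (%z. f z + g z) L z" by blast
qed

lemma chol_minus:
  "f cholomorphic_on D ==> (%z. - f z) cholomorphic_on D"
  by (rule chol_clinear)
    (auto intro: bounded_linear_minus bounded_linear_ident simp: scaleC.minus_right)

lemma chol_diff: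
  "f cholomorphic_on D ==> g cholomorphic_on D ==> (%z. f z - g z) cholomorphic_on D"
  using chol_add[OF _ chol_minus, of f D g] by simp

lemma chol_sum:
  assumes "open D" "!!i. i \<in> I ==> f i cholomorphic_on D"
  shows "(%z. \<Sum>i\<in>I. f i z) cholomorphic_on D"
  using assms(2)
  by (induction I rule: infinite_finite_induct)
    (auto intro: chol_add chol_const assms(1))

lemma chol_scaleC:
  assumes "f cholomorphic_on D" "g cholomorphic_on D"
  shows "(%z. f z *\<^sub>C g z) cholomorphic_on D"
  unfolding chol_iff
proof safe
  show "open D" using assms by (simp add: chol_iff)
  fix z assume z: "z \<in> D"
  obtain L M where LM: "has_cderivative f L z" "has_cderivative g M z"
    using assms z by (meson chol_obtain)
  then have "has_cderivative (%z. f z *\<^sub>C g z) (%v. f z *\<^sub>C M v + L v *\<^sub>C g z) z"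
    unfolding has_cderivative_def
    by (auto intro: scaleC.FDERIV
        simp: scaleC_add_right scaleC_scaleC scaleC_complex_def mult.commute mult.left_commute)
  then show "\<exists>L. has_cderivative (%z. f z *\<^sub>C g z) L z" by blast
qed

lemma chol_mult:
  fixes f g :: "'a::complex_normed_space => complex"
  shows "f cholomorphic_on D ==> g cholomorphic_on D ==> (%z. f z * g z) cholomorphic_on D"
  using chol_scaleC[of f D g] by (simp add: scaleC_complex_def)

lemma chol_power:
  fixes f :: "'a::complex_normed_space => complex"
  assumes "f cholomorphic_on D"
  shows "(%z. f z ^ n) cholomorphic_on D"
  using assms
  by (induction n) (auto intro: chol_const chol_mult chol_open)

lemma chol_prod:
  fixes f :: "'i => 'a::complex_normed_space => complex"
  assumes "open D" "!!i. i \<in> I ==> f i cholomorphic_on D"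
  shows "(%z. \<Prod>i\<in>I. f i z) cholomorphic_on D"
  using assms(2)
  by (induction I rule: infinite_finite_induct)
    (auto intro: chol_mult chol_const assms(1))

lemma chol_fst: "f cholomorphic_on D ==> (%z. fst (f z)) cholomorphic_on D"
  by (rule chol_clinear) (auto intro: bounded_linear_fst simp: scaleC_prod_def)

lemma chol_snd: "f cholomorphic_on D ==> (%z. snd (f z)) cholomorphic_on D"
  by (rule chol_clinear) (auto intro: bounded_linear_snd simp: scaleC_prod_def)

lemma chol_vec_nth: "f cholomorphic_on D ==> (%z. f z $ i) cholomorphic_on D"
  by (rule chol_clinear) (auto intro: bounded_linear_vec_nth simp: scaleC_vec_def)

lemma cholomorphic_on_Pair:
  assumes "f cholomorphic_on D" "g cholomorphic_on D"
  shows "(%z. (f z, g z)) cholomorphic_on D"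
proof -
  have "(%z. (f z, 0) + (0, g z)) cholomorphic_on D"
    by (intro chol_add chol_clinear[OF assms(1), of "%x. (x, 0)"]
        chol_clinear[OF assms(2), of "%x. (0, x)"])
      (auto intro!: bounded_linear_intros simp: scaleC_prod_def scaleC.zero_right)
  then show ?thesis by simp
qed

lemma chol_vec_lambda:
  assumes "open D" "!!i. f i cholomorphic_on D"
  shows "(%z. (\<chi> i. f i z) :: 'b::complex_normed_space ^ 'n) cholomorphic_on D"
proof -
  have bl: "bounded_linear (%x::'b. (axis i x :: 'b ^ 'n))" for i
  proof (rule bounded_linear_intro[where K=1])
    show "norm (axis i x :: 'b ^ 'n) <= norm x * 1" for x :: 'b
    proof -
      have "norm (axis i x :: 'b ^ 'n) <= (\<Sum>j\<in>UNIV. norm (axis i x $ j))"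
        unfolding norm_vec_def by (rule L2_set_le_sum) simp
      also have "... = norm x"
        by (simp add: axis_def if_distrib[of norm] cong: if_cong)
      finally show ?thesis by simp
    qed
  qed (auto simp: axis_def vec_eq_iff)
  have "(%z. \<Sum>i\<in>UNIV. axis i (f i z) :: 'b ^ 'n) cholomorphic_on D"
    by (intro chol_sum assms chol_clinear[OF assms(2) bl])
      (auto simp: axis_def scaleC_vec_def vec_eq_iff scaleC.zero_right)
  moreover have "(\<Sum>i\<in>UNIV. axis i (f i z)) = ((\<chi> i. f i z) :: 'b ^ 'n)" for z
    by (auto simp: vec_eq_iff axis_def)
  ultimately show ?thesis by simp
qed

lemma chol_matrix_vector:
  fixes A :: "_ => complex ^ 'n ^ 'm"
  assumes "A cholomorphic_on D" "f cholomorphic_on D"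
  shows "(%z. A z *v f z) cholomorphic_on D"
  unfolding matrix_vector_mult_def using assms
  by (intro chol_vec_lambda chol_sum chol_mult
      chol_vec_nth chol_open)

lemmas cholomorphic_intros = chol_const chol_ident chol_add
  chol_diff chol_minus chol_mult chol_power
  chol_scaleC chol_sum chol_prod chol_fst
  chol_snd chol_vec_nth cholomorphic_on_Pair chol_vec_lambda
  chol_matrix_vector

lemma cholomorphic_line:
  assumes "open D"
  shows "(%ze::complex. z + ze *\<^sub>C v) cholomorphic_on {ze. z + ze *\<^sub>C v \<in> D}"
proof -
  have "open ((%ze::complex. z + ze *\<^sub>C v) -` D)"
    by (intro open_vimage assms continuous_intros scaleC.continuous_on)
  then show ?thesis
    unfolding vimage_def by (intro cholomorphic_intros)
qed

text \<open>Estimates in several variables are reduced to one complex variable by restriction to the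
  complex line through \<open>z\<close> in direction \<open>v\<close>.\<close>

lemma cholomorphic_slice:
  fixes f :: "'a::complex_normed_space => complex"
  assumes "f cholomorphic_on D"
  shows "(%ze. f (z + ze *\<^sub>C v)) holomorphic_on {ze. z + ze *\<^sub>C v \<in> D}"
  using chol_compose[OF cholomorphic_line[OF chol_open[OF assms], of z v] assms]
  by (auto simp: cholomorphic_on_complex_iff image_subset_iff)

lemma has_cderivative_slice:
  fixes f :: "'a::complex_normed_space => complex"
  assumes "has_cderivative f L z"
  shows "((%ze. f (z + ze *\<^sub>C v)) has_field_derivative L v) (at 0)"
proof -
  have 1: "((%ze::complex. z + ze *\<^sub>C v) has_derivative (%ze. ze *\<^sub>C v)) (at 0)"
    by (auto intro!: derivative_eq_intros scaleC.FDERIV simp: scaleC.zero_right)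
  have 2: "(f has_derivative L) (at (z + 0 *\<^sub>C v))"
    using assms by (simp add: has_cderivative_def scaleC.zero_left)
  have "((%ze. f (z + ze *\<^sub>C v)) has_derivative (%ze. L (ze *\<^sub>C v))) (at 0)"
    using has_derivative_compose[OF 1 2] .
  moreover have "(%ze. L (ze *\<^sub>C v)) = (*) (L v)"
    using assms by (auto simp: has_cderivative_def scaleC_complex_def mult.commute)
  ultimately show ?thesis
    by (simp add: has_field_derivative_def)
qed

section \<open>Cauchy estimates and uniform limits\<close>

lemma le_of_forall_lt_mult:
  fixes a R M :: real
  assumes "0 < R" "0 <= a" "!!r. 0 < r ==> r < R ==> a * r <= M"
  shows "a * R <= M"
proof (rule tendsto_upperbound)
  show "\<forall>\<^sub>F r in at_left R. a * r <= M"
    using assms(1,3) eventually_at_left_real[of 0 R] by (auto elim!: eventually_mono)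
  show "((%r. a * r) \<longlongrightarrow> a * R) (at_left R)"
    by (intro tendsto_intros)
qed auto

text \<open>The line \<open>z + ze v\<close> stays in the ball for \<open>|ze| < r / |v|\<close>,
  and the restriction has derivative \<open>L v\<close> at 0, so Cauchy's inequality applies on
  every smaller circle; letting its radius grow restores the full constant.\<close>

lemma cauchy_estimate:
  fixes f :: "'a::complex_normed_space => complex"
  assumes f: "f cholomorphic_on ball z r" and L: "has_cderivative f L z"
    and M: "!!w. w \<in> ball z r ==> norm (f w) <= M" and r: "r > 0"
  shows "norm (L v) <= M / r * norm v"
proof (cases "v = 0")
  case True
  have "L 0 = 0"
    using L linear_0[of L] has_derivative_linear unfolding has_cderivative_def by blast
  then show ?thesis using True by simp
next
  case False
  define R where "R = r / norm v"
  have R: "R > 0" using r False by (simp add: R_def)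
  have in_ball: "z + ze *\<^sub>C v \<in> ball z r" if "cmod ze < R" for ze
    using that False by (simp add: dist_norm norm_scaleC R_def field_simps)
  define g where "g = (%ze. f (z + ze *\<^sub>C v))"
  have "g holomorphic_on {ze. z + ze *\<^sub>C v \<in> ball z r}"
    unfolding g_def by (rule cholomorphic_slice[OF f])
  then have g: "g holomorphic_on ball 0 R"
    by (rule holomorphic_on_subset) (use in_ball in auto)
  have dg: "deriv g 0 = L v"
    unfolding g_def by (rule DERIV_imp_deriv[OF has_cderivative_slice[OF L]])
  have "norm (L v) * rh <= M" if rh: "0 < rh" "rh < R" for rh
  proof -
    have "norm ((deriv ^^ 1) g 0) <= fact 1 * M / rh ^ 1"
    proof (rule Cauchy_inequality)
      show "g holomorphic_on ball 0 rh" "continuous_on (cball 0 rh) g"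
        using rh by (auto intro!: holomorphic_on_imp_continuous_on holomorphic_on_subset[OF g])
      show "norm (g x) <= M" if "norm (0 - x) = rh" for x
        unfolding g_def using that rh by (intro M in_ball) auto
    qed (use rh in auto)
    then show ?thesis
      using rh dg by (simp add: field_simps)
  qed
  then have "norm (L v) * R <= M"
    by (rule le_of_forall_lt_mult[rotated 2]) (use R in auto)
  then show ?thesis
    using r False by (simp add: R_def field_simps)
qed

text \<open>Weierstrass' theorem. Cauchy estimates turn uniform closeness of the functions into
  uniform closeness of the derivatives on a smaller ball, so the theorem on differentiating a
  sequence applies; complex linearity of the derivative passes to the limit.\<close>

lemma cholomorphic_uniform_limit:
  fixes f :: "nat => 'a::complex_normed_space => complex"
  assumes f: "!!n. f n cholomorphic_on D"
    and lim: "!!e. e > 0 ==> \<exists>N. \<forall>n\<ge>N. \<forall>z\<in>D. norm (f n z - g z) <= e"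
  shows "g cholomorphic_on D"
  unfolding chol_iff
proof safe
  show D: "open D" using f[of 0] by (simp add: chol_iff)
  fix z0 assume z0: "z0 \<in> D"
  obtain R where R: "R > 0" "ball z0 R \<subseteq> D"
    using D z0 openE by blast
  \<comment> \<open>Half the radius: every point of \<open>S\<close> still has a ball of radius
    \<open>r\<close> inside \<open>D\<close>, which the Cauchy estimate requires.\<close>
  define r where "r = R / 2"
  have r: "r > 0" using R by (simp add: r_def)
  define S where "S = ball z0 r"
  have SD: "ball z r \<subseteq> D" if "z \<in> S" for z
  proof
    fix w assume "w \<in> ball z r"
    then have "w \<in> ball z0 R"
      using that dist_triangle[of z0 w z] by (simp add: S_def r_def)
    then show "w \<in> D" using R by blast
  qed
  have SD': "z \<in> D" if "z \<in> S" for z using SD[OF that] r by auto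
  have "\<forall>n z. \<exists>L. z \<in> S --> has_cderivative (f n) L z"
    using f SD' by (meson chol_iff)
  then obtain f' where f': "!!n z. z \<in> S ==> has_cderivative (f n) (f' n z) z"
    by metis
  have diff: "norm (f' m z h - f' n z h) <= 2 * e / r * norm h"
    if "!!w. w \<in> D ==> norm (f n w - g w) <= e" "!!w. w \<in> D ==> norm (f m w - g w) <= e" "z \<in> S"
    for m n z h e
  proof (rule cauchy_estimate[where f="%z. f m z - f n z" and L="%v. f' m z v - f' n z v" and z=z and r=r and M="2 * e"])
    show "(%z. f m z - f n z) cholomorphic_on ball z r"
      by (intro chol_diff chol_subset[OF f] SD that) auto
    show "has_cderivative (%z. f m z - f n z) (%v. f' m z v - f' n z v) z"
      using f'[OF that(3), of m] f'[OF that(3), of n] unfolding has_cderivative_def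
      by (auto intro: has_derivative_diff simp: scaleC.diff_right)
    fix w assume "w \<in> ball z r"
    then have "w \<in> D" using SD that by blast
    then show "norm (f m w - f n w) <= 2 * e"
      using that(1,2)[of w] norm_triangle_ineq4[of "f m w - g w" "f n w - g w"] by simp
  qed (fact r)
  have conv: "convergent (%n. f' n z h)" if "z \<in> S" for z h
    unfolding Cauchy_convergent_iff[symmetric]
  proof (rule metric_CauchyI)
    fix e :: real assume e: "e > 0"
    \<comment> \<open>Chosen so that \<open>2 * e' / r * norm h\<close> falls below
      \<open>e\<close>; adding 1 to \<open>norm h\<close> covers \<open>h = 0\<close>.\<close>
    define e' where "e' = e * r / (4 * (norm h + 1))"
    have e': "e' > 0" using e r by (simp add: e'_def add_nonneg_pos)
    obtain N where N: "!!n w. n >= N ==> w \<in> D ==> norm (f n w - g w) <= e'"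
      using lim[OF e'] by blast
    show "\<exists>M. \<forall>m\<ge>M. \<forall>n\<ge>M. dist (f' m z h) (f' n z h) < e"
    proof (intro exI allI impI)
      fix m n assume mn: "N <= m" "N <= n"
      have "dist (f' m z h) (f' n z h) <= 2 * e' / r * norm h"
        unfolding dist_norm using N mn that by (intro diff) auto
      also have "... = e * (norm h / (2 * (norm h + 1)))"
      proof -
        have "norm h + 1 ~= 0" using norm_ge_zero[of h] by linarith
        then show ?thesis using r by (simp add: e'_def divide_simps)
      qed
      also have "... < e * 1"
      proof (rule mult_strict_left_mono[OF _ e])
        have "0 < 2 * (norm h + 1)" by (intro mult_pos_pos add_nonneg_pos) auto
        then show "norm h / (2 * (norm h + 1)) < 1" by (simp add: divide_less_eq)
      qed
      finally show "dist (f' m z h) (f' n z h) < e" by simp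
    qed
  qed
  define g' where "g' z h = lim (%n. f' n z h)" for z h
  have g': "(%n. f' n z h) \<longlonglongrightarrow> g' z h" if "z \<in> S" for z h
    unfolding g'_def using conv[OF that] convergent_LIMSEQ_iff by blast
  have gl: "(%n. f n z) \<longlonglongrightarrow> g z" if "z \<in> D" for z
  proof (rule metric_LIMSEQ_I)
    fix e :: real assume "e > 0"
    then obtain N where "\<forall>n\<ge>N. \<forall>z\<in>D. norm (f n z - g z) <= e / 2"
      using lim[of "e / 2"] by auto
    then show "\<exists>N. \<forall>n\<ge>N. dist (f n z) (g z) < e"
      using that \<open>e > 0\<close> by (force simp: dist_norm)
  qed
  have "\<exists>G. \<forall>x\<in>S. (%n. f n x) \<longlonglongrightarrow> G x & (G has_derivative g' x) (at x within S)"
  proof (rule has_derivative_sequence[where f'=f'])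
    show "convex S" by (simp add: S_def)
    show "(f n has_derivative f' n x) (at x within S)" if "x \<in> S" for n x
      using f'[OF that] by (auto simp: has_cderivative_def intro: has_derivative_at_withinI)
    show "z0 \<in> S" using r by (simp add: S_def)
    show "(%n. f n z0) \<longlonglongrightarrow> g z0" by (rule gl[OF z0])
    fix e :: real assume e: "e > 0"
    obtain N where N: "!!n w. n >= N ==> w \<in> D ==> norm (f n w - g w) <= e * r / 2"
      using lim[of "e * r / 2"] e r by auto
    have "norm (f' n x h - g' x h) <= e * norm h" if n: "n >= N" and x: "x \<in> S" for n x h
    proof (rule LIMSEQ_le_const2)
      show "(%m. norm (f' n x h - f' m x h)) \<longlonglongrightarrow> norm (f' n x h - g' x h)"
        by (intro tendsto_intros g' x)
      show "\<exists>M. \<forall>m\<ge>M. norm (f' n x h - f' m x h) <= e * norm h"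
        using diff[of _ "e * r / 2", OF N N x] n r by (intro exI[of _ N]) auto
    qed
    then show "\<forall>\<^sub>F n in sequentially. \<forall>x\<in>S. \<forall>h. norm (f' n x h - g' x h) <= e * norm h"
      unfolding eventually_sequentially by blast
  qed
  then obtain G where G: "!!x. x \<in> S ==> (%n. f n x) \<longlonglongrightarrow> G x"
      "!!x. x \<in> S ==> (G has_derivative g' x) (at x within S)"
    by blast
  have z0S: "z0 \<in> S" and opS: "open S" using r by (auto simp: S_def)
  have Gg: "G x = g x" if "x \<in> S" for x
    using LIMSEQ_unique[OF G(1)[OF that] gl[OF SD'[OF that]]] .
  have "(G has_derivative g' z0) (at z0)"
    using G(2)[OF z0S] at_within_open[OF z0S opS] by simp
  then have "(g has_derivative g' z0) (at z0)"
    using has_derivative_transform_within_open[OF _ opS z0S] Gg by metis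
  moreover have "g' z0 (c *\<^sub>C v) = c *\<^sub>C g' z0 v" for c v
  proof (rule LIMSEQ_unique[OF g'[OF z0S]])
    have "f' n z0 (c *\<^sub>C v) = c *\<^sub>C f' n z0 v" for n
      using f'[OF z0S, of n] by (simp add: has_cderivative_def)
    then show "(%n. f' n z0 (c *\<^sub>C v)) \<longlonglongrightarrow> c *\<^sub>C g' z0 v"
      by (simp add: scaleC_complex_def tendsto_mult g'[OF z0S])
  qed
  ultimately show "\<exists>L. has_cderivative g L z0"
    unfolding has_cderivative_def by blast
qed

section \<open>The Schwarz lemma for zeros of higher order\<close>

lemma holomorphic_bound_div:
  assumes h: "h holomorphic_on ball 0 R" and M: "!!ze. cmod ze < R ==> cmod (ze * h ze) <= M"
    and z: "cmod z < R"
  shows "cmod (h z) <= M / R"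
proof -
  have R: "0 < R" using z by (smt (verit) norm_ge_zero)
  have small: "cmod (h z) * r <= M" if r: "cmod z < r" "r < R" for r
  proof -
    have r0: "r > 0" using r(1) by (smt (verit) norm_ge_zero)
    have "cmod (h z) <= M / r"
    proof (rule maximum_modulus_frontier[where S="cball 0 r" and f=h and \<xi>=z])
      show "h holomorphic_on interior (cball 0 r)"
        using r by (intro holomorphic_on_subset[OF h]) auto
      show "continuous_on (closure (cball 0 r)) h"
        using r by (intro holomorphic_on_imp_continuous_on holomorphic_on_subset[OF h]) auto
      show "cmod (h w) <= M / r" if "w \<in> frontier (cball 0 r)" for w
        using that M[of w] r r0 by (simp add: norm_mult field_simps)
    qed (use r in auto)
    then show ?thesis using r0 by (simp add: field_simps)
  qed
  have "cmod (h z) * R <= M"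
  proof (rule tendsto_upperbound)
    show "\<forall>\<^sub>F r in at_left R. cmod (h z) * r <= M"
      using small eventually_at_left_real[OF z] by (auto elim!: eventually_mono)
    show "((%r. cmod (h z) * r) \<longlongrightarrow> cmod (h z) * R) (at_left R)"
      by (intro tendsto_intros)
  qed auto
  then show ?thesis using R by (simp add: field_simps)
qed

text \<open>The limit hypothesis says that \<open>g\<close> has a zero of order at least
  \<open>j + 1\<close> at 0. Each induction step divides out one factor \<open>ze\<close>; by the
  maximum principle the bound \<open>M\<close> becomes \<open>M / R\<close>, and the factor returns
  as \<open>|z|\<close>.\<close>

lemma schwarz_order:
  assumes "g holomorphic_on ball 0 R" "!!ze. cmod ze < R ==> cmod (g ze) <= M"
    and "((%ze. g ze / ze ^ j) \<longlongrightarrow> 0) (at 0)" and "cmod z < R"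
  shows "cmod (g z) <= M * (cmod z / R) ^ Suc j"
  using assms
proof (induction j arbitrary: g M)
  case (0 g M)
  have R: "R > 0" using \<open>cmod z < R\<close> by (smt (verit) norm_ge_zero)
  have "isCont g 0"
    using 0(1) R by (meson centre_in_ball continuous_on_eq_continuous_at holomorphic_on_imp_continuous_on open_ball)
  then have "g 0 = 0"
    using 0(3) unfolding isCont_def by (simp add: LIM_unique)
  then obtain h where h: "h holomorphic_on ball 0 R" "!!ze. cmod ze < R ==> g ze = ze * h ze"
    using Schwarz3[OF 0(1)] by blast
  have "cmod (h z) <= M / R"
    by (rule holomorphic_bound_div[OF h(1) _ 0(4)]) (use 0(2) h(2) in auto)
  then have "cmod z * cmod (h z) <= cmod z * (M / R)"
    by (intro mult_left_mono) auto
  then show ?case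
    using h(2)[OF 0(4)] by (simp add: norm_mult field_simps)
next
  case (Suc j g M)
  have R: "R > 0" using \<open>cmod z < R\<close> by (smt (verit) norm_ge_zero)
  have "((%ze. g ze / ze ^ Suc j * ze ^ Suc j) \<longlongrightarrow> 0 * 0 ^ Suc j) (at 0)"
    by (intro tendsto_mult Suc.prems(3) tendsto_power tendsto_ident_at)
  moreover have "\<forall>\<^sub>F ze in at 0. g ze / ze ^ Suc j * ze ^ Suc j = g ze"
    unfolding eventually_at_filter by simp
  ultimately have "(g \<longlongrightarrow> 0) (at 0)"
    using Lim_transform_eventually by force
  moreover have "isCont g 0"
    using Suc(2) R by (meson centre_in_ball continuous_on_eq_continuous_at holomorphic_on_imp_continuous_on open_ball)
  ultimately have "g 0 = 0"
    unfolding isCont_def by (simp add: LIM_unique)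
  then obtain h where h: "h holomorphic_on ball 0 R" "!!ze. cmod ze < R ==> g ze = ze * h ze"
    using Schwarz3[OF Suc(2)] by blast
  have "cmod (h z) <= (M / R) * (cmod z / R) ^ Suc j"
  proof (rule Suc.IH[OF h(1)])
    show "cmod (h ze) <= M / R" if "cmod ze < R" for ze
      by (rule holomorphic_bound_div[OF h(1) _ that]) (use Suc(3) h(2) in auto)
    have ev: "\<forall>\<^sub>F ze in at 0. g ze / ze ^ Suc j = h ze / ze ^ j"
      unfolding eventually_at using h(2) R by (intro exI[of _ R]) auto
    show "((%ze. h ze / ze ^ j) \<longlongrightarrow> 0) (at 0)"
      by (rule Lim_transform_eventually[OF Suc.prems(3) ev])
  qed (fact Suc.prems)
  then have "cmod z * cmod (h z) <= cmod z * ((M / R) * (cmod z / R) ^ Suc j)"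
    by (intro mult_left_mono) auto
  then show ?case
    using h(2)[OF Suc.prems(4)] R by (simp add: norm_mult field_simps)
qed

subsection \<open>Derivatives, periodicity and the torus\<close>

definition cpartial :: "('a::complex_normed_space => complex) => 'a => 'a => complex"
  where "cpartial f v z = deriv (%ze. f (z + ze *\<^sub>C v)) 0"

lemma cpartial_eq: "has_cderivative f L z ==> cpartial f v z = L v"
  unfolding cpartial_def by (rule DERIV_imp_deriv[OF has_cderivative_slice])

text \<open>The Taylor remainder of order two along the line is bounded by \<open>3 * M\<close>, one
  \<open>M\<close> for each of its three terms, and has a double zero at 0, so the Schwarz lemma
  bounds it quadratically. The rate depends only on \<open>M\<close> and \<open>r\<close>, hence is
  uniform in \<open>z\<close>.\<close>

lemma difference_quotient_bound:
  fixes f :: "'a::complex_normed_space => complex"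
  assumes f: "f cholomorphic_on ball z r" and M: "!!w. w \<in> ball z r ==> norm (f w) <= M"
    and r: "r > 0" and v: "norm v <= 1" and h: "h ~= 0" "cmod h < r"
  shows "cmod ((f (z + h *\<^sub>C v) - f z) / h - cpartial f v z) <= 3 * M / r\<^sup>2 * cmod h"
proof -
  obtain L where L: "has_cderivative f L z"
    using f r by (metis centre_in_ball chol_obtain)
  have in_ball: "z + ze *\<^sub>C v \<in> ball z r" if "cmod ze < r" for ze
  proof -
    have "cmod ze * norm v <= cmod ze * 1" using v by (intro mult_left_mono) auto
    then show ?thesis using that by (simp add: dist_norm norm_scaleC)
  qed
  have M0: "0 <= M" using M[of z] r norm_ge_zero order_trans by (metis centre_in_ball)
  have "cmod (L v) <= M / r * norm v"
    by (rule cauchy_estimate[OF f L M r])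
  also have "... <= M / r * 1"
    using M0 r v by (intro mult_left_mono) auto
  finally have Lv: "cmod (L v) <= M / r" by simp
  define g where "g ze = f (z + ze *\<^sub>C v) - f z - ze * L v" for ze
  have "(%ze. f (z + ze *\<^sub>C v)) holomorphic_on ball 0 r"
    by (rule holomorphic_on_subset[OF cholomorphic_slice[OF f]]) (use in_ball in auto)
  then have hol: "g holomorphic_on ball 0 r"
    unfolding g_def by (intro holomorphic_intros)
  have bd: "cmod (g ze) <= 3 * M" if "cmod ze < r" for ze
  proof -
    have "cmod (ze * L v) <= r * (M / r)"
      unfolding norm_mult using that Lv r by (intro mult_mono) auto
    moreover have "cmod (f (z + ze *\<^sub>C v)) <= M" "cmod (f z) <= M"
      using M in_ball[OF that] r by auto
    ultimately show ?thesis
      using norm_triangle_ineq4[of "f (z + ze *\<^sub>C v) - f z" "ze * L v"]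
        norm_triangle_ineq4[of "f (z + ze *\<^sub>C v)" "f z"] r
      unfolding g_def by simp
  qed
  have "((%ze. f (z + ze *\<^sub>C v)) has_field_derivative L v) (at 0)"
    by (rule has_cderivative_slice[OF L])
  then have "((%ze. (f (z + ze *\<^sub>C v) - f z) / ze) \<longlongrightarrow> L v) (at 0)"
    by (simp add: DERIV_def scaleC.zero_left)
  then have "((%ze. (f (z + ze *\<^sub>C v) - f z) / ze - L v) \<longlongrightarrow> L v - L v) (at 0)"
    by (intro tendsto_intros)
  moreover have "\<forall>\<^sub>F ze in at 0. (f (z + ze *\<^sub>C v) - f z) / ze - L v = g ze / ze ^ 1"
    unfolding eventually_at_filter by (simp add: g_def field_simps)
  ultimately have lim: "((%ze. g ze / ze ^ 1) \<longlongrightarrow> 0) (at 0)"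
    using Lim_transform_eventually by force
  have "cmod (g h) <= 3 * M * (cmod h / r) ^ Suc 1"
    using schwarz_order[where j=1 and g=g and M="3 * M", OF hol bd lim h(2)] .
  then have "cmod (g h) / cmod h <= 3 * M * (cmod h / r) ^ Suc 1 / cmod h"
    by (intro divide_right_mono) auto
  moreover have "(f (z + h *\<^sub>C v) - f z) / h - cpartial f v z = g h / h"
    using h by (simp add: g_def cpartial_eq[OF L] field_simps)
  ultimately show ?thesis
    using h r by (simp add: norm_divide power2_eq_square field_simps)
qed

text \<open>A directional derivative is locally the uniform limit of difference quotients, each of
  which is holomorphic. This makes iterated partial derivatives accessible.\<close>

lemma cholomorphic_cpartial:
  assumes f: "f cholomorphic_on D" and v: "norm v <= 1"
  shows "cpartial f v cholomorphic_on D"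
proof (rule chol_locally)
  fix z0 assume z0: "z0 \<in> D"
  have D: "open D" using f by (rule chol_open)
  have "isCont f z0"
    using chol_imp_continuous_on[OF f] D z0 continuous_on_eq_continuous_at by blast
  then obtain d where d: "d > 0" "!!w. dist w z0 < d ==> dist (f w) (f z0) < 1"
    unfolding continuous_at_eps_delta by (metis zero_less_one)
  obtain R where R: "R > 0" "ball z0 R \<subseteq> D" using D z0 openE by blast
  define r where "r = min d R / 2"
  have r: "r > 0" using d R by (simp add: r_def)
  define M where "M = cmod (f z0) + 1"
  have sub: "ball z r \<subseteq> ball z0 (min d R)" if "z \<in> ball z0 r" for z
  proof
    fix w assume "w \<in> ball z r"
    then show "w \<in> ball z0 (min d R)"
      using that dist_triangle[of z0 w z] by (simp add: r_def)
  qed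
  have subD: "ball z r \<subseteq> D" if "z \<in> ball z0 r" for z
    using sub[OF that] R by (metis (no_types, lifting) min_le_iff_disj order_refl order_trans subset_ball)
  have bd: "cmod (f w) <= M" if "z \<in> ball z0 r" "w \<in> ball z r" for z w
  proof -
    have "w \<in> ball z0 (min d R)" using sub[OF that(1)] that(2) by blast
    then have "dist w z0 < d" by (simp add: dist_commute)
    then have "cmod (f w - f z0) < 1" using d by (simp add: dist_norm)
    then show ?thesis using norm_triangle_sub[of "f w" "f z0"] by (simp add: M_def)
  qed
  \<comment> \<open>Real steps tending to 0; the shift by 2 keeps every step nonzero and shorter
    than \<open>r\<close>.\<close>
  define h where "h n = complex_of_real (r / (2 + real n))" for n
  have h: "h n ~= 0" "cmod (h n) < r" "cmod (h n) = r / (2 + real n)" for n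
  proof -
    show 3: "cmod (h n) = r / (2 + real n)"
      unfolding h_def norm_of_real using r by simp
    show "h n ~= 0"
      unfolding h_def of_real_eq_0_iff using r by (simp add: add_nonneg_pos)
    show "cmod (h n) < r"
      unfolding 3 using r by (simp add: divide_less_eq add_nonneg_pos)
  qed
  have hv: "z + h n *\<^sub>C v \<in> ball z r" for z n
  proof -
    have "cmod (h n) * norm v <= cmod (h n) * 1" using v by (intro mult_left_mono) auto
    then show ?thesis using h(2)[of n] by (simp add: dist_norm norm_scaleC)
  qed
  have zD: "z \<in> D" if "z \<in> ball z0 r" for z using subD[OF that] r by auto
  have "cpartial f v cholomorphic_on ball z0 r"
  proof (rule cholomorphic_uniform_limit)
    fix n
    have "(%z. f (z + h n *\<^sub>C v)) cholomorphic_on ball z0 r"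
    proof (rule chol_compose[OF _ f])
      show "(%z. z + h n *\<^sub>C v) ` ball z0 r \<subseteq> D"
        using subD hv by blast
    qed (intro cholomorphic_intros open_ball)
    moreover have "f cholomorphic_on ball z0 r"
      using zD by (intro chol_subset[OF f]) auto
    ultimately have "(%z. inverse (h n) * (f (z + h n *\<^sub>C v) - f z)) cholomorphic_on ball z0 r"
      by (intro cholomorphic_intros) auto
    then show "(%z. (f (z + h n *\<^sub>C v) - f z) / h n) cholomorphic_on ball z0 r"
      by (simp add: field_simps)
  next
    fix e :: real assume e: "e > 0"
    have M0: "M >= 0" by (simp add: M_def)
    obtain N where N: "real N > 3 * M / r / e" using reals_Archimedean2 by blast
    have "cmod ((f (z + h n *\<^sub>C v) - f z) / h n - cpartial f v z) <= e"
      if n: "n >= N" and z: "z \<in> ball z0 r" for n z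
    proof -
      have "cmod ((f (z + h n *\<^sub>C v) - f z) / h n - cpartial f v z) <= 3 * M / r\<^sup>2 * cmod (h n)"
        using subD[OF z] bd[OF z] h by (intro difference_quotient_bound r v chol_subset[OF f]) auto
      also have "... = 3 * M / r / (2 + real n)"
        using r h(3) by (simp add: power2_eq_square)
      also have "... <= e"
      proof -
        have "3 * M / r <= e * real N" using N e r by (simp add: field_simps)
        also have "... <= e * (2 + real n)" using n e by (intro mult_left_mono) auto
        finally show ?thesis
          by (subst pos_divide_le_eq) (simp_all add: add_nonneg_pos)
      qed
      finally show ?thesis .
    qed
    then show "\<exists>N. \<forall>n\<ge>N. \<forall>z\<in>ball z0 r.
        cmod ((f (z + h n *\<^sub>C v) - f z) / h n - cpartial f v z) <= e" by blast
  qed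
  then show "\<exists>V. z0 \<in> V & V \<subseteq> D & cpartial f v cholomorphic_on V"
    using r zD by (intro exI[of _ "ball z0 r"]) auto
qed

fun xy_dir :: "'m option => 'm::finite xy"
  where "xy_dir None = (1, 0)" | "xy_dir (Some i) = (0, axis i 1)"

lemma norm_xy_dir: "norm (xy_dir d) <= 1"
  by (cases d) (simp_all add: norm_axis_1)

lemma xy_partial_eq_cpartial: "xy_partial d f (u, q) = cpartial (%u. f (u, q)) (xy_dir d) u"
proof -
  obtain x y where u: "u = (x, y)" by (cases u)
  have shift: "deriv g a = deriv (%ze. g (a + ze)) 0" for g :: "complex => complex" and a
    unfolding deriv_def using DERIV_shift[of g _ 0 a] by (simp add: add.commute)
  show ?thesis
  proof (cases d)
    case None
    show ?thesis
      unfolding u None cpartial_def using shift[of "%s. f ((s, y), q)" x]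
      by (simp add: scaleC_prod_def scaleC_complex_def scaleC.zero_right)
  next
    case (Some i)
    have "(\<chi> j. if j = i then y $ i + ze else y $ j) = y + ze *\<^sub>C axis i 1" for ze
      by (auto simp: vec_eq_iff axis_def scaleC_vec_def scaleC_complex_def)
    then show ?thesis
      unfolding u Some cpartial_def
      using shift[of "%s. f ((x, \<chi> j. if j = i then s else y $ j), q)" "y $ i"]
      by (simp add: scaleC_prod_def scaleC_complex_def scaleC.zero_right)
  qed
qed

lemma xy_expand:
  fixes u :: "'m::finite xy"
  shows "u = fst u *\<^sub>C xy_dir None + (\<Sum>i\<in>UNIV. (snd u $ i) *\<^sub>C xy_dir (Some i))"
proof -
  have "(\<Sum>i\<in>UNIV. snd u $ i * axis i 1 $ j) = snd u $ j" for j
    unfolding axis_def by (simp add: if_distrib[of "%x. _ * x"] cong: if_cong)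
  then show ?thesis
    by (simp add: prod_eq_iff fst_sum snd_sum vec_eq_iff scaleC_prod_def scaleC_vec_def
        scaleC_complex_def)
qed

lemma norm_fst_le_norm: "norm (fst z) <= norm z"
  and norm_snd_le_norm: "norm (snd z) <= norm z"
  unfolding norm_prod_def by (rule real_le_rsqrt, simp)+

text \<open>Induction on the order: each first partial derivative vanishes to one order less, hence
  is small against \<open>norm u ^ n\<close>, and the mean value inequality on the ball of radius
  \<open>norm u\<close> supplies one more power.\<close>

lemma vanishing_little_o:
  fixes f :: "'m::finite xy \<times> 'c => complex"
  assumes "(%u. f (u, q)) cholomorphic_on V" "0 \<in> V" "vanishes_to_order n f q" "e > 0"
  shows "\<exists>d>0. \<forall>u. norm u < d --> cmod (f (u, q)) <= e * norm u ^ n"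
  using assms
proof (induction n arbitrary: f e)
  case (0 f e)
  have f0: "f (0, q) = 0"
    using 0(3) unfolding vanishes_to_order_def by (auto dest: spec[of _ "[]"] simp: zero_prod_def)
  have "isCont (%u. f (u, q)) 0"
    using chol_imp_continuous_on[OF 0(1)] chol_open[OF 0(1)] 0(2)
      continuous_on_eq_continuous_at by blast
  then obtain d where "d > 0" "!!u. dist u 0 < d ==> dist (f (u, q)) (f (0, q)) < e"
    unfolding continuous_at_eps_delta using 0(4) by blast
  then show ?case
    using f0 by (intro exI[of _ d]) (auto simp: less_imp_le)
next
  case (Suc n f e)
  have f0: "f (0, q) = 0"
    using Suc.prems(3) unfolding vanishes_to_order_def
    by (auto dest: spec[of _ "[]"] simp: zero_prod_def)
  \<comment> \<open>The number of coordinate directions; each partial derivative receives the share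
    \<open>e / c\<close> of the error.\<close>
  define c where "c = real (CARD('m)) + 1"
  have c: "c > 0" by (simp add: c_def)
  have "\<exists>dl>0. \<forall>u. norm u < dl --> cmod (xy_partial d f (u, q)) <= e / c * norm u ^ n" for d
  proof (rule Suc.IH[OF _ Suc.prems(2)])
    show "(%u. xy_partial d f (u, q)) cholomorphic_on V"
      unfolding xy_partial_eq_cpartial by (rule cholomorphic_cpartial[OF Suc.prems(1) norm_xy_dir])
    show "vanishes_to_order n (xy_partial d f) q"
      unfolding vanishes_to_order_def
    proof (intro allI impI)
      fix ds :: "'m option list" assume "length ds <= n"
      \<comment> \<open>\<open>foldr\<close> applies the last list entry first, so appending
        \<open>d\<close> means differentiating in direction \<open>d\<close> before all of
        \<open>ds\<close>.\<close>
      then have "foldr xy_partial (ds @ [d]) f ((0, 0), q) = 0"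
        using Suc.prems(3) unfolding vanishes_to_order_def by (metis length_append_singleton Suc_le_mono)
      then show "foldr xy_partial ds (xy_partial d f) ((0, 0), q) = 0" by simp
    qed
  qed (use Suc.prems c in auto)
  then obtain dl where dl: "!!d. dl d > 0"
      "!!d u. norm u < dl d ==> cmod (xy_partial d f (u, q)) <= e / c * norm u ^ n" by metis
  obtain R where R: "R > 0" "ball 0 R \<subseteq> V"
    using chol_open[OF Suc.prems(1)] Suc.prems(2) openE by blast
  define dl0 where "dl0 = min R (Min (range dl))"
  have dl0: "dl0 > 0" using R dl(1) by (simp add: dl0_def)
  have ledl: "dl0 <= dl d" for d by (simp add: dl0_def min.coboundedI2)
  have "cmod (f (u, q)) <= e * norm u ^ Suc n" if u: "norm u < dl0" for u
  proof -
    have inV: "w \<in> V" if "w \<in> cball 0 (norm u)" for w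
      using that u R by (auto simp: dl0_def)
    have "\<forall>w. \<exists>L. w \<in> cball 0 (norm u) --> has_cderivative (%u. f (u, q)) L w"
      using Suc.prems(1) inV by (meson chol_obtain)
    then obtain L where L: "!!w. w \<in> cball 0 (norm u) ==> has_cderivative (%u. f (u, q)) (L w) w"
      by metis
    have onorm: "onorm (L w) <= e * norm u ^ n" if w: "w \<in> cball 0 (norm u)" for w
    proof (rule onorm_le)
      fix v :: "'m xy"
      have lin: "linear (L w)" and sc: "!!c v. L w (c *\<^sub>C v) = c * L w v"
        using L[OF w] has_derivative_linear unfolding has_cderivative_def scaleC_complex_def by blast+
      have p: "cmod (L w (xy_dir d)) <= e / c * norm u ^ n" for d
      proof -
        have "cmod (L w (xy_dir d)) = cmod (xy_partial d f (w, q))"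
          by (simp add: xy_partial_eq_cpartial cpartial_eq[OF L[OF w]])
        also have "... <= e / c * norm w ^ n"
          using w u ledl[of d] by (intro dl(2)) auto
        also have "... <= e / c * norm u ^ n"
          using w c Suc.prems(4) by (intro mult_left_mono power_mono) auto
        finally show ?thesis .
      qed
      have "L w v = fst v * L w (xy_dir None) + (\<Sum>i\<in>UNIV. (snd v $ i) * L w (xy_dir (Some i)))"
        by (subst xy_expand[of v]) (simp only: linear_add[OF lin] linear_sum[OF lin] sc)
      also have "cmod ... <= cmod (fst v * L w (xy_dir None)) + (\<Sum>i\<in>UNIV. cmod ((snd v $ i) * L w (xy_dir (Some i))))"
        by (rule order_trans[OF norm_triangle_ineq]) (intro add_left_mono norm_sum)
      also have "... <= norm v * (e / c * norm u ^ n) + (\<Sum>i\<in>(UNIV::'m set). norm v * (e / c * norm u ^ n))"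
        unfolding norm_mult
        by (intro add_mono sum_mono mult_mono p order_trans[OF Finite_Cartesian_Product.norm_nth_le norm_snd_le_norm] norm_fst_le_norm) auto
      also have "... = c * (norm v * (e / c * norm u ^ n))"
        by (simp add: c_def ring_distribs del: times_divide_eq_left times_divide_eq_right)
      also have "... = e * norm u ^ n * norm v" using c by simp
      finally show "norm (L w v) <= e * norm u ^ n * norm v" .
    qed
    have "norm (f (u, q) - f (0, q)) <= (e * norm u ^ n) * norm (u - 0)"
    proof (rule differentiable_bound[where S="cball 0 (norm u)" and f="%u. f (u, q)"])
      show "((%u. f (u, q)) has_derivative L w) (at w within cball 0 (norm u))" if "w \<in> cball 0 (norm u)" for w
        using L[OF that] has_derivative_at_withinI unfolding has_cderivative_def by blast
    qed (use onorm in auto)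
    then show ?thesis using f0 by (simp add: mult.commute mult.left_commute)
  qed
  then show ?case using dl0 by blast
qed

text \<open>The qualitative smallness becomes an explicit power with a constant independent of
  \<open>q\<close>: the Schwarz lemma is applied on the line through \<open>u\<close>, on a disc of
  radius \<open>r / norm u\<close>, and evaluated at \<open>ze = 1\<close>.\<close>

lemma vanishing_bound:
  fixes f :: "'m::finite xy \<times> 'c => complex"
  assumes f: "(%u. f (u, q)) cholomorphic_on ball 0 r" and M: "!!u. norm u < r ==> cmod (f (u, q)) <= M"
    and n: "vanishes_to_order n f q" and u: "norm u < r"
  shows "cmod (f (u, q)) <= M * (norm u / r) ^ Suc n"
proof (cases "u = 0")
  case True
  have "f (0, q) = 0"
    using n unfolding vanishes_to_order_def by (auto dest: spec[of _ "[]"] simp: zero_prod_def)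
  then show ?thesis using True by simp
next
  case False
  have r: "r > 0" using u norm_ge_zero by (smt (verit))
  define R where "R = r / norm u"
  have R: "1 < R" using u False by (simp add: R_def)
  have inb: "norm (ze *\<^sub>C u) < r" if "cmod ze < R" for ze
    using that False by (simp add: R_def norm_scaleC field_simps)
  have "cmod (f (0 + 1 *\<^sub>C u, q)) <= M * (cmod 1 / R) ^ Suc n"
  proof (rule schwarz_order[where g="%ze. f (0 + ze *\<^sub>C u, q)"])
    show "(%ze. f (0 + ze *\<^sub>C u, q)) holomorphic_on ball 0 R"
      using inb by (intro holomorphic_on_subset[OF cholomorphic_slice[OF f]]) auto
    show "cmod (f (0 + ze *\<^sub>C u, q)) <= M" if "cmod ze < R" for ze
      using M inb[OF that] by simp
    show "((%ze. f (0 + ze *\<^sub>C u, q) / ze ^ n) \<longlongrightarrow> 0) (at 0)"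
    proof (rule LIM_I)
      fix e :: real assume e: "e > 0"
      define e' where "e' = e / (2 * norm u ^ n)"
      have e': "e' > 0" using e False by (simp add: e'_def)
      obtain d where d: "d > 0" "!!u. norm u < d ==> cmod (f (u, q)) <= e' * norm u ^ n"
        using vanishing_little_o[OF f _ n e'] r by auto
      have "norm (f (0 + ze *\<^sub>C u, q) / ze ^ n - 0) < e" if "ze ~= 0" "cmod ze < d / norm u" for ze
      proof -
        have "cmod (f (ze *\<^sub>C u, q)) <= e' * norm (ze *\<^sub>C u) ^ n"
          using that False by (intro d) (simp add: norm_scaleC field_simps)
        also have "... = e / 2 * cmod ze ^ n"
          using False by (simp add: e'_def norm_scaleC power_mult_distrib)
        finally have "cmod (f (ze *\<^sub>C u, q)) / cmod ze ^ n <= e / 2"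
          using that by (simp add: divide_le_eq)
        then have "cmod (f (ze *\<^sub>C u, q)) / cmod ze ^ n < e" using e by linarith
        then show ?thesis by (simp add: norm_divide norm_power)
      qed
      then show "\<exists>s>0. \<forall>x. x ~= 0 & norm (x - 0) < s --> norm (f (0 + x *\<^sub>C u, q) / x ^ n - 0) < e"
        using d(1) False by (intro exI[of _ "d / norm u"]) auto
    qed
  qed (use R in auto)
  then show ?thesis by (simp add: R_def)
qed

lemma lipschitz_cauchy:
  fixes f :: "'a::complex_normed_space => complex"
  assumes f: "f cholomorphic_on V" and S: "convex S" "!!v. v \<in> S ==> ball v r \<subseteq> V" and r: "r > 0"
    and M: "!!v. v \<in> V ==> cmod (f v) <= M" and v: "v1 \<in> S" "v2 \<in> S"
  shows "cmod (f v1 - f v2) <= M / r * norm (v1 - v2)"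
proof -
  have inV: "w \<in> V" if "w \<in> S" for w
    using S(2)[OF that] r by auto
  have "\<forall>w. \<exists>L. w \<in> S --> has_cderivative f L w"
    using f inV by (meson chol_obtain)
  then obtain L where L: "!!w. w \<in> S ==> has_cderivative f (L w) w" by metis
  show ?thesis
  proof (rule differentiable_bound[OF S(1) _ _ v])
    show "(f has_derivative L w) (at w within S)" if "w \<in> S" for w
      using L[OF that] has_derivative_at_withinI unfolding has_cderivative_def by blast
    show "onorm (L w) <= M / r" if w: "w \<in> S" for w
    proof (rule onorm_bound)
      show "0 <= M / r" using M[OF inV[OF v(1)]] r norm_ge_zero[of "f v1"] by (intro divide_nonneg_pos) linarith+
      show "norm (L w v) <= M / r * norm v" for v
        using M S(2)[OF w]
        by (intro cauchy_estimate[OF chol_subset[OF f open_ball S(2)[OF w]] L[OF w] _ r]) blast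
    qed
  qed
qed

section \<open>Closed strips, the lattice and the torus norm\<close>

definition cstrip :: "real => (complex ^ 'd) set"
  where "cstrip sg = {th. \<forall>i. \<bar>Im (th $ i)\<bar> <= sg}"

lemma norm_vec_le_sum: "norm (v :: 'a::real_normed_vector ^ 'n) <= (\<Sum>i\<in>UNIV. norm (v $ i))"
  unfolding norm_vec_def by (rule L2_set_le_sum) simp

lemma compact_fundamental_domain:
  "compact {th :: complex ^ 'd. (\<forall>i. 0 <= Re (th $ i) & Re (th $ i) <= 1) & th \<in> cstrip sg}" (is "compact ?S")
proof -
  have "closed ?S"
    unfolding cstrip_def mem_Collect_eq
    by (intro closed_Collect_conj closed_Collect_all closed_Collect_le continuous_intros)
  moreover have "bounded ?S"
  proof (rule boundedI)
    fix th :: "complex ^ 'd" assume th: "th \<in> ?S"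
    have "cmod (th $ i) <= 1 + sg" for i
      using th cmod_le[of "th $ i"] unfolding cstrip_def by (smt (verit) mem_Collect_eq)
    then show "norm th <= (\<Sum>i\<in>(UNIV::'d set). 1 + sg)"
      by (intro order_trans[OF norm_vec_le_sum] sum_mono)
  qed
  ultimately show ?thesis by (simp add: compact_eq_bounded_closed)
qed

lemma lattice_add: "k \<in> lattice_pts ==> l \<in> lattice_pts ==> k + l \<in> lattice_pts"
  and lattice_minus: "k \<in> lattice_pts ==> - k \<in> lattice_pts"
  and lattice_diff: "k \<in> lattice_pts ==> l \<in> lattice_pts ==> k - l \<in> lattice_pts"
  and lattice_zero: "0 \<in> lattice_pts"
  by (auto simp: lattice_pts_def)

lemma torus_eq_refl [simp]: "a \<doteq> a"
  and torus_eq_sym: "a \<doteq> b ==> b \<doteq> a"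
  and torus_eq_trans: "a \<doteq> b ==> b \<doteq> c ==> a \<doteq> c"
  and torus_eq_add: "a \<doteq> b ==> c \<doteq> d ==> a + c \<doteq> b + d"
  and torus_eq_diff: "a \<doteq> b ==> c \<doteq> d ==> a - c \<doteq> b - d"
proof -
  show "a \<doteq> a" by (simp add: torus_eq_def lattice_zero)
  show "a \<doteq> b ==> b \<doteq> a" unfolding torus_eq_def using lattice_minus by fastforce
  show "a \<doteq> b ==> b \<doteq> c ==> a \<doteq> c" unfolding torus_eq_def using lattice_add by fastforce
  show "a \<doteq> b ==> c \<doteq> d ==> a + c \<doteq> b + d"
    unfolding torus_eq_def using lattice_add[of "a - b" "c - d"] by (simp add: algebra_simps)
  show "a \<doteq> b ==> c \<doteq> d ==> a - c \<doteq> b - d"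
    unfolding torus_eq_def using lattice_diff[of "a - b" "c - d"] by (simp add: algebra_simps)
qed

lemma lattice_norm_ge_1:
  assumes "k \<in> lattice_pts" "k ~= 0"
  shows "norm k >= 1"
proof -
  obtain i where "k $ i ~= 0" using assms(2) by (auto simp: vec_eq_iff)
  moreover obtain n :: int where n: "k $ i = of_int n"
    using assms(1) by (auto simp: lattice_pts_def elim: Ints_cases)
  ultimately have "1 <= \<bar>n\<bar>" by auto
  then have "1 <= norm (k $ i)" by (simp add: n norm_of_int)
  also have "... <= norm k" by (rule Finite_Cartesian_Product.norm_nth_le)
  finally show ?thesis .
qed

lemma torus_norm_le: "k \<in> lattice_pts ==> torus_norm th <= norm (th - k)"
  unfolding torus_norm_def dist_norm[symmetric] by (rule infdist_le)

lemma torus_norm_le_norm: "torus_norm th <= norm th"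
  using torus_norm_le[OF lattice_zero] by simp

lemma torus_norm_cong:
  fixes a b :: "complex ^ 'd"
  shows "a \<doteq> b ==> torus_norm a = torus_norm b"
proof -
  have le: "torus_norm a <= torus_norm b" if "a \<doteq> b" for a b :: "complex ^ 'd"
  proof -
    have ne: "lattice_pts ~= ({} :: (complex ^ 'd) set)" using lattice_zero by blast
    have "torus_norm a <= dist b k" if "k \<in> lattice_pts" for k
      using torus_norm_le[OF lattice_add[OF that \<open>a \<doteq> b\<close>[unfolded torus_eq_def]], of a]
      by (simp add: dist_norm algebra_simps)
    then show ?thesis
      unfolding torus_norm_def[of b] infdist_notempty[OF ne] by (rule cINF_greatest[OF ne])
  qed
  show "a \<doteq> b ==> torus_norm a = torus_norm b"
    using le torus_eq_sym by (metis order_antisym)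
qed

text \<open>A nonzero lattice vector has norm at least 1, so 0 is the closest lattice point to any
  vector shorter than \<open>1 / 2\<close>.\<close>

lemma torus_norm_small:
  fixes th :: "complex ^ 'd"
  assumes "norm th < 1 / 2"
  shows "torus_norm th = norm th"
proof (rule antisym[OF torus_norm_le_norm])
  have ne: "lattice_pts ~= ({} :: (complex ^ 'd) set)" using lattice_zero by blast
  have "norm th <= dist th k" if "k \<in> lattice_pts" for k
  proof (cases "k = 0")
    case False
    then show ?thesis
      using lattice_norm_ge_1[OF that False] norm_triangle_ineq2[of k th] assms
      by (simp add: dist_norm norm_minus_commute)
  qed simp
  then show "norm th <= torus_norm th"
    unfolding torus_norm_def infdist_notempty[OF ne] by (rule cINF_greatest[OF ne])
qed

lemma torus_norm_attained:
  fixes th :: "complex ^ 'd"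
  assumes "torus_norm th < b"
  obtains k where "k \<in> lattice_pts" "norm (th - k) < b"
proof -
  have ne: "lattice_pts ~= ({} :: (complex ^ 'd) set)" using lattice_zero by blast
  have "bdd_below (dist th ` lattice_pts)"
    by (rule bdd_belowI[of _ 0]) auto
  then have "\<exists>k\<in>lattice_pts. dist th k < b"
    using assms ne unfolding torus_norm_def infdist_notempty[OF ne] by (simp add: cINF_less_iff)
  then show ?thesis using that by (auto simp: dist_norm)
qed

text \<open>Two representatives shorter than \<open>1 / 2\<close> differ by a lattice vector shorter
  than 1. This is what converts congruences into equations once maps have been lifted.\<close>

lemma small_torus_eq:
  assumes "a \<doteq> b" "norm a < 1 / 2" "norm b < 1 / 2"
  shows "a = b"
proof (rule ccontr)
  assume "a ~= b"
  then have "1 <= norm (a - b)" using assms(1) by (intro lattice_norm_ge_1) (auto simp: torus_eq_def)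
  then show False using norm_triangle_ineq4[of a b] assms by simp
qed

lemma reduce_mod_lattice:
  fixes th :: "complex ^ 'd"
  obtains k where "k \<in> lattice_pts" "\<forall>i. 0 <= Re ((th + k) $ i) & Re ((th + k) $ i) <= 1"
proof
  let ?k = "(\<chi> i. - of_int \<lfloor>Re (th $ i)\<rfloor>) :: complex ^ 'd"
  show "?k \<in> lattice_pts" by (simp add: lattice_pts_def)
  have "0 <= Re ((th + ?k) $ i) & Re ((th + ?k) $ i) <= 1" for i
    using floor_correct[of "Re (th $ i)"] by simp linarith
  then show "\<forall>i. 0 <= Re ((th + ?k) $ i) & Re ((th + ?k) $ i) <= 1" by blast
qed

lemma lattice_Im: "k \<in> lattice_pts ==> Im (k $ i) = 0"
  by (simp add: lattice_pts_def complex_is_Int_iff)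

lemma strip_add_lattice_iff: "k \<in> lattice_pts ==> th + k \<in> strip sg \<longleftrightarrow> th \<in> strip sg"
  by (simp add: strip_def lattice_Im)

lemma cstrip_add_lattice_iff: "k \<in> lattice_pts ==> th + k \<in> cstrip sg \<longleftrightarrow> th \<in> cstrip sg"
  by (simp add: cstrip_def lattice_Im)

lemma open_strip: "open (strip sg :: (complex ^ 'd) set)"
proof -
  have "strip sg = (\<Inter>i. {th :: complex ^ 'd. \<bar>Im (th $ i)\<bar> < sg})"
    by (auto simp: strip_def)
  then show ?thesis
    by (auto intro!: open_INT open_Collect_less continuous_intros)
qed

text \<open>Modulo the lattice a closed strip is compact, so the tube lemma gives one radius over a
  fundamental domain, and the invariance of \<open>W\<close> under integer translations carries it
  to the whole strip.\<close>

lemma tube_subset: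
  fixes W :: "('a::{complex_normed_space, heine_borel} \<times> ('d::finite, 'p::finite) angle_param) set"
  assumes W: "torus_domain W" and sub: "{0} \<times> cstrip sg \<times> L \<subseteq> W" and L: "compact L"
  shows "\<exists>r>0. cball 0 r \<times> cstrip sg \<times> L \<subseteq> W"
proof -
  define F where "F = {th :: complex ^ 'd. (\<forall>i. 0 <= Re (th $ i) & Re (th $ i) <= 1) & th \<in> cstrip sg}"
  have "compact ({0::'a} \<times> F \<times> L)"
    unfolding F_def by (intro compact_Times compact_fundamental_domain L) auto
  moreover have "open W" "{0} \<times> F \<times> L \<subseteq> W"
    using W sub by (auto simp: torus_domain_def F_def)
  ultimately obtain e where e: "e > 0" "(\<Union>z\<in>{0} \<times> F \<times> L. cball z e) \<subseteq> W"
    using compact_subset_open_imp_cball_epsilon_subset by blast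
  have "(u, th, mu) \<in> W" if "norm u <= e" "th \<in> cstrip sg" "mu \<in> L" for u th mu
  proof -
    obtain k where k: "k \<in> lattice_pts" "\<forall>i. 0 <= Re ((th + k) $ i) & Re ((th + k) $ i) <= 1"
      using reduce_mod_lattice[of th] by blast
    have "th + k \<in> F" using k that by (auto simp: F_def cstrip_add_lattice_iff)
    moreover have "(u, th + k, mu) \<in> cball (0, th + k, mu) e"
      using that by (simp add: dist_prod_def)
    ultimately have "(u, th + k, mu) \<in> (\<Union>z\<in>{0} \<times> F \<times> L. cball z e)"
      using that by (intro UN_I[of "(0, th + k, mu)"]) auto
    then have "(u, th + k, mu) \<in> W" using e(2) by (rule subsetD[rotated])
    then have "(u, th + k + - k, mu) \<in> W"
      using W lattice_minus[OF k(1)] unfolding torus_domain_def by blast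
    then show ?thesis by simp
  qed
  then show ?thesis using e(1) by (intro exI[of _ e]) auto
qed

lemma periodic_bounded:
  fixes f :: "'a::{complex_normed_space, heine_borel} \<times> ('d::finite, 'p::finite) angle_param => 'b::complex_normed_space"
  assumes f: "analytic_fun W f" and sub: "cball 0 r \<times> cstrip sg \<times> L \<subseteq> W" and L: "compact L"
  shows "\<exists>M>0. \<forall>z\<in>cball 0 r \<times> cstrip sg \<times> L. norm (f z) <= M"
proof -
  define F where "F = {th :: complex ^ 'd. (\<forall>i. 0 <= Re (th $ i) & Re (th $ i) <= 1) & th \<in> cstrip sg}"
  have F: "cball 0 r \<times> F \<times> L \<subseteq> W" using sub by (auto simp: F_def)
  have "continuous_on (cball 0 r \<times> F \<times> L) f"
    using f unfolding analytic_fun_def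
    by (intro continuous_on_subset[OF chol_imp_continuous_on F]) simp
  then have "compact (f ` (cball 0 r \<times> F \<times> L))"
    by (rule compact_continuous_image) (unfold F_def, intro compact_Times compact_fundamental_domain L compact_cball)
  then have "bounded (f ` (cball 0 r \<times> F \<times> L))"
    by (rule compact_imp_bounded)
  then obtain M where M: "M > 0" "\<forall>y\<in>f ` (cball 0 r \<times> F \<times> L). norm y <= M"
    unfolding bounded_pos by blast
  have "norm (f (u, th, mu)) <= M" if z: "(u, th, mu) \<in> cball 0 r \<times> cstrip sg \<times> L" for u th mu
  proof -
    obtain k where k: "k \<in> lattice_pts" "\<forall>i. 0 <= Re ((th + k) $ i) & Re ((th + k) $ i) <= 1"
      using reduce_mod_lattice[of th] by blast
    have "f (u, th + k, mu) = f (u, th, mu)"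
      using f k z sub unfolding analytic_fun_def by blast
    moreover have "(u, th + k, mu) \<in> cball 0 r \<times> F \<times> L"
      using k z by (auto simp: F_def cstrip_add_lattice_iff)
    ultimately show ?thesis using M(2) by (metis imageI)
  qed
  then show ?thesis using M(1) by (intro exI[of _ M]) auto
qed

subsection \<open>Weighted fixed points and sectors\<close>

text \<open>The bound \<open>M * w2\<close> persists for all iterates. Where \<open>w2\<close> is at
  most a small multiple of \<open>w1\<close> it already suffices; elsewhere the factor
  \<open>1 - c\<close> is at most some \<open>\<tau> < 1\<close>. Measured against
  \<open>w1\<close>, the error is therefore at most \<open>M * max et' (\<tau> ^ k)\<close>. The
  index \<open>k0\<close> is chosen before the sequence \<open>e\<close>, so the decay is uniform
  over all sequences satisfying the recursion.\<close>

lemma majorant_decay: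
  fixes p q c w1 w2 :: "'a => real"
  assumes r: "!!z. z \<in> D ==> r z \<in> D"
    and pos: "!!z. z \<in> D ==> 0 <= p z" "!!z. z \<in> D ==> 0 <= q z" "!!z. z \<in> D ==> 0 <= c z"
      "!!z. z \<in> D ==> 0 <= w2 z" "!!z. z \<in> D ==> w2 z <= w1 z" "0 <= M"
    and w1: "!!z. z \<in> D ==> p z * w1 (r z) + q z * w1 z <= (1 - c z) * w1 z"
    and w2: "!!z. z \<in> D ==> p z * w2 (r z) + q z * w2 z <= (1 - c z) * w2 z"
    and mix: "!!et. et > 0 ==> \<exists>\<tau>\<ge>0. \<tau> < 1 & (\<forall>z\<in>D. w2 z <= et * w1 z \<or> 1 - c z <= \<tau>)"
    and et: "et > 0"
  shows "\<exists>k0. \<forall>e :: nat => 'a => real. (\<forall>z\<in>D. e 0 z <= M * w2 z) -->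
    (\<forall>k. \<forall>z\<in>D. e (Suc k) z <= p z * e k (r z) + q z * e k z) -->
    (\<forall>k\<ge>k0. \<forall>z\<in>D. e k z <= et * w1 z)"
proof -
  \<comment> \<open>Dividing by \<open>M + 1\<close> rather than \<open>M\<close> allows
    \<open>M = 0\<close>.\<close>
  define et' where "et' = et / (M + 1)"
  have et': "et' > 0" "M * et' <= et" using et pos(6) by (simp_all add: et'_def field_simps)
  obtain \<tau> where \<tau>: "\<tau> >= 0" "\<tau> < 1" "!!z. z \<in> D ==> w2 z <= et' * w1 z \<or> 1 - c z <= \<tau>"
    using mix[OF et'(1)] by blast
  obtain k0 where k0: "\<tau> ^ k0 < et'" using real_arch_pow_inv[OF et'(1) \<tau>(2)] by blast
  show ?thesis
  proof (intro exI[of _ k0] allI impI ballI)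
    fix e :: "nat => 'a => real" and k z
    assume e0': "\<forall>z\<in>D. e 0 z <= M * w2 z"
      and es': "\<forall>k. \<forall>z\<in>D. e (Suc k) z <= p z * e k (r z) + q z * e k z"
      and k: "k >= k0" and z: "z \<in> D"
    note e0 = bspec[OF e0'] and es = bspec[OF spec[OF es']]
    have step: "e (Suc k) z <= p z * (a * w (r z)) + q z * (a * w z)"
      if "!!z. z \<in> D ==> e k z <= a * w z" "z \<in> D" for k z a and w :: "'a => real"
      using es[OF that(2), of k] mult_left_mono[OF that(1)[OF r[OF that(2)]] pos(1)[OF that(2)]]
        mult_left_mono[OF that(1)[OF that(2)] pos(2)[OF that(2)]] by linarith
    have b2: "e k z <= M * w2 z" if "z \<in> D" for k z
      using that
    proof (induction k arbitrary: z)
      case (Suc k z)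
      have "e (Suc k) z <= M * (p z * w2 (r z) + q z * w2 z)"
        using step[of k M w2 z] Suc by (simp add: algebra_simps)
      also have "... <= M * ((1 - c z) * w2 z)"
        by (intro mult_left_mono w2 Suc pos)
      also have "... <= M * (1 * w2 z)"
        by (intro mult_left_mono mult_right_mono pos Suc) (use pos(3)[OF Suc(2)] in auto)
      finally show ?case by simp
    qed (use e0 in auto)
    have w1p: "0 <= w1 z" if "z \<in> D" for z using pos(4,5)[OF that] by linarith
    have b1: "e k z <= M * (max et' (\<tau> ^ k)) * w1 z" if "z \<in> D" for k z
      using that
    proof (induction k arbitrary: z)
      case (0 z)
      have "M * w2 z <= M * (max et' 1 * w1 z)"
        using pos(5)[OF 0] w1p[OF 0] mult_right_mono[of 1 "max et' 1" "w1 z"]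
        by (intro mult_left_mono pos) auto
      then show ?case using e0[OF 0] by (simp add: mult.assoc)
    next
      case (Suc k z)
      show ?case
      proof (cases "w2 z <= et' * w1 z")
        case True
        have "e (Suc k) z <= M * (et' * w1 z)"
          using b2[OF Suc(2), of "Suc k"] mult_left_mono[OF True pos(6)] by linarith
        also have "... <= M * (max et' (\<tau> ^ Suc k) * w1 z)"
          by (intro mult_left_mono mult_right_mono pos w1p Suc) auto
        finally show ?thesis by (simp add: mult.assoc)
      next
        case False
        then have c: "1 - c z <= \<tau>" using \<tau>(3)[OF Suc(2)] by blast
        let ?a = "M * max et' (\<tau> ^ k)"
        have a0: "0 <= ?a" using pos(6) et'(1) by (intro mult_nonneg_nonneg) auto
        have "e (Suc k) z <= ?a * (p z * w1 (r z) + q z * w1 z)"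
          using step[of k ?a w1 z, OF Suc.IH Suc(2)] by (simp add: algebra_simps)
        also have "... <= ?a * (\<tau> * w1 z)"
        proof (rule mult_left_mono[OF _ a0])
          show "p z * w1 (r z) + q z * w1 z <= \<tau> * w1 z"
            using w1[OF Suc(2)] mult_right_mono[OF c w1p[OF Suc(2)]] by linarith
        qed
        also have "... = M * ((max et' (\<tau> ^ k) * \<tau>) * w1 z)" by simp
        also have "... <= M * (max et' (\<tau> ^ Suc k) * w1 z)"
        proof (intro mult_left_mono mult_right_mono pos w1p Suc)
          have "et' * \<tau> <= et' * 1" using et' \<tau> by (intro mult_left_mono) auto
          then show "max et' (\<tau> ^ k) * \<tau> <= max et' (\<tau> ^ Suc k)"
            by (auto simp: max_def mult.commute)
        qed
        finally show ?thesis by (simp add: mult.assoc)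
      qed
    qed
    have "\<tau> ^ k <= \<tau> ^ k0" using k \<tau> by (intro power_decreasing) auto
    then have "max et' (\<tau> ^ k) = et'" using k0 by simp
    then have "e k z <= M * et' * w1 z" using b1[OF z, of k] by simp
    also have "... <= et * w1 z" by (intro mult_right_mono et' w1p z)
    finally show "e k z <= et * w1 z" .
  qed
qed

text \<open>\<open>A z\<close> depends on the unknown at \<open>z\<close> and, through its last
  argument, at \<open>r z\<close>; \<open>q\<close> and \<open>p\<close> are the Lipschitz constants
  for the two. The norms \<open>n z\<close> are equivalent to the given one only pointwise, with
  constants that may degenerate, so smallness is measured by weights: \<open>w2\<close> bounds the
  solution, and convergence is uniform relative to the larger weight \<open>w1\<close>.\<close>

lemma weighted_fixed_point:
  fixes A :: "'a => 'e::banach => 'e => 'e" and n :: "'a => 'e => real" and p q c w1 w2 b b' :: "'a => real"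
    and U :: "nat => 'a => 'e"
  assumes r: "!!z. z \<in> D ==> r z \<in> D"
    and pos: "!!z. z \<in> D ==> 0 <= p z" "!!z. z \<in> D ==> 0 <= q z" "!!z. z \<in> D ==> 0 <= c z"
      "!!z. z \<in> D ==> 0 <= w2 z" "!!z. z \<in> D ==> w2 z <= w1 z" "0 <= M"
    and w1: "!!z. z \<in> D ==> p z * w1 (r z) + q z * w1 z <= (1 - c z) * w1 z"
    and w2: "!!z. z \<in> D ==> p z * w2 (r z) + q z * w2 z <= (1 - c z) * w2 z"
    and mix: "!!et. et > 0 ==> \<exists>\<tau>\<ge>0. \<tau> < 1 & (\<forall>z\<in>D. w2 z <= et * w1 z \<or> 1 - c z <= \<tau>)"
    and n_tri: "!!z u v. z \<in> D ==> n z (u + v) <= n z u + n z v"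
    and n_minus: "!!z u. z \<in> D ==> n z (- u) = n z u"
    and n_lower: "!!z u. z \<in> D ==> norm u <= b z * n z u" and b: "!!z. z \<in> D ==> b z > 0"
    and n_upper: "!!z u. z \<in> D ==> n z u <= b' z * norm u"
    and lip: "!!z dl1 dl2 et1 et2. z \<in> D ==> dl1 \<in> S z ==> dl2 \<in> S z ==>
      n z (A z dl1 et1 - A z dl2 et2) <= p z * n (r z) (et1 - et2) + q z * n z (dl1 - dl2)"
    and ball: "!!z dl. z \<in> D ==> n z dl <= M * w2 z ==> dl \<in> S z"
    and init: "!!z. z \<in> D ==> n z (A z 0 0) <= c z * (M * w2 z)"
    and U0: "!!z. U 0 z = 0" and US: "!!k z. U (Suc k) z = A z (U k z) (U k (r z))"
  obtains u where "!!z. z \<in> D ==> u z = A z (u z) (u (r z))" "!!z. z \<in> D ==> n z (u z) <= M * w2 z"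
    "!!k z. z \<in> D ==> n z (U k z) <= M * w2 z"
    "!!et. et > 0 ==> \<exists>k0. \<forall>k\<ge>k0. \<forall>z\<in>D. n z (U k z - u z) <= et * w1 z"
proof -
  have n0: "n z 0 = 0" if "z \<in> D" for z
    using n_upper[OF that, of 0] n_lower[OF that, of 0] b[OF that] by (simp add: zero_le_mult_iff)
  \<comment> \<open>The ball of radius \<open>M * w2\<close> is preserved exactly: the Lipschitz
    part contributes \<open>1 - c\<close> of the radius and the starting error at most
    \<open>c\<close> of it.\<close>
  have bound: "n z (U k z) <= M * w2 z" if "z \<in> D" for k z
    using that
  proof (induction k arbitrary: z)
    case 0
    then show ?case using pos(4,6) by (simp add: U0 n0)
  next
    case (Suc k z)
    have "n z (U (Suc k) z) <= n z (A z (U k z) (U k (r z)) - A z 0 0) + n z (A z 0 0)"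
      using n_tri[OF Suc(2), of "A z (U k z) (U k (r z)) - A z 0 0" "A z 0 0"] by (simp add: US)
    also have "n z (A z (U k z) (U k (r z)) - A z 0 0) <= p z * n (r z) (U k (r z) - 0) + q z * n z (U k z - 0)"
      using Suc ball n0 pos(4,6) by (intro lip) (auto intro!: ball)
    also have "... <= p z * (M * w2 (r z)) + q z * (M * w2 z)"
      using Suc r by (intro add_mono mult_left_mono pos) auto
    also have "... = M * (p z * w2 (r z) + q z * w2 z)" by (simp add: algebra_simps)
    also have "... <= M * ((1 - c z) * w2 z)"
      by (intro mult_left_mono w2 Suc pos)
    finally show ?case using init[OF Suc(2)] by (simp add: algebra_simps)
  qed
  have inS: "U k z \<in> S z" if "z \<in> D" for k z using ball[OF that bound[OF that]] .
  have nn: "n z u >= 0" if "z \<in> D" for z u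
    using order_trans[OF norm_ge_zero n_lower[OF that, of u]] b[OF that] by (simp add: zero_le_mult_iff)
  \<comment> \<open>For fixed \<open>j\<close> the distance between the iterates \<open>k\<close>
    and \<open>j + k\<close> is an admissible sequence for the majorant lemma, and its
    \<open>k0\<close> does not depend on \<open>j\<close>.\<close>
  have cauchy: "\<exists>k0. \<forall>k\<ge>k0. \<forall>j. \<forall>z\<in>D. n z (U k z - U (j + k) z) <= et * w1 z" if et: "et > 0" for et
  proof -
    obtain k0 where k0: "\<forall>e :: nat => 'a => real. (\<forall>z\<in>D. e 0 z <= M * w2 z) -->
      (\<forall>k. \<forall>z\<in>D. e (Suc k) z <= p z * e k (r z) + q z * e k z) -->
      (\<forall>k\<ge>k0. \<forall>z\<in>D. e k z <= et * w1 z)"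
      using majorant_decay[where p=p and q=q and c=c and r=r and D=D and M=M, OF r pos w1 w2 mix et]
      by (rule exE)
    have "n z (U k z - U (j + k) z) <= et * w1 z" if "k >= k0" "z \<in> D" for k j z
    proof (rule k0[THEN spec[of _ "%k z. n z (U k z - U (j + k) z)"], rule_format, OF _ _ that])
      show "n z (U 0 z - U (j + 0) z) <= M * w2 z" if "z \<in> D" for z
        using bound[OF that] n_minus[OF that] by (simp add: U0)
      show "n z (U (Suc k) z - U (j + Suc k) z) \<le>
          p z * n (r z) (U k (r z) - U (j + k) (r z)) + q z * n z (U k z - U (j + k) z)" if "z \<in> D" for k z
        using lip[OF that inS[OF that] inS[OF that], of k "U k (r z)" "j + k" "U (j + k) (r z)"]
        by (simp add: US)
    qed
    then show ?thesis by blast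
  qed
  have w1p: "0 <= w1 z" if "z \<in> D" for z using pos(4,5)[OF that] by linarith
  have conv: "convergent (%k. U k z)" if z: "z \<in> D" for z
    unfolding Cauchy_convergent_iff[symmetric]
  proof (rule metric_CauchyI)
    fix ep :: real assume ep: "ep > 0"
    define et where "et = ep / (4 * b z * (w1 z + 1))"
    have et: "et > 0" using ep b[OF z] w1p[OF z] by (simp add: et_def)
    have "b z * (et * w1 z) <= b z * (et * (w1 z + 1))"
      using b[OF z] et by (intro mult_left_mono) auto
    also have "... = ep / 4" using b[OF z] w1p[OF z] by (simp add: et_def)
    finally have small: "b z * (et * w1 z) <= ep / 4" .
    obtain k0 where k0: "\<forall>k\<ge>k0. \<forall>j. \<forall>z\<in>D. n z (U k z - U (j + k) z) <= et * w1 z"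
      using cauchy[OF et] by blast
    have d: "norm (U k0 z - U m z) <= ep / 4" if m: "m >= k0" for m
    proof -
      have "norm (U k0 z - U m z) <= b z * n z (U k0 z - U m z)" by (rule n_lower[OF z])
      also have "... <= b z * (et * w1 z)"
      proof (rule mult_left_mono)
        show "n z (U k0 z - U m z) <= et * w1 z"
          using k0[rule_format, OF order_refl z, of "m - k0"] m by simp
      qed (use b[OF z] in simp)
      finally show ?thesis using small by linarith
    qed
    show "\<exists>M. \<forall>m\<ge>M. \<forall>n\<ge>M. dist (U m z) (U n z) < ep"
    proof (intro exI allI impI)
      fix m n assume mn: "k0 <= m" "k0 <= n"
      have "dist (U m z) (U n z) <= dist (U k0 z) (U m z) + dist (U k0 z) (U n z)"
        by (metis dist_commute dist_triangle)
      then show "dist (U m z) (U n z) < ep"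
        using d[OF mn(1)] d[OF mn(2)] ep by (simp add: dist_norm)
    qed
  qed
  define u where "u z = lim (%k. U k z)" for z
  have lim: "(%k. U k z) \<longlonglongrightarrow> u z" if "z \<in> D" for z
    unfolding u_def using conv[OF that] convergent_LIMSEQ_iff by blast
  \<comment> \<open>Estimates of \<open>n z\<close> pass to the limit through the comparison
    \<open>n_upper\<close> with the given norm.\<close>
  have n_lim: "n z (v - u z) <= C" if z: "z \<in> D" and ev: "!!k. k >= k0 ==> n z (v - U k z) <= C" for z v C k0
  proof (rule LIMSEQ_le_const)
    have "(%k. C + b' z * norm (U k z - u z)) \<longlonglongrightarrow> C + b' z * norm (u z - u z)"
      by (intro tendsto_intros lim z)
    then show "(%k. C + b' z * norm (U k z - u z)) \<longlonglongrightarrow> C" by simp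
    show "\<exists>N. \<forall>k\<ge>N. n z (v - u z) <= C + b' z * norm (U k z - u z)"
    proof (intro exI allI impI)
      fix k assume "k0 <= k"
      then show "n z (v - u z) <= C + b' z * norm (U k z - u z)"
        using n_tri[OF z, of "v - U k z" "U k z - u z"] ev n_upper[OF z, of "U k z - u z"] by force
    qed
  qed
  have unif: "\<exists>k0. \<forall>k\<ge>k0. \<forall>z\<in>D. n z (U k z - u z) <= et * w1 z" if et: "et > 0" for et
  proof -
    obtain k0 where k0: "\<forall>k\<ge>k0. \<forall>j. \<forall>z\<in>D. n z (U k z - U (j + k) z) <= et * w1 z"
      using cauchy[OF et] by blast
    have "n z (U k z - u z) <= et * w1 z" if "k >= k0" "z \<in> D" for k z
    proof (rule n_lim[OF that(2)])
      show "n z (U k z - U m z) <= et * w1 z" if "m >= k" for m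
        using k0[rule_format, OF \<open>k >= k0\<close> \<open>z \<in> D\<close>, of "m - k"] that by simp
    qed
    then show ?thesis by blast
  qed
  have ub: "n z (u z) <= M * w2 z" if z: "z \<in> D" for z
    using n_lim[OF z, of 0 0 "M * w2 z"] bound[OF z] n_minus[OF z] by simp
  have uS: "u z \<in> S z" if z: "z \<in> D" for z using ball[OF z ub[OF z]] .
  have fix_u: "u z = A z (u z) (u (r z))" if z: "z \<in> D" for z
  proof (rule LIMSEQ_unique[where X="%k. U (Suc k) z"])
    show "(%k. U (Suc k) z) \<longlonglongrightarrow> u z"
      using lim[OF z] by (rule LIMSEQ_Suc)
    show "(%k. U (Suc k) z) \<longlonglongrightarrow> A z (u z) (u (r z))"
    proof (rule metric_LIMSEQ_I)
      fix ep :: real assume ep: "ep > 0"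
      define X where "X = b z * (p z * w1 (r z) + q z * w1 z) + 1"
      have X: "X > 0"
        unfolding X_def using b[OF z] pos(1,2)[OF z] w1p[OF z] w1p[OF r[OF z]]
        by (intro add_nonneg_pos mult_nonneg_nonneg add_nonneg_nonneg) auto
      define et where "et = ep / (2 * X)"
      have et: "et > 0" using ep X by (simp add: et_def)
      obtain k0 where k0: "\<forall>k\<ge>k0. \<forall>z\<in>D. n z (U k z - u z) <= et * w1 z"
        using unif[OF et] by blast
      have "dist (U (Suc k) z) (A z (u z) (u (r z))) < ep" if k: "k >= k0" for k
      proof -
        have "norm (U (Suc k) z - A z (u z) (u (r z))) <= b z * n z (U (Suc k) z - A z (u z) (u (r z)))"
          by (rule n_lower[OF z])
        also have "... <= b z * (p z * n (r z) (U k (r z) - u (r z)) + q z * n z (U k z - u z))"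
          unfolding US using b[OF z] by (intro mult_left_mono lip z inS uS) auto
        also have "... <= b z * (p z * (et * w1 (r z)) + q z * (et * w1 z))"
          using k0 k z r[OF z] b[OF z] by (intro mult_left_mono add_mono pos z) auto
        also have "... = et * (X - 1)" by (simp add: X_def algebra_simps)
        also have "... <= et * X" using et by (intro mult_left_mono) auto
        also have "... < ep" using X ep by (simp add: et_def)
        finally show ?thesis by (simp add: dist_norm)
      qed
      then show "\<exists>N. \<forall>k\<ge>N. dist (U (Suc k) z) (A z (u z) (u (r z))) < ep" by blast
    qed
  qed
  show ?thesis by (rule that[of u]) (fact fix_u ub bound unif)+
qed

text \<open>The constant sequence of distances between two fixed points satisfies the recursion of
  the majorant lemma, so it lies below every positive multiple of \<open>w1\<close>.\<close>

lemma weighted_fixed_point_unique: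
  fixes A :: "'a => 'e::banach => 'e => 'e" and n :: "'a => 'e => real" and p q c w1 w2 b :: "'a => real"
  assumes r: "!!z. z \<in> D ==> r z \<in> D"
    and pos: "!!z. z \<in> D ==> 0 <= p z" "!!z. z \<in> D ==> 0 <= q z" "!!z. z \<in> D ==> 0 <= c z"
      "!!z. z \<in> D ==> 0 <= w2 z" "!!z. z \<in> D ==> w2 z <= w1 z" "0 <= M"
    and w1: "!!z. z \<in> D ==> p z * w1 (r z) + q z * w1 z <= (1 - c z) * w1 z"
    and w2: "!!z. z \<in> D ==> p z * w2 (r z) + q z * w2 z <= (1 - c z) * w2 z"
    and mix: "!!et. et > 0 ==> \<exists>\<tau>\<ge>0. \<tau> < 1 & (\<forall>z\<in>D. w2 z <= et * w1 z \<or> 1 - c z <= \<tau>)"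
    and n_lower: "!!z u. z \<in> D ==> norm u <= b z * n z u" and b: "!!z. z \<in> D ==> b z > 0"
    and lip: "!!z dl1 dl2 et1 et2. z \<in> D ==> dl1 \<in> S z ==> dl2 \<in> S z ==>
      n z (A z dl1 et1 - A z dl2 et2) <= p z * n (r z) (et1 - et2) + q z * n z (dl1 - dl2)"
    and u: "!!z. z \<in> D ==> u z = A z (u z) (u (r z))" "!!z. z \<in> D ==> u z \<in> S z"
    and v: "!!z. z \<in> D ==> v z = A z (v z) (v (r z))" "!!z. z \<in> D ==> v z \<in> S z"
    and uv: "!!z. z \<in> D ==> n z (u z - v z) <= M * w2 z" and z: "z \<in> D"
  shows "u z = v z"
proof -
  have w1p: "0 <= w1 z" using pos(4,5)[OF z] by linarith
  have le: "n z (u z - v z) <= et * w1 z" if et: "et > 0" for et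
  proof -
    obtain k0 where k0: "\<forall>e :: nat => 'a => real. (\<forall>z\<in>D. e 0 z <= M * w2 z) -->
      (\<forall>k. \<forall>z\<in>D. e (Suc k) z <= p z * e k (r z) + q z * e k z) -->
      (\<forall>k\<ge>k0. \<forall>z\<in>D. e k z <= et * w1 z)"
      using majorant_decay[where p=p and q=q and c=c and r=r and D=D and M=M, OF r pos w1 w2 mix et]
      by (rule exE)
    show ?thesis
    proof (rule k0[THEN spec[of _ "%k z. n z (u z - v z)"], rule_format, OF uv _ order_refl z])
      show "n z (u z - v z) <= p z * n (r z) (u (r z) - v (r z)) + q z * n z (u z - v z)" if "z \<in> D" for z
        using lip[OF that u(2)[OF that] v(2)[OF that], of "u (r z)" "v (r z)"] u(1)[OF that] v(1)[OF that]
        by simp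
    qed
  qed
  have "n z (u z - v z) <= 0"
  proof (rule ccontr)
    assume "\<not> n z (u z - v z) <= 0"
    then have pos: "n z (u z - v z) > 0" by simp
    define et where "et = n z (u z - v z) / (2 * (w1 z + 1))"
    have "et > 0" using pos w1p by (simp add: et_def)
    then have "n z (u z - v z) <= et * w1 z" by (rule le)
    also have "... <= et * (w1 z + 1)" using \<open>et > 0\<close> by simp
    also have "... = n z (u z - v z) / 2"
    proof -
      have "w1 z + 1 ~= 0" using w1p by linarith
      then show ?thesis by (simp add: et_def divide_simps)
    qed
    finally show False using pos by simp
  qed
  then have "norm (u z - v z) <= 0"
    using n_lower[OF z, of "u z - v z"] b[OF z] mult_nonneg_nonpos[of "b z" "n z (u z - v z)"] by linarith
  then show ?thesis by simp
qed

section \<open>Decay of the weights and invariance of narrow sectors\<close>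

lemma exp_minus_le: "exp (- y) <= 1 - y / 2" if "0 <= y" "y <= 1" for y :: real
proof -
  have "1 <= (1 - y / 2) * (1 + y)" using that mult_left_mono[OF that(2) that(1)] by (simp add: algebra_simps)
  also have "... <= (1 - y / 2) * exp y"
    using that exp_ge_add_one_self[of y] by (intro mult_left_mono) auto
  finally show ?thesis by (simp add: exp_minus field_simps)
qed

text \<open>Both factors are compared with exponentials; the exponent
  \<open>N * al + ep - q * (al - ep)\<close> is at most \<open>- al / 2 + al0 / 8\<close> because
  \<open>q\<close> exceeds \<open>N\<close> by at least \<open>1 / 2\<close>. Of the resulting gain
  \<open>al0 / 4\<close>, half is lost on linearising the exponential and another quarter on the
  term with \<open>ep\<close>, which leaves \<open>al0 / 16\<close>.\<close>

lemma weight_decrease: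
  fixes N :: nat and al al0 ep q t x x' :: real
  assumes al: "0 < al0" "al0 <= al" and q: "real N + 1 / 2 <= q" and ep: "0 < ep" "ep * (q + 4) <= al0 / 8"
    and t: "0 <= t" "al0 * t <= 1" and x: "0 <= x'" "0 <= x" "x' <= x * (1 - (al - ep) * t)"
  shows "(1 + (N * al + ep) * t) * x' powr q + ep * t * x powr q <= (1 - al0 / 16 * t) * x powr q"
proof -
  have q0: "q > 0" using q by (simp add: add_nonneg_pos order.strict_trans2)
  have "x' <= x * exp (- ((al - ep) * t))"
    using x(3) mult_left_mono[OF exp_ge_add_one_self[of "- ((al - ep) * t)"] x(2)] by (simp add: algebra_simps)
  then have "x' powr q <= (x * exp (- ((al - ep) * t))) powr q"
    using q0 x by (intro powr_mono2) auto
  also have "... = x powr q * exp (- ((al - ep) * t) * q)"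
    using x by (simp add: powr_mult exp_powr_real)
  finally have 1: "x' powr q <= x powr q * exp (- ((al - ep) * t) * q)" .
  have 2: "1 + (N * al + ep) * t <= exp ((N * al + ep) * t)" by (rule exp_ge_add_one_self)
  have nn: "0 <= 1 + (N * al + ep) * t" using al ep t by (intro add_nonneg_nonneg mult_nonneg_nonneg) auto
  have "(1 + (N * al + ep) * t) * x' powr q
      <= exp ((N * al + ep) * t) * (x powr q * exp (- ((al - ep) * t) * q))"
    using nn by (intro mult_mono 1 2) auto
  also have "... = x powr q * exp ((N * al + ep - q * (al - ep)) * t)"
    by (simp add: exp_add[symmetric] algebra_simps)
  also have "... <= x powr q * exp (- (al0 / 4 * t))"
  proof (intro mult_left_mono)
    have "(N + 1 / 2) * al <= q * al" using q al by (intro mult_right_mono) auto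
    then have "N * al + ep - q * (al - ep) <= - (al0 / 4)"
      using ep al by (simp add: algebra_simps)
    then show "exp ((N * al + ep - q * (al - ep)) * t) <= exp (- (al0 / 4 * t))"
      using mult_right_mono[OF _ t(1), of "N * al + ep - q * (al - ep)" "- (al0 / 4)"] by simp
  qed auto
  also have "... <= x powr q * (1 - al0 / 4 * t / 2)"
    using al t by (intro mult_left_mono exp_minus_le) auto
  finally have 3: "(1 + (N * al + ep) * t) * x' powr q <= x powr q * (1 - al0 / 8 * t)" by simp
  have "ep * 4 <= ep * (q + 4)" using ep q0 by (intro mult_left_mono) auto
  then have "ep <= al0 / 16" using ep(2) al by simp
  then have "ep * t * x powr q <= al0 / 16 * t * x powr q"
    using t by (intro mult_right_mono) auto
  then show ?thesis using 3 by (simp add: algebra_simps)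
qed

lemma sector_iff:
  "x \<in> sector bt rh \<longleftrightarrow> (\<exists>r \<phi>. x = complex_of_real r * cis \<phi> & 0 < r & r < rh & \<bar>\<phi>\<bar> < bt / 2)"
  by (auto simp: sector_def)

lemma sector_norm: "x \<in> sector bt rh ==> 0 < cmod x & cmod x < rh"
  by (auto simp: sector_def norm_mult)

lemma sector_mono: "bt <= bt' ==> rh <= rh' ==> sector bt rh \<subseteq> sector bt' rh'"
proof
  fix x assume le: "bt <= bt'" "rh <= rh'" and "x \<in> sector bt rh"
  then obtain r \<phi> where "x = complex_of_real r * cis \<phi>" "0 < r" "r < rh" "\<bar>\<phi>\<bar> < bt / 2"
    by (auto simp: sector_iff)
  moreover from this le have "r < rh'" "\<bar>\<phi>\<bar> < bt' / 2" by linarith+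
  ultimately show "x \<in> sector bt' rh'" unfolding sector_iff by blast
qed

lemma sector_power_angle:
  assumes x: "x \<in> sector bt rh" and n: "real n * (bt / 2) <= arctan dl"
  shows "\<bar>Im (x ^ n)\<bar> <= dl * Re (x ^ n)" "0 <= Re (x ^ n)"
proof -
  obtain r \<phi> where r: "x = complex_of_real r * cis \<phi>" "0 < r" "\<bar>\<phi>\<bar> < bt / 2"
    using x by (auto simp: sector_iff)
  have xn: "x ^ n = complex_of_real (r ^ n) * cis (n * \<phi>)"
    by (simp only: r power_mult_distrib Complex.DeMoivre of_real_power)
  have a: "\<bar>n * \<phi>\<bar> <= arctan dl"
    using n r mult_left_mono[of "\<bar>\<phi>\<bar>" "bt / 2" "real n"] by (simp add: abs_mult)
  have b: "\<bar>n * \<phi>\<bar> < pi / 2" using a arctan_ubound[of dl] by linarith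
  have c: "cos (n * \<phi>) > 0" using b by (intro cos_gt_zero_pi) auto
  have "tan \<bar>n * \<phi>\<bar> <= tan (arctan dl)"
  proof (cases "\<bar>n * \<phi>\<bar> = arctan dl")
    case False
    then show ?thesis using a b arctan_ubound[of dl]
      by (intro less_imp_le tan_monotone) (auto simp: pi_gt_zero intro: order.strict_trans2[of _ 0])
  qed simp
  then have "tan \<bar>n * \<phi>\<bar> <= dl" by (simp add: tan_arctan)
  moreover have "tan \<bar>n * \<phi>\<bar> = \<bar>sin (n * \<phi>)\<bar> / cos (n * \<phi>)"
  proof -
    have "\<bar>sin y\<bar> = sin \<bar>y\<bar>" if "\<bar>y\<bar> < pi / 2" for y :: real
      using that sin_ge_zero[of "\<bar>y\<bar>"] by (cases "y >= 0") auto
    then show ?thesis using b by (simp add: tan_def)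
  qed
  ultimately have "\<bar>sin (n * \<phi>)\<bar> <= dl * cos (n * \<phi>)" using c by (simp add: divide_le_eq)
  then have "r ^ n * \<bar>sin (n * \<phi>)\<bar> <= r ^ n * (dl * cos (n * \<phi>))"
    using r by (intro mult_left_mono) auto
  then show "\<bar>Im (x ^ n)\<bar> <= dl * Re (x ^ n)" "0 <= Re (x ^ n)"
    unfolding xn using c r by (auto simp: abs_mult algebra_simps)
qed

text \<open>The sign is what matters: multiplication by \<open>1 - w\<close> rotates against the
  sign of \<open>Im w\<close>.\<close>

lemma small_angle:
  assumes w: "cmod w <= 1 / 2"
  obtains \<psi> where "1 - w = complex_of_real (cmod (1 - w)) * cis \<psi>" "\<bar>\<psi>\<bar> <= 2 * cmod w"
    "0 < Im w ==> \<psi> < 0" "Im w < 0 ==> 0 < \<psi>"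
proof
  let ?v = "1 - w"
  have re: "Re ?v >= 1 / 2" using w complex_Re_le_cmod[of w] by simp
  define \<psi> where "\<psi> = arctan (Im ?v / Re ?v)"
  have c: "cos \<psi> > 0" unfolding \<psi>_def using arctan_bounded by (intro cos_gt_zero_pi) auto
  have s: "sin \<psi> = Im ?v / Re ?v * cos \<psi>"
    using c tan_arctan[of "Im ?v / Re ?v"] unfolding \<psi>_def[symmetric] tan_def by (simp add: field_simps)
  have "cmod ?v = Re ?v / cos \<psi>"
  proof -
    have "(Re ?v / cos \<psi>)\<^sup>2 = (Re ?v)\<^sup>2 * ((cos \<psi>)\<^sup>2 + (sin \<psi>)\<^sup>2) / (cos \<psi>)\<^sup>2"
      by (simp add: power_divide)
    also have "... = (Re ?v)\<^sup>2 * (1 + (Im ?v / Re ?v)\<^sup>2)"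
      using c unfolding s power_mult_distrib by (simp add: field_simps)
    also have "... = (Re ?v)\<^sup>2 + (Im ?v)\<^sup>2"
      unfolding power_divide using re by (simp add: distrib_left)
    finally show ?thesis
      using re c by (simp add: cmod_def real_sqrt_unique)
  qed
  then show "?v = complex_of_real (cmod ?v) * cis \<psi>"
    using c re s by (simp add: complex_eq_iff)
  have "\<bar>\<psi>\<bar> <= \<bar>Im ?v / Re ?v\<bar>"
    unfolding \<psi>_def using arctan_le_self[of "\<bar>Im ?v / Re ?v\<bar>"]
    by (cases "Im ?v / Re ?v >= 0") (auto simp: arctan_minus[symmetric] abs_if simp del: arctan_minus)
  also have "... <= cmod w / (1 / 2)"
    unfolding abs_divide using re abs_Im_le_cmod[of w] by (intro frac_le) auto
  finally show "\<bar>\<psi>\<bar> <= 2 * cmod w" by simp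
  show "0 < Im w ==> \<psi> < 0" "Im w < 0 ==> 0 < \<psi>"
    unfolding \<psi>_def using re by (auto simp: divide_less_0_iff zero_less_divide_iff)
qed

text \<open>In the inner half of the sector a rotation by less than \<open>bt / 4\<close> cannot
  reach the boundary. In the outer half \<open>A * x ^ n\<close> has an imaginary part of the same
  sign as the argument of \<open>x\<close> and dominates the error terms, so \<open>1 - w\<close>
  turns \<open>x\<close> back towards the real axis. The condition \<open>n * bt <= pi\<close> keeps
  the argument of \<open>x ^ n\<close> where the sine is increasing.\<close>

lemma sector_step:
  assumes x: "x \<in> sector bt rh" and n: "n >= 1" "real n * bt <= pi"
    and w: "w = A * x ^ n + e" "cmod e <= et * cmod x ^ n" "\<bar>Im A\<bar> <= et" "al0 <= Re A" "0 < al0"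
      "2 * et < al0 * sin (real n * bt / 4)" "cmod w <= 1 / 2" "2 * cmod w < bt / 4"
    and le: "cmod (1 - w) < 1"
  shows "x * (1 - w) \<in> sector bt rh"
proof -
  obtain r \<phi> where r: "x = complex_of_real r * cis \<phi>" "0 < r" "r < rh" "\<bar>\<phi>\<bar> < bt / 2"
    using x by (auto simp: sector_iff)
  obtain \<psi> where \<psi>: "1 - w = complex_of_real (cmod (1 - w)) * cis \<psi>" "\<bar>\<psi>\<bar> <= 2 * cmod w"
    "0 < Im w ==> \<psi> < 0" "Im w < 0 ==> 0 < \<psi>"
    using small_angle[OF w(7)] by blast
  have xn: "x ^ n = complex_of_real (r ^ n) * cis (n * \<phi>)"
    by (simp only: r power_mult_distrib Complex.DeMoivre of_real_power)
  have absn: "cmod x ^ n = r ^ n" using r by (simp add: norm_mult)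
  have b0: "bt > 0" using r by linarith
  \<comment> \<open>The factor \<open>sg\<close> treats the upper and the lower edge of the sector
    together.\<close>
  have sgn: "0 < sg * Im w" if sg: "sg = 1 \<or> sg = -1" and big: "bt / 4 <= sg * \<phi>" for sg :: real
  proof -
    have ab: "real n * (sg * \<phi>) <= real n * (bt / 2)" "real n * (bt / 4) <= real n * (sg * \<phi>)"
      using sg r(4) big by (intro mult_left_mono; auto)+
    have "sin (real n * bt / 4) <= sin (real n * (sg * \<phi>))"
    proof (rule sin_monotone_2pi_le)
      show "real n * (sg * \<phi>) <= pi / 2" using ab(1) n(2) by linarith
      have "0 <= real n * bt / 4" using b0 by simp
      then show "- (pi / 2) <= real n * bt / 4" using pi_gt_zero by linarith
      show "real n * bt / 4 <= real n * (sg * \<phi>)" using ab(2) by simp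
    qed
    moreover have "sin (real n * (sg * \<phi>)) = sg * sin (n * \<phi>)" using sg by auto
    ultimately have s: "sin (real n * bt / 4) <= sg * sin (n * \<phi>)" by simp
    have s0: "0 <= et" using w(3) by linarith
    have "r ^ n * (2 * et) < r ^ n * (Re A * (sg * sin (n * \<phi>)))"
    proof (rule mult_strict_left_mono)
      have "2 * et < al0 * (sg * sin (n * \<phi>))"
        using w(6) mult_left_mono[OF s, of al0] w(5) by linarith
      also have "... <= Re A * (sg * sin (n * \<phi>))"
      proof (rule mult_right_mono[OF w(4)])
        have "0 < al0 * sin (real n * bt / 4)" using w(6) s0 by linarith
        then show "0 <= sg * sin (n * \<phi>)" using s w(5) by (simp add: zero_less_mult_iff)
      qed
      finally show "2 * et < Re A * (sg * sin (n * \<phi>))" .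
    qed (use r in auto)
    moreover have "sg * Im w = r ^ n * (Re A * (sg * sin (n * \<phi>))) + sg * (Im A * (r ^ n * cos (n * \<phi>))) + sg * Im e"
      unfolding w(1) xn by (simp add: algebra_simps)
    moreover have "\<bar>sg * (Im A * (r ^ n * cos (n * \<phi>)))\<bar> <= 1 * (et * (r ^ n * 1))"
      unfolding abs_mult using sg w(3) r by (intro mult_mono) auto
    moreover have "\<bar>sg * Im e\<bar> <= et * r ^ n"
      using sg w(2) abs_Im_le_cmod[of e] by (auto simp: absn)
    ultimately show ?thesis by (simp add: algebra_simps)
  qed
  have "\<bar>\<phi> + \<psi>\<bar> < bt / 2"
  proof (cases "\<bar>\<phi>\<bar> < bt / 4")
    case True
    then show ?thesis using \<psi>(2) w(8) by linarith
  next
    case False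
    show ?thesis
    proof (cases "\<phi> >= 0")
      case True
      then have "\<psi> < 0" using sgn[of 1] False \<psi>(3) by simp
      then show ?thesis using True r(4) \<psi>(2) w(8) False by linarith
    next
      case 2: False
      then have "0 < \<psi>" using sgn[of "-1"] False \<psi>(4) by simp
      then show ?thesis using 2 r(4) \<psi>(2) w(8) False by linarith
    qed
  qed
  moreover have "x * (1 - w) = complex_of_real (r * cmod (1 - w)) * cis (\<phi> + \<psi>)"
  proof -
    have "x * (1 - w) = complex_of_real r * cis \<phi> * (complex_of_real (cmod (1 - w)) * cis \<psi>)"
      using r(1) \<psi>(1) by metis
    then show ?thesis by (simp add: cis_mult[symmetric] mult_ac)
  qed
  moreover have "0 < r * cmod (1 - w)"
  proof -
    have "w ~= 1" using w(7) by auto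
    then show ?thesis using r by simp
  qed
  moreover have "r * cmod (1 - w) < rh"
  proof -
    have "r * cmod (1 - w) <= r * 1" using r le by (intro mult_left_mono) auto
    then show ?thesis using r(3) by linarith
  qed
  ultimately show ?thesis unfolding sector_iff by blast
qed

lemma sqrt_one_plus_le:
  fixes y :: real
  assumes "-1 <= y"
  shows "sqrt (1 + y) <= 1 + y / 2"
proof (rule real_le_lsqrt)
  have "(1 + y / 2)\<^sup>2 = 1 + y + (y / 2)\<^sup>2" by (simp only: power2_sum) simp
  then show "1 + y <= (1 + y / 2)\<^sup>2" using zero_le_power2[of "y / 2"] by simp
qed (use assms in auto)

text \<open>\<open>|1 - w| ^ 2 = 1 - 2 Re w + |w| ^ 2\<close>, and since \<open>s\<close> lies close
  to the positive axis, \<open>Re s\<close> is almost \<open>|s|\<close>. The loss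
  \<open>Re A * dl\<close> is the aperture of the sector; \<open>3 * et\<close> pays for the
  imaginary part of \<open>A\<close>, for \<open>e\<close>, and for the quadratic term.\<close>

lemma one_minus_bounds:
  assumes s: "\<bar>Im s\<bar> <= dl * Re s" "0 <= dl" "0 <= Re s"
    and w: "w = A * s + e" "cmod e <= et * cmod s" "\<bar>Im A\<bar> <= et" "0 <= Re A"
    and small: "cmod s * (Re A + 2 * et) ^ 2 <= et"
  shows "cmod (1 - w) <= 1 - (Re A - (Re A * dl + 3 * et)) * cmod s"
    and "cmod w <= (Re A + 2 * et) * cmod s"
proof -
  have et: "0 <= et" using w(3) by linarith
  have "cmod A <= Re A + et" using cmod_le[of A] w(3,4) by linarith
  then have "cmod (A * s) <= (Re A + et) * cmod s" unfolding norm_mult by (intro mult_right_mono) auto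
  then show wn: "cmod w <= (Re A + 2 * et) * cmod s"
    using norm_triangle_ineq[of "A * s" e] w(2) unfolding w(1) by (simp add: algebra_simps)
  have "cmod s <= Re s + \<bar>Im s\<bar>" using cmod_le[of s] s(3) by linarith
  then have "cmod s * (1 - dl) <= (1 + dl) * Re s - dl * cmod s" using s(1) by (simp add: algebra_simps)
  also have "... <= Re s" using mult_left_mono[OF complex_Re_le_cmod[of s] s(2)] by (simp add: algebra_simps)
  finally have Res: "cmod s * (1 - dl) <= Re s" .
  have "Re w = Re A * Re s - Im A * Im s + Re e" by (simp add: w(1))
  moreover have "Re A * (cmod s * (1 - dl)) <= Re A * Re s" by (intro mult_left_mono Res w)
  moreover have "\<bar>Im A * Im s\<bar> <= et * cmod s"
    unfolding abs_mult by (intro mult_mono w abs_Im_le_cmod et) auto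
  moreover have "\<bar>Re e\<bar> <= et * cmod s" using abs_Re_le_cmod[of e] w(2) by linarith
  ultimately have Rew: "Re w >= (Re A - (Re A * dl + 2 * et)) * cmod s" by (simp add: algebra_simps)
  have "(cmod w)\<^sup>2 <= ((Re A + 2 * et) * cmod s)\<^sup>2" by (intro power_mono wn) auto
  also have "... = cmod s * (Re A + 2 * et) ^ 2 * cmod s" by (simp add: power2_eq_square)
  also have "... <= et * cmod s" by (intro mult_right_mono small) auto
  finally have w2: "(cmod w)\<^sup>2 <= et * cmod s" .
  have "(cmod (1 - w))\<^sup>2 = 1 - 2 * Re w + (cmod w)\<^sup>2"
    by (simp add: cmod_power2) (simp add: power2_eq_square algebra_simps)
  then have "cmod (1 - w) = sqrt (1 + ((cmod w)\<^sup>2 - 2 * Re w))"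
    by (metis add.commute diff_add_eq norm_ge_zero real_sqrt_unique add_diff_eq)
  also have "... <= 1 + ((cmod w)\<^sup>2 - 2 * Re w) / 2"
    using \<open>(cmod (1 - w))\<^sup>2 = 1 - 2 * Re w + (cmod w)\<^sup>2\<close> zero_le_power2[of "cmod (1 - w)"]
    by (intro sqrt_one_plus_le) simp
  also have "... <= 1 - (Re A - (Re A * dl + 3 * et)) * cmod s"
  proof -
    have "(Re A - (Re A * dl + 3 * et)) * cmod s = (Re A - (Re A * dl + 2 * et)) * cmod s - et * cmod s"
      by (simp add: algebra_simps)
    moreover have "0 <= et * cmod s" using et by simp
    moreover have "((cmod w)\<^sup>2 - 2 * Re w) / 2 = (cmod w)\<^sup>2 / 2 - Re w" by (simp add: diff_divide_distrib)
    ultimately show ?thesis using w2 Rew by linarith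
  qed
  finally show "cmod (1 - w) <= 1 - (Re A - (Re A * dl + 3 * et)) * cmod s" .
qed

lemma scaleC_vec_eq: "c *\<^sub>C (v :: complex ^ 'n) = c *s v"
  by (simp add: scaleC_vec_def vector_scalar_mult_def scaleC_complex_def)

lemma matrix_vector_scaleC: "(A :: complex ^ 'n ^ 'm) *v (c *\<^sub>C v) = c *\<^sub>C (A *v v)"
  by (simp add: scaleC_vec_eq vec.scale)

lemma norm_matrix_vector_le:
  fixes A :: "complex ^ 'n ^ 'm"
  shows "norm (A *v v) <= real CARD('m) * real CARD('n) * norm A * norm v"
proof -
  have "norm ((A *v v) $ i) <= real CARD('n) * (norm A * norm v)" for i
  proof -
    have "norm ((A *v v) $ i) <= (\<Sum>j\<in>UNIV. norm (A $ i $ j * v $ j))"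
      unfolding matrix_vector_mult_def by (simp add: norm_sum)
    also have "... <= (\<Sum>j\<in>(UNIV :: 'n set). norm A * norm v)"
      unfolding norm_mult
      by (intro sum_mono mult_mono order_trans[OF Finite_Cartesian_Product.norm_nth_le Finite_Cartesian_Product.norm_nth_le]
          Finite_Cartesian_Product.norm_nth_le) auto
    finally show ?thesis by simp
  qed
  then have "(\<Sum>i\<in>UNIV. norm ((A *v v) $ i)) <= (\<Sum>i\<in>(UNIV :: 'm set). real CARD('n) * (norm A * norm v))"
    by (intro sum_mono)
  then show ?thesis using norm_vec_le_sum[of "A *v v"] by (simp add: mult.assoc)
qed

subsection \<open>An annihilating product of linear factors\<close>

text \<open>The polynomial in the matrix \<open>A\<close> applied to the vector \<open>v\<close>, by
  Horner's scheme.\<close>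

definition pact :: "complex ^ 'm ^ 'm => complex poly => complex ^ 'm => complex ^ 'm"
  where "pact A p v = fold_coeffs (%c w. c *s v + A *v w) p 0"

lemma pact_0 [simp]: "pact A 0 v = 0"
  by (simp add: pact_def)

lemma pact_pCons: "pact A (pCons c p) v = c *s v + A *v pact A p v"
  by (cases "c = 0 & p = 0") (auto simp: pact_def fold_coeffs_def)

lemma pact_add: "pact A (p + q) v = pact A p v + pact A q v"
proof (induction p arbitrary: q)
  case (pCons c p)
  then show ?case
    by (cases q) (simp add: pact_pCons vec.scale_left_distrib matrix_vector_right_distrib algebra_simps)
qed simp

lemma pact_smult: "pact A (smult c p) v = c *s pact A p v"
  by (induction p) (simp_all add: pact_pCons vec.scale_right_distrib vec.scale)

lemma pact_linear_factor: "pact A ([:- \<nu>, 1:] * q) v = A *v pact A q v - \<nu> *s pact A q v"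
proof -
  have "[:- \<nu>, 1:] * q = smult (- \<nu>) q + pCons 0 q" by simp
  then have "pact A ([:- \<nu>, 1:] * q) v = pact A (smult (- \<nu>) q) v + pact A (pCons 0 q) v"
    by (simp only: pact_add)
  then show ?thesis by (simp only: pact_smult pact_pCons) simp
qed

lemma pact_sum: "pact A (\<Sum>i\<in>I. f i) v = (\<Sum>i\<in>I. pact A (f i) v)"
  by (induction I rule: infinite_finite_induct) (simp_all add: pact_add)

primrec mpow :: "complex ^ 'm ^ 'm => nat => complex ^ 'm ^ 'm"
  where "mpow A 0 = mat 1" | "mpow A (Suc i) = A ** mpow A i"

lemma pact_monom: "pact A (monom c i) v = c *s (mpow A i *v v)"
  by (induction i)
    (simp_all add: monom_0 monom_Suc pact_pCons matrix_vector_mul_assoc[symmetric] vec.scale)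

lemma scaleR_matrix_vector: "(r *\<^sub>R A) *v v = complex_of_real r *s (A *v v)"
  by (simp add: matrix_vector_mult_def vec_eq_iff sum_distrib_left scaleR_conv_of_real[where 'a=complex] mult.assoc)

text \<open>The powers of \<open>A\<close> lie in a space of finite real dimension. The coincidence
  of two powers is treated separately, since linear dependence of a set does not see
  repetitions.\<close>

lemma exists_annihilating_poly:
  fixes A :: "complex ^ 'm ^ 'm"
  shows "\<exists>p. p ~= 0 & (\<forall>v. pact A p v = 0)"
proof (cases "inj (mpow A)")
  case False
  then obtain i j where ij: "i ~= j" "mpow A i = mpow A j" by (auto simp: inj_def)
  let ?p = "monom 1 i + smult (- 1) (monom 1 j) :: complex poly"
  have "coeff ?p i ~= 0" using ij by simp
  then have "?p ~= 0" by (metis coeff_0)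
  moreover have "pact A ?p v = 0" for v
    unfolding pact_add pact_smult pact_monom ij(2) by simp
  ultimately show ?thesis by blast
next
  case True
  define I where "I = {..DIM(complex ^ 'm ^ 'm)}"
  have "card (mpow A ` I) = card I" using True by (intro card_image) (auto simp: inj_def inj_on_def)
  then have "dependent (mpow A ` I)"
    using independent_bound[of "mpow A ` I"] by (force simp: I_def)
  then obtain u where u: "\<exists>v\<in>mpow A ` I. u v ~= 0" "(\<Sum>v\<in>mpow A ` I. u v *\<^sub>R v) = 0"
    using dependent_finite[of "mpow A ` I"] by (auto simp: I_def)
  define p where "p = (\<Sum>i\<in>I. monom (complex_of_real (u (mpow A i))) i)"
  obtain i where i: "i \<in> I" "u (mpow A i) ~= 0" using u(1) by blast
  have "coeff p i = (\<Sum>j\<in>I. if j = i then complex_of_real (u (mpow A i)) else 0)"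
    unfolding p_def coeff_sum by (intro sum.cong) auto
  also have "... = complex_of_real (u (mpow A i))" using i by (simp add: I_def)
  finally have "p ~= 0" using i by auto
  moreover have "pact A p v = 0" for v
  proof -
    have "pact A p v = (\<Sum>i\<in>I. (u (mpow A i) *\<^sub>R mpow A i) *v v)"
      unfolding p_def pact_sum pact_monom scaleR_matrix_vector ..
    also have "... = (\<Sum>i\<in>I. u (mpow A i) *\<^sub>R mpow A i) *v v"
      by (simp add: matrix_vector_mult_def vec_eq_iff sum_distrib_right sum.swap[of _ I])
    also have "(\<Sum>i\<in>I. u (mpow A i) *\<^sub>R mpow A i) = (\<Sum>v\<in>mpow A ` I. u v *\<^sub>R v)"
      using True by (subst sum.reindex) (auto simp: inj_def inj_on_def)
    finally show ?thesis using u(2) by simp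
  qed
  ultimately show ?thesis by blast
qed

definition factor_list :: "complex ^ 'm ^ 'm => complex list => complex ^ 'm => complex ^ 'm"
  where "factor_list A = foldr (%\<nu> w. A *v w - \<nu> *s w)"

lemma factor_list_Nil [simp]: "factor_list A [] v = v"
  and factor_list_Cons [simp]: "factor_list A (\<nu> # ns) v = A *v factor_list A ns v - \<nu> *s factor_list A ns v"
  and factor_list_append: "factor_list A (ms @ ns) v = factor_list A ms (factor_list A ns v)"
  by (simp_all add: factor_list_def)

lemma pact_factor_list:
  assumes "p ~= 0"
  shows "\<exists>c ns. c ~= 0 & (\<forall>v. pact A p v = c *s factor_list A ns v)"
  using assms
proof (induction "degree p" arbitrary: p)
  case 0
  then obtain c where c: "p = [:c:]" by (metis degree_eq_zeroE)
  then have "c ~= 0" "\<forall>v. pact A p v = c *s factor_list A [] v" using 0 by (simp_all add: pact_pCons)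
  then show ?case by blast
next
  case (Suc n p)
  have "\<not> constant (poly p)" using Suc(2) by (simp add: constant_degree)
  then obtain \<nu> where "poly p \<nu> = 0" using fundamental_theorem_of_algebra by blast
  then obtain q where q: "p = [:- \<nu>, 1:] * q" unfolding poly_eq_0_iff_dvd by (rule dvdE)
  then have q0: "q ~= 0" using Suc(3) by auto
  have "n = degree q" using Suc(2) q0 by (simp add: q degree_mult_eq del: mult_pCons_left)
  then obtain c ns where c: "c ~= 0" "\<forall>v. pact A q v = c *s factor_list A ns v"
    using Suc(1) q0 by blast
  have "pact A p v = c *s factor_list A (\<nu> # ns) v" for v
    unfolding q pact_linear_factor by (simp add: c(2) vec.scale vec.scale_right_diff_distrib mult.commute)
  then show ?case using c(1) by blast
qed

lemma factor_list_commute: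
  "factor_list A ns (A *v v - \<nu> *s v) = A *v factor_list A ns v - \<nu> *s factor_list A ns v"
  by (induction ns)
    (simp_all add: matrix_vector_mult_diff_distrib vec.scale vec.scale_right_diff_distrib mult.commute)

text \<open>In an annihilating list of least length every factor is an eigenvalue: without it some
  vector survives, and as the factors commute, that vector is killed by
  \<open>A - \<nu>\<close>.\<close>

lemma exists_eigenvalue_list:
  fixes A :: "complex ^ 'm ^ 'm"
  obtains ns where "!!v. factor_list A ns v = 0" "set ns \<subseteq> spec A"
proof -
  obtain p where p: "p ~= 0" "\<forall>v. pact A p v = 0" using exists_annihilating_poly by blast
  obtain c ns0 where "c ~= 0" "\<forall>v. pact A p v = c *s factor_list A ns0 v"
    using pact_factor_list[OF p(1)] by blast
  then have "\<forall>v. factor_list A ns0 v = 0" using p(2) by simp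
  then obtain ns where ns: "\<forall>v. factor_list A ns v = 0"
      and min: "!!ms. \<forall>v. factor_list A ms v = 0 ==> length ns <= length ms"
    using ex_has_least_nat[of "%ns. \<forall>v. factor_list A ns v = 0" ns0 length] by blast
  have "\<nu> \<in> spec A" if mem: "\<nu> \<in> set ns" for \<nu>
  proof -
    obtain xs ys where xy: "ns = xs @ \<nu> # ys" using split_list[OF mem] by blast
    have "\<not> (\<forall>v. factor_list A (xs @ ys) v = 0)" using min[of "xs @ ys"] xy by auto
    then obtain v where v: "factor_list A (xs @ ys) v ~= 0" by blast
    have "A *v factor_list A (xs @ ys) v - \<nu> *s factor_list A (xs @ ys) v = factor_list A ns v"
      unfolding xy factor_list_append factor_list_Cons factor_list_commute ..
    then have "A *v factor_list A (xs @ ys) v = \<nu> *s factor_list A (xs @ ys) v" using ns by simp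
    then show ?thesis unfolding spec_def using v by blast
  qed
  then show ?thesis using that ns by blast
qed

text \<open>The partial products of an annihilating list form a chain with
  \<open>T (j + 1) = (A - \<nu> j) T j\<close> that ends in 0; it takes the place of a Jordan
  basis.\<close>

primrec factor_seq :: "complex ^ 'm ^ 'm => (nat => complex) => nat => complex ^ 'm => complex ^ 'm"
  where "factor_seq A \<nu> 0 v = v"
  | "factor_seq A \<nu> (Suc j) v = A *v factor_seq A \<nu> j v - \<nu> j *s factor_seq A \<nu> j v"

lemma factor_seq_eq:
  "j <= length ns ==> factor_seq A (%i. rev ns ! i) j v = factor_list A (rev (take j (rev ns))) v"
  by (induction j) (simp_all add: take_Suc_conv_app_nth)

lemma factor_seq_add: "factor_seq A \<nu> j (v + w) = factor_seq A \<nu> j v + factor_seq A \<nu> j w"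
  by (induction j) (simp_all add: matrix_vector_right_distrib vec.scale_right_distrib)

lemma factor_seq_scale: "factor_seq A \<nu> j (c *s v) = c *s factor_seq A \<nu> j v"
  by (induction j) (simp_all add: vec.scale vec.scale_right_diff_distrib mult.commute)

lemma factor_seq_diff: "factor_seq A \<nu> j (v - w) = factor_seq A \<nu> j v - factor_seq A \<nu> j w"
  using factor_seq_add[of A \<nu> j "v - w" w] by simp

lemma factor_seq_matrix: "factor_seq A \<nu> j (A *v v) = A *v factor_seq A \<nu> j v"
  by (induction j) (simp_all add: matrix_vector_mult_diff_distrib vec.scale)

lemma factor_seq_bound: "\<exists>K\<ge>0. \<forall>v. norm (factor_seq A \<nu> j v) <= K * norm v"
proof (induction j)
  case 0
  show ?case by (intro exI[of _ 1]) simp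
next
  case (Suc j)
  then obtain K where K: "K >= 0" "!!v. norm (factor_seq A \<nu> j v) <= K * norm v" by blast
  define c where "c = real CARD('a) * real CARD('a) * norm A + cmod (\<nu> j)"
  have c0: "c >= 0" by (simp add: c_def)
  have "norm (factor_seq A \<nu> (Suc j) v) <= c * K * norm v" for v
  proof -
    have "norm (factor_seq A \<nu> (Suc j) v) <= norm (A *v factor_seq A \<nu> j v) + norm (\<nu> j *\<^sub>C factor_seq A \<nu> j v)"
      by (simp add: scaleC_vec_eq norm_triangle_ineq4)
    also have "... <= c * norm (factor_seq A \<nu> j v)"
      using norm_matrix_vector_le[of A "factor_seq A \<nu> j v"] by (simp add: norm_scaleC c_def distrib_right)
    also have "... <= c * (K * norm v)" by (intro mult_left_mono K c0)
    finally show ?thesis by simp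
  qed
  then show ?case using K c0 by (intro exI[of _ "c * K"]) simp
qed

subsection \<open>Adapted norms\<close>

lemma norm_one_minus_le:
  fixes s \<nu> :: complex
  assumes a: "0 < a" "a <= Re \<nu>" and H: "cmod \<nu> <= H" "0 < H"
    and dl: "0 < dl" "dl <= 1" "dl * H <= a / 2" and s: "\<bar>Im s\<bar> <= dl * Re s" "cmod s * H\<^sup>2 <= a / 4" "a * cmod s <= 8"
  shows "cmod (1 - s * \<nu>) <= 1 - a / 8 * cmod s"
proof -
  have Re0: "0 <= Re s" using s(1) dl(1) by (smt (verit) zero_le_mult_iff abs_ge_zero)
  have "\<bar>Im s\<bar> <= 1 * Re s" using s(1) mult_right_mono[OF dl(2) Re0] by linarith
  then have "cmod s <= 2 * Re s" using cmod_le[of s] Re0 by linarith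
  then have "a / 4 * cmod s <= a / 2 * Re s" using a(1) by simp
  also have "... <= Re (s * \<nu>)"
  proof -
    have "\<bar>Im s * Im \<nu>\<bar> <= (dl * Re s) * H"
      unfolding abs_mult using order_trans[OF abs_Im_le_cmod H(1)] Re0 dl(1) by (intro mult_mono s) auto
    also have "... <= a / 2 * Re s" using mult_right_mono[OF dl(3) Re0] by (simp add: mult_ac)
    finally have "Im s * Im \<nu> <= a / 2 * Re s" by linarith
    moreover have "a * Re s <= Re s * Re \<nu>" using mult_left_mono[OF a(2) Re0] by (simp add: mult.commute)
    ultimately show ?thesis by simp
  qed
  finally have R: "a / 4 * cmod s <= Re (s * \<nu>)" .
  have "(cmod (s * \<nu>))\<^sup>2 <= (cmod s * H)\<^sup>2" unfolding norm_mult by (intro power_mono mult_left_mono H) auto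
  also have "... = cmod s * (cmod s * H\<^sup>2)" by (simp add: power2_eq_square)
  also have "... <= cmod s * (a / 4)" by (intro mult_left_mono s) auto
  finally have Q: "(cmod (s * \<nu>))\<^sup>2 <= a / 4 * cmod s" by (simp add: mult.commute)
  have "(cmod (1 - s * \<nu>))\<^sup>2 = 1 - 2 * Re (s * \<nu>) + (cmod (s * \<nu>))\<^sup>2"
    unfolding cmod_power2 by (simp add: power2_eq_square algebra_simps)
  also have "... <= 1 - a / 4 * cmod s" using R Q by linarith
  also have "... <= (1 - a / 8 * cmod s)\<^sup>2"
    by (simp add: power2_diff)
  finally have "(cmod (1 - s * \<nu>))\<^sup>2 <= (1 - a / 8 * cmod s)\<^sup>2" .
  moreover have "0 <= 1 - a / 8 * cmod s" using s(3) by simp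
  ultimately show ?thesis by (rule power2_le_imp_le)
qed

text \<open>\<open>s\<close> stands for \<open>x ^ (N - 1)\<close> with \<open>x\<close> in a narrow
  sector near 0; the linear part \<open>1 - s A\<close> of the \<open>y\<close> equation must not
  increase the norm.\<close>

definition adapted :: "real => complex ^ 'm ^ 'm => (complex ^ 'm => real) => bool"
  where "adapted dl A nrm \<longleftrightarrow>
    (\<forall>s v. cmod s <= dl --> \<bar>Im s\<bar> <= dl * Re s --> nrm (v - s *\<^sub>C (A *v v)) <= nrm v)"

definition vnorm :: "real => (complex ^ 'm => real) => bool"
  where "vnorm C nrm \<longleftrightarrow> (\<forall>v. norm v <= nrm v & nrm v <= C * norm v) &
    (\<forall>v w. nrm (v + w) <= nrm v + nrm w) & (\<forall>c v. nrm (c *\<^sub>C v) = cmod c * nrm v)"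

text \<open>The norm is the weighted sum of the \<open>M ^ j * norm (T j v)\<close>. Under
  \<open>1 - s A\<close> the entry \<open>T j\<close> is multiplied by
  \<open>1 - s * \<nu> j\<close> and receives \<open>s * T (j + 1)\<close>; a large \<open>M\<close>
  makes this shift cheap. The contraction by \<open>1 - a / 16 * |s|\<close> is strict, which leaves
  room for all matrices \<open>A'\<close> near \<open>A\<close>.\<close>

lemma adapted_norm:
  fixes A :: "complex ^ 'm ^ 'm"
  assumes spec: "!!\<nu>. \<nu> \<in> spec A ==> Re \<nu> > 0"
  shows "\<exists>nrm C dl. dl > 0 & C >= 1 & vnorm C nrm & (\<forall>A'. norm (A' - A) <= dl --> adapted dl A' nrm)"
proof -
  obtain ns where ns: "!!v. factor_list A ns v = 0" "set ns \<subseteq> spec A"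
    using exists_eigenvalue_list[of A] by blast
  define k where "k = length ns"
  define \<nu> where "\<nu> i = rev ns ! i" for i
  define T where "T = factor_seq A \<nu>"
  have Tk: "T k v = 0" for v
    unfolding T_def \<nu>_def k_def using factor_seq_eq[of "length ns" ns A v] ns(1) by simp
  have k: "k > 0"
  proof (rule ccontr)
    assume "\<not> k > 0"
    then have "(v :: complex ^ 'm) = 0" for v using Tk[of v] by (simp add: T_def)
    then have "(1 :: complex ^ 'm) = 0" by blast
    then show False by simp
  qed
  have \<nu>: "\<nu> i \<in> spec A" if "i < k" for i
    using that ns(2) nth_mem[of i "rev ns"] by (auto simp: \<nu>_def k_def)
  define a where "a = Min ((%i. Re (\<nu> i)) ` {..<k})"
  have "\<forall>x\<in>(%i. Re (\<nu> i)) ` {..<k}. 0 < x" using \<nu> spec by auto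
  then have a: "a > 0" "!!i. i < k ==> a <= Re (\<nu> i)"
    unfolding a_def using k by (subst Min_gr_iff) (auto intro!: Min_le)
  define H where "H = Max ((%i. cmod (\<nu> i)) ` {..<k}) + 1"
  have H1: "cmod (\<nu> i) <= H - 1" if "i < k" for i
  proof -
    have "cmod (\<nu> i) <= Max ((%i. cmod (\<nu> i)) ` {..<k})" using that by (intro Max_ge) auto
    then show ?thesis by (simp add: H_def)
  qed
  have H: "cmod (\<nu> i) <= H" if "i < k" for i using H1[OF that] by linarith
  have H0: "H > 0" using H1[OF k] norm_ge_zero[of "\<nu> 0"] by linarith
  \<comment> \<open>The shift then costs at most \<open>a / 16\<close>, half of the gain
    \<open>a / 8\<close> coming from the eigenvalues.\<close>
  define M where "M = max 1 (16 / a)"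
  have M: "M >= 1" "1 / M <= a / 16" using a by (auto simp: M_def field_simps max_def)
  define nrm where "nrm v = (\<Sum>j<k. M ^ j * norm (T j v))" for v
  have "\<forall>j. \<exists>K\<ge>0. \<forall>v. norm (T j v) <= K * norm v" unfolding T_def using factor_seq_bound by blast
  then obtain K where K: "!!j. K j >= 0" "!!j v. norm (T j v) <= K j * norm v" by metis
  define C where "C = 1 + (\<Sum>j<k. M ^ j * K j)"
  have C: "C >= 1" unfolding C_def using M K by (simp add: sum_nonneg)
  have lower: "norm v <= nrm v" for v
  proof -
    have "norm v = (\<Sum>j\<in>{0}. M ^ j * norm (T j v))" by (simp add: T_def)
    also have "... <= nrm v" unfolding nrm_def using k M by (intro sum_mono2) auto
    finally show ?thesis .
  qed
  have upper: "nrm v <= C * norm v" for v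
  proof -
    have "nrm v <= (\<Sum>j<k. M ^ j * (K j * norm v))"
      unfolding nrm_def using M by (intro sum_mono mult_left_mono K) auto
    also have "... = (C - 1) * norm v" by (simp add: C_def sum_distrib_right mult.assoc)
    finally show ?thesis by (simp add: algebra_simps) (smt (verit) norm_ge_zero)
  qed
  have tri: "nrm (v + w) <= nrm v + nrm w" for v w
  proof -
    have "nrm (v + w) <= (\<Sum>j<k. M ^ j * norm (T j v) + M ^ j * norm (T j w))"
      unfolding nrm_def T_def factor_seq_add distrib_left[symmetric]
      using M by (intro sum_mono mult_left_mono norm_triangle_ineq) auto
    then show ?thesis by (simp add: nrm_def sum.distrib)
  qed
  have hom: "nrm (c *\<^sub>C v) = cmod c * nrm v" for c v
    unfolding nrm_def T_def scaleC_vec_eq factor_seq_scale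
    by (simp add: scaleC_vec_eq[symmetric] norm_scaleC sum_distrib_left mult.left_commute)
  define cm where "cm = real CARD('m) * real CARD('m)"
  have "1 <= real CARD('m)" using zero_less_card_finite[where 'a='m] by linarith
  then have cm: "cm >= 1" unfolding cm_def using mult_mono[of 1 "real CARD('m)" 1 "real CARD('m)"] by simp
  \<comment> \<open>The first four entries make \<open>s\<close> small and nearly positive relative
    to the eigenvalues; the last one pays for replacing \<open>A\<close> by
    \<open>A'\<close>.\<close>
  define dl where "dl = Min {1, a / (2 * H), a / (4 * H\<^sup>2), 8 / a, a / (16 * C * cm)}"
  have dl: "dl > 0" unfolding dl_def using a H0 C cm by auto
  have dl1: "dl <= 1" "dl <= a / (2 * H)" "dl <= a / (4 * H\<^sup>2)" "dl <= 8 / a" "dl <= a / (16 * C * cm)"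
    unfolding dl_def by (rule Min_le; simp)+
  have dl2: "dl * H <= a / 2" "dl * H\<^sup>2 <= a / 4" "dl * a <= 8" "C * (cm * dl) <= a / 16"
    using dl1 H0 a C cm by (simp_all add: field_simps)
  have main: "nrm (v - s *\<^sub>C (A *v v)) <= (1 - a / 16 * cmod s) * nrm v"
    if s: "cmod s <= dl" "\<bar>Im s\<bar> <= dl * Re s" for s v
  proof -
    have one: "norm (T j (v - s *\<^sub>C (A *v v))) <= (1 - a / 8 * cmod s) * norm (T j v) + cmod s * norm (T (Suc j) v)"
      if j: "j < k" for j
    proof -
      have "T j (v - s *\<^sub>C (A *v v)) = (1 - s * \<nu> j) *\<^sub>C T j v - s *\<^sub>C T (Suc j) v"
        unfolding T_def scaleC_vec_eq factor_seq_diff factor_seq_scale factor_seq_matrix factor_seq.simps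
        by (simp add: vec.scale_left_diff_distrib vec.scale_right_diff_distrib)
      then have "norm (T j (v - s *\<^sub>C (A *v v))) <= cmod (1 - s * \<nu> j) * norm (T j v) + cmod s * norm (T (Suc j) v)"
        using norm_triangle_ineq4[of "(1 - s * \<nu> j) *\<^sub>C T j v" "s *\<^sub>C T (Suc j) v"] by (simp add: norm_scaleC)
      moreover have "cmod (1 - s * \<nu> j) <= 1 - a / 8 * cmod s"
      proof (rule norm_one_minus_le[OF a(1) a(2)[OF j] H[OF j] H0 dl dl1(1) dl2(1) s(2)])
        show "cmod s * H\<^sup>2 <= a / 4" using mult_right_mono[OF s(1), of "H\<^sup>2"] dl2(2) by simp
        show "a * cmod s <= 8" using mult_left_mono[OF s(1), of a] dl2(3) a(1) mult.commute[of dl a] by linarith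
      qed
      then have "cmod (1 - s * \<nu> j) * norm (T j v) <= (1 - a / 8 * cmod s) * norm (T j v)"
        by (intro mult_right_mono) auto
      ultimately show ?thesis by linarith
    qed
    have shift: "(\<Sum>j<k. M ^ j * norm (T (Suc j) v)) <= a / 16 * nrm v"
    proof -
      have "M * (\<Sum>j<k. M ^ j * norm (T (Suc j) v)) = (\<Sum>j<k. M ^ Suc j * norm (T (Suc j) v))"
        by (simp add: sum_distrib_left mult.assoc)
      also have "... <= norm (T 0 v) + (\<Sum>j<k. M ^ Suc j * norm (T (Suc j) v))" by simp
      also have "... = (\<Sum>j<Suc k. M ^ j * norm (T j v))" by (subst sum.lessThan_Suc_shift) simp
      also have "... = nrm v" by (simp add: nrm_def Tk)
      finally have "(\<Sum>j<k. M ^ j * norm (T (Suc j) v)) <= 1 / M * nrm v" using M by (simp add: field_simps)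
      also have "... <= a / 16 * nrm v"
        using M order_trans[OF norm_ge_zero lower] by (intro mult_right_mono) auto
      finally show ?thesis .
    qed
    have "nrm (v - s *\<^sub>C (A *v v)) <= (\<Sum>j<k. M ^ j * ((1 - a / 8 * cmod s) * norm (T j v) + cmod s * norm (T (Suc j) v)))"
      unfolding nrm_def using M one by (intro sum_mono mult_left_mono) auto
    also have "... = (1 - a / 8 * cmod s) * nrm v + cmod s * (\<Sum>j<k. M ^ j * norm (T (Suc j) v))"
      unfolding nrm_def sum_distrib_left sum.distrib[symmetric] by (intro sum.cong) (simp_all add: algebra_simps)
    also have "... <= (1 - a / 8 * cmod s) * nrm v + cmod s * (a / 16 * nrm v)"
      by (intro add_left_mono mult_left_mono shift) auto
    finally show ?thesis by (simp add: algebra_simps)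
  qed
  have "adapted dl A' nrm" if A': "norm (A' - A) <= dl" for A'
    unfolding adapted_def
  proof (intro allI impI)
    fix s v assume s: "cmod s <= dl" "\<bar>Im s\<bar> <= dl * Re s"
    have eq: "v - s *\<^sub>C (A' *v v) = (v - s *\<^sub>C (A *v v)) + (- s) *\<^sub>C ((A' - A) *v v)"
      by (simp add: matrix_vector_mult_diff_rdistrib scaleC.diff_right scaleC.minus_left)
    have "nrm ((A' - A) *v v) <= C * (cm * dl * norm v)"
    proof -
      have "norm ((A' - A) *v v) <= cm * norm (A' - A) * norm v"
        using norm_matrix_vector_le[of "A' - A" v] by (simp add: cm_def)
      also have "... <= cm * dl * norm v" using cm by (intro mult_right_mono mult_left_mono A') auto
      finally have "C * norm ((A' - A) *v v) <= C * (cm * dl * norm v)" using C by (intro mult_left_mono) auto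
      then show ?thesis using upper order_trans by blast
    qed
    also have "... = C * (cm * dl) * norm v" by simp
    also have "... <= a / 16 * nrm v" using a by (intro mult_mono dl2 lower) auto
    finally have pert: "nrm ((A' - A) *v v) <= a / 16 * nrm v" .
    have "nrm (v - s *\<^sub>C (A' *v v)) <= nrm (v - s *\<^sub>C (A *v v)) + nrm ((- s) *\<^sub>C ((A' - A) *v v))"
      unfolding eq by (rule tri)
    also have "... <= (1 - a / 16 * cmod s) * nrm v + cmod s * (a / 16 * nrm v)"
      unfolding hom norm_minus_cancel by (intro add_mono main[OF s] mult_left_mono pert) auto
    finally show "nrm (v - s *\<^sub>C (A' *v v)) <= nrm v" by (simp add: algebra_simps)
  qed
  moreover have "vnorm C nrm" unfolding vnorm_def using lower upper tri hom by blast
  ultimately show ?thesis using dl C by blast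
qed

lemma adapted_mono: "adapted dl A nrm ==> dl' <= dl ==> 0 < dl' ==> adapted dl' A nrm"
  unfolding adapted_def
proof (intro allI impI)
  fix s v
  assume ad: "\<forall>s v. cmod s <= dl --> \<bar>Im s\<bar> <= dl * Re s --> nrm (v - s *\<^sub>C (A *v v)) <= nrm v"
    and dl: "dl' <= dl" "0 < dl'" and s: "cmod s <= dl'" "\<bar>Im s\<bar> <= dl' * Re s"
  have "0 <= Re s" using s(2) dl(2) abs_ge_zero[of "Im s"] by (smt (verit) zero_le_mult_iff)
  then have "\<bar>Im s\<bar> <= dl * Re s" using s(2) mult_right_mono[OF dl(1), of "Re s"] by linarith
  then show "nrm (v - s *\<^sub>C (A *v v)) <= nrm v" using ad s(1) dl(1) by force
qed

lemma vnorm_mono: "vnorm C nrm ==> C <= C' ==> vnorm C' nrm"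
  unfolding vnorm_def by (meson mult_right_mono norm_ge_zero order_trans)

text \<open>A finite subcover of the compact set by balls of half the admissible radius. The norm
  varies with the matrix, but its constants do not.\<close>

lemma adapted_norm_compact:
  fixes S :: "(complex ^ 'm ^ 'm) set"
  assumes S: "compact S" and spec: "!!A \<nu>. A \<in> S ==> \<nu> \<in> spec A ==> Re \<nu> > 0"
  shows "\<exists>C dl. dl > 0 & C >= 1 &
    (\<forall>A\<in>S. \<forall>A'. norm (A' - A) <= dl --> (\<exists>nrm. vnorm C nrm & adapted dl A' nrm))"
proof -
  have "\<forall>A\<in>S. \<exists>nrm C dl. dl > 0 & C >= 1 & vnorm C nrm & (\<forall>A'. norm (A' - A) <= dl --> adapted dl A' nrm)"
    using adapted_norm spec by blast
  then obtain nrm C dl where *: "!!A. A \<in> S ==> dl A > 0" "!!A. A \<in> S ==> C A >= 1"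
      "!!A. A \<in> S ==> vnorm (C A) (nrm A)"
      "!!A A'. A \<in> S ==> norm (A' - A) <= dl A ==> adapted (dl A) A' (nrm A)"
    by metis
  obtain F where F: "F \<subseteq> S" "finite F" "S \<subseteq> (\<Union>A\<in>F. ball A (dl A / 2))"
    by (rule compactE_image[OF S, of S "%A. ball A (dl A / 2)"]) (use *(1) in force)+
  define d where "d = Min (insert 1 ((%A. dl A / 2) ` F))"
  define c where "c = Max (insert 1 (C ` F))"
  have "\<forall>x\<in>insert 1 ((%A. dl A / 2) ` F). 0 < x" using F(1) *(1) by auto
  then have d0: "d > 0" unfolding d_def using F(2) by (subst Min_gr_iff) auto
  have d1: "d <= dl A / 2" if "A \<in> F" for A
    unfolding d_def using F(2) that by (intro Min_le) auto
  note d = d0 d1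
  have c: "c >= 1" "!!A. A \<in> F ==> C A <= c"
    unfolding c_def using F(2) by auto
  have "\<exists>nrm. vnorm c nrm & adapted d A' nrm" if A: "A \<in> S" "norm (A' - A) <= d" for A A'
  proof -
    obtain A0 where A0: "A0 \<in> F" "A \<in> ball A0 (dl A0 / 2)" using F(3) A(1) by blast
    have A0S: "A0 \<in> S" using A0(1) F(1) by blast
    have "norm (A' - A0) <= norm (A' - A) + norm (A - A0)"
      using norm_triangle_ineq[of "A' - A" "A - A0"] by simp
    also have "... <= dl A0" using A(2) A0(2) d(2)[OF A0(1)] by (simp add: dist_norm norm_minus_commute)
    finally have "adapted (dl A0) A' (nrm A0)" by (rule *(4)[OF A0S])
    moreover have "d <= dl A0" using d(2)[OF A0(1)] *(1)[OF A0S] by linarith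
    ultimately show ?thesis
      using adapted_mono d(1) vnorm_mono[OF *(3)[OF A0S] c(2)[OF A0(1)]] by blast
  qed
  then show ?thesis using d(1) c(1) by blast
qed

section \<open>Real translations and bounds on coefficients in strips\<close>

lemma cvec_add: "cvec (a + b) = cvec a + cvec b"
  and cvec_diff: "cvec (a - b) = cvec a - cvec b"
  and cvec_scaleR: "cvec (r *\<^sub>R a) = complex_of_real r *\<^sub>C cvec a"
  and cvec_nth: "cvec a $ i = complex_of_real (a $ i)"
  by (simp_all add: cvec_def vec_eq_iff scaleC_vec_def scaleC_complex_def)

lemma norm_cvec: "norm (cvec a) = norm a"
  by (simp add: norm_vec_def cvec_nth)

lemma continuous_on_cvec: "continuous_on S cvec"
proof (rule continuous_onI)
  fix x :: "real ^ 'a" and e :: real assume "e > 0"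
  then show "\<exists>d>0. \<forall>x'\<in>S. dist x' x < d --> dist (cvec x') (cvec x) <= e"
    by (intro exI[of _ e]) (simp add: dist_norm cvec_diff[symmetric] norm_cvec)
qed

lemma cvec_lattice: "(!!i. k $ i \<in> \<int>) ==> cvec k \<in> lattice_pts"
proof -
  assume k: "!!i. k $ i \<in> \<int>"
  have "complex_of_real (k $ i) \<in> \<int>" for i
    using k[of i] by (metis Ints_cases Ints_of_int of_real_of_int_eq)
  then show "cvec k \<in> lattice_pts" by (simp add: lattice_pts_def cvec_nth)
qed

lemma cvec_in_cstrip: "cvec a + th \<in> cstrip sg \<longleftrightarrow> th \<in> cstrip sg" "th + cvec a \<in> cstrip sg \<longleftrightarrow> th \<in> cstrip sg"
  and cvec_in_strip: "cvec a + th \<in> strip sg \<longleftrightarrow> th \<in> strip sg" "th + cvec a \<in> strip sg \<longleftrightarrow> th \<in> strip sg"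
  by (simp_all add: cstrip_def strip_def cvec_nth)

lemma convex_cstrip: "convex (cstrip sg)"
proof (rule convexI)
  fix x y :: "complex ^ 'a" and u v :: real
  assume x: "x \<in> cstrip sg" and y: "y \<in> cstrip sg" and u: "0 <= u" "0 <= v" "u + v = 1"
  have "\<bar>u * Im (x $ i) + v * Im (y $ i)\<bar> <= sg" for i
  proof -
    have "\<bar>u * Im (x $ i) + v * Im (y $ i)\<bar> <= u * \<bar>Im (x $ i)\<bar> + v * \<bar>Im (y $ i)\<bar>"
      using u abs_triangle_ineq[of "u * Im (x $ i)" "v * Im (y $ i)"] by (simp add: abs_mult)
    also have "... <= u * sg + v * sg"
      using x y u by (intro add_mono mult_left_mono) (auto simp: cstrip_def)
    also have "... = sg" using u by (simp add: distrib_right[symmetric])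
    finally show ?thesis .
  qed
  then show "u *\<^sub>R x + v *\<^sub>R y \<in> cstrip sg" by (simp add: cstrip_def)
qed

lemma ball_cstrip_subset: "v \<in> cstrip sg ==> ball v (sg' - sg) \<subseteq> strip sg'"
proof
  fix w :: "complex ^ 'a" assume v: "v \<in> cstrip sg" and w: "w \<in> ball v (sg' - sg)"
  have "\<bar>Im (w $ i)\<bar> < sg'" for i
  proof -
    have "\<bar>Im ((w - v) $ i)\<bar> <= norm (w - v)"
      by (rule order_trans[OF abs_Im_le_cmod Finite_Cartesian_Product.norm_nth_le])
    also have "... < sg' - sg" using w by (simp add: dist_norm norm_minus_commute)
    finally have "\<bar>Im (w $ i) - Im (v $ i)\<bar> < sg' - sg" by simp
    moreover have "\<bar>Im (v $ i)\<bar> <= sg" using v by (simp add: cstrip_def)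
    ultimately show ?thesis by linarith
  qed
  then show "w \<in> strip sg'" by (simp add: strip_def)
qed

lemma cstrip_subset_strip: "sg < sg' ==> cstrip sg \<subseteq> strip sg'"
  and strip_subset_cstrip: "strip sg \<subseteq> cstrip sg"
  by (auto simp: strip_def cstrip_def intro: order.strict_trans1 less_imp_le)

text \<open>A coefficient is regarded as a function with a dummy first variable, so that the bounds
  for \<open>analytic_fun\<close> apply to it.\<close>

lemma analytic_coeff_fun:
  fixes f :: "('d::finite, 'p::finite) angle_param => 'b::complex_normed_space"
  assumes f: "analytic_coeff sg L f" and L: "open L"
  shows "analytic_fun ((UNIV :: 'a::complex_normed_space set) \<times> strip sg \<times> L) (%(u, q). f q)"
  unfolding analytic_fun_def
proof (intro conjI)
  show "torus_domain (UNIV \<times> strip sg \<times> L)"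
    unfolding torus_domain_def using L by (auto intro!: open_Times open_strip simp: strip_add_lattice_iff)
  have "(%z. f (snd z)) cholomorphic_on UNIV \<times> strip sg \<times> L"
    using f unfolding analytic_coeff_def
    by (intro chol_compose[of snd _ f "strip sg \<times> L"] chol_snd chol_ident)
      (auto intro!: open_Times open_strip L)
  then show "(%(u, q). f q) cholomorphic_on UNIV \<times> strip sg \<times> L" by (simp add: case_prod_beta')
  show "\<forall>u th mu. (u, th, mu) \<in> UNIV \<times> strip sg \<times> L -->
      (\<forall>k\<in>lattice_pts. (case (u, th + k, mu) of (u, q) => f q) = (case (u, th, mu) of (u, q) => f q))"
    using f unfolding analytic_coeff_def by auto
qed

lemma coeff_bounded:
  fixes f :: "('d::finite, 'p::finite) angle_param => 'b::complex_normed_space"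
  assumes f: "analytic_coeff sg0 LC f" and LC: "open LC" and sg: "sg < sg0" and L: "compact L" "L \<subseteq> LC"
  shows "\<exists>M>0. \<forall>th\<in>cstrip sg. \<forall>mu\<in>L. norm (f (th, mu)) <= M"
proof -
  have "cball (0::complex) 1 \<times> cstrip sg \<times> L \<subseteq> UNIV \<times> strip sg0 \<times> LC"
    using cstrip_subset_strip[OF sg] L(2) by blast
  from periodic_bounded[OF analytic_coeff_fun[OF f LC, where 'a=complex] this L(1)]
  obtain M where M: "M > 0" "\<forall>z\<in>cball 0 1 \<times> cstrip sg \<times> L. norm ((%(u :: complex, q). f q) z) <= M" by blast
  have "norm (f (th, mu)) <= M" if "th \<in> cstrip sg" "mu \<in> L" for th mu
    using bspec[OF M(2), of "(0, th, mu)"] that by simp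
  then show ?thesis using M(1) by blast
qed

lemma coeff_slice:
  assumes f: "analytic_coeff sg0 LC f" and mu: "mu \<in> LC"
  shows "(%th. f (th, mu)) cholomorphic_on strip sg0"
  using f mu unfolding analytic_coeff_def
  by (intro chol_compose[of "%th. (th, mu)" _ f "strip sg0 \<times> LC"] cholomorphic_intros open_strip) auto

text \<open>A Cauchy estimate that spends the gap between \<open>sg\<close> and an intermediate
  width \<open>sg1\<close>, on whose closed strip the coefficient is bounded.\<close>

lemma coeff_lipschitz:
  fixes f :: "('d::finite, 'p::finite) angle_param => complex"
  assumes f: "analytic_coeff sg0 LC f" and LC: "open LC" and sg: "sg < sg0" and L: "compact L" "L \<subseteq> LC"
  shows "\<exists>M>0. \<forall>th\<in>cstrip sg. \<forall>th'\<in>cstrip sg. \<forall>mu\<in>L. cmod (f (th, mu) - f (th', mu)) <= M * norm (th - th')"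
proof -
  define sg1 where "sg1 = (sg + sg0) / 2"
  have sg1: "sg < sg1" "sg1 < sg0" using sg by (simp_all add: sg1_def)
  obtain M where M: "M > 0" "\<forall>th\<in>cstrip sg1. \<forall>mu\<in>L. norm (f (th, mu)) <= M"
    using coeff_bounded[OF f LC sg1(2) L] by blast
  have "cmod (f (th, mu) - f (th', mu)) <= M / (sg1 - sg) * norm (th - th')"
    if "th \<in> cstrip sg" "th' \<in> cstrip sg" "mu \<in> L" for th th' mu
  proof (rule lipschitz_cauchy[where f="%th. f (th, mu)", OF _ convex_cstrip _ _ _ that(1,2)])
    show "(%th. f (th, mu)) cholomorphic_on strip sg1"
      using coeff_slice[OF f, of mu] that(3) L(2) sg1(2)
      by (intro chol_subset[OF coeff_slice[OF f, of mu] open_strip]) (auto simp: strip_def intro: order.strict_trans)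
    show "ball v (sg1 - sg) \<subseteq> strip sg1" if "v \<in> cstrip sg" for v by (rule ball_cstrip_subset[OF that])
    show "cmod (f (v, mu)) <= M" if "v \<in> strip sg1" for v
      using M(2) subsetD[OF strip_subset_cstrip that] \<open>mu \<in> L\<close> by blast
  qed (use sg1 in auto)
  moreover have "M / (sg1 - sg) > 0" using M(1) sg1 by simp
  ultimately show ?thesis by blast
qed

subsection \<open>Averages over the torus\<close>

lemma content_unit: "measure lborel (cbox 0 1 :: (real ^ 'd) set) = 1"
  using content_cbox_cart[of 0 "1 :: real ^ 'd"] by (simp add: interval_ne_empty_cart box_ne_empty less_eq_vec_def cbox_interval)

lemma integral_cbox_shift:
  fixes f :: "'a::euclidean_space => 'b::real_normed_vector"
  shows "integral (cbox a b) (%x. f (x + c)) = integral (cbox (a + c) (b + c)) f"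
  using integral_shift_cbox[of "a + c" c "b + c" f] by simp

lemma mem_cbox_split:
  fixes x :: "real ^ 'd"
  shows "x \<in> cbox a b \<longleftrightarrow> a $ i <= x $ i & x $ i <= b $ i & (\<forall>j. j ~= i --> a $ j <= x $ j & x $ j <= b $ j)"
  unfolding mem_box_cart
proof (intro iffI allI)
  fix j
  assume R: "a $ i <= x $ i & x $ i <= b $ i & (\<forall>j. j ~= i --> a $ j <= x $ j & x $ j <= b $ j)"
  show "a $ j <= x $ j & x $ j <= b $ j" using R by (cases "j = i") auto
qed simp

text \<open>The shifted cube is cut at coordinate value 1; periodicity moves the protruding slab
  back by one period, where it fills the gap left in the unit cube below
  \<open>\<tau>\<close>.\<close>

lemma integral_periodic_shift_axis:
  fixes g :: "real ^ 'd => complex"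
  assumes g: "continuous_on UNIV g" and per: "!!s. g (s + axis i 1) = g s" and \<tau>: "0 <= \<tau>" "\<tau> <= 1"
  shows "integral (cbox 0 1) (%s. g (s + \<tau> *\<^sub>R axis i 1)) = integral (cbox 0 1) g"
proof -
  let ?e = "axis i 1 :: real ^ 'd"
  have int: "g integrable_on cbox a b" for a b
    by (rule integrable_continuous[OF continuous_on_subset[OF g]]) simp
  have e: "?e \<in> Basis" by (simp add: axis_in_Basis_iff)
  have ie: "x \<bullet> ?e = x $ i" for x :: "real ^ 'd" by (simp add: inner_axis)
  define b' where "b' = (\<chi> j. if j = i then \<tau> else (1 :: real))"
  have "integral (cbox 0 1) (%s. g (s + \<tau> *\<^sub>R ?e)) = integral (cbox (0 + \<tau> *\<^sub>R ?e) (1 + \<tau> *\<^sub>R ?e)) g"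
    by (rule integral_cbox_shift)
  also have "... = integral (cbox (0 + \<tau> *\<^sub>R ?e) (1 + \<tau> *\<^sub>R ?e) \<inter> {x. x \<bullet> ?e <= 1}) g
      + integral (cbox (0 + \<tau> *\<^sub>R ?e) (1 + \<tau> *\<^sub>R ?e) \<inter> {x. x \<bullet> ?e >= 1}) g"
    by (rule integral_split[OF int e])
  also have "cbox (0 + \<tau> *\<^sub>R ?e) (1 + \<tau> *\<^sub>R ?e) \<inter> {x. x \<bullet> ?e <= 1} = cbox 0 1 \<inter> {x. x \<bullet> ?e >= \<tau>}"
    unfolding ie set_eq_iff Int_iff mem_Collect_eq mem_cbox_split[where i=i]
    using \<tau> by (auto simp: axis_def)
  also have "cbox (0 + \<tau> *\<^sub>R ?e) (1 + \<tau> *\<^sub>R ?e) \<inter> {x. x \<bullet> ?e >= 1} = cbox (0 + ?e) (b' + ?e)"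
    unfolding ie set_eq_iff Int_iff mem_Collect_eq mem_cbox_split[where i=i]
    using \<tau> by (auto simp: axis_def b'_def)
  also have "integral (cbox (0 + ?e) (b' + ?e)) g = integral (cbox 0 b') (%s. g (s + ?e))"
    by (rule integral_cbox_shift[symmetric])
  also have "... = integral (cbox 0 b') g" by (simp add: per)
  also have "cbox 0 b' = cbox 0 1 \<inter> {x. x \<bullet> ?e <= \<tau>}"
    unfolding ie set_eq_iff Int_iff mem_Collect_eq mem_cbox_split[where i=i]
    using \<tau> by (auto simp: b'_def)
  also have "integral (cbox 0 1 \<inter> {x. \<tau> <= x \<bullet> ?e}) g + integral (cbox 0 1 \<inter> {x. x \<bullet> ?e <= \<tau>}) g = integral (cbox 0 1) g"
    using integral_split[OF int e, of 0 1 \<tau>] by simp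
  finally show ?thesis .
qed

lemma periodic_int_multiple:
  fixes g :: "'a::real_vector => 'b"
  assumes "!!s. g (s + e) = g s"
  shows "g (s + of_int n *\<^sub>R e) = g s"
proof -
  have nat: "g (s + of_nat m *\<^sub>R e) = g s" for m s
  proof (induction m)
    case (Suc m)
    then show ?case using assms[of "s + of_nat m *\<^sub>R e"] by (simp add: algebra_simps)
  qed simp
  show ?thesis
  proof (cases n rule: int_cases2)
    case (nonneg m)
    then show ?thesis using nat by simp
  next
    case (nonpos m)
    then show ?thesis using nat[of "s + of_int n *\<^sub>R e" m] by simp
  qed
qed

text \<open>One coordinate is shifted at a time: its integer part disappears by periodicity and its
  fractional part by the one-axis case.\<close>

lemma integral_periodic_shift:
  fixes g :: "real ^ 'd => complex"
  assumes g: "continuous_on UNIV g" and per: "!!s i. g (s + axis i 1) = g s"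
  shows "integral (cbox 0 1) (%s. g (s + t)) = integral (cbox 0 1) g"
proof -
  have "integral (cbox 0 1) (%s. g (s + (\<Sum>i\<in>I. (t $ i) *\<^sub>R axis i 1))) = integral (cbox 0 1) g" if "finite I" for I :: "'d set"
    using that
  proof (induction I)
    case (insert j I)
    define h where "h s = g (s + (\<Sum>i\<in>I. (t $ i) *\<^sub>R axis i 1))" for s
    have cont: "continuous_on UNIV h"
      unfolding h_def by (intro continuous_on_compose2[OF g] continuous_intros) auto
    have per': "h (s + axis i 1) = h s" for s i
      unfolding h_def using per[of "s + (\<Sum>i\<in>I. (t $ i) *\<^sub>R axis i 1)" i] by (simp add: algebra_simps)
    have eq: "g (s + (\<Sum>i\<in>insert j I. (t $ i) *\<^sub>R axis i 1)) = h (s + frac (t $ j) *\<^sub>R axis j 1)" for s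
    proof -
      have "h (s + frac (t $ j) *\<^sub>R axis j 1 + of_int \<lfloor>t $ j\<rfloor> *\<^sub>R axis j 1) = h (s + frac (t $ j) *\<^sub>R axis j 1)"
        by (rule periodic_int_multiple[where g=h, OF per'])
      moreover have "s + frac (t $ j) *\<^sub>R axis j 1 + of_int \<lfloor>t $ j\<rfloor> *\<^sub>R axis j 1 = s + (t $ j) *\<^sub>R axis j 1"
        by (simp add: frac_def algebra_simps)
      ultimately have "h (s + (t $ j) *\<^sub>R axis j 1) = h (s + frac (t $ j) *\<^sub>R axis j 1)"
        by simp
      then show ?thesis using insert(1,2) by (simp add: h_def add.assoc)
    qed
    have "integral (cbox 0 1) (%s. h (s + frac (t $ j) *\<^sub>R axis j 1)) = integral (cbox 0 1) h"
      by (rule integral_periodic_shift_axis[OF cont per']) (simp_all add: frac_ge_0 less_imp_le[OF frac_lt_1])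
    also have "... = integral (cbox 0 1) g" unfolding h_def by (rule insert.IH)
    finally show ?case by (simp only: eq)
  qed simp
  from this[of UNIV] show ?thesis using basis_expansion[of t] by (simp add: scalar_mult_eq_scaleR)
qed

text \<open>The partition is chosen before the integrand: one partition serves all functions with
  small oscillation at scale \<open>dl\<close>, which gives uniformity in angles and
  parameters.\<close>

definition riemann_points :: "real => ((real ^ 'd) \<times> (real ^ 'd) set) set => bool"
  where "riemann_points dl p \<longleftrightarrow> finite p & (\<Sum>(x, k)\<in>p. measure lborel k) = 1 &
    (\<forall>g :: real ^ 'd => complex. \<forall>ep\<ge>0. continuous_on (cbox 0 1) g -->
      (\<forall>x\<in>cbox 0 1. \<forall>y\<in>cbox 0 1. dist x y < dl --> norm (g x - g y) <= ep) -->
      norm ((\<Sum>(x, k)\<in>p. measure lborel k *\<^sub>R g x) - integral (cbox 0 1) g) <= ep)"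

lemma riemann_pointsD:
  assumes "riemann_points dl p" "continuous_on (cbox 0 1) g" "0 <= ep"
    and "!!x y. x \<in> cbox 0 1 ==> y \<in> cbox 0 1 ==> dist x y < dl ==> norm (g x - g y) <= ep"
  shows "cmod ((\<Sum>(x, k)\<in>p. measure lborel k *\<^sub>R g x) - integral (cbox 0 1) g) <= ep"
  using assms unfolding riemann_points_def by simp

lemma riemann_sums:
  assumes dl: "dl > 0"
  shows "\<exists>p :: ((real ^ 'd) \<times> (real ^ 'd) set) set. riemann_points dl p"
proof -
  have "gauge (%x :: real ^ 'd. ball x dl)" by (rule gauge_ball[OF dl])
  then obtain p where p: "p tagged_division_of cbox 0 (1 :: real ^ 'd)" "(%x. ball x dl) fine p"
    by (rule fine_division_exists)
  have fin: "finite p" using p(1) by (rule tagged_division_of_finite)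
  have sum1: "(\<Sum>(x, k)\<in>p. measure lborel k) = 1"
    using additive_content_tagged_division[OF p(1)] by (simp add: content_unit)
  have main: "norm ((\<Sum>(x, k)\<in>p. measure lborel k *\<^sub>R g x) - integral (cbox 0 1) g) <= ep"
    if ep: "ep >= 0" and g: "continuous_on (cbox 0 1) g"
      and osc: "\<forall>x\<in>cbox 0 1. \<forall>y\<in>cbox 0 1. dist x y < dl --> norm (g x - g y) <= ep"
    for g :: "real ^ 'd => complex" and ep
  proof -
    have "integral (cbox 0 1) g = (\<Sum>(x, k)\<in>p. integral k g)"
      by (rule integral_combine_tagged_division_topdown[OF integrable_continuous[OF g] p(1)])
    then have "(\<Sum>(x, k)\<in>p. measure lborel k *\<^sub>R g x) - integral (cbox 0 1) g = (\<Sum>(x, k)\<in>p. measure lborel k *\<^sub>R g x - integral k g)"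
      by (simp add: sum_subtractf split_def)
    also have "norm ... <= (\<Sum>(x, k)\<in>p. ep * measure lborel k)"
      unfolding split_def
    proof (rule sum_norm_le)
      fix xk assume xk: "xk \<in> p"
      obtain x k where xk': "xk = (x, k)" by (cases xk)
      note mem = xk[unfolded xk']
      obtain a b where k: "k = cbox a b" using tagged_division_ofD(4)[OF p(1) mem] by blast
      have sub: "k \<subseteq> cbox 0 1" "x \<in> k" using tagged_division_ofD(2,3)[OF p(1) mem] by auto
      have ball: "k \<subseteq> ball x dl" using fineD[OF p(2) mem] .
      have gk: "g integrable_on cbox a b"
        using sub(1) by (intro integrable_continuous continuous_on_subset[OF g]) (simp add: k)
      have "measure lborel k *\<^sub>R g x - integral k g = integral (cbox a b) (%y. g x - g y)"
        unfolding k by (subst integral_diff[OF integrable_const gk]) simp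
      also have "norm ... <= ep * measure lborel (cbox a b)"
      proof (rule integrable_bound[OF ep])
        show "(%y. g x - g y) integrable_on cbox a b" by (intro integrable_diff integrable_const gk)
        fix y assume y: "y \<in> cbox a b"
        then have "dist x y < dl" using ball by (auto simp: k)
        then show "norm (g x - g y) <= ep" using osc sub y by (auto simp: k)
      qed
      finally show "norm (measure lborel (snd xk) *\<^sub>R g (fst xk) - integral (snd xk) g) <= ep * measure lborel (snd xk)"
        by (simp add: xk' k)
    qed
    also have "... = ep * (\<Sum>(x, k)\<in>p. measure lborel k)" by (simp add: split_def sum_distrib_left)
    finally show ?thesis using sum1 by simp
  qed
  show ?thesis
    unfolding riemann_points_def by (intro exI[of _ p] conjI fin sum1 allI impI main)
qed

text \<open>The real part of the shift disappears by periodicity. For the imaginary part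
  \<open>b\<close>, the average over translates by \<open>ze b\<close> is holomorphic in
  \<open>ze\<close> and constant on the real axis, hence takes the same value at \<open>\<i>\<close>
  and at 0.\<close>

lemma average_translate:
  fixes f :: "('d::finite, 'p::finite) angle_param => complex"
  assumes f: "analytic_coeff sg0 LC f" and LC: "open LC" and mu: "mu \<in> LC" and sg: "0 < sg" "sg < sg0" and th: "th \<in> cstrip sg"
  shows "integral (cbox 0 1) (%s. f (cvec s + th, mu)) = torus_average f mu"
proof -
  define a where "a = (\<chi> i. Re (th $ i))"
  define b where "b = (\<chi> i. Im (th $ i))"
  define sg1 where "sg1 = (sg + sg0) / 2"
  have sg1: "sg < sg1" "sg1 < sg0" using sg by (simp_all add: sg1_def)
  \<comment> \<open>Larger than 1, so that \<open>\<i>\<close> lies in \<open>S\<close>, while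
    \<open>ze b\<close> still stays in the strip of width \<open>sg1\<close>.\<close>
  define rh where "rh = sg1 / sg"
  have rh: "rh > 1" using sg sg1 by (simp add: rh_def)
  define S where "S = {ze :: complex. \<bar>Im ze\<bar> < rh}"
  have opS: "open S" unfolding S_def by (intro open_Collect_less continuous_intros)
  have "S = {ze. Im ze < rh} \<inter> {ze. Im ze > - rh}" unfolding S_def by auto
  then have conS: "connected S"
    by (simp add: convex_connected convex_Int convex_halfspace_Im_lt convex_halfspace_Im_gt)
  have theq: "th = cvec a + \<i> *\<^sub>C cvec b"
    by (simp add: vec_eq_iff cvec_nth scaleC_vec_def scaleC_complex_def a_def b_def complex_eq)
  have st: "cvec s + ze *\<^sub>C cvec b \<in> cstrip sg1" if "ze \<in> S" for s ze
  proof -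
    have "\<bar>Im ze * b $ i\<bar> <= rh * sg" for i
      unfolding abs_mult using that th rh by (intro mult_mono) (auto simp: S_def b_def cstrip_def)
    then show ?thesis
      using sg by (simp add: cvec_in_cstrip) (simp add: cstrip_def scaleC_vec_def scaleC_complex_def cvec_nth rh_def)
  qed
  have st0: "cvec s + ze *\<^sub>C cvec b \<in> strip sg0" if "ze \<in> S" for s ze
    using subsetD[OF cstrip_subset_strip[OF sg1(2)] st[OF that]] .
  have slice: "(%th. f (th, mu)) cholomorphic_on strip sg0" by (rule coeff_slice[OF f mu])
  have cont: "continuous_on A (%s. f (cvec s + w, mu))" if "!!s. cvec s + w \<in> strip sg0" for A w
    using that by (intro continuous_on_compose2[OF chol_imp_continuous_on[OF slice]] continuous_intros continuous_on_cvec) auto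
  have perf: "f (cvec (s + axis i 1) + w, mu) = f (cvec s + w, mu)" if "cvec s + w \<in> strip sg0" for s w i
  proof -
    have "cvec (axis i 1) \<in> (lattice_pts :: (complex ^ 'd) set)" by (rule cvec_lattice) (simp add: axis_def)
    then have "f (cvec s + w + cvec (axis i 1), mu) = f (cvec s + w, mu)"
      using f that mu unfolding analytic_coeff_def by blast
    then show ?thesis by (simp add: cvec_add algebra_simps)
  qed
  have shift: "integral (cbox 0 1) (%s. f (cvec (s + t) + w, mu)) = integral (cbox 0 1) (%s. f (cvec s + w, mu))"
    if "!!s. cvec s + w \<in> strip sg0" for t w
    using that by (intro integral_periodic_shift[where g="%s. f (cvec s + w, mu)"] cont perf)
  define \<phi> where "\<phi> ze = integral (cbox 0 1) (%s. f (cvec s + ze *\<^sub>C cvec b, mu))" for ze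
  obtain M where M: "M > 0" "\<forall>th\<in>cstrip sg1. \<forall>th'\<in>cstrip sg1. \<forall>mu\<in>{mu}. cmod (f (th, mu) - f (th', mu)) <= M * norm (th - th')"
    using coeff_lipschitz[OF f LC sg1(2), of "{mu}"] mu by auto
  have "\<forall>n. \<exists>p :: ((real ^ 'd) \<times> (real ^ 'd) set) set. riemann_points (1 / real (Suc n)) p"
    by (intro allI riemann_sums) simp
  then obtain p :: "nat => ((real ^ 'd) \<times> (real ^ 'd) set) set" where p: "!!n. riemann_points (1 / real (Suc n)) (p n)"
    by metis
  \<comment> \<open>The integral is the uniform limit of its Riemann sums, which are finite sums of
    holomorphic functions of \<open>ze\<close>.\<close>
  have "\<phi> cholomorphic_on S"
  proof (rule cholomorphic_uniform_limit)
    fix n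
    have "(%ze. f (cvec x + ze *\<^sub>C cvec b, mu)) holomorphic_on S" for x
      by (rule holomorphic_on_subset[OF cholomorphic_slice[OF slice]]) (use st0 in auto)
    then show "(%ze. \<Sum>(x, k)\<in>p n. measure lborel k *\<^sub>R f (cvec x + ze *\<^sub>C cvec b, mu)) cholomorphic_on S"
      unfolding cholomorphic_on_complex_iff split_def scaleR_conv_of_real
      by (intro conjI opS holomorphic_on_sum holomorphic_on_mult holomorphic_on_const)
  next
    fix e :: real assume e: "e > 0"
    obtain N where N: "M / e < real N" using reals_Archimedean2 by blast
    have "cmod ((\<Sum>(x, k)\<in>p n. measure lborel k *\<^sub>R f (cvec x + ze *\<^sub>C cvec b, mu)) - \<phi> ze) <= e"
      if n: "n >= N" and ze: "ze \<in> S" for n ze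
      unfolding \<phi>_def
    proof (rule riemann_pointsD[OF p])
      show "0 <= e" using e by simp
      show "continuous_on (cbox 0 1) (%s. f (cvec s + ze *\<^sub>C cvec b, mu))" by (rule cont) (rule st0[OF ze])
      fix x y :: "real ^ 'd" assume d: "dist x y < 1 / real (Suc n)"
      have "cmod (f (cvec x + ze *\<^sub>C cvec b, mu) - f (cvec y + ze *\<^sub>C cvec b, mu)) <= M * norm (x - y)"
        using M(2)[rule_format, OF st[OF ze, of x] st[OF ze, of y]] by (simp add: cvec_diff[symmetric] norm_cvec)
      also have "... <= M * (1 / real (Suc n))"
        using d M(1) by (intro mult_left_mono) (auto simp: dist_norm)
      also have "... <= e"
      proof -
        have "M <= e * real N" using N e by (simp add: divide_less_eq mult.commute)
        also have "... <= e * real (Suc n)" using n e by (intro mult_left_mono) auto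
        finally show ?thesis by (simp add: divide_le_eq)
      qed
      finally show "cmod (f (cvec x + ze *\<^sub>C cvec b, mu) - f (cvec y + ze *\<^sub>C cvec b, mu)) <= e" .
    qed
    then show "\<exists>N. \<forall>n\<ge>N. \<forall>ze\<in>S. cmod ((\<Sum>(x, k)\<in>p n. measure lborel k *\<^sub>R f (cvec x + ze *\<^sub>C cvec b, mu)) - \<phi> ze) <= e"
      by blast
  qed
  then have hol: "\<phi> holomorphic_on S" by (simp add: cholomorphic_on_complex_iff)
  have real: "\<phi> (complex_of_real t) = \<phi> 0" for t
  proof -
    have "cvec s + 0 \<in> strip sg0" for s :: "real ^ 'd" using sg by (simp add: strip_def cvec_nth)
    from shift[OF this, of "t *\<^sub>R b"] show ?thesis
      by (simp add: \<phi>_def cvec_add cvec_scaleR scaleC.zero_left)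
  qed
  have "\<phi> \<i> - \<phi> 0 = 0"
  proof (rule analytic_continuation[where f="%ze. \<phi> ze - \<phi> 0" and U="range complex_of_real" and \<xi>=0, OF _ opS conS])
    show "(%ze. \<phi> ze - \<phi> 0) holomorphic_on S" by (intro holomorphic_intros hol)
    show "range complex_of_real \<subseteq> S" "0 \<in> S" "\<i> \<in> S" using rh by (auto simp: S_def)
    show "0 islimpt range complex_of_real"
      unfolding islimpt_approachable
    proof (intro allI impI)
      fix e :: real assume "e > 0"
      then show "\<exists>x'\<in>range complex_of_real. x' ~= 0 & dist x' 0 < e"
        by (intro bexI[of _ "complex_of_real (e / 2)"]) (auto simp del: of_real_divide)
    qed
    show "\<phi> z - \<phi> 0 = 0" if "z \<in> range complex_of_real" for z using that real by auto
  qed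
  then have "\<phi> \<i> = torus_average f mu" by (simp add: \<phi>_def torus_average_def scaleC.zero_left)
  moreover have "integral (cbox 0 1) (%s. f (cvec s + th, mu)) = \<phi> \<i>"
  proof -
    have "\<i> \<in> S" using rh by (simp add: S_def)
    from shift[OF st0[OF this], of a] show ?thesis
      unfolding \<phi>_def theq by (simp add: cvec_add algebra_simps)
  qed
  ultimately show ?thesis by simp
qed

subsection \<open>Diophantine frequencies\<close>

text \<open>The lower bound is positive because \<open>k\<close> has a nonzero entry. Hence 1 and
  the frequencies are linearly independent over the integers.\<close>

lemma diophantine_nonresonant:
  assumes "diophantine om" "k ~= 0"
  shows "(\<Sum>i\<in>UNIV. om $ i * real_of_int (k $ i)) ~= real_of_int l"
proof
  assume eq: "(\<Sum>i\<in>UNIV. om $ i * real_of_int (k $ i)) = real_of_int l"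
  obtain c \<tau> where c: "c > 0" and *: "\<forall>k :: int ^ 'a. k ~= 0 --> (\<forall>l :: int.
    \<bar>(\<Sum>i\<in>UNIV. om $ i * real_of_int (k $ i)) - real_of_int l\<bar>
      >= c * (\<Sum>i\<in>UNIV. real_of_int \<bar>k $ i\<bar>) powr (- \<tau>))"
    using assms(1) unfolding diophantine_def by blast
  obtain i where i: "k $ i ~= 0" using assms(2) by (auto simp: vec_eq_iff)
  have "0 < real_of_int \<bar>k $ i\<bar>" using i by simp
  also have "... <= (\<Sum>i\<in>UNIV. real_of_int \<bar>k $ i\<bar>)" by (rule member_le_sum) auto
  finally have "0 < c * (\<Sum>i\<in>UNIV. real_of_int \<bar>k $ i\<bar>) powr (- \<tau>)" using c by simp
  then show False using *[rule_format, OF assms(2), of l] eq by simp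
qed

text \<open>Kronecker's theorem: the orbit of 0 under the rotation, taken in both directions of
  time, is dense in the real torus.\<close>

lemma diophantine_dense:
  fixes om :: "real ^ 'd"
  assumes dio: "diophantine om" and dl: "dl > 0"
  shows "\<exists>n :: int. \<exists>k\<in>lattice_pts. norm (cvec s - of_int n *\<^sub>C cvec om - k) < dl"
proof -
  define d where "d = CARD('d)"
  obtain h :: "nat => 'd" where h: "bij_betw h {..<d} UNIV"
    using ex_bij_betw_nat_finite[of "UNIV :: 'd set"] by (auto simp: d_def lessThan_atLeast0)
  \<comment> \<open>Below \<open>d\<close> the list enumerates the frequencies; the entry at
    \<open>d\<close> is 1, the last number in Kronecker's theorem.\<close>
  define t where "t i = (if i < d then om $ h i else 1)" for i
  have hinj: "h i = h j ==> i = j" if "i < d" "j < d" for i j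
    using h that by (auto simp: bij_betw_def inj_on_def)
  have axis_sum: "(\<Sum>j\<in>UNIV. om $ j * real_of_int (axis i c $ j)) = om $ i * real_of_int c" for i and c :: int
    by (simp add: axis_def if_distrib[of real_of_int] if_distrib[of "%x. _ * x"] cong: if_cong)
  have neq: "t i ~= t j" if ij: "i < j" "j <= d" for i j
  proof (cases "j = d")
    case True
    have "axis (h i) (1 :: int) ~= 0" by (simp add: axis_eq_0_iff)
    from diophantine_nonresonant[OF dio this, of 1] show ?thesis
      using ij True by (simp add: axis_sum t_def)
  next
    case False
    then have "i < d" "j < d" "h i ~= h j" using ij hinj[of i j] by auto
    then have "(axis (h i) 1 + axis (h j) (- 1) :: int ^ 'd) $ h i ~= 0" by (simp add: axis_def)
    then have "axis (h i) 1 + axis (h j) (- 1) ~= (0 :: int ^ 'd)" by (metis zero_index)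
    from diophantine_nonresonant[OF dio this, of 0] show ?thesis
      using \<open>i < d\<close> \<open>j < d\<close>
      by (simp add: t_def distrib_left sum.distrib axis_sum[of _ 1, simplified] axis_sum[of _ "-1", simplified] del: of_int_minus)
  qed
  have inj: "inj_on t {..d}"
    by (rule linorder_inj_onI) (use neq in auto)
  \<comment> \<open>Independence over the integers is expressed through the reals as a module over
    \<open>int\<close>.\<close>
  interpret Z: Modules.module "%(r :: int) (x :: real). of_int r * x"
    by (simp add: Modules.module.intro distrib_left distrib_right mult.assoc)
  have indep: "Z.independent (t ` {..d})"
  proof
    assume "Z.dependent (t ` {..d})"
    then obtain S u' x where S: "finite S" "S \<subseteq> t ` {..d}" "(\<Sum>x\<in>S. real_of_int (u' x) * x) = 0"
      and x: "x \<in> S" "u' x ~= 0"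
      unfolding Z.dependent_explicit by blast
    define u where "u x = (if x \<in> S then u' x else 0)" for x
    have "(\<Sum>x\<in>t ` {..d}. real_of_int (u x) * x) = (\<Sum>x\<in>S. real_of_int (u x) * x)"
      using S(2) by (intro sum.mono_neutral_right) (auto simp: u_def)
    then have sum0: "(\<Sum>x\<in>t ` {..d}. real_of_int (u x) * x) = 0"
      using S(3) by (simp add: u_def)
    define k where "k = (\<chi> j. u (om $ j))"
    have "(\<Sum>x\<in>t ` {..d}. real_of_int (u x) * x) = (\<Sum>i\<le>d. real_of_int (u (t i)) * t i)"
      using inj by (simp add: sum.reindex)
    also have "... = (\<Sum>i<d. real_of_int (u (om $ h i)) * om $ h i) + real_of_int (u 1)"
      by (simp add: lessThan_Suc_atMost[symmetric] t_def)
    also have "(\<Sum>i<d. real_of_int (u (om $ h i)) * om $ h i) = (\<Sum>j\<in>UNIV. om $ j * real_of_int (k $ j))"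
      using sum.reindex_bij_betw[OF h, of "%j. real_of_int (u (om $ j)) * om $ j"] by (simp add: k_def mult.commute)
    finally have eq: "(\<Sum>j\<in>UNIV. om $ j * real_of_int (k $ j)) = real_of_int (- u 1)" using sum0 by simp
    have k0: "k = 0" using diophantine_nonresonant[OF dio, of k "- u 1"] eq by blast
    then have "u 1 = 0" using eq by simp
    moreover have "u (om $ j) = 0" for j
      using k0 unfolding k_def vec_eq_iff by simp
    ultimately have "u x = 0" if "x \<in> t ` {..d}" for x using that by (auto simp: t_def split: if_splits)
    then have "u x = 0" using x S(2) by blast
    then show False using x by (simp add: u_def)
  qed
  \<comment> \<open>The norm is bounded by the sum of \<open>d\<close> coordinate errors, which then
    stays below \<open>dl / 2\<close>.\<close>
  define ep where "ep = dl / (2 * real d)"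
  have d0: "d > 0" by (simp add: d_def)
  have ep: "ep > 0" using dl d0 by (simp add: ep_def)
  have "t d = 1" by (simp add: t_def)
  then obtain n m where nm: "!!i. i < d ==> \<bar>of_int n * t i - of_int (m i) - s $ h i\<bar> < ep"
    using Kronecker_thm_2[OF indep inj _ ep, of "%i. s $ h i"] by blast
  define g where "g = inv_into {..<d} h"
  have g: "g j < d" "h (g j) = j" for j
    using h f_inv_into_f[of j h "{..<d}"] inv_into_into[of j h "{..<d}"] by (auto simp: g_def bij_betw_def)
  define k where "k = (\<chi> j. - complex_of_int (m (g j)))"
  have k: "k \<in> lattice_pts" by (simp add: lattice_pts_def k_def)
  have "norm (cvec s - of_int n *\<^sub>C cvec om - k) <= (\<Sum>j\<in>UNIV. norm ((cvec s - of_int n *\<^sub>C cvec om - k) $ j))"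
    by (rule norm_vec_le_sum)
  also have "... <= (\<Sum>j\<in>(UNIV :: 'd set). ep)"
  proof (rule sum_mono)
    fix j
    have "(cvec s - of_int n *\<^sub>C cvec om - k) $ j = - complex_of_real (of_int n * om $ j - of_int (m (g j)) - s $ j)"
      by (simp add: cvec_nth k_def scaleC_vec_def scaleC_complex_def)
    then have "norm ((cvec s - of_int n *\<^sub>C cvec om - k) $ j) = \<bar>of_int n * om $ j - of_int (m (g j)) - s $ j\<bar>"
      by (simp only: norm_minus_cancel norm_of_real)
    also have "... <= ep" using nm[OF g(1)[of j]] g[of j] by (simp add: t_def)
    finally show "norm ((cvec s - of_int n *\<^sub>C cvec om - k) $ j) <= ep" .
  qed
  also have "... = dl / 2" using d0 by (simp add: ep_def d_def)
  also have "... < dl" using dl by simp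
  finally show ?thesis using k by blast
qed

text \<open>A telescoping sum along the orbit, backwards in time when \<open>n\<close> is negative.
  Its bound grows with \<open>n\<close>, which is harmless because only finitely many
  \<open>n\<close> will occur.\<close>

lemma coboundary:
  fixes f :: "complex ^ 'd => complex"
  assumes M: "!!th. th \<in> cstrip sg ==> cmod (f th) <= M"
  shows "\<exists>c. \<forall>th\<in>cstrip sg. cmod (c th) <= real_of_int \<bar>n\<bar> * M &
    f th - f (th + of_int n *\<^sub>C cvec om) + c th - c (th + cvec om) = 0"
proof -
  have shift: "th + z *\<^sub>C cvec om \<in> cstrip sg" if "th \<in> cstrip sg" "Im z = 0" for th z
    using that by (simp add: cstrip_def scaleC_vec_def scaleC_complex_def cvec_nth)
  show ?thesis
  proof (cases n rule: int_cases2)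
    case (nonneg m)
    define c where "c th = - (\<Sum>i<m. f (th + of_nat i *\<^sub>C cvec om))" for th
    have "cmod (c th) <= real_of_int \<bar>n\<bar> * M" if "th \<in> cstrip sg" for th
      unfolding c_def norm_minus_cancel
      using sum_norm_le[of "{..<m}" "%i. f (th + of_nat i *\<^sub>C cvec om)" "%_. M"] M[OF shift[OF that]]
      by (simp add: nonneg)
    moreover have "f th - f (th + of_int n *\<^sub>C cvec om) + c th - c (th + cvec om) = 0" for th
    proof -
      have "th + cvec om + of_nat i *\<^sub>C cvec om = th + of_nat (Suc i) *\<^sub>C cvec om" for i
        by (simp add: scaleC_add_left add.assoc)
      then have "c (th + cvec om) = - (\<Sum>i<m. f (th + of_nat (Suc i) *\<^sub>C cvec om))"
        unfolding c_def by (simp only:)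
      then have "c th - c (th + cvec om) = (\<Sum>i<m. f (th + of_nat (Suc i) *\<^sub>C cvec om) - f (th + of_nat i *\<^sub>C cvec om))"
        unfolding c_def[of th] by (simp only: sum_subtractf) simp
      also have "... = f (th + of_nat m *\<^sub>C cvec om) - f (th + of_nat 0 *\<^sub>C cvec om)"
        by (rule sum_lessThan_telescope)
      finally show ?thesis by (simp add: nonneg scaleC.zero_left algebra_simps)
    qed
    ultimately show ?thesis by (intro exI[of _ c]) blast
  next
    case (nonpos m)
    define c where "c th = (\<Sum>i<m. f (th + (- of_nat (Suc i)) *\<^sub>C cvec om))" for th
    have "cmod (c th) <= real_of_int \<bar>n\<bar> * M" if "th \<in> cstrip sg" for th
      unfolding c_def
      using sum_norm_le[of "{..<m}" "%i. f (th + (- of_nat (Suc i)) *\<^sub>C cvec om)" "%_. M"] M[OF shift[OF that]]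
      by (simp add: nonpos)
    moreover have "f th - f (th + of_int n *\<^sub>C cvec om) + c th - c (th + cvec om) = 0" for th
    proof -
      have "th + cvec om + (- of_nat (Suc i)) *\<^sub>C cvec om = th + (- of_nat i) *\<^sub>C cvec om" for i
        by (simp add: scaleC_add_left scaleC.minus_left scaleC.diff_left)
      then have "c (th + cvec om) = (\<Sum>i<m. f (th + (- of_nat i) *\<^sub>C cvec om))"
        unfolding c_def by (simp only:)
      then have "c th - c (th + cvec om) = (\<Sum>i<m. f (th + (- of_nat (Suc i)) *\<^sub>C cvec om) - f (th + (- of_nat i) *\<^sub>C cvec om))"
        unfolding c_def[of th] by (simp only: sum_subtractf)
      also have "... = f (th + (- of_nat m) *\<^sub>C cvec om) - f (th + (- of_nat 0) *\<^sub>C cvec om)"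
        by (rule sum_lessThan_telescope)
      finally show ?thesis by (simp add: nonpos scaleC.zero_left algebra_simps)
    qed
    ultimately show ?thesis by (intro exI[of _ c]) blast
  qed
qed

text \<open>Averaging without small divisors: the mean of \<open>f\<close> is approximated by a finite convex combination
  of translates of \<open>f\<close> along the orbit of the rotation, and each such translate differs from \<open>f\<close> by a
  coboundary.\<close>

lemma approximate_cohomological_equation:
  fixes f :: "('d::finite, 'p::finite) angle_param => complex"
  assumes f: "analytic_coeff sg0 LC f" and LC: "open LC" and sg: "0 < sg" "sg < sg0" and L: "compact L" "L \<subseteq> LC"
    and dich: "diophantine om \<or> (\<forall>th\<in>strip sg0. \<forall>th'\<in>strip sg0. \<forall>mu\<in>LC. f (th, mu) = f (th', mu))"
    and ep: "ep > 0"
  shows "\<exists>c C. C > 0 & (\<forall>th\<in>cstrip sg. \<forall>mu\<in>L. cmod (c (th, mu)) <= C &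
    cmod (f (th, mu) - torus_average f mu + c (th, mu) - c (th + cvec om, mu)) <= ep)"
  using dich
proof
  assume const: "\<forall>th\<in>strip sg0. \<forall>th'\<in>strip sg0. \<forall>mu\<in>LC. f (th, mu) = f (th', mu)"
  have "torus_average f mu = f (th, mu)" if "th \<in> cstrip sg" "mu \<in> L" for th mu
  proof -
    have th: "th \<in> strip sg0" using cstrip_subset_strip[OF sg(2)] that by blast
    have "f (cvec s, mu) = f (th, mu)" for s
    proof -
      have "cvec s \<in> strip sg0" using sg by (simp add: strip_def cvec_nth)
      then show ?thesis using const th that(2) L(2) by blast
    qed
    then show ?thesis by (simp add: torus_average_def content_unit)
  qed
  then show ?thesis using ep by (intro exI[of _ "%_. 0"] exI[of _ 1]) simp
next
  assume dio: "diophantine om"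
  obtain M where M: "M > 0" "\<forall>th\<in>cstrip sg. \<forall>mu\<in>L. cmod (f (th, mu)) <= M"
    using coeff_bounded[OF f LC sg(2) L] by blast
  obtain K where K: "K > 0" "\<forall>th\<in>cstrip sg. \<forall>th'\<in>cstrip sg. \<forall>mu\<in>L. cmod (f (th, mu) - f (th', mu)) <= K * norm (th - th')"
    using coeff_lipschitz[OF f LC sg(2) L] by blast
  \<comment> \<open>At this scale \<open>f\<close> oscillates by at most \<open>ep / 2\<close>. One
    half of \<open>ep\<close> is spent on the Riemann sum and the other on replacing sample points
    by orbit points.\<close>
  define dl where "dl = ep / (2 * K)"
  have dl: "dl > 0" "K * dl <= ep / 2" using ep K(1) by (simp_all add: dl_def)
  obtain p :: "((real ^ 'd) \<times> (real ^ 'd) set) set" where rp: "riemann_points dl p"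
    using riemann_sums[OF dl(1)] by blast
  then have p: "(\<Sum>(x, k)\<in>p. measure lborel k) = 1" unfolding riemann_points_def by blast
  define w where "w j = measure lborel (snd j)" for j :: "(real ^ 'd) \<times> (real ^ 'd) set"
  have w: "0 <= w j" "(\<Sum>j\<in>p. w j) = 1" for j using p by (simp_all add: w_def split_def)
  have "\<forall>x. \<exists>n :: int. \<exists>k\<in>lattice_pts. norm (cvec x - of_int n *\<^sub>C cvec om - k) < dl"
    using diophantine_dense[OF dio dl(1)] by blast
  then obtain n k where nk: "!!x. k x \<in> lattice_pts" "!!x. norm (cvec x - of_int (n x) *\<^sub>C cvec om - k x) < dl"
    by metis
  have "\<forall>x mu. \<exists>c. mu \<in> L --> (\<forall>th\<in>cstrip sg. cmod (c th) <= real_of_int \<bar>n x\<bar> * M &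
    f (th, mu) - f (th + of_int (n x) *\<^sub>C cvec om, mu) + c th - c (th + cvec om) = 0)"
    using coboundary[of sg "%th. f (th, _)" M] M(2) by (intro allI) (metis (no_types, lifting))
  then obtain c where c: "!!x mu th. mu \<in> L ==> th \<in> cstrip sg ==> cmod (c x mu th) <= real_of_int \<bar>n x\<bar> * M"
    "!!x mu th. mu \<in> L ==> th \<in> cstrip sg ==>
      f (th, mu) - f (th + of_int (n x) *\<^sub>C cvec om, mu) + c x mu th - c x mu (th + cvec om) = 0"
    by metis
  define cc where "cc = (%(th, mu). \<Sum>j\<in>p. w j *\<^sub>R c (fst j) mu th)"
  \<comment> \<open>Adding 1 makes the bound strictly positive.\<close>
  define C where "C = (\<Sum>j\<in>p. w j * (real_of_int \<bar>n (fst j)\<bar> * M)) + 1"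
  have C: "C > 0" unfolding C_def using w M(1) by (intro add_nonneg_pos sum_nonneg mult_nonneg_nonneg) auto
  have "cmod (cc (th, mu)) <= C &
      cmod (f (th, mu) - torus_average f mu + cc (th, mu) - cc (th + cvec om, mu)) <= ep"
    if th: "th \<in> cstrip sg" and mu: "mu \<in> L" for th mu
  proof
    have "cmod (cc (th, mu)) <= (\<Sum>j\<in>p. w j * (real_of_int \<bar>n (fst j)\<bar> * M))"
      unfolding cc_def prod.case
      by (rule sum_norm_le) (use w c(1)[OF mu th] in \<open>auto intro: mult_left_mono\<close>)
    then show "cmod (cc (th, mu)) <= C" by (simp add: C_def)
    have th0: "cvec s + th \<in> strip sg0" for s
      using th cstrip_subset_strip[OF sg(2)] by (auto simp: cvec_in_strip)
    have mu': "mu \<in> LC" using mu L(2) by blast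
    have 1: "cmod ((\<Sum>j\<in>p. w j *\<^sub>R f (cvec (fst j) + th, mu)) - torus_average f mu) <= ep / 2"
    proof -
      have "continuous_on (cbox 0 1) (%s. f (cvec s + th, mu))"
        using th0 by (intro continuous_on_compose2[OF chol_imp_continuous_on[OF coeff_slice[OF f mu']]]
            continuous_intros continuous_on_cvec) auto
      moreover have "cmod (f (cvec x + th, mu) - f (cvec y + th, mu)) <= ep / 2" if "dist x y < dl" for x y
      proof -
        have "cmod (f (cvec x + th, mu) - f (cvec y + th, mu)) <= K * norm (x - y)"
          using K(2)[rule_format, of "cvec x + th" "cvec y + th" mu] th mu
          by (simp add: cvec_in_cstrip cvec_diff[symmetric] norm_cvec)
        also have "... <= K * dl" using that K(1) by (intro mult_left_mono) (auto simp: dist_norm)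
        finally show ?thesis using dl(2) by linarith
      qed
      ultimately have "cmod ((\<Sum>(x, k)\<in>p. measure lborel k *\<^sub>R f (cvec x + th, mu)) - integral (cbox 0 1) (%s. f (cvec s + th, mu))) <= ep / 2"
        using ep by (intro riemann_pointsD[OF rp]) auto
      then show ?thesis
        unfolding average_translate[OF f LC mu' sg th] by (simp add: w_def split_def)
    qed
    have 2: "cmod (f (th + of_int (n x) *\<^sub>C cvec om, mu) - f (cvec x + th, mu)) <= ep / 2" for x
    proof -
      let ?y = "th + of_int (n x) *\<^sub>C cvec om"
      have y: "?y \<in> cstrip sg" using th by (simp add: cstrip_def scaleC_vec_def scaleC_complex_def cvec_nth)
      then have y0: "?y \<in> strip sg0" using cstrip_subset_strip[OF sg(2)] by blast
      have "f (?y + k x, mu) = f (?y, mu)"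
        using f y0 mu' nk(1) unfolding analytic_coeff_def by blast
      moreover have "cmod (f (?y + k x, mu) - f (cvec x + th, mu)) <= K * norm (?y + k x - (cvec x + th))"
        by (rule K(2)[rule_format]) (use y mu th nk(1) in \<open>simp_all add: cstrip_add_lattice_iff cvec_in_cstrip\<close>)
      moreover have "norm (?y + k x - (cvec x + th)) <= dl"
        using nk(2)[of x] norm_minus_commute[of "cvec x" "of_int (n x) *\<^sub>C cvec om + k x"] by (simp add: algebra_simps)
      then have "K * norm (?y + k x - (cvec x + th)) <= K * dl" using K(1) by (intro mult_left_mono) auto
      ultimately show ?thesis using dl(2) by simp
    qed
    \<comment> \<open>The weights sum to 1, so the weighted coboundaries replace \<open>f\<close> by
      the weighted mean of its values along the orbit.\<close>
    have "f (th, mu) + cc (th, mu) - cc (th + cvec om, mu) = (\<Sum>j\<in>p. w j *\<^sub>R (f (th, mu) + c (fst j) mu th - c (fst j) mu (th + cvec om)))"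
    proof -
      have "f (th, mu) = (\<Sum>j\<in>p. w j *\<^sub>R f (th, mu))" using w(2) by (simp add: scaleR_left.sum[symmetric])
      then show ?thesis
        by (simp add: cc_def scaleR_right_distrib scaleR_right_diff_distrib sum.distrib sum_subtractf)
    qed
    also have "... = (\<Sum>j\<in>p. w j *\<^sub>R f (th + of_int (n (fst j)) *\<^sub>C cvec om, mu))"
    proof (rule sum.cong[OF refl])
      fix j :: "(real ^ 'd) \<times> (real ^ 'd) set"
      have "f (th, mu) + c (fst j) mu th - c (fst j) mu (th + cvec om) = f (th + of_int (n (fst j)) *\<^sub>C cvec om, mu)"
        using c(2)[OF mu th, of "fst j"] by (simp add: algebra_simps)
      then show "w j *\<^sub>R (f (th, mu) + c (fst j) mu th - c (fst j) mu (th + cvec om)) = w j *\<^sub>R f (th + of_int (n (fst j)) *\<^sub>C cvec om, mu)"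
        by simp
    qed
    finally have eq: "f (th, mu) + cc (th, mu) - cc (th + cvec om, mu) = (\<Sum>j\<in>p. w j *\<^sub>R f (th + of_int (n (fst j)) *\<^sub>C cvec om, mu))" .
    have 3: "cmod ((\<Sum>j\<in>p. w j *\<^sub>R f (th + of_int (n (fst j)) *\<^sub>C cvec om, mu)) - (\<Sum>j\<in>p. w j *\<^sub>R f (cvec (fst j) + th, mu))) <= ep / 2"
    proof -
      have "cmod (\<Sum>j\<in>p. w j *\<^sub>R (f (th + of_int (n (fst j)) *\<^sub>C cvec om, mu) - f (cvec (fst j) + th, mu))) <= (\<Sum>j\<in>p. w j * (ep / 2))"
      proof (rule sum_norm_le)
        show "cmod (w j *\<^sub>R (f (th + of_int (n (fst j)) *\<^sub>C cvec om, mu) - f (cvec (fst j) + th, mu))) <= w j * (ep / 2)" for j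
          unfolding norm_scaleR abs_of_nonneg[OF w(1)] by (intro mult_left_mono 2 w(1))
      qed
      also have "... = (\<Sum>j\<in>p. w j) * (ep / 2)" by (simp only: sum_distrib_right)
      also have "... = ep / 2" by (simp add: w(2))
      finally show ?thesis by (simp add: scaleR_right_diff_distrib sum_subtractf)
    qed
    have "f (th, mu) - torus_average f mu + cc (th, mu) - cc (th + cvec om, mu)
      = ((\<Sum>j\<in>p. w j *\<^sub>R f (th + of_int (n (fst j)) *\<^sub>C cvec om, mu)) - (\<Sum>j\<in>p. w j *\<^sub>R f (cvec (fst j) + th, mu)))
        + ((\<Sum>j\<in>p. w j *\<^sub>R f (cvec (fst j) + th, mu)) - torus_average f mu)"
      using eq by (simp add: algebra_simps)
    then have "cmod (f (th, mu) - torus_average f mu + cc (th, mu) - cc (th + cvec om, mu)) <= ep / 2 + ep / 2"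
      by (simp only: norm_triangle_mono[OF 3 1])
    then show "cmod (f (th, mu) - torus_average f mu + cc (th, mu) - cc (th + cvec om, mu)) <= ep"
      by simp
  qed
  then show ?thesis using C by (intro exI[of _ cc] exI[of _ C]) blast
qed

lemma continuous_torus_average:
  fixes f :: "('d::finite, 'p::finite) angle_param => 'b::{complex_normed_space, banach}"
  assumes f: "analytic_coeff sg0 LC f" and sg0: "sg0 > 0"
  shows "continuous_on LC (torus_average f)"
proof -
  have "f cholomorphic_on strip sg0 \<times> LC" using f by (simp add: analytic_coeff_def)
  then have cont: "continuous_on (strip sg0 \<times> LC) f" by (rule chol_imp_continuous_on)
  have "continuous_on (LC \<times> cbox 0 (1 :: real ^ 'd)) (%(mu, s). f (cvec s, mu))"
    unfolding split_def
    using sg0 by (intro continuous_on_compose2[OF cont] continuous_intros continuous_on_compose2[OF continuous_on_cvec])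
      (auto simp: strip_def cvec_nth)
  from integral_continuous_on_param[OF this] show ?thesis
    by (simp add: torus_average_def[abs_def])
qed

lemma norm_diff_power_le:
  fixes a b :: complex
  assumes "cmod a <= r" "cmod b <= r"
  shows "cmod (a ^ n - b ^ n) <= real n * r ^ (n - 1) * cmod (a - b)"
proof -
  have r: "0 <= r" using assms(1) norm_ge_zero order_trans by blast
  have "a ^ n - b ^ n = (a - b) * (\<Sum>i<n. a ^ i * b ^ (n - Suc i))"
    by (simp add: power_diff_sumr2 mult.commute)
  also have "cmod ... <= cmod (a - b) * (\<Sum>i<n. r ^ (n - 1))"
    unfolding norm_mult
  proof (rule mult_left_mono[OF sum_norm_le])
    fix i assume "i \<in> {..<n}"
    then have "r ^ i * r ^ (n - Suc i) = r ^ (n - 1)" by (simp add: power_add[symmetric])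
    then show "cmod (a ^ i * b ^ (n - Suc i)) <= r ^ (n - 1)"
      unfolding norm_mult norm_power using assms r
      by (metis mult_mono norm_ge_zero power_mono zero_le_power)
  qed simp
  finally show ?thesis by (simp add: mult_ac)
qed

subsection \<open>Lipschitz estimates on thin polydiscs\<close>

text \<open>Cauchy estimates in a polydisc adapted to the curve: radius of order \<open>|x|\<close>
  in the first variable, \<open>|x| ^ e\<close> in \<open>y\<close>, and the fixed width
  \<open>sg2 - sg1\<close> in the angle. The exponent \<open>e\<close> is left open: a larger
  \<open>y\<close> disc worsens the supremum but divides it by a larger radius, and the better
  choice depends on how \<open>f\<close> vanishes in \<open>y\<close>.\<close>

lemma thin_polydisc_lipschitz:
  fixes f :: "'m::finite xy \<times> (complex ^ 'd::finite) => complex"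
  assumes f: "f cholomorphic_on ball 0 r0 \<times> strip sg2" and sg: "sg1 < sg2"
    and A: "0 <= A" and e: "e = 1 \<or> e = 2" "e <= k'" and k: "1 <= k" and C0: "1 <= C0"
    and x: "0 < cmod x" "cmod x * (4 * C0) <= 1" "cmod x * (C0 + 3) < r0"
    and H1: "!!x' y' th'. cmod x' <= 2 * cmod x ==> norm y' <= (C0 + 1) * cmod x ^ 2 ==> th' \<in> strip sg2 ==>
      cmod (f ((x', y'), th')) <= A * cmod x ^ k"
    and H2: "!!x' y' th'. cmod x' <= 2 * cmod x ==> norm y' <= (C0 + 1) * cmod x ^ e ==> th' \<in> strip sg2 ==>
      cmod (f ((x', y'), th')) <= A * cmod x ^ k'"
    and x1: "cmod (x1 - x) <= C0 * cmod x ^ 2" and x2: "cmod (x2 - x) <= C0 * cmod x ^ 2"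
    and y1: "norm y1 <= C0 * cmod x ^ 2" and y2: "norm y2 <= C0 * cmod x ^ 2"
    and th1: "th1 \<in> cstrip sg1" and th2: "th2 \<in> cstrip sg1"
  shows "cmod (f ((x1, y1), th1) - f ((x2, y2), th2)) \<le>
    (4 * A + A / (sg2 - sg1)) * (cmod x ^ (k - 1) * cmod (x1 - x2) + cmod x ^ (k' - e) * norm (y1 - y2) + cmod x ^ k * norm (th1 - th2))"
proof -
  define t where "t = cmod x"
  have t: "0 < t" "t * (4 * C0) <= 1" "t * (C0 + 3) < r0" using x by (simp_all add: t_def)
  have "t * 4 <= t * (4 * C0)" using t C0 by (intro mult_left_mono) auto
  then have t1: "t <= 1 / 4" using t(2) by linarith
  have te: "t ^ 2 <= t ^ e" "t ^ e <= t"
    using e(1) t t1 power_decreasing[of 1 2 t] by auto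
  have C2: "C0 * t ^ 2 <= t / 4"
  proof -
    have "C0 * t ^ 2 = t * (4 * C0) * t / 4" by (simp add: power2_eq_square)
    also have "... <= 1 * t / 4" using t by (intro divide_right_mono mult_right_mono) auto
    finally show ?thesis by simp
  qed
  have small: "norm (x', y') < r0" if "cmod x' <= 2 * t" "norm y' <= (C0 + 1) * t ^ e" for x' and y' :: "complex ^ 'm"
  proof -
    have "(C0 + 1) * t ^ e <= (C0 + 1) * t" using te(2) C0 by (intro mult_left_mono) auto
    then have "norm (x', y') <= t * (C0 + 3)" using norm_Pair_le[of x' y'] that by (simp add: algebra_simps)
    then show ?thesis using t(3) by linarith
  qed
  have small2: "norm (x', y') < r0" if "cmod x' <= 2 * t" "norm y' <= (C0 + 1) * t ^ 2" for x' and y' :: "complex ^ 'm"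
  proof (rule small[OF that(1)])
    have "(C0 + 1) * t ^ 2 <= (C0 + 1) * t ^ e" using te(1) C0 by (intro mult_left_mono) auto
    then show "norm y' <= (C0 + 1) * t ^ e" using that(2) by linarith
  qed
  have C0le: "C0 * t ^ 2 <= (C0 + 1) * t ^ 2" by (intro mult_right_mono) auto
  have sum_le: "C0 * t ^ 2 + t ^ e <= (C0 + 1) * t ^ e"
    using mult_left_mono[OF te(1), of C0] C0 by (simp add: algebra_simps)
  have s1: "th1 \<in> strip sg2" "th2 \<in> strip sg2" using th1 th2 cstrip_subset_strip[OF sg] by auto
  have x'le: "cmod x' <= 2 * t" if "cmod (x' - x) <= t / 2" for x'
    using that norm_triangle_sub[of x' x] norm_ge_zero[of x] unfolding t_def by linarith
  have xb: "cmod x' <= 2 * t" if "x' \<in> ball x (t / 2)" for x'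
    using x'le[of x'] that norm_minus_commute[of x x'] by (simp add: dist_norm)
  have y1': "norm y1 <= (C0 + 1) * t ^ 2" using y1 C0le by (simp add: t_def)
  have yb: "norm y' <= (C0 + 1) * t ^ e" if "y' \<in> ball 0 (C0 * t ^ 2 + t ^ e)" for y' :: "complex ^ 'm"
    using that sum_le by (simp only: mem_ball_0)
  have x12: "cmod x2 <= 2 * t" by (rule x'le) (use x2 C2 t in \<open>simp add: t_def[symmetric]\<close>)
  \<comment> \<open>The two points are joined by changing \<open>x\<close>, then \<open>y\<close>,
    then the angle; each of the three moves has its own Cauchy radius.\<close>
  have 1: "cmod (f ((x1, y1), th1) - f ((x2, y1), th1)) <= (A * t ^ k) / (t / 4) * norm (x1 - x2)"
  proof (rule lipschitz_cauchy[where f="%x'. f ((x', y1), th1)" and V="ball x (t / 2)" and S="cball x (t / 4)"])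
    show "(%x'. f ((x', y1), th1)) cholomorphic_on ball x (t / 2)"
    proof (rule chol_compose[OF _ f])
      show "(%x'. ((x', y1), th1)) ` ball x (t / 2) \<subseteq> ball 0 r0 \<times> strip sg2"
        using s1 small2[OF xb y1'] by auto
    qed (intro cholomorphic_intros open_ball)
    show "ball v (t / 4) \<subseteq> ball x (t / 2)" if "v \<in> cball x (t / 4)" for v
    proof
      fix w assume "w \<in> ball v (t / 4)"
      then show "w \<in> ball x (t / 2)" using that dist_triangle[of x w v] by simp
    qed
    show "cmod (f ((v, y1), th1)) <= A * t ^ k" if "v \<in> ball x (t / 2)" for v
      using H1[of v y1 th1] xb[OF that] y1' s1 unfolding t_def by simp
    show "x1 \<in> cball x (t / 4)" "x2 \<in> cball x (t / 4)"
      using x1 x2 C2 by (auto simp: dist_norm norm_minus_commute t_def[symmetric])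
  qed (use t in auto)
  have 2: "cmod (f ((x2, y1), th1) - f ((x2, y2), th1)) <= (A * t ^ k') / (t ^ e) * norm (y1 - y2)"
  proof (rule lipschitz_cauchy[where f="%y'. f ((x2, y'), th1)" and V="ball 0 (C0 * t ^ 2 + t ^ e)" and S="cball 0 (C0 * t ^ 2)"])
    show "(%y'. f ((x2, y'), th1)) cholomorphic_on ball 0 (C0 * t ^ 2 + t ^ e)"
    proof (rule chol_compose[OF _ f])
      show "(%y' :: complex ^ 'm. ((x2, y'), th1)) ` ball 0 (C0 * t ^ 2 + t ^ e) \<subseteq> ball 0 r0 \<times> strip sg2"
      proof (intro image_subsetI SigmaI)
        show "(x2, y') \<in> ball 0 r0" if "y' \<in> ball 0 (C0 * t ^ 2 + t ^ e)" for y' :: "complex ^ 'm"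
          unfolding mem_ball_0 by (rule small[OF x12 yb[OF that]])
      qed (use s1 in auto)
    qed (intro cholomorphic_intros open_ball)
    show "ball v (t ^ e) \<subseteq> ball 0 (C0 * t ^ 2 + t ^ e)" if "v \<in> cball 0 (C0 * t ^ 2)" for v :: "complex ^ 'm"
    proof
      fix w assume "w \<in> ball v (t ^ e)"
      then show "w \<in> ball 0 (C0 * t ^ 2 + t ^ e)" using that dist_triangle[of 0 w v] by simp
    qed
    show "cmod (f ((x2, v), th1)) <= A * t ^ k'" if "v \<in> ball 0 (C0 * t ^ 2 + t ^ e)" for v
      using H2[of x2 v th1] x12 yb[OF that] s1 unfolding t_def by simp
    show "y1 \<in> cball 0 (C0 * t ^ 2)" "y2 \<in> cball 0 (C0 * t ^ 2)" using y1 y2 by (auto simp: t_def)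
  qed (use t in auto)
  have 3: "cmod (f ((x2, y2), th1) - f ((x2, y2), th2)) <= (A * t ^ k) / (sg2 - sg1) * norm (th1 - th2)"
  proof (rule lipschitz_cauchy[where f="%th'. f ((x2, y2), th')" and V="strip sg2" and S="cstrip sg1", OF _ convex_cstrip ball_cstrip_subset _ _ th1 th2])
    have y2': "norm y2 <= (C0 + 1) * t ^ 2" using y2 C0le by (simp add: t_def)
    show "(%th'. f ((x2, y2), th')) cholomorphic_on strip sg2"
    proof (rule chol_compose[OF _ f])
      show "(%th' :: complex ^ 'd. ((x2, y2), th')) ` strip sg2 \<subseteq> ball 0 r0 \<times> strip sg2"
        using small2[OF x12 y2'] by auto
    qed (intro cholomorphic_intros open_strip)
    show "cmod (f ((x2, y2), v)) <= A * t ^ k" if "v \<in> strip sg2" for v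
      using H1[of x2 y2 v] x12 y2' that unfolding t_def by simp
  qed (use sg in auto)
  define K where "K = 4 * A + A / (sg2 - sg1)"
  have KA: "A <= K" "4 * A <= K" "A / (sg2 - sg1) <= K" using A sg by (simp_all add: K_def)
  have "(A * t ^ k) / (t / 4) = 4 * A * t ^ (k - 1)" using k t by (cases k) auto
  also have "... <= K * t ^ (k - 1)" using KA t by (intro mult_right_mono) auto
  finally have b1: "(A * t ^ k) / (t / 4) * norm (x1 - x2) <= K * t ^ (k - 1) * norm (x1 - x2)"
    by (intro mult_right_mono) auto
  have "(A * t ^ k') / (t ^ e) = A * t ^ (k' - e)" using e t by (simp add: power_diff)
  also have "... <= K * t ^ (k' - e)" using KA t by (intro mult_right_mono) auto
  finally have b2: "(A * t ^ k') / (t ^ e) * norm (y1 - y2) <= K * t ^ (k' - e) * norm (y1 - y2)"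
    by (intro mult_right_mono) auto
  have "(A * t ^ k) / (sg2 - sg1) = A / (sg2 - sg1) * t ^ k" by simp
  also have "... <= K * t ^ k" using KA t by (intro mult_right_mono) auto
  finally have b3: "(A * t ^ k) / (sg2 - sg1) * norm (th1 - th2) <= K * t ^ k * norm (th1 - th2)"
    by (intro mult_right_mono) auto
  have eq: "f ((x1, y1), th1) - f ((x2, y2), th2) = (f ((x1, y1), th1) - f ((x2, y1), th1))
      + (f ((x2, y1), th1) - f ((x2, y2), th1)) + (f ((x2, y2), th1) - f ((x2, y2), th2))" by simp
  have "cmod (f ((x1, y1), th1) - f ((x2, y2), th2)) <= cmod (f ((x1, y1), th1) - f ((x2, y1), th1))
      + cmod (f ((x2, y1), th1) - f ((x2, y2), th1)) + cmod (f ((x2, y2), th1) - f ((x2, y2), th2))"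
    by (subst eq) (rule order_trans[OF norm_triangle_ineq add_right_mono[OF norm_triangle_ineq]])
  also have "... <= K * t ^ (k - 1) * norm (x1 - x2) + K * t ^ (k' - e) * norm (y1 - y2) + K * t ^ k * norm (th1 - th2)"
    by (intro add_mono order_trans[OF 1 b1] order_trans[OF 2 b2] order_trans[OF 3 b3])
  finally show ?thesis by (simp add: K_def t_def algebra_simps)
qed

subsection \<open>Homogeneous terms\<close>

lemma homogeneous_cholomorphic:
  fixes f :: "'m::finite xy \<times> ('d::finite, 'p::finite) angle_param => 'b::complex_normed_space"
  assumes f: "homogeneous_poly sg L n f" and L: "open L"
  shows "analytic_fun (UNIV \<times> strip sg \<times> L) f"
proof -
  obtain c where c: "!!j al. analytic_coeff sg L (c j al)"
    and fc: "!!x y th mu. th \<in> strip sg ==> mu \<in> L ==> f ((x, y), th, mu) =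
        (\<Sum>(j, al) | j + (\<Sum>i\<in>UNIV. al i) = n. (x ^ j * (\<Prod>i\<in>UNIV. (y $ i) ^ al i)) *\<^sub>C c j al (th, mu))"
    using f unfolding homogeneous_poly_def by blast
  define D where "D = (UNIV :: 'm xy set) \<times> (strip sg :: (complex ^ 'd) set) \<times> L"
  have D: "open D" unfolding D_def by (intro open_Times open_strip L open_UNIV)
  show ?thesis
    unfolding analytic_fun_def D_def[symmetric]
  proof (intro conjI allI impI ballI)
    show "torus_domain D"
      unfolding torus_domain_def using D by (auto simp: D_def strip_add_lattice_iff)
    show "f (u, th + k, mu) = f (u, th, mu)" if "(u, th, mu) \<in> D" "k \<in> lattice_pts" for u th mu k
    proof -
      have "c j al (th + k, mu) = c j al (th, mu)" for j al
        using c[of j al] that unfolding analytic_coeff_def D_def by blast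
      then show ?thesis using that by (cases u) (simp add: fc D_def strip_add_lattice_iff)
    qed
    have coeff: "(%z. c j al (snd z)) cholomorphic_on D" for j al
      using c[of j al] unfolding analytic_coeff_def
      by (intro chol_compose[of snd _ "c j al" "strip sg \<times> L"] chol_snd chol_ident D)
        (auto simp: D_def)
    have "(%z. \<Sum>(j, al) | j + (\<Sum>i\<in>UNIV. al i) = n.
        (fst (fst z) ^ j * (\<Prod>i\<in>UNIV. (snd (fst z) $ i) ^ al i)) *\<^sub>C c j al (snd z)) cholomorphic_on D"
      unfolding split_def by (intro cholomorphic_intros D coeff)
    then show "f cholomorphic_on D"
      by (rule chol_transform) (auto simp: D_def fc)
  qed
qed

lemma homogeneous_scale:
  fixes f :: "'m::finite xy \<times> ('d::finite, 'p::finite) angle_param => 'b::complex_normed_space"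
  assumes f: "homogeneous_poly sg L n f" and q: "th \<in> strip sg" "mu \<in> L"
  shows "f (t *\<^sub>C u, th, mu) = t ^ n *\<^sub>C f (u, th, mu)"
proof -
  obtain x y where u: "u = (x, y)" by (cases u)
  obtain c where fc: "!!x y th mu. th \<in> strip sg ==> mu \<in> L ==> f ((x, y), th, mu) =
        (\<Sum>(j, al) | j + (\<Sum>i\<in>UNIV. al i) = n. (x ^ j * (\<Prod>i\<in>UNIV. (y $ i) ^ al i)) *\<^sub>C c j al (th, mu))"
    using f unfolding homogeneous_poly_def by blast
  have "(t * x) ^ j * (\<Prod>i\<in>UNIV. (t * y $ i) ^ al i) = t ^ n * (x ^ j * (\<Prod>i\<in>UNIV. (y $ i) ^ al i))"
    if "j + (\<Sum>i\<in>UNIV. al i) = n" for j and al :: "'m => nat"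
  proof -
    have "t ^ n = t ^ j * (\<Prod>i\<in>UNIV. t ^ al i)" unfolding that[symmetric] power_add power_sum ..
    then show ?thesis by (simp add: power_mult_distrib prod.distrib)
  qed
  then show ?thesis
    unfolding u scaleC_prod_def using q
    by (auto simp: fc scaleC_vec_def scaleC_complex_def scaleC.sum_right scaleC_scaleC intro!: sum.cong)
qed

lemma homogeneous_bound:
  fixes f :: "'m::finite xy \<times> ('d::finite, 'p::finite) angle_param => 'b::complex_normed_space"
  assumes f: "homogeneous_poly sg0 LC n f" and LC: "open LC" and sg: "sg < sg0" and L: "compact L" "L \<subseteq> LC"
  shows "\<exists>M>0. \<forall>u. \<forall>th\<in>cstrip sg. \<forall>mu\<in>L. norm (f (u, th, mu)) <= M * norm u ^ n"
proof -
  have sub: "cball (0 :: 'm xy) 1 \<times> cstrip sg \<times> L \<subseteq> UNIV \<times> strip sg0 \<times> LC"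
    using cstrip_subset_strip[OF sg] L(2) by blast
  obtain M where M: "M > 0" "\<forall>z\<in>cball 0 1 \<times> cstrip sg \<times> L. norm (f z) <= M"
    using periodic_bounded[OF homogeneous_cholomorphic[OF f LC] sub L(1)] by blast
  have "norm (f (u, th, mu)) <= M * norm u ^ n" if q: "th \<in> cstrip sg" "mu \<in> L" for u th mu
  proof (cases "u = 0")
    case False
    have q': "th \<in> strip sg0" "mu \<in> LC" using q cstrip_subset_strip[OF sg] L(2) by auto
    define v where "v = complex_of_real (1 / norm u) *\<^sub>C u"
    have v: "norm v <= 1" using False by (simp add: v_def norm_scaleC del: of_real_divide)
    have u: "u = complex_of_real (norm u) *\<^sub>C v"
      using False by (simp add: v_def scaleC_scaleC)
    have "norm (f (u, th, mu)) = norm u ^ n * norm (f (v, th, mu))"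
      by (subst u) (simp add: homogeneous_scale[OF f q'] norm_scaleC norm_power)
    also have "... <= norm u ^ n * M" using M(2) v q by (intro mult_left_mono) auto
    finally show ?thesis by (simp add: mult.commute)
  next
    case True
    have q': "th \<in> strip sg0" "mu \<in> LC" using q cstrip_subset_strip[OF sg] L(2) by auto
    have z: "(0 :: complex) *\<^sub>C (0 :: 'm xy) = 0" by (simp add: scaleC.zero_left)
    show ?thesis
    proof (cases "n = 0")
      case True
      have "(0, th, mu) \<in> cball (0 :: 'm xy) 1 \<times> cstrip sg \<times> L" using q by simp
      then show ?thesis using M(2) \<open>u = 0\<close> True by simp
    next
      case False
      then have "f (0, th, mu) = 0"
        using homogeneous_scale[OF f q', of 0 0] by (simp add: z power_0_left scaleC.zero_left)
      then show ?thesis using \<open>u = 0\<close> M(1) by simp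
    qed
  qed
  then show ?thesis using M(1) by blast
qed

text \<open>Vanishing at \<open>y = 0\<close>, for \<open>j = 1\<close> together with the first
  derivative, is a zero of order \<open>j + 1\<close> on the line \<open>ze y\<close>, so the
  Schwarz lemma contributes that many factors \<open>norm y / R\<close>.\<close>

lemma y_derivative_bound:
  fixes f :: "'m::finite xy \<times> ('d::finite, 'p::finite) angle_param => complex"
  assumes f: "homogeneous_poly sg0 LC n f" and LC: "open LC" and q: "th \<in> strip sg0" "mu \<in> LC"
    and M: "!!u. norm (f (u, th, mu)) <= M * norm u ^ n"
    and f0: "f ((x, 0), th, mu) = 0"
    and j: "j = 0 \<or> j = 1 & ((%y. f ((x, y), th, mu)) has_derivative (%_. 0)) (at 0)"
    and x: "norm y <= R" "cmod x <= R" "0 < R" and M0: "0 <= M"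
  shows "cmod (f ((x, y), th, mu)) <= M * (4 * R) ^ n * (norm y / R) ^ Suc j"
proof -
  define g where "g ze = f ((x, ze *\<^sub>C y), th, mu)" for ze
  show ?thesis
  proof (cases "y = 0")
    case True
    then show ?thesis using f0 by simp
  next
    case False
    \<comment> \<open>On this disc \<open>ze y\<close> has norm at most \<open>2 * R\<close>, and
      since the radius exceeds 1 the estimate may be evaluated at \<open>ze = 1\<close>.\<close>
    define rh where "rh = 2 * R / norm y"
    have rh: "1 < rh" using x False by (simp add: rh_def)
    have fy: "(%y. f ((x, y), th, mu)) cholomorphic_on UNIV"
      using homogeneous_cholomorphic[OF f LC] q unfolding analytic_fun_def
      by (intro chol_compose[of "%y. ((x, y), th, mu)" _ f "UNIV \<times> strip sg0 \<times> LC"] cholomorphic_intros) auto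
    have hol: "g holomorphic_on ball 0 rh"
      unfolding g_def using cholomorphic_slice[OF fy, of 0 y] by (auto intro: holomorphic_on_subset)
    have bd: "cmod (g ze) <= M * (4 * R) ^ n" if ze: "cmod ze < rh" for ze
    proof -
      have "cmod ze * norm y <= rh * norm y" using ze by (intro mult_right_mono) auto
      then have "norm (ze *\<^sub>C y) <= 2 * R" using False by (simp add: norm_scaleC rh_def)
      then have "norm (x, ze *\<^sub>C y) <= 4 * R" using norm_Pair_le[of x "ze *\<^sub>C y"] x by linarith
      then have "M * norm (x, ze *\<^sub>C y) ^ n <= M * (4 * R) ^ n" using M0 by (intro mult_left_mono power_mono) auto
      then show ?thesis unfolding g_def using M order_trans by blast
    qed
    have g0: "g 0 = 0" by (simp add: g_def scaleC.zero_left f0)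
    have lim: "((%ze. g ze / ze ^ j) \<longlongrightarrow> 0) (at 0)"
      using j
    proof
      assume "j = 0"
      have "isCont g 0"
        using hol rh by (intro continuous_on_interior[OF holomorphic_on_imp_continuous_on]) auto
      then show ?thesis using g0 \<open>j = 0\<close> by (simp add: isCont_def)
    next
      assume j: "j = 1 & ((%y. f ((x, y), th, mu)) has_derivative (%_. 0)) (at 0)"
      then have "has_cderivative (%y. f ((x, y), th, mu)) (%_. 0) 0"
        by (simp add: has_cderivative_def scaleC.zero_right)
      from has_cderivative_slice[OF this, of y] have "(g has_field_derivative 0) (at 0)"
        by (simp add: g_def[abs_def])
      then show ?thesis using j g0 by (simp add: DERIV_def)
    qed
    have "cmod (g 1) <= M * (4 * R) ^ n * (cmod 1 / rh) ^ Suc j"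
      by (rule schwarz_order[OF hol bd lim]) (use rh in auto)
    also have "... <= M * (4 * R) ^ n * (norm y / R) ^ Suc j"
    proof (intro mult_left_mono power_mono)
      show "cmod 1 / rh <= norm y / R" using x False by (simp add: rh_def field_simps)
    qed (use M0 x rh in auto)
    finally show ?thesis by (simp add: g_def)
  qed
qed

lemma remainder_bound:
  fixes f :: "'m::finite xy \<times> ('d::finite, 'p::finite) angle_param => complex"
  assumes f: "analytic_fun W f" and van: "!!th mu. th \<in> cstrip sg ==> mu \<in> L ==> vanishes_to_order n f (th, mu)"
    and sub: "cball 0 r \<times> cstrip sg \<times> L \<subseteq> W" and L: "compact L" and r: "r > 0"
  shows "\<exists>M>0. \<forall>u. norm u < r --> (\<forall>th\<in>cstrip sg. \<forall>mu\<in>L. cmod (f (u, th, mu)) <= M * norm u ^ Suc n)"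
proof -
  obtain M where M: "M > 0" "\<forall>z\<in>cball 0 r \<times> cstrip sg \<times> L. cmod (f z) <= M"
    using periodic_bounded[OF f sub L] by blast
  have "cmod (f (u, th, mu)) <= M / r ^ Suc n * norm u ^ Suc n"
    if u: "norm u < r" and q: "th \<in> cstrip sg" "mu \<in> L" for u th mu
  proof -
    have "cmod (f (u, (th, mu))) <= M * (norm u / r) ^ Suc n"
    proof (rule vanishing_bound[OF _ _ van[OF q] u])
      show "(%u. f (u, (th, mu))) cholomorphic_on ball 0 r"
        using f sub q unfolding analytic_fun_def
        by (intro chol_compose[of "%u. (u, th, mu)" _ f W] cholomorphic_intros open_ball) auto
      show "cmod (f (u, (th, mu))) <= M" if "norm u < r" for u
        using M(2) that q by auto
    qed
    then show ?thesis by (simp add: power_divide)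
  qed
  moreover have "M / r ^ Suc n > 0" using M(1) r by simp
  ultimately show ?thesis by blast
qed

section \<open>Lipschitz constants along thin neighbourhoods of the curve\<close>

definition thin :: "real => complex => 'm::finite xy => bool"
  where "thin C x u \<longleftrightarrow> cmod (fst u - x) <= C * cmod x ^ 2 & norm (snd u) <= C * cmod x ^ 2"

text \<open>The three exponents are the powers of \<open>|x|\<close> in the Lipschitz constants with
  respect to \<open>x\<close>, \<open>y\<close> and the angle, at points within order
  \<open>|x| ^ 2\<close> of \<open>(x, 0)\<close>.\<close>

definition thin_lipschitz ::
  "real => (complex ^ 'p) set => real => nat => nat => nat =>
   ('m::finite xy \<times> ('d::finite, 'p::finite) angle_param => 'b::real_normed_vector) => bool"
  where "thin_lipschitz sg L C k1 k2 k3 f \<longleftrightarrow> (\<exists>K x0. K > 0 & x0 > 0 & (\<forall>x u1 u2 th1 th2 mu.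
    0 < cmod x --> cmod x < x0 --> thin C x u1 --> thin C x u2 --> th1 \<in> cstrip sg --> th2 \<in> cstrip sg --> mu \<in> L -->
    norm (f (u1, th1, mu) - f (u2, th2, mu)) <= K * (cmod x ^ k1 * cmod (fst u1 - fst u2) +
      cmod x ^ k2 * norm (snd u1 - snd u2) + cmod x ^ k3 * norm (th1 - th2))))"

lemma thin_lipschitz_add:
  fixes f g :: "'m::finite xy \<times> ('d::finite, 'p::finite) angle_param => 'b::real_normed_vector"
  assumes "thin_lipschitz sg L C k1 k2 k3 f" "thin_lipschitz sg L C k1 k2 k3 g"
  shows "thin_lipschitz sg L C k1 k2 k3 (%z. f z + g z)"
proof -
  let ?R = "%x (u1 :: 'm xy) (u2 :: 'm xy) (th1 :: complex ^ 'd) th2. cmod x ^ k1 * cmod (fst u1 - fst u2) + cmod x ^ k2 * norm (snd u1 - snd u2) + cmod x ^ k3 * norm (th1 - th2)"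
  obtain K x0 where f: "K > 0" "x0 > 0" "!!x u1 u2 th1 th2 mu. 0 < cmod x ==> cmod x < x0 ==> thin C x u1 ==> thin C x u2 ==>
      th1 \<in> cstrip sg ==> th2 \<in> cstrip sg ==> mu \<in> L ==> norm (f (u1, th1, mu) - f (u2, th2, mu)) <= K * ?R x u1 u2 th1 th2"
    using assms(1) unfolding thin_lipschitz_def by auto
  obtain K' x0' where g: "K' > 0" "x0' > 0" "!!x u1 u2 th1 th2 mu. 0 < cmod x ==> cmod x < x0' ==> thin C x u1 ==> thin C x u2 ==>
      th1 \<in> cstrip sg ==> th2 \<in> cstrip sg ==> mu \<in> L ==> norm (g (u1, th1, mu) - g (u2, th2, mu)) <= K' * ?R x u1 u2 th1 th2"
    using assms(2) unfolding thin_lipschitz_def by auto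
  show ?thesis
    unfolding thin_lipschitz_def
  proof (rule exI[of _ "K + K'"], rule exI[of _ "min x0 x0'"], intro conjI allI impI)
    fix x :: complex and u1 u2 :: "'m xy" and th1 th2 :: "complex ^ 'd" and mu :: "complex ^ 'p"
    assume *: "0 < cmod x" "cmod x < min x0 x0'" "thin C x u1" "thin C x u2" "th1 \<in> cstrip sg" "th2 \<in> cstrip sg" "mu \<in> L"
    have "norm (f (u1, th1, mu) + g (u1, th1, mu) - (f (u2, th2, mu) + g (u2, th2, mu)))
      <= norm (f (u1, th1, mu) - f (u2, th2, mu)) + norm (g (u1, th1, mu) - g (u2, th2, mu))"
      by (rule norm_diff_triangle_ineq)
    also have "... <= K * ?R x u1 u2 th1 th2 + K' * ?R x u1 u2 th1 th2"
      using * by (intro add_mono f g) auto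
    finally show "norm (f (u1, th1, mu) + g (u1, th1, mu) - (f (u2, th2, mu) + g (u2, th2, mu))) <= (K + K') * ?R x u1 u2 th1 th2"
      by (simp only: distrib_right)
  qed (use f g in auto)
qed

lemma thin_lipschitz_weaken:
  fixes f :: "'m::finite xy \<times> ('d::finite, 'p::finite) angle_param => 'b::real_normed_vector"
  assumes "thin_lipschitz sg L C k1 k2 k3 f" and k: "k1' <= k1" "k2' <= k2" "k3' <= k3"
  shows "thin_lipschitz sg L C k1' k2' k3' f"
proof -
  obtain K x0 where f: "K > 0" "x0 > 0" "!!x u1 u2 th1 th2 mu. 0 < cmod x ==> cmod x < x0 ==> thin C x u1 ==> thin C x u2 ==>
      th1 \<in> cstrip sg ==> th2 \<in> cstrip sg ==> mu \<in> L ==> norm (f (u1, th1, mu) - f (u2, th2, mu)) \<le>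
      K * (cmod x ^ k1 * cmod (fst u1 - fst u2) + cmod x ^ k2 * norm (snd u1 - snd u2) + cmod x ^ k3 * norm (th1 - th2))"
    using assms(1) unfolding thin_lipschitz_def by auto
  show ?thesis
    unfolding thin_lipschitz_def
  proof (rule exI[of _ K], rule exI[of _ "min x0 1"], intro conjI allI impI)
    fix x :: complex and u1 u2 :: "'m xy" and th1 th2 :: "complex ^ 'd" and mu :: "complex ^ 'p"
    assume *: "0 < cmod x" "cmod x < min x0 1" "thin C x u1" "thin C x u2" "th1 \<in> cstrip sg" "th2 \<in> cstrip sg" "mu \<in> L"
    have pw: "cmod x ^ k <= cmod x ^ k'" if "k' <= k" for k k'
      using *(1,2) that by (intro power_decreasing) auto
    have "norm (f (u1, th1, mu) - f (u2, th2, mu)) \<le>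
      K * (cmod x ^ k1 * cmod (fst u1 - fst u2) + cmod x ^ k2 * norm (snd u1 - snd u2) + cmod x ^ k3 * norm (th1 - th2))"
      using * by (intro f) auto
    also have "... <= K * (cmod x ^ k1' * cmod (fst u1 - fst u2) + cmod x ^ k2' * norm (snd u1 - snd u2) + cmod x ^ k3' * norm (th1 - th2))"
      using f(1) by (intro mult_left_mono add_mono mult_right_mono pw k) auto
    finally show "norm (f (u1, th1, mu) - f (u2, th2, mu)) \<le>
      K * (cmod x ^ k1' * cmod (fst u1 - fst u2) + cmod x ^ k2' * norm (snd u1 - snd u2) + cmod x ^ k3' * norm (th1 - th2))" .
  qed (use f in auto)
qed

lemma thin_lipschitz_vec:
  fixes f :: "'m::finite xy \<times> ('d::finite, 'p::finite) angle_param => 'b::real_normed_vector ^ 'n"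
  assumes "!!i. thin_lipschitz sg L C k1 k2 k3 (%z. f z $ i)"
  shows "thin_lipschitz sg L C k1 k2 k3 f"
proof -
  let ?R = "%x (u1 :: 'm xy) (u2 :: 'm xy) (th1 :: complex ^ 'd) th2. cmod x ^ k1 * cmod (fst u1 - fst u2) + cmod x ^ k2 * norm (snd u1 - snd u2) + cmod x ^ k3 * norm (th1 - th2)"
  have "\<forall>i. \<exists>K x0. K > 0 & x0 > 0 & (\<forall>x u1 u2 th1 th2 mu.
    0 < cmod x --> cmod x < x0 --> thin C x u1 --> thin C x u2 --> th1 \<in> cstrip sg --> th2 \<in> cstrip sg --> mu \<in> L -->
    norm (f (u1, th1, mu) $ i - f (u2, th2, mu) $ i) <= K * ?R x u1 u2 th1 th2)"
    using assms unfolding thin_lipschitz_def by blast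
  then obtain K x0 where f: "!!i. K i > 0" "!!i. x0 i > 0" "!!i x u1 u2 th1 th2 mu. 0 < cmod x ==> cmod x < x0 i ==> thin C x u1 ==> thin C x u2 ==>
      th1 \<in> cstrip sg ==> th2 \<in> cstrip sg ==> mu \<in> L ==> norm (f (u1, th1, mu) $ i - f (u2, th2, mu) $ i) <= K i * ?R x u1 u2 th1 th2"
    unfolding choice_iff by blast
  define X where "X = Min (range x0)"
  have X: "X > 0" "X <= x0 i" for i using f(2) by (simp_all add: X_def)
  show ?thesis
    unfolding thin_lipschitz_def
  proof (rule exI[of _ "\<Sum>i\<in>UNIV. K i"], rule exI[of _ X], intro conjI allI impI)
    fix x :: complex and u1 u2 :: "'m xy" and th1 th2 :: "complex ^ 'd" and mu :: "complex ^ 'p"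
    assume *: "0 < cmod x" "cmod x < X" "thin C x u1" "thin C x u2" "th1 \<in> cstrip sg" "th2 \<in> cstrip sg" "mu \<in> L"
    have "norm (f (u1, th1, mu) - f (u2, th2, mu)) <= (\<Sum>i\<in>UNIV. norm ((f (u1, th1, mu) - f (u2, th2, mu)) $ i))"
      by (rule norm_vec_le_sum)
    also have "... <= (\<Sum>i\<in>UNIV. K i * ?R x u1 u2 th1 th2)"
    proof (rule sum_mono)
      fix i
      have "cmod x < x0 i" using *(2) X(2)[of i] by linarith
      then show "norm ((f (u1, th1, mu) - f (u2, th2, mu)) $ i) <= K i * ?R x u1 u2 th1 th2"
        using f(3)[OF *(1) _ *(3-7)] by simp
    qed
    finally show "norm (f (u1, th1, mu) - f (u2, th2, mu)) <= (\<Sum>i\<in>UNIV. K i) * ?R x u1 u2 th1 th2"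
      by (simp only: sum_distrib_right)
  qed (use f X in \<open>auto intro!: sum_pos\<close>)
qed

text \<open>\<open>K e\<close> is the exponent of the supremum over \<open>y\<close> of size
  \<open>|x| ^ e\<close>. Increments in \<open>x\<close> and in the angle use the thinner disc,
  hence \<open>k = K 2\<close>; increments in \<open>y\<close> use the disc selected by
  \<open>e\<close>, hence \<open>k' = K e\<close>.\<close>

lemma thin_lipschitzI:
  fixes f :: "'m::finite xy \<times> ('d::finite, 'p::finite) angle_param => complex"
  assumes chol: "!!mu. mu \<in> L ==> (%(u, th). f (u, th, mu)) cholomorphic_on ball 0 r0 \<times> strip sg2"
    and sg: "sg1 < sg2" and A: "0 < A" and e: "e = 1 \<or> e = 2" "e <= k'" and k: "1 <= k" and C0: "1 <= C0" and r0: "0 < r0"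
    and H: "!!x x' y' th' mu e. 0 < cmod x ==> cmod x <= 1 ==> cmod x * (C0 + 3) < r0 ==> e = 1 \<or> e = 2 ==>
      cmod x' <= 2 * cmod x ==> norm y' <= (C0 + 1) * cmod x ^ e ==> th' \<in> cstrip sg2 ==> mu \<in> L ==>
      cmod (f ((x', y'), th', mu)) <= A * cmod x ^ K e"
    and K: "K 2 = k" "K e = k'"
  shows "thin_lipschitz sg1 L C0 (k - 1) (k' - e) k f"
  unfolding thin_lipschitz_def
proof (rule exI[of _ "4 * A + A / (sg2 - sg1)"], rule exI[of _ "min 1 (min (1 / (4 * C0)) (r0 / (C0 + 3)))"], intro conjI allI impI)
  fix x :: complex and u1 u2 :: "'m xy" and th1 th2 :: "complex ^ 'd" and mu :: "complex ^ 'p"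
  assume *: "0 < cmod x" "cmod x < min 1 (min (1 / (4 * C0)) (r0 / (C0 + 3)))" "thin C0 x u1" "thin C0 x u2"
    "th1 \<in> cstrip sg1" "th2 \<in> cstrip sg1" "mu \<in> L"
  have x: "cmod x <= 1" "cmod x * (4 * C0) <= 1" "cmod x * (C0 + 3) < r0"
    using *(2) C0 by (simp_all add: pos_less_divide_eq less_imp_le)
  have u: "u1 = (fst u1, snd u1)" "u2 = (fst u2, snd u2)" by simp_all
  have "cmod ((%(u, th). f (u, th, mu)) ((fst u1, snd u1), th1) - (%(u, th). f (u, th, mu)) ((fst u2, snd u2), th2)) \<le>
    (4 * A + A / (sg2 - sg1)) * (cmod x ^ (k - 1) * cmod (fst u1 - fst u2) + cmod x ^ (k' - e) * norm (snd u1 - snd u2) + cmod x ^ k * norm (th1 - th2))"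
  proof (rule thin_polydisc_lipschitz[OF chol[OF *(7)] sg _ e k C0 *(1) x(2,3)])
    show "cmod ((%(u, th). f (u, th, mu)) ((x', y'), th')) <= A * cmod x ^ k"
      if "cmod x' <= 2 * cmod x" "norm y' <= (C0 + 1) * cmod x ^ 2" "th' \<in> strip sg2" for x' y' th'
      using H[of x 2 x' y' th' mu] *(1,7) x that K subsetD[OF strip_subset_cstrip that(3)] by simp
    show "cmod ((%(u, th). f (u, th, mu)) ((x', y'), th')) <= A * cmod x ^ k'"
      if "cmod x' <= 2 * cmod x" "norm y' <= (C0 + 1) * cmod x ^ e" "th' \<in> strip sg2" for x' y' th'
      using H[of x e x' y' th' mu] *(1,7) x that K e(1) subsetD[OF strip_subset_cstrip that(3)] by simp
  qed (use * A in \<open>auto simp: thin_def\<close>)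
  then show "norm (f (u1, th1, mu) - f (u2, th2, mu)) \<le>
    (4 * A + A / (sg2 - sg1)) * (cmod x ^ (k - 1) * cmod (fst u1 - fst u2) + cmod x ^ (k' - e) * norm (snd u1 - snd u2) + cmod x ^ k * norm (th1 - th2))"
    by simp
next
  show "0 < 4 * A + A / (sg2 - sg1)" using A sg by (intro add_pos_pos) auto
  show "0 < min 1 (min (1 / (4 * C0)) (r0 / (C0 + 3)))" using C0 r0 by simp
qed

lemma thin_point_bound:
  assumes "0 < cmod x" "cmod x <= 1" "e = 1 \<or> e = (2::nat)" "cmod x' <= 2 * cmod x"
    "norm y' <= (C0 + 1) * cmod x ^ e" "1 <= C0"
  shows "norm y' <= (C0 + 3) * cmod x" "cmod x' <= (C0 + 3) * cmod x"
    "norm y' / ((C0 + 3) * cmod x) <= cmod x ^ (e - 1)" "norm (x', y') <= (C0 + 3) * cmod x"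
proof -
  have e1: "cmod x ^ e = cmod x * cmod x ^ (e - 1)" using assms(3) by (auto simp: power2_eq_square)
  have "cmod x ^ (e - 1) <= 1" using assms(1,2) by (intro power_le_one) auto
  then have le: "cmod x ^ e <= cmod x" using e1 assms(1) by (simp add: mult_left_le)
  have y: "norm y' <= (C0 + 1) * cmod x"
    using assms(5) mult_left_mono[OF le, of "C0 + 1"] assms(6) by linarith
  show "norm (x', y') <= (C0 + 3) * cmod x"
    using norm_Pair_le[of x' y'] y assms(4) by (simp add: algebra_simps)
  then show "norm y' <= (C0 + 3) * cmod x" "cmod x' <= (C0 + 3) * cmod x"
    using norm_snd_le_norm[of "(x', y')"] norm_fst_le_norm[of "(x', y')"] by auto
  have "norm y' <= (C0 + 3) * cmod x ^ e"
    using assms(5) mult_right_mono[of "C0 + 1" "C0 + 3" "cmod x ^ e"] zero_le_power[OF norm_ge_zero[of x], of e] by linarith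
  then show "norm y' / ((C0 + 3) * cmod x) <= cmod x ^ (e - 1)"
    using assms(1,6) by (simp add: e1 pos_divide_le_eq mult_ac)
qed

lemma slice_cholomorphic:
  assumes f: "analytic_fun W f" and sub: "ball 0 r \<times> strip sg \<times> {mu} \<subseteq> W"
  shows "(%(u, th). f (u, th, mu)) cholomorphic_on ball 0 r \<times> strip sg"
  unfolding split_def using f sub unfolding analytic_fun_def
  by (intro chol_compose[of "%p. (fst p, snd p, mu)" _ f W] cholomorphic_intros open_Times open_ball open_strip) auto

text \<open>\<open>j\<close> counts the order of vanishing in \<open>y\<close> at
  \<open>y = 0\<close>. Each such order replaces one factor of size \<open>|x|\<close> by one of
  size \<open>|x| ^ e\<close>, which accounts for \<open>n + j * (e - 1)\<close> in the
  supremum.\<close>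

lemma homogeneous_thin_lipschitz:
  fixes f :: "'m::finite xy \<times> ('d::finite, 'p::finite) angle_param => complex"
  assumes f: "homogeneous_poly sg0 LC n f" and LC: "open LC" and sg: "sg1 < sg0" and L: "compact L" "L \<subseteq> LC"
    and C0: "1 <= C0" and n: "1 <= n"
    and j: "j = 0 \<or> (\<forall>x. \<forall>th\<in>strip sg0. \<forall>mu\<in>LC. f ((x, 0), th, mu) = 0)"
      "j <= 1 \<or> j = 2 & (\<forall>x. \<forall>th\<in>strip sg0. \<forall>mu\<in>LC. ((%y. f ((x, y), th, mu)) has_derivative (%_. 0)) (at 0))"
    and e: "e = 1 \<or> e = 2" "e <= n + j * (e - 1)"
  shows "thin_lipschitz sg1 L C0 (n + j - 1) (n + j * (e - 1) - e) (n + j) f"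
proof -
  define sg2 where "sg2 = (sg1 + sg0) / 2"
  have sg2: "sg1 < sg2" "sg2 < sg0" using sg by (simp_all add: sg2_def)
  obtain M where M: "M > 0" "\<forall>u. \<forall>th\<in>cstrip sg2. \<forall>mu\<in>L. cmod (f (u, th, mu)) <= M * norm u ^ n"
    using homogeneous_bound[OF f LC sg2(2) L] by blast
  show ?thesis
  proof (rule thin_lipschitzI[where A="M * (4 * (C0 + 3)) ^ n" and ?r0.0=1 and ?sg2.0=sg2 and K="%e. n + j * (e - 1)"])
    show "(%(u, th). f (u, th, mu)) cholomorphic_on ball 0 1 \<times> strip sg2" if "mu \<in> L" for mu
      using that L(2) sg2(2)
      by (intro slice_cholomorphic[OF homogeneous_cholomorphic[OF f LC]]) (auto simp: strip_def intro: order.strict_trans)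
    fix x x' :: complex and y' :: "complex ^ 'm" and th' :: "complex ^ 'd" and mu :: "complex ^ 'p" and e :: nat
    assume *: "0 < cmod x" "cmod x <= 1" "e = 1 \<or> e = 2" "cmod x' <= 2 * cmod x" "norm y' <= (C0 + 1) * cmod x ^ e"
      and q: "th' \<in> cstrip sg2" "mu \<in> L"
    note tp = thin_point_bound[OF * C0]
    define R where "R = (C0 + 3) * cmod x"
    have R: "0 < R" using C0 *(1) by (simp add: R_def)
    have q': "th' \<in> strip sg0" "mu \<in> LC" using q cstrip_subset_strip[OF sg2(2)] L(2) by auto
    have "cmod (f ((x', y'), th', mu)) <= M * (4 * R) ^ n * (norm y' / R) ^ j"
    proof (cases j)
      case 0
      have "cmod (f ((x', y'), th', mu)) <= M * norm (x', y') ^ n" using M(2) q by blast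
      also have "... <= M * (4 * R) ^ n"
        using tp(4) R M(1) by (intro mult_left_mono power_mono) (auto simp: R_def[symmetric])
      finally show ?thesis using 0 by simp
    next
      case (Suc i)
      show ?thesis
        unfolding Suc
      proof (rule y_derivative_bound[OF f LC q'])
        show "cmod (f (u, th', mu)) <= M * norm u ^ n" for u using M(2) q by blast
        show "f ((x', 0), th', mu) = 0" using j(1) q' Suc by auto
        show "i = 0 \<or> i = 1 & ((%y. f ((x', y), th', mu)) has_derivative (%_. 0)) (at 0)"
          using j(2) q' Suc by auto
      qed (use tp R M in \<open>auto simp: R_def\<close>)
    qed
    also have "... <= M * (4 * R) ^ n * (cmod x ^ (e - 1)) ^ j"
      using tp(3) R M(1) by (intro mult_left_mono power_mono) (auto simp: R_def)
    also have "... = M * (4 * (C0 + 3)) ^ n * cmod x ^ (n + j * (e - 1))"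
      by (simp add: R_def power_mult_distrib power_add power_mult[symmetric] mult_ac)
    finally show "cmod (f ((x', y'), th', mu)) <= M * (4 * (C0 + 3)) ^ n * cmod x ^ (n + j * (e - 1))" .
  qed (use M C0 sg2 n e in auto)
qed

text \<open>The remainder is of size \<open>|x| ^ (n + 1)\<close> on both polydiscs, so the larger
  one, \<open>e = 1\<close>, gives the better exponent in \<open>y\<close>.\<close>

lemma remainder_thin_lipschitz:
  fixes f :: "'m::finite xy \<times> ('d::finite, 'p::finite) angle_param => complex"
  assumes f: "analytic_fun W f" and van: "!!th mu. th \<in> strip sg0 ==> mu \<in> L ==> vanishes_to_order n f (th, mu)"
    and W: "torus_domain W" "{0} \<times> strip sg0 \<times> L \<subseteq> W" and sg: "sg1 < sg0" and L: "compact L" and C0: "1 <= C0"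
  shows "thin_lipschitz sg1 L C0 n n (Suc n) f"
proof -
  define sg2 where "sg2 = (sg1 + sg0) / 2"
  have sg2: "sg1 < sg2" "sg2 < sg0" using sg by (simp_all add: sg2_def)
  have "{0} \<times> cstrip sg2 \<times> L \<subseteq> W" using W(2) cstrip_subset_strip[OF sg2(2)] by blast
  then obtain r where r: "r > 0" "cball 0 r \<times> cstrip sg2 \<times> L \<subseteq> W"
    using tube_subset[OF W(1) _ L] by blast
  have "!!th mu. th \<in> cstrip sg2 ==> mu \<in> L ==> vanishes_to_order n f (th, mu)"
    using van cstrip_subset_strip[OF sg2(2)] by blast
  from remainder_bound[OF f this r(2) L r(1)]
  obtain M where M: "M > 0" "\<forall>u. norm u < r --> (\<forall>th\<in>cstrip sg2. \<forall>mu\<in>L. cmod (f (u, th, mu)) <= M * norm u ^ Suc n)"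
    by blast
  have "thin_lipschitz sg1 L C0 (Suc n - 1) (Suc n - 1) (Suc n) f"
  proof (rule thin_lipschitzI[where A="M * (C0 + 3) ^ Suc n" and ?r0.0=r and ?sg2.0=sg2 and K="%e. Suc n" and e=1])
    show "(%(u, th). f (u, th, mu)) cholomorphic_on ball 0 r \<times> strip sg2" if "mu \<in> L" for mu
    proof (rule slice_cholomorphic[OF f])
      show "ball 0 r \<times> strip sg2 \<times> {mu} \<subseteq> W"
        using r(2) that ball_subset_cball[of 0 r] strip_subset_cstrip[of sg2] by blast
    qed
    fix x x' :: complex and y' :: "complex ^ 'm" and th' :: "complex ^ 'd" and mu :: "complex ^ 'p" and e :: nat
    assume *: "0 < cmod x" "cmod x <= 1" "e = 1 \<or> e = 2" "cmod x' <= 2 * cmod x" "norm y' <= (C0 + 1) * cmod x ^ e"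
      and x: "cmod x * (C0 + 3) < r" and q: "th' \<in> cstrip sg2" "mu \<in> L"
    note tp = thin_point_bound[OF * C0]
    have "norm (x', y') < r" using tp(4) x by (simp add: mult.commute)
    then have "cmod (f ((x', y'), th', mu)) <= M * norm (x', y') ^ Suc n" using M(2) q by blast
    also have "... <= M * ((C0 + 3) * cmod x) ^ Suc n"
      using tp(4) M(1) by (intro mult_left_mono power_mono) auto
    also have "... = M * (C0 + 3) ^ Suc n * cmod x ^ Suc n" by (simp only: power_mult_distrib mult.assoc)
    finally show "cmod (f ((x', y'), th', mu)) <= M * (C0 + 3) ^ Suc n * cmod x ^ Suc n" .
  qed (use M C0 sg2 r in auto)
  then show ?thesis by simp
qed

lemma homogeneous_nth:
  fixes f :: "'m::finite xy \<times> ('d::finite, 'p::finite) angle_param => complex ^ 'n"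
  assumes "homogeneous_poly sg L n f"
  shows "homogeneous_poly sg L n (%z. f z $ i)"
proof -
  obtain c where c: "!!j al. analytic_coeff sg L (c j al)"
    and fc: "!!x y th mu. th \<in> strip sg ==> mu \<in> L ==> f ((x, y), th, mu) =
        (\<Sum>(j, al) | j + (\<Sum>i\<in>UNIV. al i) = n. (x ^ j * (\<Prod>i\<in>UNIV. (y $ i) ^ al i)) *\<^sub>C c j al (th, mu))"
    using assms unfolding homogeneous_poly_def by blast
  show ?thesis
    unfolding homogeneous_poly_def
  proof (intro exI[of _ "%j al q. c j al q $ i"] conjI allI ballI)
    show "analytic_coeff sg L (%q. c j al q $ i)" for j al
      using c[of j al] unfolding analytic_coeff_def by (auto intro: chol_vec_nth)
    show "f ((x, y), th, mu) $ i = (\<Sum>(j, al) | j + (\<Sum>i\<in>UNIV. al i) = n.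
        (x ^ j * (\<Prod>i\<in>UNIV. (y $ i) ^ al i)) *\<^sub>C c j al (th, mu) $ i)"
      if "th \<in> strip sg" "mu \<in> L" for x y th mu
      unfolding fc[OF that] by (simp add: split_def scaleC_vec_def)
  qed
qed

lemma analytic_fun_nth:
  fixes f :: "_ => complex ^ 'n"
  shows "analytic_fun W f ==> analytic_fun W (%z. f z $ i)"
  unfolding analytic_fun_def by (auto intro: chol_vec_nth)

subsection \<open>Increments of the map\<close>

text \<open>Mean value inequality for \<open>z ^ N - N x ^ (N - 1) z\<close>, whose derivative is of
  order \<open>|x| ^ N\<close> within distance \<open>C * |x| ^ 2\<close> of
  \<open>x\<close>.\<close>

lemma power_increment:
  fixes x x1 x2 :: complex
  assumes N: "N >= 2" and C: "0 <= C" "C * cmod x <= 1"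
    and x1: "cmod (x1 - x) <= C * cmod x ^ 2" and x2: "cmod (x2 - x) <= C * cmod x ^ 2"
  shows "cmod (x1 ^ N - x2 ^ N - of_nat N * x ^ (N - 1) * (x1 - x2))
    <= real N * (real (N - 1) * 2 ^ (N - 2) * C) * cmod x ^ N * cmod (x1 - x2)"
    and "cmod x1 <= 2 * cmod x" "cmod x2 <= 2 * cmod x"
proof -
  define t where "t = cmod x"
  have t: "0 <= t" by (simp add: t_def)
  have "C * t ^ 2 = (C * t) * t" by (simp add: power2_eq_square)
  also have "... <= 1 * t" using C t by (intro mult_right_mono) (auto simp: t_def)
  finally have Ct: "C * t ^ 2 <= t" by simp
  have le2: "cmod z <= 2 * t" if "cmod (z - x) <= C * t ^ 2" for z
    using that Ct norm_triangle_sub[of z x] unfolding t_def by linarith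
  show x12: "cmod x1 <= 2 * cmod x" "cmod x2 <= 2 * cmod x" using le2 x1 x2 by (auto simp: t_def)
  define g where "g z = z ^ N - of_nat N * x ^ (N - 1) * z" for z
  have "cmod (g x1 - g x2) <= (real N * (real (N - 1) * 2 ^ (N - 2) * C) * t ^ N) * cmod (x1 - x2)"
  proof (rule field_differentiable_bound[where S="cball x (C * t ^ 2)" and f'="%z. of_nat N * (z ^ (N - 1) - x ^ (N - 1))"])
    show "convex (cball x (C * t ^ 2))" by simp
    show "(g has_field_derivative of_nat N * (z ^ (N - 1) - x ^ (N - 1))) (at z within cball x (C * t ^ 2))" for z
      unfolding g_def by (auto intro!: derivative_eq_intros simp: algebra_simps)
    show "cmod (of_nat N * (z ^ (N - 1) - x ^ (N - 1))) <= real N * (real (N - 1) * 2 ^ (N - 2) * C) * t ^ N"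
      if z: "z \<in> cball x (C * t ^ 2)" for z
    proof -
      have zx: "cmod (z - x) <= C * t ^ 2" using z by (simp add: dist_norm norm_minus_commute)
      have "cmod (z ^ (N - 1) - x ^ (N - 1)) <= real (N - 1) * (2 * t) ^ (N - 1 - 1) * cmod (z - x)"
        using le2[OF zx] t by (intro norm_diff_power_le) (auto simp: t_def)
      also have "... <= real (N - 1) * (2 * t) ^ (N - 2) * (C * t ^ 2)"
        using zx t by (simp add: numeral_2_eq_2 mult_left_mono)
      also have "... = real (N - 1) * 2 ^ (N - 2) * C * (t ^ (N - 2) * t ^ 2)" by (simp add: power_mult_distrib)
      also have "t ^ (N - 2) * t ^ 2 = t ^ N" using N by (simp only: power_add[symmetric] le_add_diff_inverse2)
      finally have "real N * cmod (z ^ (N - 1) - x ^ (N - 1)) <= real N * (real (N - 1) * 2 ^ (N - 2) * C * t ^ N)"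
        by (intro mult_left_mono) auto
      then show ?thesis by (simp add: norm_mult mult.assoc)
    qed
    show "x1 \<in> cball x (C * t ^ 2)" "x2 \<in> cball x (C * t ^ 2)"
      using x1 x2 by (auto simp: dist_norm norm_minus_commute t_def)
  qed
  then show "cmod (x1 ^ N - x2 ^ N - of_nat N * x ^ (N - 1) * (x1 - x2))
    <= real N * (real (N - 1) * 2 ^ (N - 2) * C) * cmod x ^ N * cmod (x1 - x2)"
    by (simp add: g_def t_def algebra_simps)
qed

text \<open>The reference coefficient \<open>a\<close> is taken at the unperturbed angle, so three
  differences arise: between the two angles, between an angle and the reference, and the
  nonlinearity of the power. Each is one order in \<open>|x|\<close> better than the linear term or
  carries the angle increment \<open>d\<close>.\<close>

lemma a_increment:
  fixes a a1 a2 x x1 x2 :: complex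
  assumes N: "N >= 2" and C: "0 <= C" "C * cmod x <= 1" "cmod x <= 1"
    and x1: "cmod (x1 - x) <= C * cmod x ^ 2" and x2: "cmod (x2 - x) <= C * cmod x ^ 2"
    and M: "0 <= M" "cmod a <= M" "cmod (a1 - a2) <= M * d" "cmod (a2 - a) <= M * (C * cmod x)" and d: "0 <= d"
  shows "cmod (a1 * x1 ^ N - a2 * x2 ^ N - of_nat N * a * x ^ (N - 1) * (x1 - x2))
    <= (M * 2 ^ N + M * C * (real N * 2 ^ (N - 1)) + M * (real N * (real (N - 1) * 2 ^ (N - 2) * C))) * cmod x ^ N * (cmod (x1 - x2) + d)"
proof -
  let ?t = "cmod x" and ?dx = "cmod (x1 - x2)"
  note pi = power_increment[OF N C(1,2) x1 x2]
  have eq: "a1 * x1 ^ N - a2 * x2 ^ N - of_nat N * a * x ^ (N - 1) * (x1 - x2) =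
    (a1 - a2) * x1 ^ N + (a2 - a) * (x1 ^ N - x2 ^ N) + a * (x1 ^ N - x2 ^ N - of_nat N * x ^ (N - 1) * (x1 - x2))"
    by (simp add: algebra_simps)
  have A: "cmod ((a1 - a2) * x1 ^ N) <= (M * 2 ^ N) * ?t ^ N * d"
  proof -
    have "cmod ((a1 - a2) * x1 ^ N) <= (M * d) * (2 * ?t) ^ N"
      unfolding norm_mult norm_power using M d pi by (intro mult_mono power_mono) auto
    then show ?thesis by (simp add: power_mult_distrib mult_ac)
  qed
  have B: "cmod ((a2 - a) * (x1 ^ N - x2 ^ N)) <= (M * C * (real N * 2 ^ (N - 1))) * ?t ^ N * ?dx"
  proof -
    have "cmod ((a2 - a) * (x1 ^ N - x2 ^ N)) <= (M * (C * ?t)) * (real N * (2 * ?t) ^ (N - 1) * ?dx)"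
      unfolding norm_mult using M C pi by (intro mult_mono norm_diff_power_le) auto
    also have "... = (M * C * (real N * 2 ^ (N - 1))) * (?t * ?t ^ (N - 1)) * ?dx"
      by (simp add: power_mult_distrib mult_ac)
    also have "?t * ?t ^ (N - 1) = ?t ^ N" using N by (simp add: power_eq_if)
    finally show ?thesis .
  qed
  have D: "cmod (a * (x1 ^ N - x2 ^ N - of_nat N * x ^ (N - 1) * (x1 - x2))) <= (M * (real N * (real (N - 1) * 2 ^ (N - 2) * C))) * ?t ^ N * ?dx"
  proof -
    have "cmod (a * (x1 ^ N - x2 ^ N - of_nat N * x ^ (N - 1) * (x1 - x2))) <= M * (real N * (real (N - 1) * 2 ^ (N - 2) * C) * ?t ^ N * ?dx)"
      unfolding norm_mult using M pi by (intro mult_mono) auto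
    then show ?thesis by (simp add: mult_ac)
  qed
  have nn: "0 <= M * 2 ^ N * ?t ^ N" "0 <= M * C * (real N * 2 ^ (N - 1)) * ?t ^ N"
      "0 <= M * (real N * (real (N - 1) * 2 ^ (N - 2) * C)) * ?t ^ N"
    using M C by auto
  have "cmod (a1 * x1 ^ N - a2 * x2 ^ N - of_nat N * a * x ^ (N - 1) * (x1 - x2)) \<le>
    (M * 2 ^ N) * ?t ^ N * d + (M * C * (real N * 2 ^ (N - 1))) * ?t ^ N * ?dx + (M * (real N * (real (N - 1) * 2 ^ (N - 2) * C))) * ?t ^ N * ?dx"
    unfolding eq by (intro order_trans[OF norm_triangle_ineq] add_mono A B D order_trans[OF norm_triangle_ineq])
  also have "... <= (M * 2 ^ N) * ?t ^ N * (?dx + d) + (M * C * (real N * 2 ^ (N - 1))) * ?t ^ N * (?dx + d)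
     + (M * (real N * (real (N - 1) * 2 ^ (N - 2) * C))) * ?t ^ N * (?dx + d)"
    using nn d by (intro add_mono mult_left_mono) auto
  finally show ?thesis by (simp only: distrib_right)
qed

text \<open>The same splitting for the matrix term. Since \<open>y1\<close> is of order
  \<open>|x| ^ 2\<close>, variations of the power and of the matrix on it also gain a factor
  \<open>|x|\<close>.\<close>

lemma B_increment:
  fixes B B1 B2 :: "complex ^ 'm ^ 'm" and x x1 x2 :: complex and y1 y2 :: "complex ^ 'm"
  assumes N: "N >= 2" and C: "0 <= C" "C * cmod x <= 1" "cmod x <= 1"
    and x1: "cmod (x1 - x) <= C * cmod x ^ 2" and x2: "cmod (x2 - x) <= C * cmod x ^ 2"
    and y1: "norm y1 <= C * cmod x ^ 2"
    and M: "0 <= M" "!!v. norm (B1 *v v) <= M * norm v" "!!v. norm (B2 *v v) <= M * norm v"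
      "!!v. norm (B1 *v v - B2 *v v) <= M * d * norm v" "!!v. norm (B2 *v v - B *v v) <= M * (C * cmod x) * norm v"
    and d: "0 <= d"
  shows "norm (x1 ^ (N - 1) *\<^sub>C (B1 *v y1) - x2 ^ (N - 1) *\<^sub>C (B2 *v y2) - x ^ (N - 1) *\<^sub>C (B *v (y1 - y2)))
    <= (2 * (real (N - 1) * 2 ^ (N - 2) * (M * C)) + 2 ^ (N - 1) * (M * C) + M * C) * cmod x ^ N * (cmod (x1 - x2) + norm (y1 - y2) + cmod x * d)"
proof -
  let ?t = "cmod x" and ?dx = "cmod (x1 - x2)" and ?dy = "norm (y1 - y2)"
  let ?a = "real (N - 1) * 2 ^ (N - 2) * (M * C)"
  note le2 = power_increment(2,3)[OF N C(1,2) x1 x2]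
  have p1: "?t ^ (N - 2) * ?t ^ 2 = ?t ^ N" using N by (simp only: power_add[symmetric] le_add_diff_inverse2)
  have p2: "?t ^ (N - 1) * ?t = ?t ^ N" using N by (metis Suc_diff_1 less_le_trans pos2 power_Suc2)
  have pd: "cmod (z ^ (N - 1) - w ^ (N - 1)) <= real (N - 1) * (2 * ?t) ^ (N - 2) * cmod (z - w)"
    if "cmod z <= 2 * ?t" "cmod w <= 2 * ?t" for z w
    using norm_diff_power_le[OF that, of "N - 1"] by (simp add: numeral_2_eq_2)
  have eq: "x1 ^ (N - 1) *\<^sub>C (B1 *v y1) - x2 ^ (N - 1) *\<^sub>C (B2 *v y2) - x ^ (N - 1) *\<^sub>C (B *v (y1 - y2)) =
    (x1 ^ (N - 1) - x2 ^ (N - 1)) *\<^sub>C (B1 *v y1) + x2 ^ (N - 1) *\<^sub>C (B1 *v y1 - B2 *v y1)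
    + (x2 ^ (N - 1) - x ^ (N - 1)) *\<^sub>C (B2 *v (y1 - y2)) + x ^ (N - 1) *\<^sub>C (B2 *v (y1 - y2) - B *v (y1 - y2))"
    by (simp add: matrix_vector_mult_diff_distrib scaleC.diff_left scaleC.diff_right)
  have A: "norm ((x1 ^ (N - 1) - x2 ^ (N - 1)) *\<^sub>C (B1 *v y1)) <= ?a * ?t ^ N * ?dx"
  proof -
    have "norm (B1 *v y1) <= M * (C * ?t ^ 2)" using M(2)[of y1] mult_left_mono[OF y1 M(1)] by linarith
    then have "norm ((x1 ^ (N - 1) - x2 ^ (N - 1)) *\<^sub>C (B1 *v y1)) <= (real (N - 1) * (2 * ?t) ^ (N - 2) * ?dx) * (M * (C * ?t ^ 2))"
      unfolding norm_scaleC using le2 by (intro mult_mono pd) auto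
    also have "... = ?a * (?t ^ (N - 2) * ?t ^ 2) * ?dx" by (simp add: power_mult_distrib mult_ac)
    finally show ?thesis unfolding p1 .
  qed
  have D: "norm (x2 ^ (N - 1) *\<^sub>C (B1 *v y1 - B2 *v y1)) <= 2 ^ (N - 1) * (M * C) * ?t ^ N * (?t * d)"
  proof -
    have "norm (B1 *v y1 - B2 *v y1) <= M * d * (C * ?t ^ 2)"
      using M(4)[of y1] mult_left_mono[OF y1, of "M * d"] M(1) d by (simp add: order_trans)
    then have "norm (x2 ^ (N - 1) *\<^sub>C (B1 *v y1 - B2 *v y1)) <= (2 * ?t) ^ (N - 1) * (M * d * (C * ?t ^ 2))"
      unfolding norm_scaleC norm_power using le2 by (intro mult_mono power_mono) auto
    also have "... = 2 ^ (N - 1) * (M * C) * (?t ^ (N - 1) * ?t) * (?t * d)"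
      by (simp add: power_mult_distrib power2_eq_square mult_ac)
    finally show ?thesis unfolding p2 .
  qed
  have E: "norm ((x2 ^ (N - 1) - x ^ (N - 1)) *\<^sub>C (B2 *v (y1 - y2))) <= ?a * ?t ^ N * ?dy"
  proof -
    have "cmod (x2 ^ (N - 1) - x ^ (N - 1)) <= real (N - 1) * (2 * ?t) ^ (N - 2) * cmod (x2 - x)"
      using le2 by (intro pd) auto
    also have "... <= real (N - 1) * (2 * ?t) ^ (N - 2) * (C * ?t ^ 2)" by (intro mult_left_mono x2) auto
    finally have "norm ((x2 ^ (N - 1) - x ^ (N - 1)) *\<^sub>C (B2 *v (y1 - y2))) <= (real (N - 1) * (2 * ?t) ^ (N - 2) * (C * ?t ^ 2)) * (M * ?dy)"
      unfolding norm_scaleC using C by (intro mult_mono M) auto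
    also have "... = ?a * (?t ^ (N - 2) * ?t ^ 2) * ?dy" by (simp add: power_mult_distrib mult_ac)
    finally show ?thesis unfolding p1 .
  qed
  have F: "norm (x ^ (N - 1) *\<^sub>C (B2 *v (y1 - y2) - B *v (y1 - y2))) <= (M * C) * ?t ^ N * ?dy"
  proof -
    have "norm (x ^ (N - 1) *\<^sub>C (B2 *v (y1 - y2) - B *v (y1 - y2))) <= ?t ^ (N - 1) * (M * (C * ?t) * ?dy)"
      unfolding norm_scaleC norm_power by (intro mult_left_mono M) auto
    also have "... = (M * C) * (?t ^ (N - 1) * ?t) * ?dy" by (simp add: mult_ac)
    finally show ?thesis unfolding p2 .
  qed
  let ?S = "?dx + ?dy + ?t * d"
  have nn: "0 <= ?a * ?t ^ N" "0 <= 2 ^ (N - 1) * (M * C) * ?t ^ N" "0 <= (M * C) * ?t ^ N" using M(1) C by auto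
  have td: "0 <= ?t * d" using d by simp
  have "norm (x1 ^ (N - 1) *\<^sub>C (B1 *v y1) - x2 ^ (N - 1) *\<^sub>C (B2 *v y2) - x ^ (N - 1) *\<^sub>C (B *v (y1 - y2))) \<le>
    ?a * ?t ^ N * ?dx + 2 ^ (N - 1) * (M * C) * ?t ^ N * (?t * d) + ?a * ?t ^ N * ?dy + (M * C) * ?t ^ N * ?dy"
    unfolding eq by (intro order_trans[OF norm_triangle_ineq] add_mono A D E F order_trans[OF norm_triangle_ineq])
  also have "... <= ?a * ?t ^ N * ?S + 2 ^ (N - 1) * (M * C) * ?t ^ N * ?S + ?a * ?t ^ N * ?S + (M * C) * ?t ^ N * ?S"
    using td by (intro add_mono mult_left_mono nn) auto
  finally show ?thesis by (simp only: distrib_right mult_2 add_ac)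
qed

lemma coeff_lipschitz_matrix:
  fixes B :: "('d::finite, 'p::finite) angle_param => complex ^ 'm ^ 'm"
  assumes f: "analytic_coeff sg0 LC B" and LC: "open LC" and sg: "sg < sg0" and L: "compact L" "L \<subseteq> LC"
  shows "\<exists>M>0. \<forall>th\<in>cstrip sg. \<forall>th'\<in>cstrip sg. \<forall>mu\<in>L. norm (B (th, mu) - B (th', mu)) <= M * norm (th - th')"
proof -
  have comp: "analytic_coeff sg0 LC (%q. B q $ i $ j)" for i j
    using f unfolding analytic_coeff_def by (auto intro!: chol_vec_nth)
  have "\<forall>ij. \<exists>M>0. \<forall>th\<in>cstrip sg. \<forall>th'\<in>cstrip sg. \<forall>mu\<in>L. cmod (B (th, mu) $ fst ij $ snd ij - B (th', mu) $ fst ij $ snd ij) <= M * norm (th - th')"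
    using coeff_lipschitz[OF comp LC sg L] by blast
  then obtain M where M: "\<forall>ij. M ij > 0 & (\<forall>th\<in>cstrip sg. \<forall>th'\<in>cstrip sg. \<forall>mu\<in>L. cmod (B (th, mu) $ fst ij $ snd ij - B (th', mu) $ fst ij $ snd ij) <= M ij * norm (th - th'))"
    unfolding choice_iff by blast
  have M': "M (i, j) > 0" for i j using M by blast
  define K where "K = (\<Sum>i\<in>UNIV. \<Sum>j\<in>UNIV. M (i, j))"
  have "norm (B (th, mu) - B (th', mu)) <= K * norm (th - th')" if q: "th \<in> cstrip sg" "th' \<in> cstrip sg" "mu \<in> L" for th th' mu
  proof -
    have "norm (B (th, mu) - B (th', mu)) <= (\<Sum>i\<in>UNIV. norm ((B (th, mu) - B (th', mu)) $ i))" by (rule norm_vec_le_sum)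
    also have "... <= (\<Sum>i\<in>UNIV. \<Sum>j\<in>UNIV. norm ((B (th, mu) - B (th', mu)) $ i $ j))" by (intro sum_mono norm_vec_le_sum)
    also have "... <= (\<Sum>i\<in>UNIV. \<Sum>j\<in>UNIV. M (i, j) * norm (th - th'))"
    proof (intro sum_mono)
      fix i j
      show "norm ((B (th, mu) - B (th', mu)) $ i $ j) <= M (i, j) * norm (th - th')"
        using conjunct2[OF M[rule_format, of "(i, j)"]] q by simp
    qed
    finally show ?thesis by (simp only: K_def sum_distrib_right)
  qed
  moreover have "K > 0" unfolding K_def using M' by (intro sum_pos) auto
  ultimately show ?thesis by blast
qed

subsection \<open>One step of the iteration\<close>

text \<open>Moving from \<open>R z\<close> to \<open>z\<close> exchanges the factors
  \<open>1 + s' * m'\<close> and \<open>1 + s * m\<close>. To first order in \<open>s\<close> this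
  changes the oscillating \<open>N a\<close> into its average, because \<open>m\<close> nearly
  solves the cohomological equation; the growth left is that of \<open>1 + N A s\<close>.\<close>

lemma step_x:
  fixes s s' a A m m' w :: complex
  assumes C: "1 <= C" "cmod a <= C" "cmod A <= C" "cmod m <= C" "cmod m' <= C"
    and t: "0 <= t" "t <= 1" "cmod s <= t" "cmod (s' - s) <= C * t * cmod s"
    and avg: "cmod (of_nat N * (a - A) + m - m') <= ep"
    and small: "t * (4 * real (N + 1) * C ^ 3) <= ep" "t * (4 * C ^ 2) <= 1"
  shows "cmod ((1 + s * m) * (1 + of_nat N * a * s) * w) <= (1 + (real N * cmod A + 4 * ep) * cmod s) * cmod ((1 + s' * m') * w)"
    and "cmod w <= 2 * cmod ((1 + s' * m') * w)"
proof -
  have C0: "0 <= C" using C(1) by linarith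
  have s': "cmod s' <= 2 * C * t"
  proof -
    have "cmod s' <= cmod s + cmod (s' - s)" using norm_triangle_sub[of s' s] .
    also have "cmod (s' - s) <= C * t * cmod s" by (fact t)
    also have "C * t * cmod s <= C * 1 * t" using C0 t by (intro mult_mono) auto
    finally have "cmod s' <= t + C * t" using t(3) by simp
    also have "... <= C * t + C * t" using mult_right_mono[OF C(1) t(1)] by simp
    finally show ?thesis by simp
  qed
  have "cmod (s' * m') <= (2 * C * t) * C" unfolding norm_mult using C0 t by (intro mult_mono s' C) auto
  also have "... = t * (4 * C ^ 2) / 2" by (simp add: power2_eq_square)
  finally have sm: "cmod (s' * m') <= 1 / 2" using small(2) by linarith
  have "1 / 2 <= cmod (1 + s' * m')" using norm_triangle_ineq2[of 1 "- (s' * m')"] sm by simp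
  then have "1 / 2 * cmod w <= cmod (1 + s' * m') * cmod w" by (intro mult_right_mono) auto
  then show w: "cmod w <= 2 * cmod ((1 + s' * m') * w)" by (simp add: norm_mult)
  \<comment> \<open>The first summand is the defect of the cohomological equation, at most
    \<open>ep * |s|\<close>; each of the others carries a further factor \<open>t\<close>.\<close>
  define \<Delta> where "\<Delta> = s * (of_nat N * (a - A) + m - m') + (s - s') * m' + s * s * m * (of_nat N * a) - of_nat N * A * s * s' * m'"
  have eq: "(1 + s * m) * (1 + of_nat N * a * s) = (1 + of_nat N * A * s) * (1 + s' * m') + \<Delta>"
    by (simp add: \<Delta>_def algebra_simps)
  have C23: "C ^ 2 <= C ^ 3" by (rule power_increasing) (use C(1) in auto)
  have "cmod \<Delta> <= cmod s * ep + cmod s * (t * C ^ 2) + cmod s * (t * (real N * C ^ 2)) + cmod s * (t * (2 * real N * C ^ 3))"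
    unfolding \<Delta>_def
  proof (intro order_trans[OF norm_triangle_ineq4] add_mono order_trans[OF norm_triangle_ineq])
    show "cmod (s * (of_nat N * (a - A) + m - m')) <= cmod s * ep"
      unfolding norm_mult by (intro mult_left_mono avg) auto
    have "cmod ((s - s') * m') <= (C * t * cmod s) * C"
      unfolding norm_mult using t(4) C0 t(1) C(5) by (intro mult_mono) (auto simp: norm_minus_commute)
    then show "cmod ((s - s') * m') <= cmod s * (t * C ^ 2)" by (simp add: power2_eq_square mult_ac)
    have "cmod (s * s * m * (of_nat N * a)) <= cmod s * t * C * (real N * C)"
      unfolding norm_mult norm_of_nat using t C C0 by (intro mult_mono) auto
    then show "cmod (s * s * m * (of_nat N * a)) <= cmod s * (t * (real N * C ^ 2))" by (simp add: power2_eq_square mult_ac)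
    have "cmod (of_nat N * A * s * s' * m') <= real N * C * cmod s * (2 * C * t) * C"
      unfolding norm_mult norm_of_nat using t C C0 s' by (intro mult_mono) auto
    then show "cmod (of_nat N * A * s * s' * m') <= cmod s * (t * (2 * real N * C ^ 3))"
      by (simp add: power3_eq_cube mult_ac)
  qed
  also have "... = cmod s * (ep + t * (C ^ 2 + real N * C ^ 2 + 2 * real N * C ^ 3))" by (simp add: algebra_simps)
  also have "... <= cmod s * (ep + t * (4 * real (N + 1) * C ^ 3))"
  proof (intro mult_left_mono add_left_mono)
    have "real N * C ^ 2 <= real N * C ^ 3" by (intro mult_left_mono C23) auto
    show "C ^ 2 + real N * C ^ 2 + 2 * real N * C ^ 3 <= 4 * real (N + 1) * C ^ 3"
    proof -
      have "0 <= real N * C ^ 3" "0 <= C ^ 3" using C0 by simp_all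
      moreover have "4 * real (N + 1) * C ^ 3 = 4 * (real N * C ^ 3) + 4 * C ^ 3" "2 * real N * C ^ 3 = 2 * (real N * C ^ 3)"
        by (simp_all add: algebra_simps)
      ultimately show ?thesis using C23 \<open>real N * C ^ 2 <= real N * C ^ 3\<close> by linarith
    qed
  qed (use t in auto)
  also have "... <= cmod s * (2 * ep)" using small(1) by (intro mult_left_mono) auto
  finally have \<Delta>: "cmod \<Delta> <= cmod s * (2 * ep)" .
  have "cmod ((1 + s * m) * (1 + of_nat N * a * s) * w) = cmod ((1 + of_nat N * A * s) * ((1 + s' * m') * w) + \<Delta> * w)"
    unfolding eq by (simp add: algebra_simps)
  also have "... <= cmod (1 + of_nat N * A * s) * cmod ((1 + s' * m') * w) + cmod \<Delta> * cmod w"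
    by (rule order_trans[OF norm_triangle_ineq]) (simp add: norm_mult)
  also have "... <= (1 + real N * cmod A * cmod s) * cmod ((1 + s' * m') * w) + (cmod s * (2 * ep)) * (2 * cmod ((1 + s' * m') * w))"
  proof (intro add_mono mult_right_mono mult_mono \<Delta> w)
    show "cmod (1 + of_nat N * A * s) <= 1 + real N * cmod A * cmod s"
      by (rule order_trans[OF norm_triangle_ineq]) (simp add: norm_mult)
    show "0 <= cmod s * (2 * ep)" using \<Delta> norm_ge_zero order_trans by blast
  qed auto
  also have "... = (1 + (real N * cmod A + 4 * ep) * cmod s) * cmod ((1 + s' * m') * w)" by (simp add: algebra_simps)
  finally show "cmod ((1 + s * m) * (1 + of_nat N * a * s) * w) <= (1 + (real N * cmod A + 4 * ep) * cmod s) * cmod ((1 + s' * m') * w)" .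
qed

text \<open>The matrix version: up to small terms \<open>(1 + s M) (1 - s B)\<close> equals
  \<open>(1 - s A) (1 + s' M')\<close>, and \<open>1 - s A\<close> does not increase the adapted
  norm.\<close>

lemma step_y:
  fixes B A M M' :: "complex ^ 'm ^ 'm" and v :: "complex ^ 'm" and s s' :: complex
  assumes nrm: "vnorm Cn nrm" and Cn: "0 <= Cn" and ad: "!!v. nrm (v - s *\<^sub>C (A *v v)) <= nrm v"
    and C: "1 <= C" "!!v. norm (B *v v) <= C * norm v" "!!v. norm (A *v v) <= C * norm v"
      "!!v. norm (M *v v) <= C * norm v" "!!v. norm (M' *v v) <= C * norm v"
    and t: "0 <= t" "t <= 1" "cmod s <= t" "cmod (s' - s) <= C * t * cmod s"
    and avg: "!!v. norm (M *v v - M' *v v - B *v v + A *v v) <= ep * norm v"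
    and small: "t * (4 * C ^ 3) <= ep" "t * (4 * C ^ 2) <= 1"
  defines "v1 \<equiv> v - s *\<^sub>C (B *v v)" and "v2 \<equiv> v + s' *\<^sub>C (M' *v v)"
  shows "nrm (v1 + s *\<^sub>C (M *v v1)) <= (1 + 4 * Cn * ep * cmod s) * nrm v2"
    and "norm v <= 2 * nrm v2"
proof -
  have C0: "0 <= C" using C(1) by linarith
  have s': "cmod s' <= 2 * C * t"
  proof -
    have "cmod s' <= cmod s + cmod (s' - s)" using norm_triangle_sub[of s' s] .
    also have "cmod (s' - s) <= C * t * cmod s" by (fact t)
    also have "C * t * cmod s <= C * 1 * t" using C0 t by (intro mult_mono) auto
    finally have "cmod s' <= t + C * t" using t(3) by simp
    also have "... <= C * t + C * t" using mult_right_mono[OF C(1) t(1)] by simp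
    finally show ?thesis by simp
  qed
  have "norm (s' *\<^sub>C (M' *v v)) <= (2 * C * t) * (C * norm v)"
    unfolding norm_scaleC using C0 t by (intro mult_mono s' C) auto
  also have "... = (t * (4 * C ^ 2)) * norm v / 2" by (simp add: power2_eq_square)
  also have "... <= 1 * norm v / 2" by (intro divide_right_mono mult_right_mono small) auto
  finally have "norm v / 2 <= norm v2"
    using norm_triangle_ineq2[of v "- (s' *\<^sub>C (M' *v v))"] by (simp add: v2_def)
  also have "norm v2 <= nrm v2" using nrm by (simp add: vnorm_def)
  finally show v: "norm v <= 2 * nrm v2" by simp
  define \<Delta> where "\<Delta> = s *\<^sub>C (M *v v - M' *v v - B *v v + A *v v) + (s - s') *\<^sub>C (M' *v v)
    - (s * s) *\<^sub>C (M *v (B *v v)) + (s * s') *\<^sub>C (A *v (M' *v v))"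
  have eq: "v1 + s *\<^sub>C (M *v v1) = (v2 - s *\<^sub>C (A *v v2)) + \<Delta>"
    unfolding v1_def v2_def \<Delta>_def
    by (simp add: matrix_vector_mult_diff_distrib matrix_vector_right_distrib matrix_vector_scaleC
        scaleC_add_right scaleC.diff_right scaleC.diff_left scaleC_scaleC)
  have C23: "C ^ 2 <= C ^ 3" by (rule power_increasing) (use C(1) in auto)
  have "norm \<Delta> <= cmod s * (ep * norm v) + cmod s * (t * C ^ 2) * norm v + cmod s * (t * C ^ 2) * norm v + cmod s * (t * (2 * C ^ 3)) * norm v"
    unfolding \<Delta>_def
  proof (intro order_trans[OF norm_triangle_ineq4] add_mono order_trans[OF norm_triangle_ineq])
    show "norm (s *\<^sub>C (M *v v - M' *v v - B *v v + A *v v)) <= cmod s * (ep * norm v)"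
      unfolding norm_scaleC by (intro mult_left_mono avg) auto
    have "norm ((s - s') *\<^sub>C (M' *v v)) <= (C * t * cmod s) * (C * norm v)"
      unfolding norm_scaleC using t(4) C0 t(1) C(5) by (intro mult_mono) (auto simp: norm_minus_commute)
    then show "norm ((s - s') *\<^sub>C (M' *v v)) <= cmod s * (t * C ^ 2) * norm v" by (simp add: power2_eq_square mult_ac)
    have "norm (M *v (B *v v)) <= C * (C * norm v)"
      using C(4)[of "B *v v"] mult_left_mono[OF C(2)[of v] C0] by linarith
    then have "norm ((s * s) *\<^sub>C (M *v (B *v v))) <= (cmod s * t) * (C * (C * norm v))"
      unfolding norm_scaleC norm_mult using t by (intro mult_mono) auto
    then show "norm ((s * s) *\<^sub>C (M *v (B *v v))) <= cmod s * (t * C ^ 2) * norm v" by (simp add: power2_eq_square mult_ac)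
    have "norm (A *v (M' *v v)) <= C * (C * norm v)"
      using C(3)[of "M' *v v"] mult_left_mono[OF C(5)[of v] C0] by linarith
    then have "norm ((s * s') *\<^sub>C (A *v (M' *v v))) <= (cmod s * (2 * C * t)) * (C * (C * norm v))"
      unfolding norm_scaleC norm_mult using s' C0 t by (intro mult_mono) auto
    then show "norm ((s * s') *\<^sub>C (A *v (M' *v v))) <= cmod s * (t * (2 * C ^ 3)) * norm v"
      by (simp add: power3_eq_cube mult_ac)
  qed
  also have "... = cmod s * (ep + t * (2 * C ^ 2 + 2 * C ^ 3)) * norm v" by (simp add: algebra_simps)
  also have "... <= cmod s * (ep + t * (4 * C ^ 3)) * norm v"
    using C23 t by (intro mult_right_mono mult_left_mono add_left_mono) auto
  also have "... <= cmod s * (2 * ep) * norm v" using small(1) by (intro mult_right_mono mult_left_mono) auto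
  finally have \<Delta>: "norm \<Delta> <= cmod s * (2 * ep) * norm v" .
  have ep0: "0 <= ep" using small(1) t(1) C0 by (meson mult_nonneg_nonneg order_trans zero_le_numeral zero_le_power)
  have "nrm (v1 + s *\<^sub>C (M *v v1)) <= nrm (v2 - s *\<^sub>C (A *v v2)) + nrm \<Delta>"
    unfolding eq using nrm by (simp add: vnorm_def)
  also have "... <= nrm v2 + Cn * (cmod s * (2 * ep) * (2 * nrm v2))"
  proof (intro add_mono ad)
    have "nrm \<Delta> <= Cn * norm \<Delta>" using nrm by (simp add: vnorm_def)
    also have "... <= Cn * (cmod s * (2 * ep) * (2 * nrm v2))"
      using v ep0 by (intro mult_left_mono order_trans[OF \<Delta>] Cn) auto
    finally show "nrm \<Delta> <= Cn * (cmod s * (2 * ep) * (2 * nrm v2))" .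
  qed
  finally show "nrm (v1 + s *\<^sub>C (M *v v1)) <= (1 + 4 * Cn * ep * cmod s) * nrm v2" by (simp add: algebra_simps)
qed

text \<open>\<open>(1 + N a s) (1 - N a s)\<close> differs from 1 by a square, so the preconditioned
  linear part cancels up to second order in \<open>s\<close>, and \<open>e\<close> is at most
  doubled.\<close>

lemma self_x:
  fixes a s d e :: complex
  assumes C: "cmod (of_nat N * a) <= C" "0 <= C" and t: "cmod s <= t" "C * t <= 1"
  shows "cmod (d - (1 + of_nat N * a * s) * ((1 - of_nat N * a * s) * d + e)) <= C ^ 2 * t * cmod s * cmod d + 2 * cmod e"
proof -
  have b: "cmod (of_nat N * a * s) <= C * cmod s" unfolding norm_mult[of _ s] by (intro mult_right_mono C) auto
  have t0: "0 <= C * t" using C(2) order_trans[OF norm_ge_zero t(1)] by simp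
  have b1: "cmod (of_nat N * a * s) <= 1" using b mult_left_mono[OF t(1) C(2)] t(2) by linarith
  have eq: "d - (1 + of_nat N * a * s) * ((1 - of_nat N * a * s) * d + e) = (of_nat N * a * s) * (of_nat N * a * s) * d - (1 + of_nat N * a * s) * e"
    by (simp add: algebra_simps)
  have "cmod ((of_nat N * a * s) * (of_nat N * a * s) * d) <= (C * t) * (C * cmod s) * cmod d"
    unfolding norm_mult[of "(of_nat N * a * s) * (of_nat N * a * s)"] norm_mult[of "of_nat N * a * s" "of_nat N * a * s"]
    using t0 b order_trans[OF b mult_left_mono[OF t(1) C(2)]] by (intro mult_right_mono mult_mono) auto
  moreover have "cmod ((1 + of_nat N * a * s) * e) <= 2 * cmod e"
    unfolding norm_mult[of _ e] using norm_triangle_ineq[of 1 "of_nat N * a * s"] b1 by (intro mult_right_mono) auto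
  ultimately show ?thesis
    unfolding eq using norm_triangle_ineq4[of "(of_nat N * a * s) * (of_nat N * a * s) * d" "(1 + of_nat N * a * s) * e"]
    by (simp add: power2_eq_square mult_ac)
qed

lemma self_y:
  fixes B :: "complex ^ 'm ^ 'm" and v e :: "complex ^ 'm"
  assumes C: "!!v. norm (B *v v) <= C * norm v" "0 <= C" and t: "cmod s <= t" "C * t <= 1"
  defines "w \<equiv> v + s *\<^sub>C (B *v v) + e"
  shows "norm (v - (w - s *\<^sub>C (B *v w))) <= C ^ 2 * t * cmod s * norm v + 2 * norm e"
proof -
  have eq: "v - (w - s *\<^sub>C (B *v w)) = (s * s) *\<^sub>C (B *v (B *v v)) - (e - s *\<^sub>C (B *v e))"
    by (simp add: w_def matrix_vector_right_distrib matrix_vector_scaleC scaleC_add_right scaleC_scaleC)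
  have t0: "0 <= t" using t(1) norm_ge_zero order_trans by blast
  have "norm (B *v (B *v v)) <= C * (C * norm v)"
    using C(1)[of "B *v v"] mult_left_mono[OF C(1)[of v] C(2)] by linarith
  then have 1: "norm ((s * s) *\<^sub>C (B *v (B *v v))) <= (t * cmod s) * (C * (C * norm v))"
    unfolding norm_scaleC norm_mult using t t0 by (intro mult_mono) auto
  have "norm (s *\<^sub>C (B *v e)) <= t * (C * norm e)"
    unfolding norm_scaleC using t0 by (intro mult_mono t C) auto
  also have "... <= norm e" using mult_right_mono[OF t(2) norm_ge_zero[of e]] by (simp add: mult_ac)
  finally have "norm (e - s *\<^sub>C (B *v e)) <= 2 * norm e"
    using norm_triangle_ineq4[of e "s *\<^sub>C (B *v e)"] by simp
  then show ?thesis
    unfolding eq using norm_triangle_ineq4[of "(s * s) *\<^sub>C (B *v (B *v v))" "e - s *\<^sub>C (B *v e)"] 1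
    by (simp add: power2_eq_square mult_ac)
qed

text \<open>The factors with \<open>m\<close> and \<open>M\<close> are the averaging change of
  variables, carried out inside the norm. \<open>kp\<close> weakens the \<open>x\<close> part
  against the influence of \<open>y\<close> on \<open>x\<close>, and \<open>t\<close>, later
  \<open>|x|\<close>, compensates the lower order of the angle.\<close>

definition wnorm :: "real => (complex ^ 'm => real) => complex => complex => complex ^ 'm ^ 'm => real => ('m::finite, 'd::finite) xy_angle => real"
  where "wnorm kp nrm s m M t v = kp * cmod ((1 + s * m) * fst (fst v)) +
    nrm (snd (fst v) + s *\<^sub>C (M *v snd (fst v))) + t * norm (snd v)"

definition precond :: "nat => complex => complex ^ 'm ^ 'm => complex => ('m::finite, 'd::finite) xy_angle => ('m, 'd) xy_angle"
  where "precond N a B s v = (((1 + of_nat N * a * s) * fst (fst v), snd (fst v) - s *\<^sub>C (B *v snd (fst v))), snd v)"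

lemma precond_diff: "precond N a B s (u - v) = precond N a B s u - precond N a B s v"
  by (simp add: precond_def prod_eq_iff algebra_simps matrix_vector_mult_diff_distrib scaleC.diff_right)

lemma wnorm_triangle: "vnorm C nrm ==> 0 <= kp ==> 0 <= t ==> wnorm kp nrm s m M t (u + v) <= wnorm kp nrm s m M t u + wnorm kp nrm s m M t v"
proof -
  assume n: "vnorm C nrm" and k: "0 <= kp" "0 <= t"
  have "kp * cmod ((1 + s * m) * (fst (fst u) + fst (fst v))) <= kp * (cmod ((1 + s * m) * fst (fst u)) + cmod ((1 + s * m) * fst (fst v)))"
    using norm_triangle_ineq[of "(1 + s * m) * fst (fst u)" "(1 + s * m) * fst (fst v)"] k
    by (intro mult_left_mono) (simp_all add: algebra_simps)
  moreover have "nrm ((snd (fst u) + snd (fst v)) + s *\<^sub>C (M *v (snd (fst u) + snd (fst v)))) \<le>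
    nrm (snd (fst u) + s *\<^sub>C (M *v snd (fst u))) + nrm (snd (fst v) + s *\<^sub>C (M *v snd (fst v)))"
  proof -
    have "(snd (fst u) + snd (fst v)) + s *\<^sub>C (M *v (snd (fst u) + snd (fst v))) =
      (snd (fst u) + s *\<^sub>C (M *v snd (fst u))) + (snd (fst v) + s *\<^sub>C (M *v snd (fst v)))"
      by (simp add: matrix_vector_right_distrib scaleC_add_right)
    then show ?thesis using n unfolding vnorm_def by metis
  qed
  moreover have "t * norm (snd u + snd v) <= t * (norm (snd u) + norm (snd v))" using k by (intro mult_left_mono norm_triangle_ineq) auto
  ultimately show ?thesis by (simp add: wnorm_def algebra_simps)
qed

lemma vnorm_minus: "vnorm C nrm ==> nrm (- v) = nrm v"
proof -
  assume "vnorm C nrm"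
  then have "nrm ((-1) *\<^sub>C v) = cmod (-1) * nrm v" unfolding vnorm_def by blast
  then show ?thesis by (simp add: scaleC.minus_left)
qed

lemma wnorm_minus: "vnorm C nrm ==> wnorm kp nrm s m M t (- v) = wnorm kp nrm s m M t v"
proof -
  assume n: "vnorm C nrm"
  have "- snd (fst v) + s *\<^sub>C (M *v (- snd (fst v))) = - (snd (fst v) + s *\<^sub>C (M *v snd (fst v)))"
    using matrix_vector_mult_diff_distrib[of M 0 "snd (fst v)"] by (simp add: scaleC.minus_right)
  then have "nrm (- snd (fst v) + s *\<^sub>C (M *v (- snd (fst v)))) = nrm (snd (fst v) + s *\<^sub>C (M *v snd (fst v)))"
    by (simp only: vnorm_minus[OF n])
  then show ?thesis by (simp only: wnorm_def fst_uminus snd_uminus mult_minus_right norm_minus_cancel)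
qed

text \<open>The perturbations \<open>s m\<close> and \<open>s M\<close> have size at most
  \<open>1 / 4\<close>, so the averaging factors change each component at most by the factor 2, up
  to the constant of \<open>nrm\<close>.\<close>

lemma wnorm_bounds:
  assumes nrm: "vnorm Cn nrm" and C: "1 <= C" "cmod m <= C" "!!v. norm (M *v v) <= C * norm v"
    and t: "cmod s <= t" "t * (4 * C ^ 2) <= 1" and kp: "0 < kp"
  shows "cmod (fst (fst v)) <= 2 * cmod ((1 + s * m) * fst (fst v))"
    and "cmod ((1 + s * m) * fst (fst v)) <= 2 * cmod (fst (fst v))"
    and "norm (snd (fst v)) <= 2 * nrm (snd (fst v) + s *\<^sub>C (M *v snd (fst v)))"
    and "nrm (snd (fst v) + s *\<^sub>C (M *v snd (fst v))) <= 2 * Cn * norm (snd (fst v))"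
    and "kp * cmod (fst (fst v)) / 2 + norm (snd (fst v)) / 2 + t * norm (snd v) <= wnorm kp nrm s m M t v"
    and "wnorm kp nrm s m M t v <= 2 * kp * cmod (fst (fst v)) + 2 * Cn * norm (snd (fst v)) + t * norm (snd v)"
proof -
  have t0: "0 <= t" using t(1) norm_ge_zero order_trans by blast
  have "C <= C ^ 2" using power_increasing[of 1 2 C] C(1) by simp
  then have tC: "t * C <= t * C ^ 2" by (rule mult_left_mono[OF _ t0])
  have tC': "t * C <= 1 / 4" using tC t(2) by linarith
  let ?x = "fst (fst v)" and ?y = "snd (fst v)"
  have "cmod (s * m * ?x) <= (t * C) * cmod ?x"
    unfolding norm_mult using t C(2) t0 by (intro mult_right_mono mult_mono) auto
  also have "... <= 1 / 4 * cmod ?x" by (intro mult_right_mono tC') auto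
  finally have x: "cmod (s * m * ?x) <= cmod ?x / 4" by simp
  have eq: "(1 + s * m) * ?x = ?x + s * m * ?x" by (simp add: algebra_simps)
  show a: "cmod ?x <= 2 * cmod ((1 + s * m) * ?x)"
    using norm_triangle_ineq2[of ?x "- (s * m * ?x)"] x norm_ge_zero[of ?x] unfolding eq norm_minus_cancel diff_minus_eq_add by linarith
  show b: "cmod ((1 + s * m) * ?x) <= 2 * cmod ?x"
    using norm_triangle_ineq[of ?x "s * m * ?x"] x norm_ge_zero[of ?x] unfolding eq by linarith
  have "norm (s *\<^sub>C (M *v ?y)) <= t * (C * norm ?y)"
    unfolding norm_scaleC using t t0 C(3)[of ?y] by (intro mult_mono) auto
  also have "... <= 1 / 4 * norm ?y" using mult_right_mono[OF tC' norm_ge_zero[of ?y]] by (simp add: mult.assoc)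
  finally have y: "norm (s *\<^sub>C (M *v ?y)) <= norm ?y / 4" by simp
  have nl: "norm w <= nrm w" "nrm w <= Cn * norm w" for w using nrm by (auto simp: vnorm_def)
  have Cn0: "0 <= Cn * norm w" for w :: "complex ^ 'a" using nl[of w] norm_ge_zero[of w] by linarith
  have y1: "norm ?y <= 2 * norm (?y + s *\<^sub>C (M *v ?y))"
    using norm_triangle_ineq2[of ?y "- (s *\<^sub>C (M *v ?y))"] y norm_ge_zero[of ?y] unfolding norm_minus_cancel diff_minus_eq_add by linarith
  then show c: "norm ?y <= 2 * nrm (?y + s *\<^sub>C (M *v ?y))" using nl(1)[of "?y + s *\<^sub>C (M *v ?y)"] by linarith
  have "norm (?y + s *\<^sub>C (M *v ?y)) <= 2 * norm ?y"
    using norm_triangle_ineq[of ?y "s *\<^sub>C (M *v ?y)"] y norm_ge_zero[of ?y] by linarith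
  moreover have "Cn >= 0 \<or> ?y = 0" using Cn0[of ?y] by (auto simp: zero_le_mult_iff)
  ultimately have "Cn * norm (?y + s *\<^sub>C (M *v ?y)) <= Cn * (2 * norm ?y)" by (auto intro: mult_left_mono)
  then show d: "nrm (?y + s *\<^sub>C (M *v ?y)) <= 2 * Cn * norm ?y"
    using nl(2)[of "?y + s *\<^sub>C (M *v ?y)"] by simp
  have "kp * cmod ?x <= kp * (2 * cmod ((1 + s * m) * ?x))" "kp * cmod ((1 + s * m) * ?x) <= kp * (2 * cmod ?x)"
    using a b kp by (auto intro!: mult_left_mono)
  then show "kp * cmod ?x / 2 + norm ?y / 2 + t * norm (snd v) <= wnorm kp nrm s m M t v"
    "wnorm kp nrm s m M t v <= 2 * kp * cmod ?x + 2 * Cn * norm ?y + t * norm (snd v)"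
    using c d unfolding wnorm_def by linarith+
qed

text \<open>The Lipschitz constant of the step with respect to the value at \<open>R z\<close>. The
  same factor \<open>1 + p |s|\<close> must serve three components: the growth \<open>N A\<close> of
  \<open>x\<close>, the averaging error in \<open>y\<close>, and the change of the angle weight from
  \<open>t'\<close> to \<open>t\<close>.\<close>

lemma wnorm_step:
  fixes B A M M' :: "complex ^ 'm ^ 'm" and v :: "('m::finite, 'd::finite) xy_angle" and s s' :: complex
  assumes nrm: "vnorm Cn nrm" and Cn: "0 <= Cn" and ad: "!!v. nrm (v - s *\<^sub>C (A *v v)) <= nrm v"
    and C: "1 <= C" "!!v. norm (B *v v) <= C * norm v" "!!v. norm (A *v v) <= C * norm v"
      "!!v. norm (M *v v) <= C * norm v" "!!v. norm (M' *v v) <= C * norm v"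
      "cmod a <= C" "cmod A0 <= C" "cmod m <= C" "cmod m' <= C"
    and t: "0 <= t" "t <= 1" "cmod s <= t" "cmod (s' - s) <= C * t * cmod s"
    and avg: "!!v. norm (M *v v - M' *v v - B *v v + A *v v) <= ep * norm v" "cmod (of_nat N * (a - A0) + m - m') <= ep"
    and small: "t * (4 * real (N + 1) * C ^ 3) <= ep" "t * (4 * C ^ 2) <= 1"
    and p: "real N * cmod A0 + 4 * ep <= p" "4 * Cn * ep <= p" "t <= (1 + p * cmod s) * t'" and kp: "0 <= kp"
  shows "wnorm kp nrm s m M t (precond N a B s v) <= (1 + p * cmod s) * wnorm kp nrm s' m' M' t' v"
proof -
  have C0: "0 <= C ^ 3" using C(1) by simp
  have "t * (4 * C ^ 3) <= t * (4 * real (N + 1) * C ^ 3)"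
    using t C0 by (intro mult_left_mono mult_right_mono) auto
  then have small': "t * (4 * C ^ 3) <= ep" using small by linarith
  have s0: "0 <= cmod s" by simp
  have "cmod ((1 + s * m) * ((1 + of_nat N * a * s) * fst (fst v))) <= (1 + (real N * cmod A0 + 4 * ep) * cmod s) * cmod ((1 + s' * m') * fst (fst v))"
    using step_x(1)[OF C(1) C(6-9) t avg(2) small] by (simp only: mult.assoc)
  also have "... <= (1 + p * cmod s) * cmod ((1 + s' * m') * fst (fst v))"
    using p(1) by (intro mult_right_mono add_left_mono) auto
  finally have X: "kp * cmod ((1 + s * m) * ((1 + of_nat N * a * s) * fst (fst v))) <= kp * ((1 + p * cmod s) * cmod ((1 + s' * m') * fst (fst v)))"
    by (rule mult_left_mono) (rule kp)
  define y where "y = snd (fst v)"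
  define y1 where "y1 = y - s *\<^sub>C (B *v y)"
  define y2 where "y2 = y + s' *\<^sub>C (M' *v y)"
  have "nrm (y1 + s *\<^sub>C (M *v y1)) <= (1 + 4 * Cn * ep * cmod s) * nrm y2"
    unfolding y1_def y2_def by (rule step_y(1)[where nrm=nrm and A=A and Cn=Cn, OF nrm Cn ad C(1-5) t avg(1) small' small(2)])
  also have "... <= (1 + p * cmod s) * nrm y2"
  proof (intro mult_right_mono add_left_mono p s0)
    have "norm y2 <= nrm y2" using nrm by (simp add: vnorm_def)
    then show "0 <= nrm y2" using norm_ge_zero order_trans by blast
  qed
  finally have Y: "nrm (y1 + s *\<^sub>C (M *v y1)) <= (1 + p * cmod s) * nrm y2" .
  have T: "t * norm (snd v) <= ((1 + p * cmod s) * t') * norm (snd v)" by (intro mult_right_mono p) auto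
  show ?thesis
    using X Y T unfolding wnorm_def precond_def y1_def y2_def y_def by (simp add: algebra_simps)
qed

text \<open>The Lipschitz constant with respect to the value at \<open>z\<close> itself. Exact
  inversion would make it zero; left over are second order terms and the nonlinear couplings in the
  hypothesis on \<open>w\<close>.\<close>

lemma wnorm_self:
  fixes B M :: "complex ^ 'm ^ 'm" and v w :: "('m::finite, 'd::finite) xy_angle" and s :: complex
  assumes nrm: "vnorm Cn nrm" and Cn: "0 <= Cn"
    and C: "1 <= C" "!!v. norm (B *v v) <= C * norm v" "!!v. norm (M *v v) <= C * norm v"
      "cmod (of_nat N * a) <= C" "cmod m <= C"
    and t: "0 <= t" "t <= 1" "cmod s <= t" "t * (4 * C ^ 2) <= 1" and K: "0 <= K"
    and w: "cmod (fst (fst w) - (1 - of_nat N * a * s) * fst (fst v)) <= K * cmod s * (norm (snd (fst v)) + t * (cmod (fst (fst v)) + norm (snd v)))"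
      "norm (snd (fst w) - (snd (fst v) + s *\<^sub>C (B *v snd (fst v)))) <= K * (cmod s * t) * (cmod (fst (fst v)) + norm (snd (fst v)) + t * norm (snd v))"
      "norm (snd w - snd v) <= K * cmod s * (cmod (fst (fst v)) + norm (snd (fst v)) + t * norm (snd v))"
    and kp: "0 < kp" "kp <= 1" "16 * kp * K <= ep" "4 * t * ((2 * C ^ 2 + 4 * K) * (Cn + 1) + K) <= ep * kp"
  shows "wnorm kp nrm s m M t (v - precond N a B s w) <= ep * cmod s * wnorm kp nrm s m M t v"
proof -
  define dx where "dx = cmod (fst (fst v))"
  define dy where "dy = norm (snd (fst v))"
  define dt where "dt = norm (snd v)"
  have d0: "0 <= dx" "0 <= dy" "0 <= dt" by (auto simp: dx_def dy_def dt_def)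
  have C0: "0 <= C" using C(1) by linarith
  have "C <= C ^ 2" using power_increasing[of 1 2 C] C(1) by simp
  then have "t * C <= t * C ^ 2" by (rule mult_left_mono[OF _ t(1)])
  then have Ct: "C * t <= 1" using t(4) by (simp add: mult.commute)
  define X where "X = cmod (fst (fst (v - precond N a B s w)))"
  define Y where "Y = norm (snd (fst (v - precond N a B s w)))"
  define T where "T = norm (snd (v - precond N a B s w))"
  have X: "X <= C ^ 2 * t * cmod s * dx + 2 * (K * cmod s * (dy + t * (dx + dt)))"
    using self_x[OF C(4) C0 t(3) Ct, of "fst (fst v)" "fst (fst w) - (1 - of_nat N * a * s) * fst (fst v)"] w(1)
    unfolding X_def precond_def dx_def dy_def dt_def by simp
  have Y: "Y <= C ^ 2 * t * cmod s * dy + 2 * (K * (cmod s * t) * (dx + dy + t * dt))"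
    using self_y[OF C(2) C0 t(3) Ct, of "snd (fst v)" "snd (fst w) - (snd (fst v) + s *\<^sub>C (B *v snd (fst v)))"] w(2)
    unfolding Y_def precond_def dx_def dy_def dt_def by simp
  have T: "T <= K * cmod s * (dx + dy + t * dt)"
    using w(3) by (simp add: T_def precond_def dx_def dy_def dt_def norm_minus_commute)
  note bnd = wnorm_bounds[OF nrm C(1,5,3) t(3,4) kp(1)]
  define G where "G = 2 * C ^ 2 + 4 * K"
  have G0: "0 <= G" using K by (simp add: G_def)
  have tH: "4 * (t * (G * (Cn + 1) + K)) <= ep * kp" using kp(4) by (simp add: G_def mult.assoc)
  have H0: "0 <= t * (G * (Cn + 1) + K)" using t G0 Cn K by auto
  have epkp: "ep * kp <= ep" "0 <= ep" using kp K
    by (metis mult.commute mult_left_le mult_nonneg_nonneg order_trans less_imp_le zero_le_numeral)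
       (meson kp(1,3) K mult_nonneg_nonneg order_trans less_imp_le zero_le_numeral)
  \<comment> \<open>The \<open>x\<close> increment is only counted with weight
    \<open>kp / 2\<close>, so its coefficient must be small against \<open>kp\<close>; every summand
    carries \<open>t\<close>, and smallness of the radius suffices.\<close>
  have Cx: "kp * (2 * C ^ 2 * t + 4 * K * t) + 4 * Cn * K * t + t * K <= ep * kp / 2"
  proof -
    have "kp * (G * t) <= 1 * (G * t)" using kp G0 t by (intro mult_right_mono) auto
    moreover have "4 * Cn * K * t <= Cn * G * t" using Cn t by (simp add: G_def algebra_simps)
    moreover have "t * (G * (Cn + 1) + K) = Cn * G * t + G * t + t * K" by (simp add: algebra_simps)
    moreover have "kp * (2 * C ^ 2 * t + 4 * K * t) = kp * (G * t)" by (simp add: G_def algebra_simps)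
    ultimately show ?thesis using tH H0 by linarith
  qed
  \<comment> \<open>The summand \<open>4 * (kp * K)\<close> comes from \<open>y\<close> entering the
    \<open>x\<close> component and carries no factor \<open>t\<close>: it is small only because
    \<open>kp\<close> is.\<close>
  have Cy: "4 * (kp * K) + Cn * (2 * C ^ 2 * t + 4 * K * t) + t * K <= ep / 2"
  proof -
    have "Cn * (2 * C ^ 2 * t + 4 * K * t) = Cn * G * t" by (simp add: G_def algebra_simps)
    moreover have "t * (G * (Cn + 1) + K) = Cn * G * t + G * t + t * K" by (simp add: algebra_simps)
    moreover have "0 <= G * t" using G0 t by simp
    moreover have "16 * (kp * K) <= ep" using kp(3) by simp
    ultimately show ?thesis using tH epkp by linarith
  qed
  have Ct: "4 * (kp * K) + 4 * Cn * K * t + t * K <= ep"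
  proof -
    have "4 * Cn * K * t <= Cn * (2 * C ^ 2 * t + 4 * K * t)" using Cn t by (simp add: algebra_simps)
    then show ?thesis using Cy epkp by linarith
  qed
  have "wnorm kp nrm s m M t (v - precond N a B s w) <= 2 * kp * X + 2 * Cn * Y + t * T"
    using bnd(6)[of "v - precond N a B s w"] unfolding X_def Y_def T_def by simp
  also have "... <= 2 * kp * (C ^ 2 * t * cmod s * dx + 2 * (K * cmod s * (dy + t * (dx + dt)))) +
    2 * Cn * (C ^ 2 * t * cmod s * dy + 2 * (K * (cmod s * t) * (dx + dy + t * dt))) + t * (K * cmod s * (dx + dy + t * dt))"
    using X Y T kp(1) Cn t(1) by (intro add_mono mult_left_mono) auto
  also have "... = cmod s * ((kp * (2 * C ^ 2 * t + 4 * K * t) + 4 * Cn * K * t + t * K) * dx +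
    (4 * (kp * K) + Cn * (2 * C ^ 2 * t + 4 * K * t) + t * K) * dy + (4 * (kp * K) + 4 * Cn * K * t + t * K) * (t * dt))"
    by (simp add: algebra_simps)
  also have "... <= cmod s * ((ep * kp / 2) * dx + (ep / 2) * dy + ep * (t * dt))"
    using d0 t by (intro mult_left_mono add_mono mult_right_mono Cx Cy Ct) auto
  also have "... = ep * cmod s * (kp * dx / 2 + dy / 2 + t * dt)" by (simp add: algebra_simps)
  also have "... <= ep * cmod s * wnorm kp nrm s m M t v"
    using bnd(5)[of v] epkp(2) unfolding dx_def dy_def dt_def by (intro mult_left_mono) auto
  finally show ?thesis .
qed

subsection \<open>Lifting torus-valued maps\<close>

text \<open>The representative shorter than \<open>1 / 4\<close> is unique. Near any point a local
  holomorphic representative, corrected by a lattice vector, is shorter than \<open>1 / 2\<close>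
  and therefore coincides with it; the same argument gives exact periodicity.\<close>

lemma lift_small:
  fixes g :: "'a::complex_normed_space \<times> ('d::finite, 'p::finite) angle_param => complex ^ 'd"
  assumes g: "analytic_torus_valued D g" and small: "!!z. z \<in> D ==> torus_norm (g z) < 1 / 4"
  shows "\<exists>h. analytic_fun D h & (\<forall>z\<in>D. h z \<doteq> g z & norm (h z) = torus_norm (g z))"
proof -
  have "\<forall>z. \<exists>k. z \<in> D --> k \<in> lattice_pts & norm (g z - k) < 1 / 4"
    using torus_norm_attained[OF small] by metis
  then obtain k where k: "!!z. z \<in> D ==> k z \<in> lattice_pts" "!!z. z \<in> D ==> norm (g z - k z) < 1 / 4"
    unfolding choice_iff by blast
  define h where "h z = g z - k z" for z
  have hg: "h z \<doteq> g z" if "z \<in> D" for z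
    using k(1)[OF that] lattice_minus by (simp add: torus_eq_def h_def)
  have hn: "norm (h z) < 1 / 4" if "z \<in> D" for z using k(2)[OF that] by (simp add: h_def)
  have ht: "norm (h z) = torus_norm (g z)" if "z \<in> D" for z
    using torus_norm_small[of "h z"] torus_norm_cong[OF hg[OF that]] hn[OF that] by simp
  have D: "torus_domain D" using g by (simp add: analytic_torus_valued_def)
  have "h cholomorphic_on D"
  proof (rule chol_locally)
    fix z assume z: "z \<in> D"
    then obtain V f where V: "z \<in> V" "V \<subseteq> D" "f cholomorphic_on V" "!!w. w \<in> V ==> g w \<doteq> f w"
      using g unfolding analytic_torus_valued_def by metis
    define l where "l = f z - h z"
    have "f z \<doteq> h z" using torus_eq_sym[OF torus_eq_trans[OF hg[OF z] V(4)[OF V(1)]]] .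
    then have l: "l \<in> lattice_pts" by (simp add: torus_eq_def l_def)
    have V0: "open V" using V(3) by (rule chol_open)
    \<comment> \<open>On this neighbourhood the corrected local representative remains short enough
      for uniqueness.\<close>
    define V' where "V' = V \<inter> (%w. f w - l) -` ball 0 (1 / 2)"
    have "(%w. f w - l) cholomorphic_on V" using V(3) V0 by (intro cholomorphic_intros)
    then have fl: "(%w. f w - l) cholomorphic_on V" .
    have oV: "open V'"
      unfolding V'_def by (rule continuous_open_preimage[OF chol_imp_continuous_on[OF fl] V0]) simp
    have zV: "z \<in> V'" using V(1) hn[OF z] by (simp add: V'_def l_def)
    have eq: "f w - l = h w" if w: "w \<in> V'" for w
    proof (rule small_torus_eq)
      have wV: "w \<in> V" "norm (f w - l) < 1 / 2" using w by (auto simp: V'_def)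
      show "norm (f w - l) < 1 / 2" by (fact wV)
      show "norm (h w) < 1 / 2" using hn[of w] wV V by auto
      have "f w \<doteq> h w" using torus_eq_sym[OF torus_eq_trans[OF hg V(4)[OF wV(1)]]] wV V by blast
      moreover have "l \<doteq> 0" using l by (simp add: torus_eq_def)
      ultimately have "f w - l \<doteq> h w - 0" by (rule torus_eq_diff)
      then show "f w - l \<doteq> h w" by simp
    qed
    have "(%w. f w - l) cholomorphic_on V'" by (rule chol_subset[OF fl oV]) (auto simp: V'_def)
    then have "h cholomorphic_on V'" using eq by (rule chol_transform)
    then show "\<exists>V. z \<in> V & V \<subseteq> D & h cholomorphic_on V" using zV V by (intro exI[of _ V']) (auto simp: V'_def)
  qed
  moreover have "h (u, th + l, mu) = h (u, th, mu)" if z: "(u, th, mu) \<in> D" and l: "l \<in> lattice_pts" for u th mu l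
  proof (rule small_torus_eq)
    have z': "(u, th + l, mu) \<in> D" using D z l by (auto simp: torus_domain_def)
    have "g (u, th + l, mu) \<doteq> g (u, th, mu)" using g z l by (auto simp: analytic_torus_valued_def)
    then show "h (u, th + l, mu) \<doteq> h (u, th, mu)"
      using hg[OF z'] torus_eq_sym[OF hg[OF z]] by (blast intro: torus_eq_trans)
    show "norm (h (u, th + l, mu)) < 1 / 2" "norm (h (u, th, mu)) < 1 / 2" using hn[OF z] hn[OF z'] by auto
  qed
  ultimately have "analytic_fun D h" using D by (auto simp: analytic_fun_def)
  then show ?thesis using hg ht by (intro exI[of _ h]) auto
qed

subsection \<open>The map near the invariant torus\<close>

text \<open>\<open>v\<close> is an increment and \<open>w\<close> its image. The factors
  \<open>t\<close> record the couplings: in the first line the \<open>y\<close> increment alone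
  lacks one, while the third line is multiplied by \<open>t\<close> in the weighted norm.\<close>

definition near_linear :: "nat => complex => complex ^ 'm ^ 'm => complex => real => real => ('m::finite, 'd::finite) xy_angle => ('m, 'd) xy_angle => bool"
  where "near_linear N a B s t K v w \<longleftrightarrow>
    cmod (fst (fst w) - (1 - of_nat N * a * s) * fst (fst v)) <= K * cmod s * (norm (snd (fst v)) + t * (cmod (fst (fst v)) + norm (snd v))) &
    norm (snd (fst w) - (snd (fst v) + s *\<^sub>C (B *v snd (fst v)))) <= K * (cmod s * t) * (cmod (fst (fst v)) + norm (snd (fst v)) + t * norm (snd v)) &
    norm (snd w - snd v) <= K * cmod s * (cmod (fst (fst v)) + norm (snd (fst v)) + t * norm (snd v))"

locale map_data =
  fixes N P :: nat and sg0 :: real and LC :: "(complex ^ 'p::finite) set"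
    and W :: "('m::finite xy \<times> ('d::finite, 'p) angle_param) set"
    and a :: "('d, 'p) angle_param => complex"
    and B :: "('d, 'p) angle_param => complex ^ 'm ^ 'm"
    and fN fR :: "'m xy \<times> ('d, 'p) angle_param => complex"
    and gN gR :: "'m xy \<times> ('d, 'p) angle_param => complex ^ 'm"
    and hP hR :: "'m xy \<times> ('d, 'p) angle_param => complex ^ 'd"
  assumes NP: "N >= 2" "P >= N" and LC: "open LC" and torus_W: "torus_domain W"
    and W: "W \<subseteq> UNIV \<times> strip sg0 \<times> LC" "{0} \<times> strip sg0 \<times> LC \<subseteq> W"
    and coeffs: "analytic_coeff sg0 LC a" "analytic_coeff sg0 LC B"
    and polys: "homogeneous_poly sg0 LC N fN" "homogeneous_poly sg0 LC N gN" "homogeneous_poly sg0 LC P hP"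
    and fN_0: "!!x th mu. th \<in> strip sg0 ==> mu \<in> LC ==> fN ((x, 0), th, mu) = 0"
    and gN_0: "!!x th mu. th \<in> strip sg0 ==> mu \<in> LC ==> gN ((x, 0), th, mu) = 0"
    and DgN_0: "!!x th mu. th \<in> strip sg0 ==> mu \<in> LC ==> ((%y. gN ((x, y), th, mu)) has_derivative (%_. 0)) (at 0)"
    and remainders: "analytic_fun W fR" "analytic_fun W gR" "analytic_fun W hR"
    and fR_0: "!!th mu. th \<in> strip sg0 ==> mu \<in> LC ==> vanishes_to_order N fR (th, mu)"
    and gR_0: "!!i th mu. th \<in> strip sg0 ==> mu \<in> LC ==> vanishes_to_order N (%z. gR z $ i) (th, mu)"
    and hR_0: "!!i th mu. th \<in> strip sg0 ==> mu \<in> LC ==> vanishes_to_order P (%z. hR z $ i) (th, mu)"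
begin

text \<open>The angle component omits \<open>\<theta> + \<omega>\<close>, which makes it
  vector-valued and exactly periodic; the rotation is restored in the equation for the
  correction.\<close>

definition Fl :: "'m xy \<times> ('d, 'p) angle_param => ('m, 'd) xy_angle"
  where "Fl = (%(u, q). ((fst u - a q * fst u ^ N + fN (u, q) + fR (u, q),
      snd u + fst u ^ (N - 1) *\<^sub>C (B q *v snd u) + gN (u, q) + gR (u, q)), hP (u, q) + hR (u, q)))"

lemma Fl_cholomorphic: "Fl cholomorphic_on W"
proof -
  have oW: "open W" using torus_W by (simp add: torus_domain_def)
  have q: "(%z :: 'm xy \<times> ('d, 'p) angle_param. f (snd z)) cholomorphic_on W" if "analytic_coeff sg0 LC f"
    for f :: "('d, 'p) angle_param => 'c::complex_normed_space"
    using that W(1) oW unfolding analytic_coeff_def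
    by (intro chol_compose[of snd W f "strip sg0 \<times> LC"] cholomorphic_intros) auto
  have h: "f cholomorphic_on W" if "homogeneous_poly sg0 LC n f"
    for f :: "'m xy \<times> ('d, 'p) angle_param => 'c::complex_normed_space" and n
    using homogeneous_cholomorphic[OF that LC] W(1) oW unfolding analytic_fun_def by (blast intro: chol_subset)
  have r: "fR cholomorphic_on W" "gR cholomorphic_on W" "hR cholomorphic_on W" using remainders by (simp_all add: analytic_fun_def)
  have "(%z. ((fst (fst z) - a (snd z) * fst (fst z) ^ N + fN z + fR z,
      snd (fst z) + fst (fst z) ^ (N - 1) *\<^sub>C (B (snd z) *v snd (fst z)) + gN z + gR z), hP z + hR z)) cholomorphic_on W"
    by (intro cholomorphic_intros oW q coeffs h[OF polys(1)] h[OF polys(2)] h[OF polys(3)] r)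
  then show ?thesis by (simp add: Fl_def split_def)
qed

lemma Fl_periodic: "(u, th, mu) \<in> W ==> k \<in> lattice_pts ==> Fl (u, th + k, mu) = Fl (u, th, mu)"
proof -
  assume z: "(u, th, mu) \<in> W" and k: "k \<in> lattice_pts"
  have s: "th \<in> strip sg0" "mu \<in> LC" using z W(1) by auto
  have h: "f (u, th + k, mu) = f (u, th, mu)" if "homogeneous_poly sg0 LC n f"
    for f :: "'m xy \<times> ('d, 'p) angle_param => 'c::complex_normed_space" and n
    using homogeneous_cholomorphic[OF that LC] s k unfolding analytic_fun_def by blast
  have r: "f (u, th + k, mu) = f (u, th, mu)" if "analytic_fun W f"
    for f :: "'m xy \<times> ('d, 'p) angle_param => 'c::complex_normed_space"
    using that z k unfolding analytic_fun_def by blast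
  have c: "f (th + k, mu) = f (th, mu)" if "analytic_coeff sg0 LC f"
    for f :: "('d, 'p) angle_param => 'c::complex_normed_space"
    using that s k unfolding analytic_coeff_def by blast
  show ?thesis
    unfolding Fl_def prod.case h[OF polys(1)] h[OF polys(2)] h[OF polys(3)] r[OF remainders(1)] r[OF remainders(2)]
      r[OF remainders(3)] c[OF coeffs(1)] c[OF coeffs(2)] by (rule refl)
qed

lemma Fl_tube: 
  assumes sg1: "sg1 < sg0" and L: "compact L" "L \<subseteq> LC"
  shows "\<exists>r>0. cball 0 r \<times> cstrip sg1 \<times> L \<subseteq> W"
proof (rule tube_subset[OF torus_W _ L(1)])
  show "{0} \<times> cstrip sg1 \<times> L \<subseteq> W" using W(2) L(2) cstrip_subset_strip[OF sg1] by blast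
qed

text \<open>Smallness of the angle displacement, so that the lifted equation stays in the range
  where representatives are unique.\<close>

lemma angle_bound:
  assumes sg1: "sg1 < sg0" and L: "compact L" "L \<subseteq> LC"
  shows "\<exists>M r. 0 < M & 0 < r & (\<forall>u. norm u < r --> (\<forall>th\<in>cstrip sg1. \<forall>mu\<in>L. norm (snd (Fl (u, th, mu))) <= M * norm u))"
proof -
  obtain r where r: "r > 0" "cball 0 r \<times> cstrip sg1 \<times> L \<subseteq> W" using Fl_tube[OF assms] by blast
  obtain M where M: "M > 0" "!!u th mu. th \<in> cstrip sg1 ==> mu \<in> L ==> norm (hP (u, th, mu)) <= M * norm u ^ P"
    using homogeneous_bound[OF polys(3) LC sg1 L] by auto
  have "\<forall>i. \<exists>M>0. \<forall>u. norm u < r --> (\<forall>th\<in>cstrip sg1. \<forall>mu\<in>L. cmod (hR (u, th, mu) $ i) <= M * norm u ^ Suc P)"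
    using hR_0 cstrip_subset_strip[OF sg1] L(2)
    by (intro allI remainder_bound[OF analytic_fun_nth[OF remainders(3)] _ r(2) L(1) r(1)]) blast
  then obtain m where m: "!!i. m i > 0" "!!i u th mu. norm u < r ==> th \<in> cstrip sg1 ==> mu \<in> L ==> cmod (hR (u, th, mu) $ i) <= m i * norm u ^ Suc P"
    unfolding choice_iff by blast
  define K where "K = M + (\<Sum>i\<in>UNIV. m i)"
  have s0: "0 <= (\<Sum>i\<in>UNIV. m i)" using m(1) by (intro sum_nonneg) (auto simp: less_imp_le)
  have "norm (snd (Fl (u, th, mu))) <= K * norm u" if u: "norm u < min r 1" "th \<in> cstrip sg1" "mu \<in> L" for u th mu
  proof -
    have p: "norm u ^ P <= norm u" "norm u ^ Suc P <= norm u"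
      using power_decreasing[of 1 P "norm u"] power_decreasing[of 1 "Suc P" "norm u"] u NP by auto
    have "norm (hP (u, th, mu)) <= M * norm u"
      using M(2)[OF u(2,3), of u] mult_left_mono[OF p(1), of M] M(1) by linarith
    moreover have "norm (hR (u, th, mu)) <= (\<Sum>i\<in>UNIV. m i * norm u)"
    proof (rule order_trans[OF norm_vec_le_sum sum_mono])
      fix i
      show "norm (hR (u, th, mu) $ i) <= m i * norm u"
        using order_trans[OF m(2)[of u th mu i] mult_left_mono[OF p(2), of "m i"]] u m(1)[of i] by simp
    qed
    moreover have "(\<Sum>i\<in>UNIV. m i * norm u) = (\<Sum>i\<in>UNIV. m i) * norm u" by (simp add: sum_distrib_right)
    ultimately have "norm (hP (u, th, mu) + hR (u, th, mu)) <= M * norm u + (\<Sum>i\<in>UNIV. m i) * norm u"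
      by (intro order_trans[OF norm_triangle_ineq] add_mono) auto
    then show ?thesis by (simp add: Fl_def K_def distrib_right)
  qed
  moreover have "K > 0" "min r 1 > 0" using M(1) s0 r(1) by (auto simp: K_def)
  ultimately show ?thesis by (intro exI[of _ K] exI[of _ "min r 1"]) blast
qed

text \<open>The diagonal part comes from \<open>a\<close> and \<open>B\<close>; all other terms
  contribute through their thin Lipschitz exponents, with coefficients frozen at the angle
  \<open>th\<close>, which may differ from the points compared by order \<open>|x|\<close>.\<close>

lemma increments:
  assumes sg1: "sg1 < sg0" and L: "compact L" "L \<subseteq> LC" and C0: "1 <= C0"
  shows "\<exists>K x0. 0 < K & 0 < x0 & (\<forall>x u1 u2 th th1 th2 mu. 0 < cmod x --> cmod x < x0 --> thin C0 x u1 --> thin C0 x u2 -->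
    th \<in> cstrip sg1 --> th1 \<in> cstrip sg1 --> th2 \<in> cstrip sg1 --> norm (th2 - th) <= C0 * cmod x --> mu \<in> L -->
    near_linear N (a (th, mu)) (B (th, mu)) (x ^ (N - 1)) (cmod x) K (u1 - u2, th1 - th2)
      (Fl (u1, th1, mu) - Fl (u2, th2, mu) + (0, th1 - th2)))"
proof -
  have C0': "0 <= C0" using C0 by linarith
  have W2: "{0} \<times> strip sg0 \<times> L \<subseteq> W" using W(2) L(2) by blast
  have N1: "1 <= N" "1 <= P" using NP by auto
  \<comment> \<open>\<open>fN\<close> vanishes at \<open>y = 0\<close>, hence \<open>j = 1\<close>:
    exponent \<open>N\<close> in \<open>x\<close>, but only \<open>N - 1\<close> in
    \<open>y\<close>. This is the coupling that \<open>kp\<close> controls.\<close>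
  have p1: "thin_lipschitz sg1 L C0 (N + 1 - 1) (N + 1 * (1 - 1) - 1) (N + 1) fN"
    using fN_0 N1 by (intro homogeneous_thin_lipschitz[OF polys(1) LC sg1 L C0]) auto
  have p2: "thin_lipschitz sg1 L C0 N N (Suc N) fR"
    using fR_0 L(2) by (intro remainder_thin_lipschitz[OF remainders(1) _ torus_W W2 sg1 L(1) C0]) blast
  have p: "thin_lipschitz sg1 L C0 N (N - 1) N (%z. fN z + fR z)"
    by (intro thin_lipschitz_add thin_lipschitz_weaken[OF p1] thin_lipschitz_weaken[OF p2]) auto
  have q: "thin_lipschitz sg1 L C0 N N (Suc N) (%z. gN z + gR z)"
  proof (rule thin_lipschitz_vec)
    fix i
    \<comment> \<open>\<open>gN\<close> vanishes to second order in \<open>y\<close>. The thinner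
      disc \<open>e = 2\<close> gives exponent \<open>N\<close> in \<open>y\<close>, where
      \<open>e = 1\<close> would give \<open>N - 1\<close>.\<close>
    have "thin_lipschitz sg1 L C0 (N + 2 - 1) (N + 2 * (2 - 1) - 2) (N + 2) (%z. gN z $ i)"
    proof (rule homogeneous_thin_lipschitz[OF homogeneous_nth[OF polys(2)] LC sg1 L C0 N1(1)])
      show "2 = 0 \<or> (\<forall>x. \<forall>th\<in>strip sg0. \<forall>mu\<in>LC. gN ((x, 0), th, mu) $ i = 0)" using gN_0 by simp
      have "((%y. gN ((x, y), th, mu) $ i) has_derivative (%_. 0)) (at 0)" if "th \<in> strip sg0" "mu \<in> LC" for x th mu
        using bounded_linear.has_derivative[OF bounded_linear_vec_nth DgN_0[OF that, of x], of i] by simp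
      then show "(2::nat) <= 1 \<or> 2 = 2 & (\<forall>x. \<forall>th\<in>strip sg0. \<forall>mu\<in>LC. ((%y. gN ((x, y), th, mu) $ i) has_derivative (%_. 0)) (at 0))" by simp
    qed auto
    then have 1: "thin_lipschitz sg1 L C0 N N (Suc N) (%z. gN z $ i)" by (rule thin_lipschitz_weaken) auto
    have 2: "thin_lipschitz sg1 L C0 N N (Suc N) (%z. gR z $ i)"
      using gR_0 L(2) by (intro remainder_thin_lipschitz[OF analytic_fun_nth[OF remainders(2)] _ torus_W W2 sg1 L(1) C0]) blast
    show "thin_lipschitz sg1 L C0 N N (Suc N) (%z. (gN z + gR z) $ i)"
      using thin_lipschitz_add[OF 1 2] by simp
  qed
  have h: "thin_lipschitz sg1 L C0 (N - 1) (N - 1) N (%z. hP z + hR z)"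
  proof (rule thin_lipschitz_vec)
    fix i
    have "thin_lipschitz sg1 L C0 (P + 0 - 1) (P + 0 * (1 - 1) - 1) (P + 0) (%z. hP z $ i)"
      using N1 by (intro homogeneous_thin_lipschitz[OF homogeneous_nth[OF polys(3)] LC sg1 L C0]) auto
    then have 1: "thin_lipschitz sg1 L C0 (N - 1) (N - 1) N (%z. hP z $ i)" by (rule thin_lipschitz_weaken) (use NP in auto)
    have "thin_lipschitz sg1 L C0 P P (Suc P) (%z. hR z $ i)"
      using hR_0 L(2) by (intro remainder_thin_lipschitz[OF analytic_fun_nth[OF remainders(3)] _ torus_W W2 sg1 L(1) C0]) blast
    then have 2: "thin_lipschitz sg1 L C0 (N - 1) (N - 1) N (%z. hR z $ i)" by (rule thin_lipschitz_weaken) (use NP in auto)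
    show "thin_lipschitz sg1 L C0 (N - 1) (N - 1) N (%z. (hP z + hR z) $ i)"
      using thin_lipschitz_add[OF 1 2] by simp
  qed
  obtain K1 x1 where K1: "K1 > 0" "x1 > 0" "!!x u1 u2 th1 th2 mu. 0 < cmod x ==> cmod x < x1 ==> thin C0 x u1 ==> thin C0 x u2 ==> th1 \<in> cstrip sg1 ==> th2 \<in> cstrip sg1 ==> mu \<in> L ==>
    norm ((fN (u1, th1, mu) + fR (u1, th1, mu)) - (fN (u2, th2, mu) + fR (u2, th2, mu))) <= K1 * (cmod x ^ N * cmod (fst u1 - fst u2) +
      cmod x ^ (N - 1) * norm (snd u1 - snd u2) + cmod x ^ N * norm (th1 - th2))"
    using p unfolding thin_lipschitz_def by auto
  obtain K2 x2 where K2: "K2 > 0" "x2 > 0" "!!x u1 u2 th1 th2 mu. 0 < cmod x ==> cmod x < x2 ==> thin C0 x u1 ==> thin C0 x u2 ==> th1 \<in> cstrip sg1 ==> th2 \<in> cstrip sg1 ==> mu \<in> L ==>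
    norm ((gN (u1, th1, mu) + gR (u1, th1, mu)) - (gN (u2, th2, mu) + gR (u2, th2, mu))) <= K2 * (cmod x ^ N * cmod (fst u1 - fst u2) +
      cmod x ^ N * norm (snd u1 - snd u2) + cmod x ^ Suc N * norm (th1 - th2))"
    using q unfolding thin_lipschitz_def by auto
  obtain K3 x3 where K3: "K3 > 0" "x3 > 0" "!!x u1 u2 th1 th2 mu. 0 < cmod x ==> cmod x < x3 ==> thin C0 x u1 ==> thin C0 x u2 ==> th1 \<in> cstrip sg1 ==> th2 \<in> cstrip sg1 ==> mu \<in> L ==>
    norm ((hP (u1, th1, mu) + hR (u1, th1, mu)) - (hP (u2, th2, mu) + hR (u2, th2, mu))) <= K3 * (cmod x ^ (N - 1) * cmod (fst u1 - fst u2) +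
      cmod x ^ (N - 1) * norm (snd u1 - snd u2) + cmod x ^ N * norm (th1 - th2))"
    using h unfolding thin_lipschitz_def by auto
  obtain Ma where Ma: "Ma > 0" "!!th mu. th \<in> cstrip sg1 ==> mu \<in> L ==> cmod (a (th, mu)) <= Ma"
    using coeff_bounded[OF coeffs(1) LC sg1 L] by auto
  obtain Mb where Mb: "Mb > 0" "!!th th' mu. th \<in> cstrip sg1 ==> th' \<in> cstrip sg1 ==> mu \<in> L ==> cmod (a (th, mu) - a (th', mu)) <= Mb * norm (th - th')"
    using coeff_lipschitz[OF coeffs(1) LC sg1 L] by auto
  define n where "n = real CARD('m) * real CARD('m)"
  have n0: "0 <= n" by (simp add: n_def)
  obtain Mc where Mc: "Mc > 0" "!!th mu. th \<in> cstrip sg1 ==> mu \<in> L ==> norm (B (th, mu)) <= Mc"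
    using coeff_bounded[OF coeffs(2) LC sg1 L] by auto
  obtain Md where Md: "Md > 0" "!!th th' mu. th \<in> cstrip sg1 ==> th' \<in> cstrip sg1 ==> mu \<in> L ==> norm (B (th, mu) - B (th', mu)) <= Md * norm (th - th')"
    using coeff_lipschitz_matrix[OF coeffs(2) LC sg1 L] by auto
  define M where "M = Ma + Mb + n * (Mc + Md)"
  have "0 <= n * Mc" "0 <= n * Md" using n0 Mc(1) Md(1) by auto
  then have Mge: "Ma <= M" "Mb <= M" "n * Mc <= M" "n * Md <= M" "0 <= M"
    using Ma(1) Mb(1) unfolding M_def distrib_left by linarith+
  define Ka where "Ka = M * 2 ^ N + M * C0 * (real N * 2 ^ (N - 1)) + M * (real N * (real (N - 1) * 2 ^ (N - 2) * C0))"
  define Kb where "Kb = 2 * (real (N - 1) * 2 ^ (N - 2) * (M * C0)) + 2 ^ (N - 1) * (M * C0) + M * C0"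
  have Kab: "0 <= Ka" "0 <= Kb" using Mge C0' by (auto simp: Ka_def Kb_def)
  define K where "K = Ka + Kb + K1 + K2 + K3"
  define x0 where "x0 = min (min x1 x2) (min x3 (min 1 (1 / C0)))"
  have K: "0 < K" "Ka + K1 <= K" "Kb + K2 <= K" "K3 <= K" using Kab K1(1) K2(1) K3(1) by (auto simp: K_def)
  have x0: "0 < x0" using K1(2) K2(2) K3(2) C0 by (auto simp: x0_def)
  have "near_linear N (a (th, mu)) (B (th, mu)) (x ^ (N - 1)) (cmod x) K (u1 - u2, th1 - th2)
      (Fl (u1, th1, mu) - Fl (u2, th2, mu) + (0, th1 - th2))"
    if x: "0 < cmod x" "cmod x < x0" and u: "thin C0 x u1" "thin C0 x u2" and th: "th \<in> cstrip sg1" "th1 \<in> cstrip sg1" "th2 \<in> cstrip sg1"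
      "norm (th2 - th) <= C0 * cmod x" and mu: "mu \<in> L" for x u1 u2 th th1 th2 mu
  proof -
    let ?s = "x ^ (N - 1)" and ?t = "cmod x"
    define dx where "dx = cmod (fst u1 - fst u2)"
    define dy where "dy = norm (snd u1 - snd u2)"
    define dt where "dt = norm (th1 - th2)"
    have d0: "0 <= dx" "0 <= dy" "0 <= dt" by (auto simp: dx_def dy_def dt_def)
    have xs: "?t < x1" "?t < x2" "?t < x3" "?t <= 1" "?t < 1 / C0" using x by (auto simp: x0_def)
    have Cx: "C0 * ?t <= 1" using xs(5) C0 by (simp add: field_simps)
    have tN: "?t ^ N = ?t ^ (N - 1) * ?t" using N1(1) by (metis Suc_diff_1 less_le_trans zero_less_one power_Suc2)
    have thn: "cmod (fst u1 - x) <= C0 * ?t ^ 2" "cmod (fst u2 - x) <= C0 * ?t ^ 2" "norm (snd u1) <= C0 * ?t ^ 2"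
      using u by (auto simp: thin_def)
    have a1: "cmod (a (th, mu)) <= M" using Ma(2)[OF th(1) mu] Mge by linarith
    have a2: "cmod (a (th1, mu) - a (th2, mu)) <= M * dt"
      using Mb(2)[OF th(2,3) mu] mult_right_mono[OF Mge(2) d0(3)] unfolding dt_def by linarith
    have a3: "cmod (a (th2, mu) - a (th, mu)) <= M * (C0 * ?t)"
      using Mb(2)[OF th(3,1) mu] mult_mono[OF Mge(2) th(4)] Mge(5) by (smt (verit) norm_ge_zero)
    have AI: "cmod (a (th1, mu) * fst u1 ^ N - a (th2, mu) * fst u2 ^ N - of_nat N * a (th, mu) * ?s * (fst u1 - fst u2)) <= Ka * ?t ^ N * (dx + dt)"
      unfolding Ka_def dx_def by (rule a_increment[OF NP(1) C0' Cx xs(4) thn(1,2) Mge(5) a1 a2 a3 d0(3)])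
    have mv: "norm (A *v v) <= n * norm A * norm v" for A :: "complex ^ 'm ^ 'm" and v
      using norm_matrix_vector_le[of A v] by (simp add: n_def)
    have mv': "norm (A *v v) <= M * c * norm v" if "norm A <= m * c" "0 <= c" "n * m <= M" for A :: "complex ^ 'm ^ 'm" and v m c
    proof -
      have "n * norm A <= n * (m * c)" by (intro mult_left_mono n0 that)
      also have "... <= M * c" using mult_right_mono[OF that(3,2)] by (simp add: mult.assoc)
      finally show ?thesis using mv[of A v] mult_right_mono[of "n * norm A" "M * c" "norm v"] by simp
    qed
    have b1: "norm (B (th', mu) *v v) <= M * norm v" if "th' \<in> cstrip sg1" for th' v
      using mv'[of "B (th', mu)" Mc 1 v] Mc(2)[OF that mu] Mge by simp
    have b2: "norm (B (th1, mu) *v v - B (th2, mu) *v v) <= M * dt * norm v" for v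
      unfolding matrix_vector_mult_diff_rdistrib[symmetric] using Md(2)[OF th(2,3) mu] d0 Mge by (intro mv'[where m=Md]) (auto simp: dt_def)
    have b3: "norm (B (th2, mu) *v v - B (th, mu) *v v) <= M * (C0 * ?t) * norm v" for v
      unfolding matrix_vector_mult_diff_rdistrib[symmetric]
    proof (rule mv')
      show "norm (B (th2, mu) - B (th, mu)) <= Md * (C0 * ?t)"
        using Md(2)[OF th(3,1) mu] mult_left_mono[OF th(4), of Md] Md(1) by linarith
    qed (use C0' Mge in auto)
    have BI: "norm (fst u1 ^ (N - 1) *\<^sub>C (B (th1, mu) *v snd u1) - fst u2 ^ (N - 1) *\<^sub>C (B (th2, mu) *v snd u2) - ?s *\<^sub>C (B (th, mu) *v (snd u1 - snd u2)))
      <= Kb * ?t ^ N * (dx + dy + ?t * dt)"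
      unfolding Kb_def dx_def dy_def by (rule B_increment[OF NP(1) C0' Cx xs(4) thn Mge(5) b1[OF th(2)] b1[OF th(3)] b2 b3 d0(3)])
    note PI = K1(3)[OF x(1) xs(1) u th(2,3) mu, folded dx_def dy_def dt_def]
    note QI = K2(3)[OF x(1) xs(2) u th(2,3) mu, folded dx_def dy_def dt_def]
    note HI = K3(3)[OF x(1) xs(3) u th(2,3) mu, folded dx_def dy_def dt_def]
    define T where "T = ?t ^ (N - 1)"
    have T0: "0 <= T" by (simp add: T_def)
    have sT: "cmod ?s = T" by (simp add: T_def norm_power)
    have t0: "0 <= ?t" by simp
    have pos: "0 <= T * ?t * dx" "0 <= T * ?t * dt" "0 <= T * dy" "0 <= T * ?t * dy" "0 <= T * dx" "0 <= T * ?t * ?t * dt"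
      using T0 t0 d0 by auto
    let ?w = "Fl (u1, th1, mu) - Fl (u2, th2, mu) + (0, th1 - th2)"
    have X: "cmod (fst (fst ?w) - (1 - of_nat N * a (th, mu) * ?s) * (fst u1 - fst u2)) <= K * T * (dy + ?t * (dx + dt))"
    proof -
      have eq: "fst (fst ?w) - (1 - of_nat N * a (th, mu) * ?s) * (fst u1 - fst u2) =
        ((fN (u1, th1, mu) + fR (u1, th1, mu)) - (fN (u2, th2, mu) + fR (u2, th2, mu))) -
        (a (th1, mu) * fst u1 ^ N - a (th2, mu) * fst u2 ^ N - of_nat N * a (th, mu) * ?s * (fst u1 - fst u2))"
        by (simp add: Fl_def algebra_simps)
      have "cmod (fst (fst ?w) - (1 - of_nat N * a (th, mu) * ?s) * (fst u1 - fst u2)) \<le>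
        K1 * (?t ^ N * dx + ?t ^ (N - 1) * dy + ?t ^ N * dt) + Ka * ?t ^ N * (dx + dt)"
        unfolding eq by (rule order_trans[OF norm_triangle_ineq4 add_mono[OF PI AI]])
      also have "... = K1 * (T * dy) + (Ka + K1) * (T * ?t * dx + T * ?t * dt)" unfolding tN T_def[symmetric] by (simp add: algebra_simps)
      also have "... <= K * (T * dy) + K * (T * ?t * dx + T * ?t * dt)"
        using K Kab pos by (intro add_mono mult_right_mono) auto
      finally show ?thesis by (simp add: algebra_simps)
    qed
    have Y: "norm (snd (fst ?w) - ((snd u1 - snd u2) + ?s *\<^sub>C (B (th, mu) *v (snd u1 - snd u2)))) <= K * (T * ?t) * (dx + dy + ?t * dt)"
    proof -
      have eq: "snd (fst ?w) - ((snd u1 - snd u2) + ?s *\<^sub>C (B (th, mu) *v (snd u1 - snd u2))) =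
        ((gN (u1, th1, mu) + gR (u1, th1, mu)) - (gN (u2, th2, mu) + gR (u2, th2, mu))) +
        (fst u1 ^ (N - 1) *\<^sub>C (B (th1, mu) *v snd u1) - fst u2 ^ (N - 1) *\<^sub>C (B (th2, mu) *v snd u2) - ?s *\<^sub>C (B (th, mu) *v (snd u1 - snd u2)))"
        by (simp add: Fl_def algebra_simps)
      have "norm (snd (fst ?w) - ((snd u1 - snd u2) + ?s *\<^sub>C (B (th, mu) *v (snd u1 - snd u2)))) \<le>
        K2 * (?t ^ N * dx + ?t ^ N * dy + ?t ^ Suc N * dt) + Kb * ?t ^ N * (dx + dy + ?t * dt)"
        unfolding eq by (rule order_trans[OF norm_triangle_ineq add_mono[OF QI BI]])
      also have "... = (Kb + K2) * (T * ?t * dx + T * ?t * dy + T * ?t * ?t * dt)" unfolding power_Suc tN T_def[symmetric] by (simp add: algebra_simps)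
      also have "... <= K * (T * ?t * dx + T * ?t * dy + T * ?t * ?t * dt)"
        using K pos by (intro mult_right_mono) auto
      finally show ?thesis by (simp add: algebra_simps)
    qed
    have H: "norm (snd ?w - (th1 - th2)) <= K * T * (dx + dy + ?t * dt)"
    proof -
      have "snd ?w - (th1 - th2) = (hP (u1, th1, mu) + hR (u1, th1, mu)) - (hP (u2, th2, mu) + hR (u2, th2, mu))"
        by (simp add: Fl_def)
      then have "norm (snd ?w - (th1 - th2)) <= K3 * (?t ^ (N - 1) * dx + ?t ^ (N - 1) * dy + ?t ^ N * dt)" using HI by simp
      also have "... = K3 * (T * dx + T * dy + T * ?t * dt)" unfolding tN T_def[symmetric] by (simp add: algebra_simps)
      also have "... <= K * (T * dx + T * dy + T * ?t * dt)"
        using K pos by (intro mult_right_mono) auto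
      finally show ?thesis by (simp add: algebra_simps)
    qed
    show ?thesis
      unfolding near_linear_def sT using X Y H by (simp only: fst_conv snd_conv fst_diff snd_diff dx_def dy_def dt_def)
  qed
  then show ?thesis using K(1) x0 by (intro exI[of _ K] exI[of _ x0]) blast
qed

end

subsection \<open>The modified Newton iteration\<close>

text \<open>\<open>\<Phi> z d\<close> is the lifted difference between \<open>F\<close> at
  \<open>K + d\<close> and \<open>K\<close> at \<open>R z\<close>, so the equation reads
  \<open>\<Phi> z (u z) = u (rr z)\<close>. \<open>C\<close> bounds the coefficients,
  \<open>Cn\<close> compares the adapted norm with the given one, \<open>K\<close> measures the
  deviation from the linear part and \<open>CE\<close> the initial error. \<open>ep\<close> is the
  loss allowed against \<open>al0\<close>, and \<open>ep'\<close> the accuracy of the averaging. The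
  invariance \<open>step\<close> covers all smaller radii because uniqueness is first established on
  a smaller sector.\<close>

locale averaging_iteration =
  fixes N Q :: nat and bt rh sg :: real and LC :: "(complex ^ 'p::finite) set" and om :: "real ^ 'd::finite"
    and rx :: "complex \<times> ('d, 'p) angle_param => complex"
    and \<Phi> :: "complex \<times> ('d, 'p) angle_param => ('m::finite, 'd) xy_angle => ('m, 'd) xy_angle"
    and a m :: "('d, 'p) angle_param => complex" and A :: "complex ^ 'p => complex"
    and B M :: "('d, 'p) angle_param => complex ^ 'm ^ 'm" and Ab :: "complex ^ 'p => complex ^ 'm ^ 'm"
    and nrm :: "complex ^ 'p => complex ^ 'm => real"
    and al0 ep ep' kp Cn C K CE :: real
  assumes NQ: "2 <= N" "N <= Q" and rh: "0 < rh" "rh <= 1"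
    and step: "!!x th mu rh'. rh' <= rh ==> x \<in> sector bt rh' ==> th \<in> strip sg ==> mu \<in> LC ==> rx (x, th, mu) \<in> sector bt rh'"
    and rx_hol: "analytic_fun (sector bt rh \<times> strip sg \<times> LC) rx"
    and rx: "!!x th mu. x \<in> sector bt rh ==> th \<in> strip sg ==> mu \<in> LC ==>
        cmod (rx (x, th, mu)) <= cmod x * (1 - (Re (A mu) - ep) * cmod x ^ (N - 1)) &
        cmod x <= (1 + (real N * Re (A mu) + ep) * cmod x ^ (N - 1)) * cmod (rx (x, th, mu)) &
        cmod (rx (x, th, mu) ^ (N - 1) - x ^ (N - 1)) <= C * cmod x * cmod (x ^ (N - 1))"
    and A: "!!mu. mu \<in> LC ==> al0 <= Re (A mu)" "!!mu. mu \<in> LC ==> real N * cmod (A mu) + 4 * ep' <= real N * Re (A mu) + ep"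
    and params: "0 < al0" "0 < ep" "ep * (real Q + 5) <= al0 / 8" "al0 * rh <= 1" "1 <= Cn" "1 <= C" "0 <= K" "0 <= CE" "0 < kp" "kp <= 1"
        "16 * kp * K <= ep" "4 * rh * ((2 * C ^ 2 + 4 * K) * (Cn + 1) + K) <= ep * kp"
        "rh * (4 * real (N + 1) * C ^ 3) <= ep'" "rh * (4 * C ^ 2) <= 1" "4 * Cn * ep' <= ep"
        "rh * (2 * (16 * (5 + 4 * Cn) * CE / al0)) <= kp"
    and a: "analytic_coeff sg LC a" "analytic_coeff sg LC B"
    and bounds: "!!th mu. th \<in> strip sg ==> mu \<in> LC ==> cmod (of_nat N * a (th, mu)) <= C & cmod (a (th, mu)) <= C & cmod (A mu) <= C & cmod (m (th, mu)) <= C"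
        "!!th mu v. th \<in> strip sg ==> mu \<in> LC ==> norm (B (th, mu) *v v) <= C * norm v & norm (Ab mu *v v) <= C * norm v & norm (M (th, mu) *v v) <= C * norm v"
    and nrm: "!!mu. mu \<in> LC ==> vnorm Cn (nrm mu)"
        "!!mu x v. mu \<in> LC ==> x \<in> sector bt rh ==> nrm mu (v - x ^ (N - 1) *\<^sub>C (Ab mu *v v)) <= nrm mu v"
    and avg: "!!th mu. th \<in> strip sg ==> mu \<in> LC ==> cmod (of_nat N * (a (th, mu) - A mu) + m (th, mu) - m (th + cvec om, mu)) <= ep'"
        "!!th mu v. th \<in> strip sg ==> mu \<in> LC ==> norm (M (th, mu) *v v - M (th + cvec om, mu) *v v - B (th, mu) *v v + Ab mu *v v) <= ep' * norm v"
    and \<Phi>: "!!x th mu dl1 dl2. x \<in> sector bt rh ==> th \<in> strip sg ==> mu \<in> LC ==>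
        thin 1 x (fst dl1 + (x, 0)) ==> norm (snd dl1) <= cmod x ==> thin 1 x (fst dl2 + (x, 0)) ==> norm (snd dl2) <= cmod x ==>
        near_linear N (a (th, mu)) (B (th, mu)) (x ^ (N - 1)) (cmod x) K (dl1 - dl2) (\<Phi> (x, th, mu) dl1 - \<Phi> (x, th, mu) dl2)"
    and err: "!!x th mu. x \<in> sector bt rh ==> th \<in> strip sg ==> mu \<in> LC ==> cmod (fst (fst (\<Phi> (x, th, mu) 0))) <= CE * cmod x ^ (Q + N) &
        norm (snd (fst (\<Phi> (x, th, mu) 0))) <= CE * cmod x ^ (Q + N) & norm (snd (\<Phi> (x, th, mu) 0)) <= CE * cmod x ^ (Q + N - 1)"
    and \<Phi>_hol: "!!g. g cholomorphic_on (sector bt rh \<times> strip sg \<times> LC) ==>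
        (!!z. z \<in> sector bt rh \<times> strip sg \<times> LC ==> thin 1 (fst z) (fst (g z) + (fst z, 0)) & norm (snd (g z)) <= cmod (fst z)) ==>
        (%z. \<Phi> z (g z)) cholomorphic_on (sector bt rh \<times> strip sg \<times> LC)"
    and \<Phi>_per: "!!x th mu k dl. x \<in> sector bt rh ==> th \<in> strip sg ==> mu \<in> LC ==> k \<in> lattice_pts ==>
        thin 1 x (fst dl + (x, 0)) ==> norm (snd dl) <= cmod x ==> \<Phi> (x, th + k, mu) dl = \<Phi> (x, th, mu) dl"
begin

abbreviation D :: "real => (complex \<times> ('d, 'p) angle_param) set"
  where "D rh' \<equiv> sector bt rh' \<times> strip sg \<times> LC"

definition rr :: "complex \<times> ('d, 'p) angle_param => complex \<times> ('d, 'p) angle_param"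
  where "rr z = (rx z, fst (snd z) + cvec om, snd (snd z))"

definition admissible :: "complex \<times> ('d, 'p) angle_param => ('m, 'd) xy_angle set"
  where "admissible z = {dl. thin 1 (fst z) (fst dl + (fst z, 0)) & norm (snd dl) <= cmod (fst z)}"

text \<open>\<open>et\<close> stands for the value of the unknown at \<open>rr z\<close>. The
  preconditioner uses the coefficients at the unperturbed angle.\<close>

definition newton :: "complex \<times> ('d, 'p) angle_param => ('m, 'd) xy_angle => ('m, 'd) xy_angle => ('m, 'd) xy_angle"
  where "newton z dl et = dl - precond N (a (snd z)) (B (snd z)) (fst z ^ (N - 1)) (\<Phi> z dl - et)"

definition wn :: "complex \<times> ('d, 'p) angle_param => ('m, 'd) xy_angle => real"
  where "wn z = wnorm kp (nrm (snd (snd z))) (fst z ^ (N - 1)) (m (snd z)) (M (snd z)) (cmod (fst z))"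

text \<open>The smallest radius for which the starting error fills at most the fraction
  \<open>cw\<close> of the ball: \<open>5 + 4 * Cn\<close> is the cost of measuring the
  preconditioned error, and \<open>16 / al0\<close> inverts the coefficient of
  \<open>cw\<close>.\<close>

definition Mw :: real where "Mw = 16 * (5 + 4 * Cn) * CE / al0"

definition pw :: "complex \<times> ('d, 'p) angle_param => real"
  where "pw z = 1 + (real N * Re (A (snd (snd z))) + ep) * cmod (fst z) ^ (N - 1)"

definition qw :: "complex \<times> ('d, 'p) angle_param => real"
  where "qw z = ep * cmod (fst z) ^ (N - 1)"

definition cw :: "complex \<times> ('d, 'p) angle_param => real"
  where "cw z = al0 / 16 * cmod (fst z) ^ (N - 1)"

text \<open>The smallest exponent for which \<open>weight_decrease\<close> still gives a gain; as
  \<open>Q >= N\<close>, it lies at least \<open>1 / 2\<close> below the exponent of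
  \<open>w2\<close>.\<close>

definition w1 :: "complex \<times> ('d, 'p) angle_param => real"
  where "w1 z = cmod (fst z) powr (real N + 1 / 2)"

definition w2 :: "complex \<times> ('d, 'p) angle_param => real"
  where "w2 z = cmod (fst z) ^ (Q + 1)"

lemma strip_cvec [simp]: "th + cvec om \<in> strip sg \<longleftrightarrow> th \<in> strip sg"
  by (simp add: strip_def cvec_def)

lemma D_mono: "rh' <= rh ==> z \<in> D rh' ==> z \<in> D rh"
  using sector_mono[of bt bt rh' rh] by auto

lemma rr_D: "rh' <= rh ==> z \<in> D rh' ==> rr z \<in> D rh'"
  using step[of rh' "fst z" "fst (snd z)" "snd (snd z)"] by (auto simp: rr_def mem_Times_iff)

lemma radius:
  assumes "z \<in> D rh"
  shows "0 < cmod (fst z)" "cmod (fst z) < rh" "cmod (fst z) <= 1" "cmod (fst z) ^ (N - 1) <= cmod (fst z)" "0 < cmod (fst z) ^ (N - 1)"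
proof -
  show t: "0 < cmod (fst z)" "cmod (fst z) < rh" using assms sector_norm by (auto simp: mem_Times_iff)
  then show t1: "cmod (fst z) <= 1" using rh by linarith
  show "cmod (fst z) ^ (N - 1) <= cmod (fst z)" using power_decreasing[of 1 "N - 1" "cmod (fst z)"] t1 NQ by simp
  show "0 < cmod (fst z) ^ (N - 1)" using t by simp
qed

lemma small:
  assumes "z \<in> D rh" "0 <= c" "rh * c <= b"
  shows "cmod (fst z) * c <= b"
  using mult_right_mono[OF less_imp_le[OF radius(2)[OF assms(1)]] assms(2)] assms(3) by linarith

lemma constants_nonneg: "0 <= C ^ 2" "0 <= C ^ 3" "0 <= Cn" "0 <= (2 * C ^ 2 + 4 * K) * (Cn + 1) + K"
  using params by auto

lemma wn_bounds:
  assumes z: "z \<in> D rh"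
  shows "kp * cmod (fst (fst v)) / 2 + norm (snd (fst v)) / 2 + cmod (fst z) * norm (snd v) <= wn z v"
    and "wn z v <= 2 * kp * cmod (fst (fst v)) + 2 * Cn * norm (snd (fst v)) + cmod (fst z) * norm (snd v)"
proof -
  obtain x th mu where z': "z = (x, th, mu)" "x \<in> sector bt rh" "th \<in> strip sg" "mu \<in> LC" using z by (cases z) auto
  have s: "cmod (x ^ (N - 1)) <= cmod x" using radius(4)[OF z] by (simp add: z' norm_power)
  have sm: "cmod x * (4 * C ^ 2) <= 1" using small[OF z _ params(14)] by (simp add: z')
  have b: "cmod (m (th, mu)) <= C" "norm (M (th, mu) *v v) <= C * norm v" for v using bounds z' by auto
  show "kp * cmod (fst (fst v)) / 2 + norm (snd (fst v)) / 2 + cmod (fst z) * norm (snd v) <= wn z v"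
    "wn z v <= 2 * kp * cmod (fst (fst v)) + 2 * Cn * norm (snd (fst v)) + cmod (fst z) * norm (snd v)"
    using wnorm_bounds(5,6)[where nrm="nrm mu" and v=v, OF nrm(1)[OF z'(4)] params(6) b s sm params(9)] unfolding wn_def z'(1) fst_conv snd_conv .
qed

lemma newton_lipschitz:
  assumes z: "z \<in> D rh" and dl: "dl1 \<in> admissible z" "dl2 \<in> admissible z"
  shows "wn z (newton z dl1 et1 - newton z dl2 et2) <= pw z * wn (rr z) (et1 - et2) + qw z * wn z (dl1 - dl2)"
proof -
  obtain x th mu where z': "z = (x, th, mu)" "x \<in> sector bt rh" "th \<in> strip sg" "mu \<in> LC" using z by (cases z) auto
  have th': "th + cvec om \<in> strip sg" using z'(3) by simp
  define s where "s = x ^ (N - 1)"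
  define t where "t = cmod x"
  have st: "cmod s <= t" "0 <= t" "t <= 1" using radius[OF z] by (auto simp: s_def t_def z' norm_power)
  have cs: "cmod s = cmod x ^ (N - 1)" by (simp add: s_def norm_power)
  have c0: "0 <= 4 * real (N + 1) * C ^ 3" "0 <= 4 * ((2 * C ^ 2 + 4 * K) * (Cn + 1) + K)" "0 <= 4 * C ^ 2"
    using constants_nonneg by (auto simp del: of_nat_add)
  have c1: "t * (4 * real (N + 1) * C ^ 3) <= ep'" using small[OF z c0(1) params(13)] by (simp add: t_def z')
  have c2: "t * (4 * C ^ 2) <= 1" using small[OF z c0(3) params(14)] by (simp add: t_def z')
  have "rh * (4 * ((2 * C ^ 2 + 4 * K) * (Cn + 1) + K)) <= ep * kp" using params(12) by (simp only: mult_ac)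
  then have c3: "4 * t * ((2 * C ^ 2 + 4 * K) * (Cn + 1) + K) <= ep * kp" using small[OF z c0(2)] by (simp only: t_def z' fst_conv mult_ac)
  note R = rx[OF z'(2-4), folded t_def s_def]
  note vn = nrm(1)[OF z'(4)]
  define p where "p = real N * Re (A mu) + ep"
  have p0: "ep <= p" using A(1)[OF z'(4)] params(1) by (simp add: p_def)
  have b: "cmod (of_nat N * a (th, mu)) <= C" "cmod (a (th, mu)) <= C" "cmod (A mu) <= C" "cmod (m (th, mu)) <= C" "cmod (m (th + cvec om, mu)) <= C"
    using bounds(1)[OF z'(3,4)] bounds(1)[OF th' z'(4)] by auto
  have bm: "norm (B (th, mu) *v v) <= C * norm v" "norm (Ab mu *v v) <= C * norm v" "norm (M (th, mu) *v v) <= C * norm v"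
    "norm (M (th + cvec om, mu) *v v) <= C * norm v" for v
    using bounds(2)[OF z'(3,4), of v] bounds(2)[OF th' z'(4), of v] by auto
  have ad: "nrm mu (v - s *\<^sub>C (Ab mu *v v)) <= nrm mu v" for v using nrm(2)[OF z'(4,2)] by (simp add: s_def)
  have p4: "real N * cmod (A mu) + 4 * ep' <= p" using A(2)[OF z'(4)] by (simp add: p_def)
  have p5: "4 * Cn * ep' <= p" using p0 params(15) by linarith
  have p6: "t <= (1 + p * cmod s) * cmod (rx (x, th, mu))" using R unfolding p_def cs t_def by blast
  have R3: "cmod (rx (x, th, mu) ^ (N - 1) - s) <= C * t * cmod s" using R by blast
  have S: "wnorm kp (nrm mu) s (m (th, mu)) (M (th, mu)) t (precond N (a (th, mu)) (B (th, mu)) s (et1 - et2)) \<le>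
    (1 + p * cmod s) * wnorm kp (nrm mu) (rx (x, th, mu) ^ (N - 1)) (m (th + cvec om, mu)) (M (th + cvec om, mu)) (cmod (rx (x, th, mu))) (et1 - et2)"
    by (rule wnorm_step[where nrm="nrm mu" and A="Ab mu" and Cn=Cn and ep=ep' and ?A0.0="A mu", OF vn constants_nonneg(3) ad params(6) bm(1) bm(2) bm(3) bm(4) b(2-5)
      st(2,3,1) R3 avg(2)[OF z'(3,4)] avg(1)[OF z'(3,4)] c1 c2 p4 p5 p6 less_imp_le[OF params(9)]])
  have nl: "near_linear N (a (th, mu)) (B (th, mu)) s t K (dl1 - dl2) (\<Phi> z dl1 - \<Phi> z dl2)"
    using dl unfolding s_def t_def z'(1) admissible_def by (intro \<Phi> z') auto
  note nl' = nl[unfolded near_linear_def]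
  have T: "wnorm kp (nrm mu) s (m (th, mu)) (M (th, mu)) t ((dl1 - dl2) - precond N (a (th, mu)) (B (th, mu)) s (\<Phi> z dl1 - \<Phi> z dl2)) \<le>
    ep * cmod s * wnorm kp (nrm mu) s (m (th, mu)) (M (th, mu)) t (dl1 - dl2)"
    by (rule wnorm_self[where nrm="nrm mu" and Cn=Cn, OF vn constants_nonneg(3) params(6) bm(1) bm(3) b(1,4) st(2,3,1) c2 params(7)
      conjunct1[OF nl'] conjunct1[OF conjunct2[OF nl']] conjunct2[OF conjunct2[OF nl']] params(9,10,11) c3])
  have "newton z dl1 et1 - newton z dl2 et2 = precond N (a (th, mu)) (B (th, mu)) s (et1 - et2) +
    ((dl1 - dl2) - precond N (a (th, mu)) (B (th, mu)) s (\<Phi> z dl1 - \<Phi> z dl2))"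
    unfolding newton_def precond_diff z'(1) s_def by (simp add: precond_diff algebra_simps)
  then have "wn z (newton z dl1 et1 - newton z dl2 et2) \<le>
    wnorm kp (nrm mu) s (m (th, mu)) (M (th, mu)) t (precond N (a (th, mu)) (B (th, mu)) s (et1 - et2)) +
    wnorm kp (nrm mu) s (m (th, mu)) (M (th, mu)) t ((dl1 - dl2) - precond N (a (th, mu)) (B (th, mu)) s (\<Phi> z dl1 - \<Phi> z dl2))"
    using wnorm_triangle[OF vn less_imp_le[OF params(9)] st(2)] unfolding wn_def z'(1) s_def t_def by simp
  also have "... <= pw z * wn (rr z) (et1 - et2) + qw z * wn z (dl1 - dl2)"
    using add_mono[OF S T] unfolding cs unfolding wn_def rr_def pw_def qw_def p_def z'(1) fst_conv snd_conv s_def t_def .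
  finally show ?thesis .
qed

lemma in_admissible_iff: "dl \<in> admissible z \<longleftrightarrow> cmod (fst (fst dl)) <= cmod (fst z) ^ 2 & norm (snd (fst dl)) <= cmod (fst z) ^ 2 & norm (snd dl) <= cmod (fst z)"
  by (simp add: admissible_def thin_def)

text \<open>A ball of order \<open>|x| ^ (Q + 1)\<close> has \<open>Q + 1 >= 3\<close>, so it gains
  a factor \<open>|x|\<close> over the thin domain of size \<open>|x| ^ 2\<close>; the bound on
  \<open>rh\<close> with \<open>2 * Mw\<close> and \<open>kp\<close> turns this gain into
  inclusion.\<close>

lemma ball_admissible:
  assumes z: "z \<in> D rh" and dl: "wn z dl <= Mw * w2 z"
  shows "dl \<in> admissible z"
    and "cmod (fst (fst dl)) <= 2 * Mw / kp * cmod (fst z) ^ (Q + 1)" "norm (snd (fst dl)) <= 2 * Mw * cmod (fst z) ^ (Q + 1)"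
      "norm (snd dl) <= Mw * cmod (fst z) ^ Q"
proof -
  define t where "t = cmod (fst z)"
  have t: "0 < t" "t < rh" "t <= 1" using radius[OF z] by (auto simp: t_def)
  have M0: "0 <= Mw" using params by (simp add: Mw_def)
  have le: "kp * cmod (fst (fst dl)) / 2 + norm (snd (fst dl)) / 2 + t * norm (snd dl) <= Mw * t ^ (Q + 1)"
    using order_trans[OF wn_bounds(1)[OF z] dl] by (simp add: w2_def t_def)
  have nn: "0 <= kp * cmod (fst (fst dl))" "0 <= norm (snd (fst dl))" "0 <= t * norm (snd dl)" using t params by auto
  have x: "kp * cmod (fst (fst dl)) <= 2 * Mw * t ^ (Q + 1)" using le nn by linarith
  show "cmod (fst (fst dl)) <= 2 * Mw / kp * cmod (fst z) ^ (Q + 1)" using x params(9) by (simp add: t_def field_simps)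
  have y: "norm (snd (fst dl)) <= 2 * Mw * t ^ (Q + 1)" using le nn by linarith
  then show "norm (snd (fst dl)) <= 2 * Mw * cmod (fst z) ^ (Q + 1)" by (simp add: t_def)
  have "Mw * t ^ (Q + 1) = t * (Mw * t ^ Q)" by simp
  then have "t * norm (snd dl) <= t * (Mw * t ^ Q)" using le nn by linarith
  then have thn: "norm (snd dl) <= Mw * t ^ Q" using t by simp
  then show "norm (snd dl) <= Mw * cmod (fst z) ^ Q" by (simp add: t_def)
  have tM: "t * (2 * Mw) <= kp" using small[OF z _ params(16)] M0 by (simp add: t_def Mw_def)
  have Q1: "t ^ (Q + 1) <= t ^ 3" "t ^ Q <= t ^ 2" using NQ t by (intro power_decreasing; simp)+
  have "kp * cmod (fst (fst dl)) <= 2 * Mw * t ^ 3" using x mult_left_mono[OF Q1(1), of "2 * Mw"] M0 by linarith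
  also have "... = (t * (2 * Mw)) * t ^ 2" by (simp add: power2_eq_square power3_eq_cube)
  also have "... <= kp * t ^ 2" by (intro mult_right_mono tM) auto
  finally have 1: "cmod (fst (fst dl)) <= t ^ 2" using params(9) by simp
  have "norm (snd (fst dl)) <= 2 * Mw * t ^ 3" using y mult_left_mono[OF Q1(1), of "2 * Mw"] M0 by linarith
  also have "... = (t * (2 * Mw)) * t ^ 2" by (simp add: power2_eq_square power3_eq_cube)
  also have "... <= 1 * t ^ 2" using tM params(10) by (intro mult_right_mono) auto
  finally have 2: "norm (snd (fst dl)) <= t ^ 2" by simp
  have "norm (snd dl) <= Mw * t ^ 2" using thn mult_left_mono[OF Q1(2) M0] by linarith
  also have "... = (t * Mw) * t" by (simp add: power2_eq_square)
  also have "... <= 1 * t" using tM params(10) t M0 by (intro mult_right_mono) auto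
  finally have 3: "norm (snd dl) <= t" by simp
  show "dl \<in> admissible z" using 1 2 3 by (simp add: in_admissible_iff t_def)
qed

lemma newton_init:
  assumes z: "z \<in> D rh"
  shows "wn z (newton z 0 0) <= cw z * (Mw * w2 z)"
proof -
  obtain x th mu where z': "z = (x, th, mu)" "x \<in> sector bt rh" "th \<in> strip sg" "mu \<in> LC" using z by (cases z) auto
  define s where "s = x ^ (N - 1)"
  define t where "t = cmod x"
  have st: "cmod s <= t" "0 <= t" "t <= 1" using radius[OF z] by (auto simp: s_def t_def z' norm_power)
  have "C <= C ^ 2" using power_increasing[of 1 2 C] params(6) by simp
  then have "t * C <= t * (4 * C ^ 2)" using st params(6) by (intro mult_left_mono) auto
  also have "... <= 1" using small[OF z _ params(14)] by (simp add: t_def z')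
  finally have tC: "t * C <= 1" .
  let ?E = "\<Phi> z 0"
  have E: "cmod (fst (fst ?E)) <= CE * t ^ (Q + N)" "norm (snd (fst ?E)) <= CE * t ^ (Q + N)" "norm (snd ?E) <= CE * t ^ (Q + N - 1)"
    using err[OF z'(2-4)] by (auto simp: z' t_def)
  let ?P = "precond N (a (th, mu)) (B (th, mu)) s ?E"
  have N: "newton z 0 0 = - ?P" by (simp add: newton_def z' s_def)
  have "cmod (of_nat N * a (th, mu) * s * fst (fst ?E)) <= C * t * cmod (fst (fst ?E))"
    unfolding norm_mult[of _ "fst (fst ?E)"] norm_mult[of _ s] using bounds(1)[OF z'(3,4)] st params(6) by (intro mult_right_mono mult_mono) auto
  also have "... <= 1 * cmod (fst (fst ?E))" using tC by (intro mult_right_mono) (auto simp: mult.commute)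
  finally have "cmod (fst (fst ?P)) <= 2 * cmod (fst (fst ?E))"
    using norm_triangle_ineq[of "fst (fst ?E)" "of_nat N * a (th, mu) * s * fst (fst ?E)"] by (simp add: precond_def distrib_right)
  then have X: "cmod (fst (fst ?P)) <= 2 * (CE * t ^ (Q + N))" using E(1) by linarith
  have "norm (s *\<^sub>C (B (th, mu) *v snd (fst ?E))) <= t * (C * norm (snd (fst ?E)))"
    unfolding norm_scaleC using bounds(2)[OF z'(3,4)] st by (intro mult_mono) auto
  also have "... <= 1 * norm (snd (fst ?E))" using mult_right_mono[OF tC norm_ge_zero[of "snd (fst ?E)"]] by (simp only: mult.assoc)
  finally have "norm (snd (fst ?P)) <= 2 * norm (snd (fst ?E))"
    using norm_triangle_ineq4[of "snd (fst ?E)" "s *\<^sub>C (B (th, mu) *v snd (fst ?E))"] by (simp add: precond_def)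
  then have Y: "norm (snd (fst ?P)) <= 2 * (CE * t ^ (Q + N))" using E(2) by linarith
  have "t * norm (snd ?P) <= t * (CE * t ^ (Q + N - 1))" using E(3) st by (intro mult_left_mono) (auto simp: precond_def)
  also have "... = CE * t ^ (Q + N)" using NQ by (cases "Q + N") auto
  finally have T: "t * norm (snd ?P) <= CE * t ^ (Q + N)" .
  have "wn z (newton z 0 0) = wn z ?P" unfolding N wn_def using wnorm_minus[OF nrm(1)[OF z'(4)]] by (simp add: z')
  also have "... <= 2 * kp * cmod (fst (fst ?P)) + 2 * Cn * norm (snd (fst ?P)) + t * norm (snd ?P)"
    using wn_bounds(2)[OF z, of ?P] by (simp add: z' t_def)
  also have "... <= 2 * 1 * (2 * (CE * t ^ (Q + N))) + 2 * Cn * (2 * (CE * t ^ (Q + N))) + CE * t ^ (Q + N)"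
    using X Y params st by (intro T add_mono mult_mono) auto
  also have "... = (5 + 4 * Cn) * CE * t ^ (Q + N)" by (simp add: algebra_simps)
  \<comment> \<open>The error exponent is that of the weight plus that of the contraction gain
    \<open>cw\<close>.\<close>
  also have "Q + N = (N - 1) + (Q + 1)" using NQ by simp
  also have "t ^ ((N - 1) + (Q + 1)) = t ^ (N - 1) * t ^ (Q + 1)" by (rule power_add)
  also have "(5 + 4 * Cn) * CE * (t ^ (N - 1) * t ^ (Q + 1)) = cw z * (Mw * w2 z)"
    using params(1) by (simp add: cw_def Mw_def w2_def z' t_def)
  finally show ?thesis .
qed

text \<open>\<open>weight_decrease\<close> is used with the exponents \<open>N + 1 / 2\<close> and
  \<open>Q + 1\<close>; the natural power is rewritten as a real one for this purpose.\<close>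

lemma weights:
  assumes z: "z \<in> D rh"
  shows "pw z * w1 (rr z) + qw z * w1 z <= (1 - cw z) * w1 z" "pw z * w2 (rr z) + qw z * w2 z <= (1 - cw z) * w2 z"
    "0 <= pw z" "0 <= qw z" "0 <= cw z" "0 <= w2 z" "w2 z <= w1 z"
proof -
  obtain x th mu where z': "z = (x, th, mu)" "x \<in> sector bt rh" "th \<in> strip sg" "mu \<in> LC" using z by (cases z) auto
  note t = radius[OF z]
  have al: "al0 <= Re (A mu)" using A(1)[OF z'(4)] .
  have rz: "rr z \<in> D rh" using rr_D[OF order_refl z] .
  have "al0 * cmod x ^ (N - 1) <= al0 * rh" using t params(1) by (intro mult_left_mono) (auto simp: z')
  then have alt: "al0 * cmod x ^ (N - 1) <= 1" using params(4) by linarith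
  have dec: "(1 + (real N * Re (A mu) + ep) * cmod x ^ (N - 1)) * cmod (rx z) powr q + ep * cmod x ^ (N - 1) * cmod x powr q
    <= (1 - al0 / 16 * cmod x ^ (N - 1)) * cmod x powr q" if q: "real N + 1 / 2 <= q" "q <= real Q + 1" for q
  proof (rule weight_decrease[OF params(1) al q(1) params(2)])
    have "ep * (q + 4) <= ep * (real Q + 5)" using q(2) params(2) by (intro mult_left_mono) auto
    then show "ep * (q + 4) <= al0 / 8" using params(3) by linarith
    show "cmod (rx z) <= cmod x * (1 - (Re (A mu) - ep) * cmod x ^ (N - 1))" using rx[OF z'(2-4)] by (simp add: z')
  qed (use alt in auto)
  have pr: "cmod x ^ (Q + 1) = cmod x powr (real Q + 1)" "cmod (rx z) ^ (Q + 1) = cmod (rx z) powr (real Q + 1)"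
    using powr_realpow[of "cmod x" "Q + 1"] powr_realpow[of "cmod (rx z)" "Q + 1"] t(1) radius(1)[OF rz] by (auto simp: z' rr_def add.commute)
  have NQ': "real N + 1 / 2 <= real Q + 1" using NQ by simp
  show "pw z * w1 (rr z) + qw z * w1 z <= (1 - cw z) * w1 z"
    using dec[OF order_refl NQ'] by (simp add: pw_def qw_def cw_def w1_def rr_def z')
  show "pw z * w2 (rr z) + qw z * w2 z <= (1 - cw z) * w2 z"
    using dec[OF NQ' order_refl] unfolding pw_def qw_def cw_def w2_def rr_def z'(1) fst_conv snd_conv pr[unfolded z'(1)] .
  show "0 <= pw z" "0 <= qw z" "0 <= cw z" "0 <= w2 z"
    using al params by (auto simp: pw_def qw_def cw_def w2_def z' intro!: add_nonneg_nonneg mult_nonneg_nonneg)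
  show "w2 z <= w1 z"
    unfolding w1_def w2_def z'(1) fst_conv pr(1) using t NQ' by (intro powr_mono') (auto simp: z')
qed

text \<open>The ratio of \<open>w2\<close> to \<open>w1\<close> is at most the square root of
  \<open>|x|\<close>, hence at most \<open>et\<close> as long as \<open>|x| <= et ^ 2\<close>.
  Farther out, \<open>cw\<close> is bounded below by its value at that radius.\<close>

lemma weights_mix:
  assumes et: "et > 0"
  shows "\<exists>\<tau>\<ge>0. \<tau> < 1 & (\<forall>z\<in>D rh. w2 z <= et * w1 z \<or> 1 - cw z <= \<tau>)"
proof (intro exI[of _ "max 0 (1 - al0 / 16 * (et ^ 2) ^ (N - 1))"] conjI ballI)
  show "max 0 (1 - al0 / 16 * (et ^ 2) ^ (N - 1)) < 1" using params(1) et by simp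
  fix z assume z: "z \<in> D rh"
  note t = radius[OF z]
  show "w2 z <= et * w1 z \<or> 1 - cw z <= max 0 (1 - al0 / 16 * (et ^ 2) ^ (N - 1))"
  proof (cases "cmod (fst z) <= et ^ 2")
    case True
    have "w2 z = cmod (fst z) powr (real Q + 1)" using powr_realpow[of "cmod (fst z)" "Q + 1"] t(1) by (simp add: w2_def add.commute)
    also have "... <= cmod (fst z) powr (1 / 2 + (real N + 1 / 2))" using t NQ by (intro powr_mono') auto
    also have "... = cmod (fst z) powr (1 / 2) * w1 z" unfolding powr_add w1_def by simp
    also have "cmod (fst z) powr (1 / 2) = sqrt (cmod (fst z))" by (simp add: powr_half_sqrt)
    also have "sqrt (cmod (fst z)) * w1 z <= et * w1 z"
      using real_sqrt_le_mono[OF True] et by (intro mult_right_mono) (auto simp: w1_def)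
    finally show ?thesis by simp
  next
    case False
    then have "(et ^ 2) ^ (N - 1) <= cmod (fst z) ^ (N - 1)" by (intro power_mono) auto
    then have "al0 / 16 * (et ^ 2) ^ (N - 1) <= cw z" unfolding cw_def using params(1) by (intro mult_left_mono) auto
    then have "1 - cw z <= 1 - al0 / 16 * (et ^ 2) ^ (N - 1)" by linarith
    then show ?thesis by (intro disjI2 max.coboundedI2)
  qed
qed auto

text \<open>The constant degenerates like \<open>1 / |x|\<close> because of the weight on the angle;
  this is compensated later by \<open>w1 <= |x|\<close>.\<close>

lemma wn_lower:
  assumes z: "z \<in> D rh"
  shows "norm v <= ((2 / kp + 3) / cmod (fst z)) * wn z v"
proof -
  define t where "t = cmod (fst z)"
  have t: "0 < t" "t <= 1" using radius[OF z] by (auto simp: t_def)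
  have le: "kp * cmod (fst (fst v)) / 2 + norm (snd (fst v)) / 2 + t * norm (snd v) <= wn z v" using wn_bounds(1)[OF z] by (simp add: t_def)
  have nn: "0 <= kp * cmod (fst (fst v))" "0 <= norm (snd (fst v))" "0 <= t * norm (snd v)" using t params by auto
  have w0: "0 <= wn z v" using le nn by linarith
  have "kp * cmod (fst (fst v)) <= 2 * wn z v" using le nn by linarith
  then have 1: "cmod (fst (fst v)) <= 2 / kp * wn z v" using params(9) by (simp add: field_simps)
  have 2: "norm (snd (fst v)) <= 2 * wn z v" using le nn by linarith
  have "t * norm (snd v) <= wn z v" using le nn by linarith
  then have 3: "norm (snd v) <= 1 / t * wn z v" using t by (simp add: field_simps)
  have it: "1 <= 1 / t" using t by simp
  have "norm v <= norm (fst v) + norm (snd v)" using norm_Pair_le[of "fst v" "snd v"] by simp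
  also have "norm (fst v) <= cmod (fst (fst v)) + norm (snd (fst v))" using norm_Pair_le[of "fst (fst v)" "snd (fst v)"] by simp
  finally have "norm v <= (2 / kp + 2) * wn z v + 1 / t * wn z v" using 1 2 3 unfolding distrib_right by linarith
  also have "... <= (2 / kp + 2) * (1 / t) * wn z v + 1 / t * wn z v"
    using mult_right_mono[OF mult_left_mono[OF it, of "2 / kp + 2"] w0] params(9) by simp
  also have "... = ((2 / kp + 3) / t) * wn z v" by (simp add: add_divide_distrib algebra_simps)
  finally show ?thesis by (simp add: t_def)
qed

text \<open>The preconditioner is injective: \<open>N a s\<close> and \<open>s B\<close> have size
  at most \<open>1 / 4\<close>.\<close>

lemma newton_fixed_iff:
  assumes z: "z \<in> D rh"
  shows "newton z dl et = dl \<longleftrightarrow> \<Phi> z dl = et"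
proof
  obtain x th mu where z': "z = (x, th, mu)" "x \<in> sector bt rh" "th \<in> strip sg" "mu \<in> LC" using z by (cases z) auto
  define s where "s = x ^ (N - 1)"
  define t where "t = cmod x"
  have st: "cmod s <= t" "0 <= t" "t <= 1" using radius[OF z] by (auto simp: s_def t_def z' norm_power)
  have "C <= C ^ 2" using power_increasing[of 1 2 C] params(6) by simp
  then have "t * (4 * C) <= t * (4 * C ^ 2)" using st by (intro mult_left_mono) auto
  also have "... <= 1" using small[OF z _ params(14)] by (simp add: t_def z')
  finally have tC: "t * C <= 1 / 4" by simp
  define v where "v = \<Phi> z dl - et"
  assume "newton z dl et = dl"
  then have P: "precond N (a (th, mu)) (B (th, mu)) s v = 0" by (simp add: newton_def v_def s_def z')
  have "cmod (of_nat N * a (th, mu) * s) <= C * t"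
    unfolding norm_mult[of _ s] using bounds(1)[OF z'(3,4)] st params(6) by (intro mult_mono) auto
  then have "of_nat N * a (th, mu) * s ~= -1" using tC by (metis mult.commute norm_minus_cancel norm_one not_le order_trans divide_less_eq_1_pos one_less_numeral_iff semiring_norm(76) zero_less_numeral)
  then have "1 + of_nat N * a (th, mu) * s ~= 0" by (metis add.commute add_eq_0_iff2 eq_neg_iff_add_eq_0)
  moreover have "(1 + of_nat N * a (th, mu) * s) * fst (fst v) = 0" using P by (simp add: precond_def prod_eq_iff)
  ultimately have 1: "fst (fst v) = 0" by simp
  have "snd (fst v) = s *\<^sub>C (B (th, mu) *v snd (fst v))" using P by (simp add: precond_def prod_eq_iff)
  then have "norm (snd (fst v)) = cmod s * norm (B (th, mu) *v snd (fst v))" by (metis norm_scaleC)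
  also have "... <= t * (C * norm (snd (fst v)))" using bounds(2)[OF z'(3,4)] st by (intro mult_mono) auto
  also have "... <= 1 / 4 * norm (snd (fst v))" using mult_right_mono[OF tC norm_ge_zero[of "snd (fst v)"]] by (simp only: mult.assoc)
  finally have 2: "snd (fst v) = 0" by simp
  have 3: "snd v = 0" using P by (simp add: precond_def prod_eq_iff)
  show "\<Phi> z dl = et" using 1 2 3 by (simp add: v_def prod_eq_iff)
qed (simp add: newton_def precond_def zero_prod_def[symmetric] scaleC.zero_right)

primrec iterate :: "nat => complex \<times> ('d, 'p) angle_param => ('m, 'd) xy_angle"
  where "iterate 0 = (%z. 0)" | "iterate (Suc k) = (%z. newton z (iterate k z) (iterate k (rr z)))"

text \<open>\<open>rr\<close> maps the domain into itself and commutes with integer translations, so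
  each step preserves holomorphy and periodicity as long as the iterates stay where
  \<open>\<Phi>\<close> is controlled.\<close>

lemma iterate_analytic:
  assumes adm: "!!k z. z \<in> D rh ==> iterate k z \<in> admissible z"
  shows "analytic_fun (D rh) (iterate k)"
proof (induction k)
  case 0
  have "torus_domain (D rh)" using rx_hol by (simp add: analytic_fun_def)
  then show ?case by (auto simp: analytic_fun_def torus_domain_def intro: chol_const)
next
  case (Suc k)
  have tD: "torus_domain (D rh)" and oD: "open (D rh)" and rxh: "rx cholomorphic_on D rh"
    using rx_hol by (auto simp: analytic_fun_def torus_domain_def)
  have Uk: "iterate k cholomorphic_on D rh" using Suc by (simp add: analytic_fun_def)
  have rrh: "rr cholomorphic_on D rh" unfolding rr_def by (intro cholomorphic_intros rxh oD)
  have Ur: "(%z. iterate k (rr z)) cholomorphic_on D rh"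
    by (rule chol_compose[OF rrh Uk]) (use rr_D[OF order_refl] in blast)
  have Ph: "(%z. \<Phi> z (iterate k z)) cholomorphic_on D rh"
    using adm by (intro \<Phi>_hol Uk) (auto simp: admissible_def)
  have q: "(%z :: complex \<times> ('d, 'p) angle_param. f (snd z)) cholomorphic_on D rh" if "analytic_coeff sg LC f"
    for f :: "('d, 'p) angle_param => 'c::complex_normed_space"
    using that oD unfolding analytic_coeff_def
    by (intro chol_compose[of snd "D rh" f "strip sg \<times> LC"] cholomorphic_intros) auto
  have "iterate (Suc k) cholomorphic_on D rh"
    unfolding iterate.simps newton_def precond_def by (intro cholomorphic_intros oD Uk Ur Ph q a)
  moreover have "iterate (Suc k) (x, th + l, mu) = iterate (Suc k) (x, th, mu)" if z: "(x, th, mu) \<in> D rh" and l: "l \<in> lattice_pts" for x th mu l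
  proof -
    have z': "x \<in> sector bt rh" "th \<in> strip sg" "mu \<in> LC" using z by auto
    have 1: "iterate k (x, th + l, mu) = iterate k (x, th, mu)" using Suc z l by (auto simp: analytic_fun_def)
    have "rx (x, th + l, mu) = rx (x, th, mu)" using rx_hol z l by (auto simp: analytic_fun_def)
    then have "rr (x, th + l, mu) = (rx (x, th, mu), (th + cvec om) + l, mu)" by (simp add: rr_def add_ac)
    moreover have "(rx (x, th, mu), th + cvec om, mu) \<in> D rh" using rr_D[OF order_refl z] by (simp add: rr_def)
    then have "iterate k (rx (x, th, mu), (th + cvec om) + l, mu) = iterate k (rx (x, th, mu), th + cvec om, mu)"
      using Suc l unfolding analytic_fun_def by blast
    ultimately have 2: "iterate k (rr (x, th + l, mu)) = iterate k (rr (x, th, mu))" by (simp only: rr_def fst_conv snd_conv)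
    have 3: "a (th + l, mu) = a (th, mu)" "B (th + l, mu) = B (th, mu)" using a z' l by (auto simp: analytic_coeff_def)
    have 4: "\<Phi> (x, th + l, mu) (iterate k (x, th, mu)) = \<Phi> (x, th, mu) (iterate k (x, th, mu))"
      using adm[OF z, of k] by (intro \<Phi>_per z' l) (auto simp: admissible_def)
    show ?thesis by (simp add: newton_def 1 2 3 4)
  qed
  ultimately show ?case using tD by (auto simp: analytic_fun_def)
qed

theorem solution:
  "\<exists>u. analytic_fun (D rh) u & (\<forall>z\<in>D rh. \<Phi> z (u z) = u (rr z) & u z \<in> admissible z & wn z (u z) <= Mw * w2 z)"
proof -
  have M0: "0 <= Mw" using params by (simp add: Mw_def)
  have b0: "(2 / kp + 3) / cmod (fst z) > 0" if "z \<in> D rh" for z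
    using radius(1)[OF that] params(9) by (simp add: add_pos_pos)
  have up: "wn z v <= (2 * kp + 2 * Cn + cmod (fst z)) * norm v" if z: "z \<in> D rh" for z v
  proof -
    have f: "norm (fst v) <= norm v" "norm (snd v) <= norm v" by (auto intro: norm_fst_le_norm norm_snd_le_norm)
    have "cmod (fst (fst v)) <= norm v" "norm (snd (fst v)) <= norm v"
      using f(1) norm_fst_le_norm[of "fst v"] norm_snd_le_norm[of "fst v"] by auto
    then have "2 * kp * cmod (fst (fst v)) + 2 * Cn * norm (snd (fst v)) + cmod (fst z) * norm (snd v) <= 2 * kp * norm v + 2 * Cn * norm v + cmod (fst z) * norm v"
      using f params by (intro add_mono mult_left_mono) auto
    then show ?thesis using wn_bounds(2)[OF z, of v] by (simp add: distrib_right)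
  qed
  have LCz: "snd (snd z) \<in> LC" if "z \<in> D rh" for z :: "complex \<times> ('d, 'p) angle_param" using that by auto
  have tri: "wn z (u + v) <= wn z u + wn z v" if "z \<in> D rh" for z u v
    unfolding wn_def by (rule wnorm_triangle[OF nrm(1)[OF LCz[OF that]] less_imp_le[OF params(9)] norm_ge_zero])
  have mns: "wn z (- u) = wn z u" if "z \<in> D rh" for z u
    unfolding wn_def by (rule wnorm_minus[OF nrm(1)[OF LCz[OF that]]])
  obtain u where u: "!!z. z \<in> D rh ==> u z = newton z (u z) (u (rr z))" "!!z. z \<in> D rh ==> wn z (u z) <= Mw * w2 z"
    "!!k z. z \<in> D rh ==> wn z (iterate k z) <= Mw * w2 z"
    "!!et. et > 0 ==> \<exists>k0. \<forall>k\<ge>k0. \<forall>z\<in>D rh. wn z (iterate k z - u z) <= et * w1 z"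
  proof (rule weighted_fixed_point[where D="D rh" and r=rr and p=pw and q=qw and c=cw and ?w1.0=w1 and ?w2.0=w2 and M=Mw and n=wn
          and A=newton and S=admissible and U=iterate and b="%z. (2 / kp + 3) / cmod (fst z)" and b'="%z. 2 * kp + 2 * Cn + cmod (fst z)",
        OF rr_D[OF order_refl] weights(3-7) M0 weights(1,2) weights_mix tri mns wn_lower b0 up newton_lipschitz ball_admissible(1) newton_init], (assumption | (simp; fail))+, goal_cases)
    case (1 u)
    note h = this
    show ?case by (rule h(1)[OF h(2-5)])
  qed
  have adm: "iterate k z \<in> admissible z" if "z \<in> D rh" for k z using ball_admissible(1)[OF that u(3)[OF that]] .
  note an = iterate_analytic[OF adm]
  \<comment> \<open>The factor \<open>1 / |x|\<close> from \<open>wn_lower\<close> cancels against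
    \<open>w1 <= |x|\<close>, so the iterates converge uniformly on the whole domain, up to the
    vertex.\<close>
  have lim: "\<exists>k0. \<forall>k\<ge>k0. \<forall>z\<in>D rh. norm (iterate k z - u z) <= e" if e: "e > 0" for e
  proof -
    define et where "et = e / (2 / kp + 3)"
    have c: "2 / kp + 3 > 0" using params(9) by (simp add: add_pos_pos)
    then have et: "et > 0" using e by (simp add: et_def)
    obtain k0 where k0: "!!k z. k >= k0 ==> z \<in> D rh ==> wn z (iterate k z - u z) <= et * w1 z" using u(4)[OF et] by blast
    have "norm (iterate k z - u z) <= e" if k: "k >= k0" and z: "z \<in> D rh" for k z
    proof -
      note t = radius[OF z]
      have "w1 z <= cmod (fst z) powr 1" unfolding w1_def using t NQ by (intro powr_mono') auto
      then have w: "w1 z <= cmod (fst z)" using t by simp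
      have "norm (iterate k z - u z) <= ((2 / kp + 3) / cmod (fst z)) * (et * cmod (fst z))"
        by (rule order_trans[OF wn_lower[OF z] mult_left_mono[OF order_trans[OF k0[OF k z] mult_left_mono[OF w less_imp_le[OF et]]] less_imp_le[OF b0[OF z]]]])
      also have "... = e" using t(1) c by (simp add: et_def)
      finally show ?thesis .
    qed
    then show ?thesis by blast
  qed
  have comp: "(%z. f (u z)) cholomorphic_on D rh"
    if f: "!!v w. cmod (f v - f w) <= norm (v - w)" "!!k. (%z. f (iterate k z)) cholomorphic_on D rh" for f
  proof (rule cholomorphic_uniform_limit[OF f(2)])
    fix e :: real assume "e > 0"
    then obtain k0 where "\<forall>k\<ge>k0. \<forall>z\<in>D rh. norm (iterate k z - u z) <= e" using lim by blast
    then show "\<exists>k0. \<forall>k\<ge>k0. \<forall>z\<in>D rh. cmod (f (iterate k z) - f (u z)) <= e" using f(1) order_trans by meson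
  qed
  have oD: "open (D rh)" and tD: "torus_domain (D rh)" using rx_hol by (auto simp: analytic_fun_def torus_domain_def)
  have ih: "iterate k cholomorphic_on D rh" for k using an by (simp add: analytic_fun_def)
  have n1: "cmod (fst (fst v) - fst (fst w)) <= norm (v - w)" for v w :: "('m, 'd) xy_angle"
    using norm_fst_le_norm[of "v - w"] norm_fst_le_norm[of "fst (v - w)"] by simp
  have n2: "cmod (snd (fst v) $ i - snd (fst w) $ i) <= norm (v - w)" for v w :: "('m, 'd) xy_angle" and i
    using norm_fst_le_norm[of "v - w"] norm_snd_le_norm[of "fst (v - w)"] Finite_Cartesian_Product.norm_nth_le[of "snd (fst (v - w))" i] by simp
  have n3: "cmod (snd v $ i - snd w $ i) <= norm (v - w)" for v w :: "('m, 'd) xy_angle" and i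
    using norm_snd_le_norm[of "v - w"] Finite_Cartesian_Product.norm_nth_le[of "snd (v - w)" i] by simp
  \<comment> \<open>The limit is reassembled from its scalar coordinates, to which the uniform limit
    theorem applies.\<close>
  have "(%z. ((fst (fst (u z)), (\<chi> i. snd (fst (u z)) $ i)), (\<chi> i. snd (u z) $ i))) cholomorphic_on D rh"
    by (intro cholomorphic_on_Pair chol_vec_lambda oD comp n1 n2 n3 chol_fst chol_snd chol_vec_nth ih)
  then have uh: "u cholomorphic_on D rh" by (simp add: vec_nth_inverse)
  have per: "u (x, th + l, mu) = u (x, th, mu)" if z: "(x, th, mu) \<in> D rh" and l: "l \<in> lattice_pts" for x th mu l
  proof -
    have z': "(x, th + l, mu) \<in> D rh" using tD z l by (auto simp: torus_domain_def)
    have "norm (u (x, th + l, mu) - u (x, th, mu)) <= 0 + e" if e: "e > 0" for e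
    proof -
      obtain k0 where k0: "!!k z. k >= k0 ==> z \<in> D rh ==> norm (iterate k z - u z) <= e / 2" using lim[of "e / 2"] e half_gt_zero[OF e] by blast
      have "iterate k0 (x, th + l, mu) = iterate k0 (x, th, mu)" using an[of k0] z l by (auto simp: analytic_fun_def)
      then have eq: "u (x, th + l, mu) - u (x, th, mu) = (iterate k0 (x, th, mu) - u (x, th, mu)) - (iterate k0 (x, th + l, mu) - u (x, th + l, mu))" by simp
      have "norm (u (x, th + l, mu) - u (x, th, mu)) <= e / 2 + e / 2"
        unfolding eq by (rule order_trans[OF norm_triangle_ineq4 add_mono[OF k0[OF order_refl z] k0[OF order_refl z']]])
      then show ?thesis by simp
    qed
    then have "norm (u (x, th + l, mu) - u (x, th, mu)) <= 0" by (rule field_le_epsilon)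
    then show ?thesis by simp
  qed
  have "analytic_fun (D rh) u" using uh tD per by (auto simp: analytic_fun_def)
  moreover have "\<Phi> z (u z) = u (rr z) & u z \<in> admissible z & wn z (u z) <= Mw * w2 z" if z: "z \<in> D rh" for z
    using newton_fixed_iff[OF z] u(1)[OF z] u(2)[OF z] ball_admissible(1)[OF z u(2)[OF z]] by metis
  ultimately show ?thesis by (intro exI[of _ u]) blast
qed

text \<open>The equation alone determines the solution among admissible maps of the required order,
  already on a smaller sector, since that sector is invariant as well.\<close>

theorem unique:
  assumes rh': "rh' <= rh"
    and u: "!!z. z \<in> D rh' ==> \<Phi> z (u z) = u (rr z)" "!!z. z \<in> D rh' ==> u z \<in> admissible z"
    and v: "!!z. z \<in> D rh' ==> \<Phi> z (v z) = v (rr z)" "!!z. z \<in> D rh' ==> v z \<in> admissible z"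
    and M: "!!z. z \<in> D rh' ==> cmod (fst (fst (u z - v z))) <= M' * cmod (fst z) ^ (Q + 1) &
      norm (snd (fst (u z - v z))) <= M' * cmod (fst z) ^ (Q + 1) & norm (snd (u z - v z)) <= M' * cmod (fst z) ^ Q"
    and M': "0 <= M'" and z: "z \<in> D rh'"
  shows "u z = v z"
proof -
  have sub: "z \<in> D rh" if "z \<in> D rh'" for z using D_mono[OF rh' that] .
  have b0: "(2 / kp + 3) / cmod (fst z) > 0" if "z \<in> D rh'" for z
    using radius(1)[OF sub[OF that]] params(9) by (simp add: add_pos_pos)
  have mix: "\<exists>\<tau>\<ge>0. \<tau> < 1 & (\<forall>z\<in>D rh'. w2 z <= et * w1 z \<or> 1 - cw z <= \<tau>)" if "et > 0" for et
    using weights_mix[OF that] sub by meson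
  have n: "wn z (u z - v z) <= ((3 + 2 * Cn) * M') * w2 z" if z: "z \<in> D rh'" for z
  proof -
    define t where "t = cmod (fst z)"
    have t0: "0 <= t" by (simp add: t_def)
    have "2 * kp * cmod (fst (fst (u z - v z))) + 2 * Cn * norm (snd (fst (u z - v z))) + t * norm (snd (u z - v z)) \<le>
      2 * 1 * (M' * t ^ (Q + 1)) + 2 * Cn * (M' * t ^ (Q + 1)) + t * (M' * t ^ Q)"
      using M[OF z] params t0 by (intro add_mono mult_mono) (auto simp: t_def)
    also have "... = ((3 + 2 * Cn) * M') * w2 z" by (simp add: w2_def t_def algebra_simps)
    finally show ?thesis using wn_bounds(2)[OF sub[OF z], of "u z - v z"] by (simp add: t_def)
  qed
  have M0: "0 <= (3 + 2 * Cn) * M'" using M' params(5) by simp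
  have fu: "u z = newton z (u z) (u (rr z))" if "z \<in> D rh'" for z using newton_fixed_iff[OF sub[OF that]] u(1)[OF that] by metis
  have fv: "v z = newton z (v z) (v (rr z))" if "z \<in> D rh'" for z using newton_fixed_iff[OF sub[OF that]] v(1)[OF that] by metis
  show ?thesis
    by (rule weighted_fixed_point_unique[where D="D rh'" and r=rr and p=pw and q=qw and c=cw and ?w1.0=w1 and ?w2.0=w2 and M="(3 + 2 * Cn) * M'" and n=wn
          and A=newton and S=admissible and b="%z. (2 / kp + 3) / cmod (fst z)" and u=u and v=v and z=z,
        OF rr_D[OF rh'] weights(3-7)[OF sub] M0 weights(1,2)[OF sub] mix wn_lower[OF sub] b0 newton_lipschitz[OF sub] fu u(2) fv v(2) n z])
      assumption+
qed

end

subsection \<open>Sectors and analytic continuation\<close>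

text \<open>For \<open>bt <= pi\<close> the sector lies in the right half-plane, where
  \<open>Arg\<close> is continuous and recovers the polar angle.\<close>

lemma open_sector:
  assumes "bt <= pi"
  shows "open (sector bt rh)"
proof -
  have pos: "x \<notin> \<real>\<^sub>\<le>\<^sub>0 & Arg x = \<phi>" if x: "x = complex_of_real r * cis \<phi>" "0 < r" "\<bar>\<phi>\<bar> < bt / 2" for x r \<phi>
  proof -
    have "\<bar>\<phi>\<bar> < pi / 2" using x(3) assms by linarith
    then have "cos \<phi> > 0" by (intro cos_gt_zero_pi) auto
    then have "Re x > 0" using x by simp
    moreover have "Arg x = \<phi>"
    proof -
      have "- pi < \<phi>" "\<phi> <= pi" using \<open>\<bar>\<phi>\<bar> < pi / 2\<close> pi_gt_zero by linarith+
      then show ?thesis using Arg_rcis[of \<phi> r] x unfolding rcis_def by simp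
    qed
    ultimately show ?thesis by (simp add: complex_nonpos_Reals_iff)
  qed
  have "sector bt rh = (- \<real>\<^sub>\<le>\<^sub>0 \<inter> Arg -` {- (bt / 2)<..<bt / 2}) \<inter> ball 0 rh"
  proof (intro equalityI subsetI)
    fix x assume "x \<in> sector bt rh"
    then obtain r \<phi> where x: "x = complex_of_real r * cis \<phi>" "0 < r" "r < rh" "\<bar>\<phi>\<bar> < bt / 2" by (auto simp: sector_iff)
    then have "- (bt / 2) < \<phi>" "\<phi> < bt / 2" by linarith+
    then show "x \<in> (- \<real>\<^sub>\<le>\<^sub>0 \<inter> Arg -` {- (bt / 2)<..<bt / 2}) \<inter> ball 0 rh"
      using pos[OF x(1,2,4)] x by (simp add: norm_mult)
  next
    fix x assume x: "x \<in> (- \<real>\<^sub>\<le>\<^sub>0 \<inter> Arg -` {- (bt / 2)<..<bt / 2}) \<inter> ball 0 rh"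
    then have "x ~= 0" by auto
    with x show "x \<in> sector bt rh"
      unfolding sector_iff using rcis_cmod_Arg[of x] by (intro exI[of _ "cmod x"] exI[of _ "Arg x"]) (auto simp: rcis_def)
  qed
  moreover have "open (- \<real>\<^sub>\<le>\<^sub>0 \<inter> Arg -` {- (bt / 2)<..<bt / 2})"
    by (rule continuous_open_preimage) (auto intro!: continuous_at_imp_continuous_on continuous_at_Arg simp: closed_nonpos_Reals_complex open_Compl)
  ultimately show ?thesis by (simp add: open_Int)
qed

lemma connected_sector: "connected (sector bt rh)"
proof -
  have "sector bt rh = (%p. complex_of_real (fst p) * cis (snd p)) ` ({0<..<rh} \<times> {- (bt / 2)<..<bt / 2})"
  proof (intro equalityI subsetI)
    fix x assume "x \<in> sector bt rh"
    then obtain r \<phi> where x: "x = complex_of_real r * cis \<phi>" "0 < r" "r < rh" "\<bar>\<phi>\<bar> < bt / 2" by (auto simp: sector_iff)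
    then show "x \<in> (%p. complex_of_real (fst p) * cis (snd p)) ` ({0<..<rh} \<times> {- (bt / 2)<..<bt / 2})"
      by (intro image_eqI[of _ _ "(r, \<phi>)"]) (auto simp: abs_less_iff)
  next
    fix x assume "x \<in> (%p. complex_of_real (fst p) * cis (snd p)) ` ({0<..<rh} \<times> {- (bt / 2)<..<bt / 2})"
    then obtain r \<phi> where "x = complex_of_real r * cis \<phi>" "0 < r" "r < rh" "- (bt / 2) < \<phi>" "\<phi> < bt / 2" by auto
    moreover from this have "\<bar>\<phi>\<bar> < bt / 2" by linarith
    ultimately show "x \<in> sector bt rh" unfolding sector_iff by blast
  qed
  moreover have "connected ((%p. complex_of_real (fst p) * cis (snd p)) ` ({0<..<rh} \<times> {- (bt / 2)<..<bt / 2}))"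
    by (intro connected_continuous_image connected_Times continuous_intros) auto
  ultimately show ?thesis by simp
qed

lemma sector_nonempty: "0 < bt ==> 0 < rh ==> sector bt rh ~= {}"
proof -
  assume "0 < bt" "0 < rh"
  then have "complex_of_real (rh / 2) * cis 0 \<in> sector bt rh" unfolding sector_iff by (intro exI[of _ "rh / 2"] exI[of _ 0]) auto
  then show ?thesis by blast
qed

text \<open>The identity theorem in \<open>x\<close> alone, with angle and parameter fixed.\<close>

lemma sector_continuation:
  fixes f g :: "complex \<times> 'a::complex_normed_space => complex"
  assumes f: "f cholomorphic_on sector bt rh \<times> T" and g: "g cholomorphic_on sector bt rh \<times> T"
    and bt: "0 < bt" "bt <= pi" and rh': "0 < rh'" "rh' <= rh"
    and eq: "!!x q. x \<in> sector bt rh' ==> q \<in> T ==> f (x, q) = g (x, q)" and x: "x \<in> sector bt rh" and q: "q \<in> T"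
  shows "f (x, q) = g (x, q)"
proof -
  have sl: "(%x. h (x, q)) holomorphic_on sector bt rh" if "h cholomorphic_on sector bt rh \<times> T" for h :: "complex \<times> 'a => complex"
  proof -
    have "(%x. h (x, q)) cholomorphic_on sector bt rh"
      using q by (intro chol_compose[of "%x. (x, q)" _ h, OF _ that] cholomorphic_intros open_sector[OF bt(2)]) auto
    then show ?thesis by (simp add: cholomorphic_on_complex_iff)
  qed
  define h where "h x = f (x, q) - g (x, q)" for x
  have hh: "h holomorphic_on sector bt rh" unfolding h_def by (intro holomorphic_on_diff sl f g)
  obtain \<xi> where \<xi>: "\<xi> \<in> sector bt rh'" using sector_nonempty[OF bt(1) rh'(1)] by blast
  have sub: "sector bt rh' \<subseteq> sector bt rh" using sector_mono[OF order_refl rh'(2)] .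
  have "\<xi> islimpt sector bt rh'" using interior_limit_point[of \<xi> "sector bt rh'"] interior_open[OF open_sector[OF bt(2)]] \<xi> by auto
  then have "h x = 0"
    by (rule analytic_continuation[OF hh open_sector[OF bt(2)] connected_sector sub subsetD[OF sub \<xi>]]) (auto simp: h_def eq q x)
  then show ?thesis by (simp add: h_def)
qed

section \<open>Congruences of torus-valued maps\<close>

lemma analytic_torus_valued_local:
  assumes "analytic_torus_valued D f" "z \<in> D"
  obtains V h where "z \<in> V" "V \<subseteq> D" "h cholomorphic_on V" "\<forall>w\<in>V. f w \<doteq> h w"
proof -
  have "\<exists>V h. z \<in> V & V \<subseteq> D & h cholomorphic_on V & (\<forall>w\<in>V. f w \<doteq> h w)"
    using assms unfolding analytic_torus_valued_def by simp
  then obtain V h where "z \<in> V & V \<subseteq> D & h cholomorphic_on V & (\<forall>w\<in>V. f w \<doteq> h w)" by (elim exE)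
  then show ?thesis by (intro that[of V h]) auto
qed

text \<open>The exponential turns a congruence into an equation between functions that do not depend
  on the chosen representatives.\<close>

lemma torus_eq_exp: "f \<doteq> g \<longleftrightarrow> (\<forall>i. exp (2 * complex_of_real pi * \<i> * (f $ i - g $ i)) = 1)"
proof -
  have "exp (2 * complex_of_real pi * \<i> * w) = 1 \<longleftrightarrow> w \<in> \<int>" for w
  proof
    assume "exp (2 * complex_of_real pi * \<i> * w) = 1"
    then obtain n :: int where "Re (2 * complex_of_real pi * \<i> * w) = 0" "Im (2 * complex_of_real pi * \<i> * w) = of_int (2 * n) * pi"
      by (auto simp: exp_eq_1)
    then have "w = of_int n" by (simp add: complex_eq_iff)
    then show "w \<in> \<int>" by simp
  qed (auto simp: Ints_def exp_eq_1)
  then show ?thesis by (simp add: torus_eq_def lattice_pts_def)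
qed

text \<open>The representatives may jump, but the exponential of their difference is holomorphic,
  being locally that of a difference of holomorphic representatives. The identity theorem is applied
  to it.\<close>

lemma sector_continuation_torus:
  fixes f g :: "complex \<times> ('d::finite, 'p::finite) angle_param => complex ^ 'd"
  assumes f: "analytic_torus_valued (sector bt rh \<times> T) f" and g: "analytic_torus_valued (sector bt rh \<times> T) g"
    and bt: "0 < bt" "bt <= pi" and rh': "0 < rh'" "rh' <= rh"
    and eq: "!!x q. x \<in> sector bt rh' ==> q \<in> T ==> f (x, q) \<doteq> g (x, q)" and x: "x \<in> sector bt rh" and q: "q \<in> T"
  shows "f (x, q) \<doteq> g (x, q)"
  unfolding torus_eq_exp
proof
  fix i
  let ?D = "sector bt rh \<times> T"
  have oD: "open ?D" using f by (simp add: analytic_torus_valued_def torus_domain_def)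
  define e where "e z = exp (2 * complex_of_real pi * \<i> * (f z $ i - g z $ i))" for z
  have cexp: "exp cholomorphic_on (UNIV :: complex set)" by (simp add: cholomorphic_on_complex_iff holomorphic_intros)
  have "e cholomorphic_on ?D"
  proof (rule chol_locally)
    fix z assume z: "z \<in> ?D"
    obtain V h where V: "z \<in> V" "V \<subseteq> ?D" "h cholomorphic_on V" "\<forall>w\<in>V. f w \<doteq> h w" by (rule analytic_torus_valued_local[OF f z])
    obtain V' h' where V': "z \<in> V'" "V' \<subseteq> ?D" "h' cholomorphic_on V'" "\<forall>w\<in>V'. g w \<doteq> h' w" by (rule analytic_torus_valued_local[OF g z])
    have oV: "open (V \<inter> V')" using chol_open[OF V(3)] chol_open[OF V'(3)] by (rule open_Int)
    have "h cholomorphic_on V \<inter> V'" "h' cholomorphic_on V \<inter> V'"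
      by (rule chol_subset[OF V(3) oV Int_lower1], rule chol_subset[OF V'(3) oV Int_lower2])
    then have "(%w. 2 * complex_of_real pi * \<i> * (h w $ i - h' w $ i)) cholomorphic_on V \<inter> V'" using oV by (intro cholomorphic_intros)
    then have "(%w. exp (2 * complex_of_real pi * \<i> * (h w $ i - h' w $ i))) cholomorphic_on V \<inter> V'"
      by (rule chol_compose[OF _ cexp]) simp
    moreover have "exp (2 * complex_of_real pi * \<i> * (h w $ i - h' w $ i)) = e w" if w: "w \<in> V \<inter> V'" for w
    proof -
      have "f w \<doteq> h w" "g w \<doteq> h' w" using V(4) V'(4) w by auto
      then have "f w - g w \<doteq> h w - h' w" by (rule torus_eq_diff)
      then have "exp (2 * complex_of_real pi * \<i> * ((f w $ i - g w $ i) - (h w $ i - h' w $ i))) = 1"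
        unfolding torus_eq_exp by simp
      then have "exp (2 * complex_of_real pi * \<i> * (f w $ i - g w $ i)) / exp (2 * complex_of_real pi * \<i> * (h w $ i - h' w $ i)) = 1"
        by (simp add: exp_diff right_diff_distrib)
      then show ?thesis by (simp add: e_def)
    qed
    ultimately have "e cholomorphic_on V \<inter> V'" by (rule chol_transform)
    then show "\<exists>V. z \<in> V & V \<subseteq> ?D & e cholomorphic_on V" using V(1,2) V'(1) by (intro exI[of _ "V \<inter> V'"]) auto
  qed
  moreover have "(%z. 1) cholomorphic_on ?D" by (rule chol_const[OF oD])
  ultimately have "e (x, q) = 1"
    by (rule sector_continuation[OF _ _ bt rh' _ x q]) (use eq in \<open>auto simp: e_def torus_eq_exp\<close>)
  then show "exp (2 * complex_of_real pi * \<i> * (f (x, q) $ i - g (x, q) $ i)) = 1" by (simp add: e_def)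
qed

lemma analytic_fun_subset:
  assumes "analytic_fun E f" "torus_domain D" "D \<subseteq> E"
  shows "analytic_fun D f"
  using assms unfolding analytic_fun_def by (auto intro: chol_subset simp: torus_domain_def)

lemma analytic_torus_valued_subset:
  assumes f: "analytic_torus_valued E f" and D: "torus_domain D" "D \<subseteq> E"
  shows "analytic_torus_valued D f"
proof -
  have oD: "open D" using D by (simp add: torus_domain_def)
  have "\<exists>V h. z \<in> V & V \<subseteq> D & h cholomorphic_on V & (\<forall>w\<in>V. f w \<doteq> h w)" if z: "z \<in> D" for z
  proof -
    obtain V h where V: "z \<in> V" "V \<subseteq> E" "h cholomorphic_on V" "\<forall>w\<in>V. f w \<doteq> h w"
      by (rule analytic_torus_valued_local[OF f subsetD[OF D(2) z]])
    have "h cholomorphic_on V \<inter> D"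
      using V(3) oD chol_open[OF V(3)] by (intro chol_subset[OF V(3)]) auto
    then show ?thesis using V z by (intro exI[of _ "V \<inter> D"] exI[of _ h]) auto
  qed
  moreover have "f (u, th + k, mu) \<doteq> f (u, th, mu)" if "(u, th, mu) \<in> D" "k \<in> lattice_pts" for u th mu k
    using f subsetD[OF D(2) that(1)] that(2) by (simp add: analytic_torus_valued_def)
  ultimately show ?thesis using D(1) unfolding analytic_torus_valued_def by simp
qed

lemma analytic_fun_torus_valued: "analytic_fun D f ==> analytic_torus_valued D f"
proof -
  assume f: "analytic_fun D f"
  then have h: "f cholomorphic_on D" by (simp add: analytic_fun_def)
  have "\<exists>V h. z \<in> V & V \<subseteq> D & h cholomorphic_on V & (\<forall>w\<in>V. f w \<doteq> h w)" if "z \<in> D" for z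
    by (rule exI[of _ D], rule exI[of _ f]) (simp add: that h)
  then show ?thesis using f by (simp add: analytic_fun_def analytic_torus_valued_def)
qed

text \<open>Subtracting the angle from a torus map close to the identity leaves a small torus-valued
  map, which can be lifted.\<close>

lemma analytic_torus_valued_diff_angle:
  fixes f :: "'a::complex_normed_space \<times> ('d::finite, 'p::finite) angle_param => complex ^ 'd"
  assumes f: "analytic_torus_valued D f"
  shows "analytic_torus_valued D (%z. f z - fst (snd z))"
  unfolding analytic_torus_valued_def
proof (intro conjI ballI allI impI)
  fix z assume z: "z \<in> D"
  obtain V h where V: "z \<in> V" "V \<subseteq> D" "h cholomorphic_on V" "\<forall>w\<in>V. f w \<doteq> h w"
    by (rule analytic_torus_valued_local[OF f z])
  have "(%z. h z - fst (snd z)) cholomorphic_on V" using chol_open[OF V(3)] by (intro cholomorphic_intros V)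
  then show "\<exists>V h. z \<in> V & V \<subseteq> D & h cholomorphic_on V & (\<forall>w\<in>V. f w - fst (snd w) \<doteq> h w)"
    using V by (intro exI[of _ V] exI[of _ "%z. h z - fst (snd z)"]) (auto intro: torus_eq_diff)
next
  fix u th mu and k :: "complex ^ 'd" assume z: "(u, th, mu) \<in> D" and k: "k \<in> lattice_pts"
  have "th + k \<doteq> th" using k by (simp add: torus_eq_def)
  then show "f (u, th + k, mu) - fst (snd (u, th + k, mu)) \<doteq> f (u, th, mu) - fst (snd (u, th, mu))"
    using torus_eq_diff[of "f (u, th + k, mu)" "f (u, th, mu)"] f z k by (simp add: analytic_torus_valued_def)
qed (use f in \<open>simp add: analytic_torus_valued_def\<close>)

lemma torus_domain_sector: "bt <= pi ==> open L ==> torus_domain (sector bt rh \<times> strip sg \<times> L)"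
  by (auto simp: torus_domain_def strip_add_lattice_iff intro!: open_Times open_sector open_strip)

text \<open>All smallness conditions on a radius have the form \<open>rh * c <= b\<close> with
  \<open>b > 0\<close> and are met together.\<close>

lemma small_radius:
  fixes ps :: "(real \<times> real) list"
  assumes "\<forall>p\<in>set ps. 0 < snd p"
  shows "\<exists>rh>0. \<forall>p\<in>set ps. rh * fst p <= snd p"
  using assms
proof (induction ps)
  case Nil
  then show ?case by (auto intro: exI[of _ 1])
next
  case (Cons p ps)
  then obtain rh where rh: "rh > 0" "\<forall>p\<in>set ps. rh * fst p <= snd p" by auto
  define r where "r = min rh (snd p / (\<bar>fst p\<bar> + 1))"
  have p: "0 < snd p" using Cons by simp
  have r: "0 < r" "r <= rh" using rh p by (auto simp: r_def add_nonneg_pos)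
  have "r * fst p <= r * (\<bar>fst p\<bar> + 1)" using r by (intro mult_left_mono) auto
  also have "... <= snd p / (\<bar>fst p\<bar> + 1) * (\<bar>fst p\<bar> + 1)" by (intro mult_right_mono) (auto simp: r_def)
  finally have 1: "r * fst p <= snd p" by (simp add: add_nonneg_eq_0_iff)
  have "r * fst q <= snd q" if q: "q \<in> set ps" for q
  proof (cases "0 <= fst q")
    case True
    then show ?thesis using mult_right_mono[OF r(2) True] rh(2) q by force
  next
    case False
    then have "r * fst q <= 0" using r by (simp add: mult_le_0_iff)
    then show ?thesis using Cons.prems q by force
  qed
  then show ?case using r(1) 1 by auto
qed

subsection \<open>The radial dynamics\<close>

text \<open>With \<open>r = x * (1 - w)\<close> one has \<open>w = A * x ^ (N - 1) + e\<close>.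
  Besides invariance and decrease, the norm comparison uses the reverse estimate, which controls the
  change of the angle weight, and the slow variation of \<open>x ^ (N - 1)\<close>.\<close>

lemma radial_step:
  assumes x: "x \<in> sector bt rh" and N: "2 <= N" and bt: "real (N - 1) * bt <= pi" "real (N - 1) * (bt / 2) <= arctan dl" "0 < dl"
    and A: "0 < al0" "al0 <= Re A" "\<bar>Im A\<bar> <= et" "2 * et < al0 * sin (real (N - 1) * bt / 4)" "Re A * dl + 3 * et <= ep" "ep < al0"
    and r: "cmod (r - (x - A * x ^ N)) <= C' * cmod x ^ (N + 1)"
    and C: "real N * (Re A + 2 * et) <= C" "real N * Re A + ep <= C"
    and small: "cmod x <= 1" "cmod x * C' <= et" "cmod x * C ^ 2 <= et" "cmod x * C <= 1 / 2" "cmod x * (2 * C) <= bt / 8"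
  shows "r \<in> sector bt rh" "cmod r <= cmod x * (1 - (Re A - ep) * cmod x ^ (N - 1))"
    "cmod x <= (1 + (real N * Re A + ep) * cmod x ^ (N - 1)) * cmod r"
    "cmod (r ^ (N - 1) - x ^ (N - 1)) <= C * cmod x * cmod (x ^ (N - 1))"
proof -
  define s where "s = x ^ (N - 1)"
  define t where "t = cmod x"
  define w where "w = 1 - r / x"
  have t: "0 < t" "t <= 1" using sector_norm[OF x] small(1) by (auto simp: t_def)
  have x0: "x ~= 0" using t by (auto simp: t_def)
  have rx: "r = x * (1 - w)" using x0 by (simp add: w_def)
  have et0: "0 <= et" using A(3) by linarith
  have A0: "0 < Re A" using A by linarith
  have xN: "x ^ N = x * s" using N by (simp add: s_def flip: power_Suc)
  have cs: "cmod s = t ^ (N - 1)" by (simp add: s_def t_def norm_power)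
  have s0: "0 < cmod s" using t by (simp add: cs)
  have st: "cmod s <= t" using power_decreasing[of 1 "N - 1" t] t N by (simp add: cs)
  define e where "e = w - A * s"
  have "r - (x - A * x ^ N) = - (x * e)" unfolding rx xN e_def by (simp add: algebra_simps)
  then have "t * cmod e <= C' * t ^ (N + 1)" using r by (simp add: norm_mult t_def)
  also have "... = t * ((t * C') * cmod s)" using N unfolding cs by (cases N) auto
  finally have "cmod e <= (t * C') * cmod s" using t by simp
  also have "... <= et * cmod s" using small(2) by (intro mult_right_mono) (auto simp: t_def)
  finally have e: "cmod e <= et * cmod s" .
  have w: "w = A * s + e" by (simp add: e_def)
  define b where "b = Re A + 2 * et"
  have b0: "0 < b" using A0 et0 by (simp add: b_def)
  have "1 * b <= real N * b" using N b0 by (intro mult_right_mono) auto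
  then have bC: "b <= C" using C(1) by (simp add: b_def)
  have C0: "0 < C" using b0 bC by linarith
  have ang: "\<bar>Im s\<bar> <= dl * Re s" "0 <= Re s" using sector_power_angle[OF x bt(2)] by (auto simp: s_def)
  have "cmod s * b ^ 2 <= t * C ^ 2" using st bC b0 t by (intro mult_mono power_mono) auto
  then have sm: "cmod s * (Re A + 2 * et) ^ 2 <= et" using small(3) by (simp add: b_def t_def)
  note ob = one_minus_bounds[OF ang(1) less_imp_le[OF bt(3)] ang(2) w e A(3) less_imp_le[OF A0] sm]
  have "cmod w <= b * cmod s" using ob(2) by (simp add: b_def)
  also have "... <= C * t" using bC st b0 by (intro mult_mono) auto
  finally have wC: "cmod w <= t * C" by (simp add: mult.commute)
  have "(Re A - ep) * cmod s <= (Re A - (Re A * dl + 3 * et)) * cmod s" using A(5) by (intro mult_right_mono) auto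
  then have le: "cmod (1 - w) <= 1 - (Re A - ep) * cmod s" using ob(1) by linarith
  have "0 < (Re A - ep) * cmod s" using A s0 by (intro mult_pos_pos) auto
  then have lt: "cmod (1 - w) < 1" using le by linarith
  have w1: "cmod w <= 1 / 2" using wC small(4) by (simp add: t_def)
  have bt0: "0 < bt" using x by (auto simp: sector_iff)
  have "2 * cmod w <= bt / 8" using wC small(5) by (simp add: t_def)
  then have w2: "2 * cmod w < bt / 4" using bt0 by linarith
  have "x * (1 - w) \<in> sector bt rh"
    by (rule sector_step[OF x _ bt(1) w[unfolded s_def] _ A(3,2,1,4) w1 w2 lt]) (use N e cs t_def in auto)
  then show "r \<in> sector bt rh" by (simp add: rx)
  have cr: "cmod r = t * cmod (1 - w)" by (simp add: rx norm_mult t_def)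
  show "cmod r <= cmod x * (1 - (Re A - ep) * cmod x ^ (N - 1))"
    unfolding cr using mult_left_mono[OF le less_imp_le[OF t(1)]] by (simp add: cs t_def)
  define p where "p = real N * Re A + ep"
  have NA: "2 * Re A <= real N * Re A" using N A0 by (intro mult_right_mono) auto
  have dlA: "0 <= Re A * dl" using A0 bt(3) by simp
  have "2 * et < al0 * 1" using A(4) mult_left_mono[OF sin_le_one[of "real (N - 1) * bt / 4"] less_imp_le[OF A(1)]] by linarith
  then have etA: "et <= Re A" using A(2) et0 by linarith
  have p0: "0 <= p" using A0 NA A(5) et0 dlA by (simp add: p_def)
  have "p * b * cmod s <= C * C * t" using C(2) bC st p0 b0 C0 by (intro mult_mono) (auto simp: p_def)
  also have "... = t * C ^ 2" by (simp add: power2_eq_square)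
  also have "... <= et" using small(3) by (simp add: t_def)
  finally have pb: "p * b * cmod s <= et" .
  \<comment> \<open>The decrease of \<open>|x|\<close> is at most \<open>b |s|\<close>, and
    \<open>p\<close> exceeds \<open>b\<close> by roughly \<open>(N - 1) * Re A\<close>, which for
    \<open>N >= 2\<close> absorbs the product \<open>p b |s|\<close>.\<close>
  have "p - b - p * b * cmod s >= 0" using pb NA A(5) dlA etA et0 by (simp add: p_def b_def)
  then have "0 <= (p - b - p * b * cmod s) * cmod s" by simp
  then have pos: "1 <= (1 + p * cmod s) * (1 - b * cmod s)" by (simp add: algebra_simps)
  have "1 - b * cmod s <= cmod (1 - w)" using norm_triangle_ineq2[of 1 w] ob(2) by (simp add: b_def)
  then have "(1 + p * cmod s) * (1 - b * cmod s) <= (1 + p * cmod s) * cmod (1 - w)" using p0 by (intro mult_left_mono) auto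
  then have "t * 1 <= t * ((1 + p * cmod s) * cmod (1 - w))" using pos t by (intro mult_left_mono) auto
  then show "cmod x <= (1 + (real N * Re A + ep) * cmod x ^ (N - 1)) * cmod r"
    unfolding cr by (simp add: p_def cs t_def mult_ac)
  have "r ^ (N - 1) - x ^ (N - 1) = s * ((1 - w) ^ (N - 1) - 1 ^ (N - 1))" unfolding rx s_def power_mult_distrib by (simp add: right_diff_distrib)
  moreover have "cmod ((1 - w) ^ (N - 1) - 1 ^ (N - 1)) <= real (N - 1) * 1 ^ (N - 1 - 1) * cmod (1 - w - 1)"
    using lt by (intro norm_diff_power_le) auto
  ultimately have "cmod (r ^ (N - 1) - x ^ (N - 1)) <= cmod s * (real (N - 1) * cmod w)"
    by (simp add: norm_mult mult_left_mono)
  also have "... <= cmod s * (real N * (b * t))"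
  proof -
    have "cmod w <= b * t" using ob(2) mult_left_mono[OF st less_imp_le[OF b0]] by (simp add: b_def)
    then show ?thesis by (intro mult_left_mono mult_mono) auto
  qed
  also have "... = (real N * b) * t * cmod s" by simp
  also have "... <= C * t * cmod s" using C(1) t by (intro mult_right_mono) (auto simp: b_def)
  finally show "cmod (r ^ (N - 1) - x ^ (N - 1)) <= C * cmod x * cmod (x ^ (N - 1))" by (simp add: s_def t_def)
qed

subsection \<open>Averaged data near a compact set of parameters\<close>

lemma torus_average_nth:
  fixes B :: "('d::finite, 'p::finite) angle_param => complex ^ 'm ^ 'n"
  assumes B: "analytic_coeff sg0 LC B" and sg0: "sg0 > 0" and mu: "mu \<in> LC"
  shows "torus_average (%q. B q $ i $ j) mu = torus_average B mu $ i $ j"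
proof -
  have "continuous_on (cbox 0 1) (%th :: real ^ 'd. B (cvec th, mu))"
    by (rule continuous_on_compose2[OF chol_imp_continuous_on[OF coeff_slice[OF B mu]] continuous_on_cvec])
      (auto simp: strip_def cvec_def sg0)
  then have int: "(%th :: real ^ 'd. B (cvec th, mu)) integrable_on cbox 0 1" by (rule integrable_continuous)
  have bl: "bounded_linear (%v :: complex ^ 'm ^ 'n. v $ i $ j)"
    by (rule bounded_linear_compose[OF bounded_linear_vec_nth bounded_linear_vec_nth])
  show ?thesis using integral_linear[OF int bl] by (simp add: torus_average_def o_def)
qed

lemma matrix_vector_entry_bound:
  fixes A :: "complex ^ 'm ^ 'm"
  assumes e: "!!i j. cmod (A $ i $ j) <= e"
  shows "norm (A *v v) <= (real CARD('m) * real CARD('m)) * ((real CARD('m) * real CARD('m)) * e) * norm v"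
proof -
  have "norm A <= (\<Sum>i\<in>UNIV. \<Sum>j\<in>UNIV. norm (A $ i $ j))"
    by (rule order_trans[OF norm_vec_le_sum sum_mono[OF norm_vec_le_sum]])
  also have "... <= (\<Sum>i\<in>(UNIV :: 'm set). \<Sum>j\<in>(UNIV :: 'm set). e)" by (intro sum_mono e)
  finally have "norm A <= (real CARD('m) * real CARD('m)) * e" by simp
  then show ?thesis
    by (intro order_trans[OF norm_matrix_vector_le] mult_right_mono mult_left_mono) auto
qed

text \<open>All constants that do not involve the radius. The order of choice matters:
  \<open>al0\<close> and the adapted norms from the averages on \<open>S\<close>, then
  \<open>ep\<close>, \<open>ep'\<close>, \<open>dl\<close>, the aperture \<open>bt\<close>, and
  \<open>et\<close> against the sine of a fraction of \<open>bt\<close>. Only then is the parameter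
  neighbourhood shrunk so that the averages meet these bounds.\<close>

lemma averaging_data:
  fixes a :: "('d::finite, 'p::finite) angle_param => complex" and B :: "('d, 'p) angle_param => complex ^ 'm ^ 'm"
  assumes coeffs: "analytic_coeff sg0 LC a" "analytic_coeff sg0 LC B" and LC: "open LC" and sg: "0 < sg" "sg < sg0"
    and S: "compact S" "S \<subseteq> LC" and N: "2 <= N" and bt0: "0 < bt0"
    and dich: "diophantine om \<or> (\<forall>th\<in>strip sg0. \<forall>th'\<in>strip sg0. \<forall>mu\<in>LC. a (th, mu) = a (th', mu) & B (th, mu) = B (th', mu))"
    and apos: "!!mu. mu \<in> S ==> Im (torus_average a mu) = 0 & 0 < Re (torus_average a mu)"
    and Bpos: "!!mu \<nu>. mu \<in> S ==> \<nu> \<in> spec (torus_average B mu) ==> Re \<nu> > 0"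
  obtains L LC' al0 ep ep' dl bt et Cn C m M nrm where
    "compact L" "L \<subseteq> LC" "open LC'" "S \<subseteq> LC'" "LC' \<subseteq> L"
    "0 < al0" "0 < ep" "ep * (real Q + 5) <= al0 / 8" "0 < ep'" "4 * Cn * ep' <= ep" "1 <= Cn" "1 <= C"
    "0 < dl" "0 < bt" "bt <= bt0" "bt <= pi" "real (N - 1) * bt <= pi" "real (N - 1) * (bt / 2) <= arctan dl"
    "0 < et" "2 * et < al0 * sin (real (N - 1) * bt / 4)"
    "\<forall>mu\<in>LC'. al0 <= Re (torus_average a mu) & \<bar>Im (torus_average a mu)\<bar> <= et & Re (torus_average a mu) * dl + 3 * et <= ep &
      real N * cmod (torus_average a mu) + 4 * ep' <= real N * Re (torus_average a mu) + ep &
      real N * (Re (torus_average a mu) + 2 * et) <= C & real N * Re (torus_average a mu) + ep <= C"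
    "\<forall>mu\<in>LC'. vnorm Cn (nrm mu) & adapted dl (torus_average B mu) (nrm mu)"
    "\<forall>th\<in>strip sg. \<forall>mu\<in>LC'. cmod (of_nat N * a (th, mu)) <= C & cmod (a (th, mu)) <= C & cmod (torus_average a mu) <= C & cmod (m (th, mu)) <= C"
    "\<forall>th\<in>strip sg. \<forall>mu\<in>LC'. \<forall>v. norm (B (th, mu) *v v) <= C * norm v & norm (torus_average B mu *v v) <= C * norm v & norm (M (th, mu) *v v) <= C * norm v"
    "\<forall>th\<in>strip sg. \<forall>mu\<in>LC'. cmod (of_nat N * (a (th, mu) - torus_average a mu) + m (th, mu) - m (th + cvec om, mu)) <= ep'"
    "\<forall>th\<in>strip sg. \<forall>mu\<in>LC'. \<forall>v. norm (M (th, mu) *v v - M (th + cvec om, mu) *v v - B (th, mu) *v v + torus_average B mu *v v) <= ep' * norm v"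
proof -
  have sg0: "0 < sg0" using sg by linarith
  let ?A = "torus_average a" and ?B = "torus_average B"
  have cA: "continuous_on LC ?A" and cB: "continuous_on LC ?B"
    using continuous_torus_average[OF coeffs(1) sg0] continuous_torus_average[OF coeffs(2) sg0] by auto
  obtain e where e: "e > 0" "(\<Union>x\<in>S. cball x e) \<subseteq> LC"
    using compact_subset_open_imp_cball_epsilon_subset[OF S(1) LC S(2)] by auto
  \<comment> \<open>A sum of compact sets, hence a compact neighbourhood of \<open>S\<close>; the
    coefficient bounds are taken on it.\<close>
  define L where "L = {x + y |x y. x \<in> S & y \<in> cball 0 e}"
  have L: "compact L" unfolding L_def by (intro compact_sums S compact_cball)
  have LLC: "L \<subseteq> LC"
  proof
    fix z assume "z \<in> L"
    then obtain x y where "z = x + y" "x \<in> S" "norm y <= e" by (auto simp: L_def)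
    then have "z \<in> cball x e" "x \<in> S" by (auto simp: dist_norm)
    then show "z \<in> LC" using e(2) by blast
  qed
  define Lo where "Lo = (\<Union>x\<in>S. ball x e)"
  have Lo: "open Lo" by (auto simp: Lo_def)
  have LoL: "Lo \<subseteq> L"
  proof
    fix z assume "z \<in> Lo"
    then obtain x where x: "x \<in> S" "dist x z < e" by (auto simp: Lo_def)
    have "z = x + (z - x)" "z - x \<in> cball 0 e" using x by (auto simp: dist_norm norm_minus_commute)
    then show "z \<in> L" unfolding L_def using x(1) by blast
  qed
  have SLo: "S \<subseteq> Lo" using e(1) by (auto simp: Lo_def intro!: bexI[of _ _ S])
  have cRe: "continuous_on S (%mu. Re (?A mu))" using continuous_on_subset[OF cA S(2)] by (intro continuous_intros)
  have cI: "compact ((%mu. Re (?A mu)) ` S)" by (rule compact_continuous_image[OF cRe S(1)])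
  obtain a0 where a0: "a0 > 0" "!!mu. mu \<in> S ==> a0 <= Re (?A mu)"
  proof -
    obtain y where y: "y \<in> insert 1 ((%mu. Re (?A mu)) ` S)" "\<forall>t\<in>insert 1 ((%mu. Re (?A mu)) ` S). y <= t"
      using compact_attains_inf[OF compact_insert[OF cI, of 1]] by blast
    have "y > 0" using y(1) apos by auto
    then show ?thesis using y(2) by (intro that[of y]) auto
  qed
  obtain b0 where b0: "b0 > 0" "!!mu. mu \<in> S ==> \<bar>Re (?A mu)\<bar> <= b0"
    using compact_imp_bounded[OF cI] by (auto simp: bounded_pos)
  define al0 where "al0 = a0 / 2"
  define al1 where "al1 = b0 + 1"
  have al: "0 < al0" "0 < al1" and alS: "!!mu. mu \<in> S ==> al0 < Re (?A mu) & Re (?A mu) < al1"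
    using a0 b0 by (force simp: al0_def al1_def)+
  have cBS: "compact (?B ` S)" by (rule compact_continuous_image[OF continuous_on_subset[OF cB S(2)] S(1)])
  obtain Cn dl0 where Cn: "dl0 > 0" "Cn >= 1" "\<forall>A\<in>?B ` S. \<forall>A'. norm (A' - A) <= dl0 --> (\<exists>nrm. vnorm Cn nrm & adapted dl0 A' nrm)"
    using adapted_norm_compact[OF cBS] Bpos by blast
  \<comment> \<open>\<open>weight_decrease\<close> asks for \<open>ep * (q + 4) <= al0 / 8\<close>,
    and the largest exponent used is \<open>q = Q + 1\<close>.\<close>
  define ep where "ep = al0 / (8 * (real Q + 5))"
  have ep: "0 < ep" "ep * (real Q + 5) <= al0 / 8" using al by (auto simp: ep_def field_simps add_pos_nonneg)
  \<comment> \<open>Small enough for the \<open>y\<close> part, where it is multiplied by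
    \<open>4 * Cn\<close>, and to leave half of \<open>ep\<close> for the imaginary part of the
    average of \<open>a\<close>.\<close>
  define ep' where "ep' = ep / (8 * Cn)"
  have ep': "0 < ep'" "8 * Cn * ep' = ep" using ep Cn by (auto simp: ep'_def)
  have "1 * ep' <= Cn * ep'" using Cn ep' by (intro mult_right_mono) auto
  then have ep'2: "4 * Cn * ep' <= ep" "8 * ep' <= ep" using ep' by auto
  define dl where "dl = min dl0 (ep / (2 * al1))"
  have dl: "0 < dl" "dl <= dl0" using Cn ep al by (auto simp: dl_def)
  have "al1 * dl <= al1 * (ep / (2 * al1))" using al by (intro mult_left_mono) (auto simp: dl_def)
  then have aldl: "al1 * dl <= ep / 2" using al by simp
  define bt where "bt = min bt0 (min (pi / real N) (2 * arctan dl / real N))"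
  have bt: "0 < bt" "bt <= bt0" using bt0 N dl by (auto simp: bt_def)
  have "real N * bt <= real N * (pi / real N)" "real N * bt <= real N * (2 * arctan dl / real N)"
    by (intro mult_left_mono; simp add: bt_def)+
  then have Nbt: "real N * bt <= pi" "real N * bt <= 2 * arctan dl" using N by auto
  have "real (N - 1) * bt <= real N * bt" "1 * bt <= real N * bt" using bt N by (intro mult_right_mono; simp)+
  then have bt': "bt <= pi" "real (N - 1) * bt <= pi" "real (N - 1) * (bt / 2) <= arctan dl" using Nbt by auto
  have "0 < real (N - 1) * bt / 4" "real (N - 1) * bt / 4 < pi" using N bt(1) mult_pos_pos[of "real (N - 1)" bt] bt'(2) pi_gt_zero by (simp, linarith)
  then have sin0: "0 < sin (real (N - 1) * bt / 4)" by (rule sin_gt_zero)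
  \<comment> \<open>The entries serve, in turn, the decrease of \<open>|x|\<close>, the replacement
    of the modulus of the average by its real part, and the inward rotation at the sector
    edges.\<close>
  define et where "et = min (ep / 6) (min (ep / (2 * real N)) (al0 * sin (real (N - 1) * bt / 4) / 4))"
  have as0: "0 < al0 * sin (real (N - 1) * bt / 4)" using al sin0 by simp
  have et: "0 < et" "et <= ep / 6" "et <= al0 * sin (real (N - 1) * bt / 4) / 4" 
  proof -
    have "0 < ep / 6" "0 < ep / (2 * real N)" "0 < al0 * sin (real (N - 1) * bt / 4) / 4" using ep N as0 by simp_all
    then show "0 < et" by (simp only: et_def min_less_iff_conj simp_thms)
    show "et <= ep / 6" unfolding et_def by (rule min.cobounded1)
    show "et <= al0 * sin (real (N - 1) * bt / 4) / 4" unfolding et_def by (rule min.coboundedI2[OF min.cobounded2])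
  qed
  have et2: "2 * et < al0 * sin (real (N - 1) * bt / 4)" using et(3) as0 by linarith
  have "real N * et <= real N * (ep / (2 * real N))" by (intro mult_left_mono) (auto simp: et_def)
  then have Net: "real N * et <= ep / 2" using N by simp
  \<comment> \<open>Open conditions on the pair of averages; since the averages are continuous in
    the parameter, the preimage is an open neighbourhood of \<open>S\<close>.\<close>
  define T where "T = {p :: complex \<times> (complex ^ 'm ^ 'm). al0 < Re (fst p) & Re (fst p) < al1 & \<bar>Im (fst p)\<bar> < et} \<inter> (\<Union>mu\<in>S. {p. norm (snd p - ?B mu) < dl0})"
  have oT: "open T" unfolding T_def
    by (intro open_Int open_UN ballI open_Collect_conj open_Collect_less continuous_intros)
  define LC' where "LC' = Lo \<inter> (%mu. (?A mu, ?B mu)) -` T"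
  have LC'1: "open LC'" unfolding LC'_def
    using continuous_on_subset[OF cA] continuous_on_subset[OF cB] LoL LLC
    by (intro continuous_open_preimage Lo oT continuous_intros) blast+
  have LC'2: "S \<subseteq> LC'"
  proof
    fix mu assume mu: "mu \<in> S"
    have "\<exists>\<nu>\<in>S. norm (?B mu - ?B \<nu>) < dl0" using Cn(1) mu by (intro bexI[of _ mu]) auto
    then show "mu \<in> LC'" using SLo alS[OF mu] apos[OF mu] et(1) mu by (auto simp: LC'_def T_def)
  qed
  have LC'3: "LC' \<subseteq> L" using LoL by (auto simp: LC'_def)
  have LC'T: "al0 < Re (?A mu)" "Re (?A mu) < al1" "\<bar>Im (?A mu)\<bar> < et" "\<exists>\<nu>\<in>S. norm (?B mu - ?B \<nu>) <= dl0" if "mu \<in> LC'" for mu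
    using that by (auto simp: LC'_def T_def) (meson less_imp_le)
  have "\<forall>mu. \<exists>n. mu \<in> LC' --> vnorm Cn n & adapted dl (?B mu) n"
  proof
    fix mu
    show "\<exists>n. mu \<in> LC' --> vnorm Cn n & adapted dl (?B mu) n"
    proof (cases "mu \<in> LC'")
      case True
      then obtain \<nu> where \<nu>: "\<nu> \<in> S" "norm (?B mu - ?B \<nu>) <= dl0" using LC'T(4) by auto
      obtain n where n: "vnorm Cn n" "adapted dl0 (?B mu) n" using Cn(3)[rule_format, OF imageI[OF \<nu>(1)] \<nu>(2)] by auto
      show ?thesis by (rule exI[of _ n]) (simp add: n(1) adapted_mono[OF n(2) dl(2,1)])
    qed simp
  qed
  then obtain nrm where nrm: "\<forall>mu. mu \<in> LC' --> vnorm Cn (nrm mu) & adapted dl (?B mu) (nrm mu)" by metis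
  define n where "n = real CARD('m) * real CARD('m)"
  have n1: "1 <= n"
  proof -
    have "1 <= real CARD('m)" using zero_less_card_finite[where 'a='m] by linarith
    then have "1 * 1 <= real CARD('m) * real CARD('m)" by (intro mult_mono) auto
    then show ?thesis by (simp add: n_def)
  qed
  have da: "diophantine om \<or> (\<forall>th\<in>strip sg0. \<forall>th'\<in>strip sg0. \<forall>mu\<in>LC. a (th, mu) = a (th', mu))" using dich by auto
  have eN: "ep' / real N > 0" using ep' N by simp
  obtain ca Ca where ca: "Ca > 0" "\<forall>th\<in>cstrip sg. \<forall>mu\<in>L. cmod (ca (th, mu)) <= Ca &
      cmod (a (th, mu) - ?A mu + ca (th, mu) - ca (th + cvec om, mu)) <= ep' / real N"
    using approximate_cohomological_equation[where om=om, OF coeffs(1) LC sg L LLC da eN] by (elim exE conjE) (rule that)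
  \<comment> \<open>One factor \<open>n\<close> passes from the entries to the norm of a matrix, the
    other from the norm to the matrix acting on vectors.\<close>
  define ep'' where "ep'' = ep' / (n * n)"
  have ep'': "0 < ep''" "n * (n * ep'') = ep'" using ep' n1 by (auto simp: ep''_def)
  have cij: "analytic_coeff sg0 LC (%q. B q $ i $ j)" for i j
    using coeffs(2) unfolding analytic_coeff_def by (auto intro!: chol_vec_nth)
  define prim where "prim ij c C \<longleftrightarrow> C > 0 & (\<forall>th\<in>cstrip sg. \<forall>mu\<in>L. cmod (c (th, mu)) <= C &
      cmod (B (th, mu) $ fst ij $ snd ij - torus_average (%q. B q $ fst ij $ snd ij) mu + c (th, mu) - c (th + cvec om, mu)) <= ep'')"
    for ij :: "'m \<times> 'm" and c :: "('d, 'p) angle_param => complex" and C :: real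
  have "\<exists>c C. prim ij c C" for ij
  proof -
    have d: "diophantine om \<or> (\<forall>th\<in>strip sg0. \<forall>th'\<in>strip sg0. \<forall>mu\<in>LC. B (th, mu) $ fst ij $ snd ij = B (th', mu) $ fst ij $ snd ij)"
      using dich
    proof
      assume h: "\<forall>th\<in>strip sg0. \<forall>th'\<in>strip sg0. \<forall>mu\<in>LC. a (th, mu) = a (th', mu) & B (th, mu) = B (th', mu)"
      show ?thesis
      proof (intro disjI2 ballI)
        fix th th' :: "complex ^ 'd" and mu assume "th \<in> strip sg0" "th' \<in> strip sg0" "mu \<in> LC"
        then have "B (th, mu) = B (th', mu)" using h by blast
        then show "B (th, mu) $ fst ij $ snd ij = B (th', mu) $ fst ij $ snd ij" by simp
      qed
    qed (rule disjI1)
    show ?thesis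
      unfolding prim_def
      by (rule approximate_cohomological_equation[where f="%q. B q $ fst ij $ snd ij" and om=om, OF cij[of "fst ij" "snd ij"] LC sg L LLC d ep''(1)])
  qed
  then have "\<forall>ij. \<exists>c C. prim ij c C" by (rule allI)
  then obtain cb Cb where prim: "!!ij. prim ij (cb ij) (Cb ij)" by metis
  note cb = prim[unfolded prim_def]
  define Cs where "Cs = Max (range Cb)"
  have Cs: "Cb ij <= Cs" for ij by (simp add: Cs_def)
  have Cs0: "0 < Cs" using less_le_trans[OF conjunct1[OF cb] Cs[of undefined]] .
  \<comment> \<open>The factor \<open>N\<close> appears because the preconditioner contains
    \<open>N a s\<close>. In the next definition the sign is reversed because \<open>B\<close>
    enters as \<open>1 - s B\<close>.\<close>
  define m where "m q = of_nat N * ca q" for q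
  define M :: "('d, 'p) angle_param => complex ^ 'm ^ 'm" where "M q = (\<chi> i j. - cb (i, j) q)" for q
  obtain Ma where Ma: "Ma > 0" "\<forall>th\<in>cstrip sg. \<forall>mu\<in>L. norm (a (th, mu)) <= Ma" using coeff_bounded[OF coeffs(1) LC sg(2) L LLC] by auto
  obtain MB where MB: "MB > 0" "\<forall>th\<in>cstrip sg. \<forall>mu\<in>L. norm (B (th, mu)) <= MB" using coeff_bounded[OF coeffs(2) LC sg(2) L LLC] by auto
  obtain Mb where Mb: "Mb > 0" "!!mu. mu \<in> L ==> norm (?B mu) <= Mb"
    using compact_imp_bounded[OF compact_continuous_image[OF continuous_on_subset[OF cB LLC] L]] by (auto simp: bounded_pos)
  define X1 where "X1 = real N * (al1 + 2 * et)"
  define X2 where "X2 = real N * al1 + ep"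
  define X3 where "X3 = real N * Ma"
  define X6 where "X6 = real N * Ca"
  define X7 where "X7 = n * MB"
  define X8 where "X8 = n * Mb"
  define X9 where "X9 = n * (n * Cs)"
  define C where "C = 1 + X1 + X2 + X3 + Ma + (al1 + et) + X6 + X7 + X8 + X9"
  have X: "0 <= X1" "0 <= X2" "0 <= X3" "0 <= X6" "0 <= X7" "0 <= X8" "0 <= X9"
    using al et ep Ma MB Mb Cs0 ca(1) n1 by (auto simp: X1_def X2_def X3_def X6_def X7_def X8_def X9_def)
  have C: "1 <= C" "X1 <= C" "X2 <= C" "X3 <= C" "Ma <= C" "al1 + et <= C" "X6 <= C" "X7 <= C" "X8 <= C" "X9 <= C"
    using X al et Ma unfolding C_def by linarith+
  have cs: "th \<in> cstrip sg" "th + cvec om \<in> cstrip sg" if "th \<in> strip sg" for th :: "complex ^ 'd"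
    using subsetD[OF strip_subset_cstrip that] by (auto simp: cvec_in_cstrip)
  have mvn: "norm (A *v v) <= C * norm v" if "norm A <= k" "n * k <= C" for A :: "complex ^ 'm ^ 'm" and k v
  proof -
    have "n * norm A <= C" using mult_left_mono[OF that(1), of n] that(2) n1 by linarith
    then have "n * norm A * norm v <= C * norm v" by (rule mult_right_mono) simp
    then show ?thesis using norm_matrix_vector_le[of A v] by (simp add: n_def)
  qed
  show thesis
  proof (rule that[OF L LLC LC'1 LC'2 LC'3 al(1) ep ep'(1) ep'2(1) Cn(2) C(1) dl(1) bt bt' et(1) et2])
    show "\<forall>mu\<in>LC'. al0 <= Re (?A mu) & \<bar>Im (?A mu)\<bar> <= et & Re (?A mu) * dl + 3 * et <= ep &
      real N * cmod (?A mu) + 4 * ep' <= real N * Re (?A mu) + ep &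
      real N * (Re (?A mu) + 2 * et) <= C & real N * Re (?A mu) + ep <= C"
    proof (intro ballI conjI)
      fix mu assume mu: "mu \<in> LC'"
      note T = LC'T[OF mu]
      show "al0 <= Re (?A mu)" "\<bar>Im (?A mu)\<bar> <= et" using T by auto
      have "Re (?A mu) * dl <= al1 * dl" using T dl by (intro mult_right_mono) auto
      then show "Re (?A mu) * dl + 3 * et <= ep" using aldl et(2) by linarith
      have "cmod (?A mu) <= Re (?A mu) + et" using cmod_le[of "?A mu"] T al by linarith
      then have "real N * cmod (?A mu) <= real N * (Re (?A mu) + et)" by (intro mult_left_mono) auto
      then show "real N * cmod (?A mu) + 4 * ep' <= real N * Re (?A mu) + ep" using Net ep'2(2) unfolding distrib_left by linarith
      have "real N * (Re (?A mu) + 2 * et) <= X1" "real N * Re (?A mu) <= real N * al1" using T unfolding X1_def by (intro mult_left_mono; simp)+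
      then show "real N * (Re (?A mu) + 2 * et) <= C" "real N * Re (?A mu) + ep <= C" using C(2,3) unfolding X2_def by linarith+
    qed
    show "\<forall>mu\<in>LC'. vnorm Cn (nrm mu) & adapted dl (?B mu) (nrm mu)" using nrm by simp
    show "\<forall>th\<in>strip sg. \<forall>mu\<in>LC'. cmod (of_nat N * a (th, mu)) <= C & cmod (a (th, mu)) <= C & cmod (?A mu) <= C & cmod (m (th, mu)) <= C"
    proof (intro ballI conjI)
      fix th :: "complex ^ 'd" and mu assume q: "th \<in> strip sg" "mu \<in> LC'"
      have mu: "mu \<in> L" using q LC'3 by auto
      have am: "cmod (a (th, mu)) <= Ma" using Ma(2) cs(1)[OF q(1)] mu by auto
      have "real N * cmod (a (th, mu)) <= X3" unfolding X3_def by (intro mult_left_mono am) simp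
      then show "cmod (of_nat N * a (th, mu)) <= C" "cmod (a (th, mu)) <= C" using am C by (auto simp: norm_mult)
      show "cmod (?A mu) <= C" using cmod_le[of "?A mu"] LC'T[OF q(2)] al C(6) by linarith
      have "real N * cmod (ca (th, mu)) <= X6" unfolding X6_def using ca(2) cs(1)[OF q(1)] mu by (intro mult_left_mono) auto
      then show "cmod (m (th, mu)) <= C" using C(7) by (simp add: m_def norm_mult)
    qed
    show "\<forall>th\<in>strip sg. \<forall>mu\<in>LC'. \<forall>v. norm (B (th, mu) *v v) <= C * norm v & norm (?B mu *v v) <= C * norm v & norm (M (th, mu) *v v) <= C * norm v"
    proof (intro ballI allI conjI)
      fix th :: "complex ^ 'd" and mu and v :: "complex ^ 'm" assume q: "th \<in> strip sg" "mu \<in> LC'"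
      have mu: "mu \<in> L" using q LC'3 by auto
      show "norm (B (th, mu) *v v) <= C * norm v" using MB(2) cs(1)[OF q(1)] mu C(8) by (intro mvn[of _ MB]) (auto simp: X7_def)
      show "norm (?B mu *v v) <= C * norm v" using Mb(2)[OF mu] C(9) by (intro mvn[of _ Mb]) (auto simp: X8_def)
      have "norm (M (th, mu) *v v) <= n * (n * Cs) * norm v"
        unfolding n_def
      proof (rule matrix_vector_entry_bound)
        fix i j
        have "cmod (cb (i, j) (th, mu)) <= Cb (i, j)" using conjunct2[OF cb[of "(i, j)"]] cs(1)[OF q(1)] mu by simp
        then show "cmod (M (th, mu) $ i $ j) <= Cs" using Cs[of "(i, j)"] by (simp add: M_def)
      qed
      also have "... <= C * norm v" using C(10) by (intro mult_right_mono) (auto simp: X9_def)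
      finally show "norm (M (th, mu) *v v) <= C * norm v" .
    qed
    show "\<forall>th\<in>strip sg. \<forall>mu\<in>LC'. cmod (of_nat N * (a (th, mu) - ?A mu) + m (th, mu) - m (th + cvec om, mu)) <= ep'"
    proof (intro ballI)
      fix th :: "complex ^ 'd" and mu assume q: "th \<in> strip sg" "mu \<in> LC'"
      have eq: "of_nat N * (a (th, mu) - ?A mu) + m (th, mu) - m (th + cvec om, mu) = of_nat N * (a (th, mu) - ?A mu + ca (th, mu) - ca (th + cvec om, mu))"
        by (simp add: m_def algebra_simps)
      have "cmod (a (th, mu) - ?A mu + ca (th, mu) - ca (th + cvec om, mu)) <= ep' / real N" using ca(2) cs(1)[OF q(1)] q(2) LC'3 by blast
      then have "real N * cmod (a (th, mu) - ?A mu + ca (th, mu) - ca (th + cvec om, mu)) <= real N * (ep' / real N)" by (rule mult_left_mono) simp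
      then show "cmod (of_nat N * (a (th, mu) - ?A mu) + m (th, mu) - m (th + cvec om, mu)) <= ep'"
        unfolding eq norm_mult norm_of_nat using N by simp
    qed
    show "\<forall>th\<in>strip sg. \<forall>mu\<in>LC'. \<forall>v. norm (M (th, mu) *v v - M (th + cvec om, mu) *v v - B (th, mu) *v v + ?B mu *v v) <= ep' * norm v"
    proof (intro ballI allI)
      fix th :: "complex ^ 'd" and mu and v :: "complex ^ 'm" assume q: "th \<in> strip sg" "mu \<in> LC'"
      have mu: "mu \<in> L" "mu \<in> LC" using q LC'3 LLC by auto
      have "norm ((M (th, mu) - M (th + cvec om, mu) - B (th, mu) + ?B mu) *v v) <= n * (n * ep'') * norm v"
        unfolding n_def
      proof (rule matrix_vector_entry_bound)
        fix i j
        have "cmod (B (th, mu) $ i $ j - torus_average (%q. B q $ i $ j) mu + cb (i, j) (th, mu) - cb (i, j) (th + cvec om, mu)) <= ep''"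
          using conjunct2[OF cb[of "(i, j)"]] cs(1)[OF q(1)] mu(1) by simp
        moreover have "(M (th, mu) - M (th + cvec om, mu) - B (th, mu) + ?B mu) $ i $ j =
          - (B (th, mu) $ i $ j - torus_average (%q. B q $ i $ j) mu + cb (i, j) (th, mu) - cb (i, j) (th + cvec om, mu))"
          by (simp add: M_def torus_average_nth[OF coeffs(2) sg0 mu(2)])
        ultimately show "cmod ((M (th, mu) - M (th + cvec om, mu) - B (th, mu) + ?B mu) $ i $ j) <= ep''" by (simp only: norm_minus_cancel)
      qed
      then show "norm (M (th, mu) *v v - M (th + cvec om, mu) *v v - B (th, mu) *v v + ?B mu *v v) <= ep' * norm v"
        by (simp only: ep''(2) matrix_vector_mult_diff_rdistrib matrix_vector_mult_add_rdistrib)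
    qed
  qed
qed

section \<open>Lifting the equation, solving it, and returning to torus-valued maps\<close>

lemma order_O_obtain:
  assumes "order_O D l e"
  obtains C r where "C > 0" "r > 0" "!!x th mu. (x, th, mu) \<in> D ==> cmod x < r ==> e (x, th, mu) <= C * cmod x ^ l"
  using assms unfolding order_O_def by auto

theorem theorem2p1:
  fixes N P Q :: nat
    and \<omega> :: "real ^ 'd"
    and U :: "(real \<times> (real ^ 'm)) set"
    and \<Lambda> :: "(real ^ 'p) set"
    and \<Lambda>C :: "(complex ^ 'p) set"
    and W :: "('m xy \<times> ('d, 'p) angle_param) set"
    and F :: "'m xy \<times> ('d, 'p) angle_param \<Rightarrow> ('m, 'd) xy_angle"
    and a :: "('d, 'p) angle_param \<Rightarrow> complex"
    and B :: "('d, 'p) angle_param \<Rightarrow> complex ^ 'm ^ 'm"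
    and fN fR :: "'m xy \<times> ('d, 'p) angle_param \<Rightarrow> complex"
    and gN gR :: "'m xy \<times> ('d, 'p) angle_param \<Rightarrow> complex ^ 'm"
    and hP hR :: "'m xy \<times> ('d, 'p) angle_param \<Rightarrow> complex ^ 'd"
    and K :: "complex \<times> ('d, 'p) angle_param \<Rightarrow> ('m, 'd) xy_angle"
    and R :: "complex \<times> ('d, 'p) angle_param \<Rightarrow> complex \<times> (complex ^ 'd)"
    and \<beta>0 \<rho>0 \<sigma>0 C :: real
  defines "D0 \<equiv> sector \<beta>0 \<rho>0 \<times> strip \<sigma>0 \<times> \<Lambda>C"
  assumes NP: "N \<ge> 2" "P \<ge> 1"
    and U: "open U" "(0, 0) \<in> U"
    and pos: "\<beta>0 > 0" "\<rho>0 > 0" "\<sigma>0 > 0"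
    and \<Lambda>C: "open \<Lambda>C" "cvec ` \<Lambda> \<subseteq> \<Lambda>C"
    (* F and its holomorphic extension *)
    and W: "W \<subseteq> UNIV \<times> strip \<sigma>0 \<times> \<Lambda>C" "{(0, 0)} \<times> strip \<sigma>0 \<times> \<Lambda>C \<subseteq> W"
    and F: "real_analytic_map U \<Lambda> W F"
    and F_x: "\<And>x y \<theta> \<mu>. ((x, y), \<theta>, \<mu>) \<in> W \<Longrightarrow> fst (fst (F ((x, y), \<theta>, \<mu>))) =
        x - a (\<theta>, \<mu>) * x ^ N + fN ((x, y), \<theta>, \<mu>) + fR ((x, y), \<theta>, \<mu>)"
    and F_y: "\<And>x y \<theta> \<mu>. ((x, y), \<theta>, \<mu>) \<in> W \<Longrightarrow> snd (fst (F ((x, y), \<theta>, \<mu>))) =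
        y + x ^ (N - 1) *\<^sub>C (B (\<theta>, \<mu>) *v y) + gN ((x, y), \<theta>, \<mu>) + gR ((x, y), \<theta>, \<mu>)"
    and F_\<theta>: "\<And>x y \<theta> \<mu>. ((x, y), \<theta>, \<mu>) \<in> W \<Longrightarrow> snd (F ((x, y), \<theta>, \<mu>)) \<doteq>
        \<theta> + cvec \<omega> + hP ((x, y), \<theta>, \<mu>) + hR ((x, y), \<theta>, \<mu>)"
    and coeffs: "analytic_coeff \<sigma>0 \<Lambda>C a" "analytic_coeff \<sigma>0 \<Lambda>C B"
    (* the homogeneous terms and the remainders *)
    and polys: "homogeneous_poly \<sigma>0 \<Lambda>C N fN" "homogeneous_poly \<sigma>0 \<Lambda>C N gN"
        "homogeneous_poly \<sigma>0 \<Lambda>C P hP"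
    and fN_0: "\<And>x \<theta> \<mu>. \<theta> \<in> strip \<sigma>0 \<Longrightarrow> \<mu> \<in> \<Lambda>C \<Longrightarrow> fN ((x, 0), \<theta>, \<mu>) = 0"
    and gN_0: "\<And>x \<theta> \<mu>. \<theta> \<in> strip \<sigma>0 \<Longrightarrow> \<mu> \<in> \<Lambda>C \<Longrightarrow> gN ((x, 0), \<theta>, \<mu>) = 0"
    and DgN_0: "\<And>x \<theta> \<mu>. \<theta> \<in> strip \<sigma>0 \<Longrightarrow> \<mu> \<in> \<Lambda>C \<Longrightarrow>
        ((\<lambda>y. gN ((x, y), \<theta>, \<mu>)) has_derivative (\<lambda>_. 0)) (at 0)"
    and remainders: "analytic_fun W fR" "analytic_fun W gR" "analytic_fun W hR"
    and fR_0: "\<And>\<theta> \<mu>. \<theta> \<in> strip \<sigma>0 \<Longrightarrow> \<mu> \<in> \<Lambda>C \<Longrightarrow> vanishes_to_order N fR (\<theta>, \<mu>)"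
    and gR_0: "\<And>i \<theta> \<mu>. \<theta> \<in> strip \<sigma>0 \<Longrightarrow> \<mu> \<in> \<Lambda>C \<Longrightarrow>
        vanishes_to_order N (\<lambda>z. gR z $ i) (\<theta>, \<mu>)"
    and hR_0: "\<And>i \<theta> \<mu>. \<theta> \<in> strip \<sigma>0 \<Longrightarrow> \<mu> \<in> \<Lambda>C \<Longrightarrow>
        vanishes_to_order P (\<lambda>z. hR z $ i) (\<theta>, \<mu>)"
    and h1: "P \<ge> N"
    and h2: "diophantine \<omega> \<or>
        (\<forall>\<theta>\<in>strip \<sigma>0. \<forall>\<theta>'\<in>strip \<sigma>0. \<forall>\<mu>\<in>\<Lambda>C. a (\<theta>, \<mu>) = a (\<theta>', \<mu>) \<and> B (\<theta>, \<mu>) = B (\<theta>', \<mu>))"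
    and h3: "\<And>\<mu>. \<mu> \<in> \<Lambda> \<Longrightarrow>
        torus_average a (cvec \<mu>) \<in> \<real> \<and> Re (torus_average a (cvec \<mu>)) > 0"
    and h4: "\<And>\<mu> \<nu>. \<mu> \<in> \<Lambda> \<Longrightarrow> \<nu> \<in> spec (torus_average B (cvec \<mu>)) \<Longrightarrow> Re \<nu> > 0"
    (* the approximate solution *)
    and Q: "Q \<ge> N"
    and K: "analytic_map D0 K" "\<And>z. z \<in> D0 \<Longrightarrow> snd (K z) \<in> strip \<sigma>0"
    and R: "analytic_map D0 R" "\<And>z. z \<in> D0 \<Longrightarrow> snd (R z) \<in> strip \<sigma>0"
    and C: "C > 0"
    and K_x: "\<And>x \<theta> \<mu>. (x, \<theta>, \<mu>) \<in> D0 \<Longrightarrow> cmod (fst (fst (K (x, \<theta>, \<mu>))) - x) \<le> C * cmod x ^ 2"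
    and K_y: "\<And>x \<theta> \<mu>. (x, \<theta>, \<mu>) \<in> D0 \<Longrightarrow> norm (snd (fst (K (x, \<theta>, \<mu>)))) \<le> C * cmod x ^ 2"
    and K_\<theta>: "\<And>x \<theta> \<mu>. (x, \<theta>, \<mu>) \<in> D0 \<Longrightarrow> torus_norm (snd (K (x, \<theta>, \<mu>)) - \<theta>) \<le> C * cmod x"
    and R_x: "order_O D0 (N + 1)
        (\<lambda>(x, \<theta>, \<mu>). cmod (fst (R (x, \<theta>, \<mu>)) - (x - torus_average a \<mu> * x ^ N)))"
    and R_\<theta>: "\<And>x \<theta> \<mu>. (x, \<theta>, \<mu>) \<in> D0 \<Longrightarrow> snd (R (x, \<theta>, \<mu>)) \<doteq> \<theta> + cvec \<omega>"
    and FK_defined: "\<And>x \<theta> \<mu>. (x, \<theta>, \<mu>) \<in> D0 \<Longrightarrow>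
        (fst (K (x, \<theta>, \<mu>)), snd (K (x, \<theta>, \<mu>)), \<mu>) \<in> W"
    and KR_defined: "\<And>z. z \<in> D0 \<Longrightarrow> fst (R z) \<in> sector \<beta>0 \<rho>0"
    and E_x: "order_O D0 (Q + N) (\<lambda>z. cmod (fst (fst ((F \<circ>\<^sub>\<mu> K) z - (K \<circ>\<^sub>\<mu> R) z))))"
    and E_y: "order_O D0 (Q + N) (\<lambda>z. norm (snd (fst ((F \<circ>\<^sub>\<mu> K) z - (K \<circ>\<^sub>\<mu> R) z))))"
    and E_\<theta>: "order_O D0 (Q + N - 1) (\<lambda>z. torus_norm (snd ((F \<circ>\<^sub>\<mu> K) z - (K \<circ>\<^sub>\<mu> R) z)))"
  shows "\<forall>\<sigma>. 0 < \<sigma> \<and> \<sigma> < \<sigma>0 \<longrightarrow> (\<forall>\<Lambda>0. compact \<Lambda>0 \<and> \<Lambda>0 \<subseteq> \<Lambda> \<longrightarrow>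
    (\<exists>\<beta> \<rho> \<Lambda>C'. 0 < \<beta> \<and> \<beta> \<le> \<beta>0 \<and> 0 < \<rho> \<and> \<rho> \<le> \<rho>0 \<and>
      open \<Lambda>C' \<and> cvec ` \<Lambda>0 \<subseteq> \<Lambda>C' \<and> \<Lambda>C' \<subseteq> \<Lambda>C \<and>
      (\<forall>z \<in> sector \<beta> \<rho> \<times> strip \<sigma> \<times> \<Lambda>C'. fst (R z) \<in> sector \<beta> \<rho>) \<and>
      (\<exists>\<Delta>. correction W F K R Q \<sigma> (sector \<beta> \<rho> \<times> strip \<sigma> \<times> \<Lambda>C') \<Delta> \<and>
        (\<forall>\<Delta>'. correction W F K R Q \<sigma> (sector \<beta> \<rho> \<times> strip \<sigma> \<times> \<Lambda>C') \<Delta>' \<longrightarrow>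
          (\<forall>z \<in> sector \<beta> \<rho> \<times> strip \<sigma> \<times> \<Lambda>C'.
            fst (\<Delta>' z) = fst (\<Delta> z) \<and> snd (\<Delta>' z) \<doteq> snd (\<Delta> z))))))"
proof (intro allI impI)
  fix sg and \<Lambda>0 :: "(real ^ 'p) set"
  assume sg: "0 < sg & sg < \<sigma>0" and \<Lambda>0: "compact \<Lambda>0 & \<Lambda>0 \<subseteq> \<Lambda>"
  let ?Rz = "%z. (fst (R z), snd (R z), snd (snd z))"
  have torus_W: "torus_domain W" using remainders(1) by (simp add: analytic_fun_def)
  have W0: "{0} \<times> strip \<sigma>0 \<times> \<Lambda>C \<subseteq> W" using W(2) by (simp add: zero_prod_def)
  interpret MD: map_data N P \<sigma>0 \<Lambda>C W a B fN fR gN gR hP hR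
    by unfold_locales (fact NP h1 \<Lambda>C torus_W W W0 coeffs polys fN_0 gN_0 DgN_0 remainders fR_0 gR_0 hR_0)+
  have cS: "compact (cvec ` \<Lambda>0 :: (complex ^ 'p) set)"
    by (rule compact_continuous_image[OF continuous_on_cvec]) (use \<Lambda>0 in simp)
  have SL: "cvec ` \<Lambda>0 \<subseteq> \<Lambda>C" using \<Lambda>0 \<Lambda>C(2) by blast
  have apos: "Im (torus_average a mu) = 0 & 0 < Re (torus_average a mu)" if "mu \<in> cvec ` \<Lambda>0" for mu
    using that h3 \<Lambda>0 by (auto simp: complex_is_Real_iff)
  have Bpos: "Re \<nu> > 0" if "mu \<in> cvec ` \<Lambda>0" "\<nu> \<in> spec (torus_average B mu)" for mu \<nu>
    using that h4 \<Lambda>0 by auto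
  obtain L LC' al0 ep ep' dl bt et Cn Cc m M nrm where
    L: "compact L" "L \<subseteq> \<Lambda>C" and LC': "open LC'" "cvec ` \<Lambda>0 \<subseteq> LC'" "LC' \<subseteq> L"
    and c1: "0 < al0" "0 < ep" "ep * (real Q + 5) <= al0 / 8" "0 < ep'" "4 * Cn * ep' <= ep" "1 <= Cn" "1 <= Cc"
    and c2: "0 < dl" "0 < bt" "bt <= \<beta>0" "bt <= pi" "real (N - 1) * bt <= pi" "real (N - 1) * (bt / 2) <= arctan dl"
      "0 < et" "2 * et < al0 * sin (real (N - 1) * bt / 4)"
    and av: "\<forall>mu\<in>LC'. al0 <= Re (torus_average a mu) & \<bar>Im (torus_average a mu)\<bar> <= et & Re (torus_average a mu) * dl + 3 * et <= ep &
      real N * cmod (torus_average a mu) + 4 * ep' <= real N * Re (torus_average a mu) + ep &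
      real N * (Re (torus_average a mu) + 2 * et) <= Cc & real N * Re (torus_average a mu) + ep <= Cc"
    and nrm: "\<forall>mu\<in>LC'. vnorm Cn (nrm mu) & adapted dl (torus_average B mu) (nrm mu)"
    and bd1: "\<forall>th\<in>strip sg. \<forall>mu\<in>LC'. cmod (of_nat N * a (th, mu)) <= Cc & cmod (a (th, mu)) <= Cc & cmod (torus_average a mu) <= Cc & cmod (m (th, mu)) <= Cc"
    and bd2: "\<forall>th\<in>strip sg. \<forall>mu\<in>LC'. \<forall>v. norm (B (th, mu) *v v) <= Cc * norm v & norm (torus_average B mu *v v) <= Cc * norm v & norm (M (th, mu) *v v) <= Cc * norm v"
    and avg1: "\<forall>th\<in>strip sg. \<forall>mu\<in>LC'. cmod (of_nat N * (a (th, mu) - torus_average a mu) + m (th, mu) - m (th + cvec \<omega>, mu)) <= ep'"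
    and avg2: "\<forall>th\<in>strip sg. \<forall>mu\<in>LC'. \<forall>v. norm (M (th, mu) *v v - M (th + cvec \<omega>, mu) *v v - B (th, mu) *v v + torus_average B mu *v v) <= ep' * norm v"
    by (rule averaging_data[where Q=Q and om=\<omega> and ?bt0.0=\<beta>0, OF coeffs \<Lambda>C(1) conjunct1[OF sg] conjunct2[OF sg] cS SL NP(1) pos(1) h2 apos Bpos])
  \<comment> \<open>The angle of \<open>K + \<Delta>\<close> leaves the strip of width
    \<open>sg\<close> slightly; the gap up to \<open>sg1\<close> takes this up, and the gap up to
    \<open>\<sigma>0\<close> serves the Cauchy estimates.\<close>
  define sg1 where "sg1 = (sg + \<sigma>0) / 2"
  have sg1: "sg < sg1" "sg1 < \<sigma>0" using sg by (auto simp: sg1_def)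
  \<comment> \<open>\<open>C\<close> accounts for \<open>K\<close> and 1 for an admissible
    correction.\<close>
  define C0 where "C0 = C + 1"
  have C0: "1 <= C0" using C by (simp add: C0_def)
  obtain Ki x0 where Ki: "0 < Ki" "0 < x0" "\<forall>x u1 u2 th th1 th2 mu. 0 < cmod x --> cmod x < x0 --> thin C0 x u1 --> thin C0 x u2 -->
    th \<in> cstrip sg1 --> th1 \<in> cstrip sg1 --> th2 \<in> cstrip sg1 --> norm (th2 - th) <= C0 * cmod x --> mu \<in> L -->
    near_linear N (a (th, mu)) (B (th, mu)) (x ^ (N - 1)) (cmod x) Ki (u1 - u2, th1 - th2)
      (MD.Fl (u1, th1, mu) - MD.Fl (u2, th2, mu) + (0, th1 - th2))"
    using MD.increments[OF sg1(2) L C0] by (elim exE conjE) (rule that)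
  obtain Mt rt where Mt: "0 < Mt" "0 < rt" "\<forall>u. norm u < rt --> (\<forall>th\<in>cstrip sg1. \<forall>mu\<in>L. norm (snd (MD.Fl (u, th, mu))) <= Mt * norm u)"
    using MD.angle_bound[OF sg1(2) L] by (elim exE conjE) (rule that)
  obtain rw where rw: "rw > 0" "cball 0 rw \<times> cstrip sg1 \<times> L \<subseteq> W" using MD.Fl_tube[OF sg1(2) L] by blast
  obtain CR rR where CR: "CR > 0" "rR > 0" "!!x th mu. (x, th, mu) \<in> D0 ==> cmod x < rR ==>
      cmod (fst (R (x, th, mu)) - (x - torus_average a mu * x ^ N)) <= CR * cmod x ^ (N + 1)"
    using R_x by (rule order_O_obtain) simp
  obtain Ex rx where Ex: "Ex > 0" "rx > 0" "!!x th mu. (x, th, mu) \<in> D0 ==> cmod x < rx ==>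
      cmod (fst (fst ((F \<circ>\<^sub>\<mu> K) (x, th, mu) - (K \<circ>\<^sub>\<mu> R) (x, th, mu)))) <= Ex * cmod x ^ (Q + N)"
    using E_x by (rule order_O_obtain) simp
  obtain Ey ry where Ey: "Ey > 0" "ry > 0" "!!x th mu. (x, th, mu) \<in> D0 ==> cmod x < ry ==>
      norm (snd (fst ((F \<circ>\<^sub>\<mu> K) (x, th, mu) - (K \<circ>\<^sub>\<mu> R) (x, th, mu)))) <= Ey * cmod x ^ (Q + N)"
    using E_y by (rule order_O_obtain) simp
  obtain Et rth where Et: "Et > 0" "rth > 0" "!!x th mu. (x, th, mu) \<in> D0 ==> cmod x < rth ==>
      torus_norm (snd ((F \<circ>\<^sub>\<mu> K) (x, th, mu) - (K \<circ>\<^sub>\<mu> R) (x, th, mu))) <= Et * cmod x ^ (Q + N - 1)"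
    using E_\<theta> by (rule order_O_obtain) simp
  define CE where "CE = Ex + Ey + Et"
  have CE: "0 <= CE" "Ex <= CE" "Ey <= CE" "Et <= CE" using Ex(1) Ey(1) Et(1) by (auto simp: CE_def)
  \<comment> \<open>Fixed before the radius, since the influence of \<open>y\<close> on
    \<open>x\<close> is not made small by shrinking the sector.\<close>
  define kp where "kp = min 1 (ep / (16 * Ki))"
  have kp: "0 < kp" "kp <= 1" using c1(2) Ki(1) by (auto simp: kp_def)
  have "16 * Ki * kp <= 16 * Ki * (ep / (16 * Ki))" using Ki(1) by (intro mult_left_mono) (auto simp: kp_def)
  then have kpK: "16 * kp * Ki <= ep" using Ki(1) by (simp add: mult_ac)
  \<comment> \<open>The pairs keep points inside the domains of the estimates, keep angle
    displacements below fractions of \<open>1 / 2\<close>, and supply the conditions of the radial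
    step and of the iteration.\<close>
  have "\<exists>rh>0. \<forall>p\<in>set [(1, 1), (1, \<rho>0), (C, 1 / 8), (1, x0), (1 + 2 * C0, rt), (Mt * (1 + 2 * C0), 1 / 8), (1 + 2 * C0, rw), (C0, sg1 - sg),
      (1, rR), (1, rx), (1, ry), (1, rth), (CR, et), (Cc ^ 2, et), (Cc, 1 / 2), (2 * Cc, bt / 8), (al0, 1),
      (4 * ((2 * Cc ^ 2 + 4 * Ki) * (Cn + 1) + Ki), ep * kp), (4 * real (N + 1) * Cc ^ 3, ep'), (4 * Cc ^ 2, 1),
      (2 * (16 * (5 + 4 * Cn) * CE / al0), kp), (1, sg / 2), (1, 1 / 16), (1, dl)]. rh * fst p <= snd p"
    by (rule small_radius) (use pos Ki Mt rw sg1 CR Ex Ey Et c1 c2 kp sg in simp)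
  then obtain rh where \<rho>0: "0 < rh" and rh: "rh * 1 <= 1" "rh * 1 <= \<rho>0" "rh * C <= 1 / 8" "rh * 1 <= x0" "rh * (1 + 2 * C0) <= rt" "rh * (Mt * (1 + 2 * C0)) <= 1 / 8"
      "rh * (1 + 2 * C0) <= rw" "rh * C0 <= sg1 - sg" "rh * 1 <= rR" "rh * 1 <= rx" "rh * 1 <= ry" "rh * 1 <= rth" "rh * CR <= et" "rh * Cc ^ 2 <= et" "rh * Cc <= 1 / 2"
      "rh * (2 * Cc) <= bt / 8" "rh * al0 <= 1" "rh * (4 * ((2 * Cc ^ 2 + 4 * Ki) * (Cn + 1) + Ki)) <= ep * kp" "rh * (4 * real (N + 1) * Cc ^ 3) <= ep'"
      "rh * (4 * Cc ^ 2) <= 1" "rh * (2 * (16 * (5 + 4 * Cn) * CE / al0)) <= kp" "rh * 1 <= sg / 2" "rh * 1 <= 1 / 16" "rh * 1 <= dl"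
    unfolding list.set ball_simps fst_conv snd_conv by (elim exE conjE) (rule that)
  have scale: "cmod x * c <= d" if "x \<in> sector bt rh" "0 <= c" "rh * c <= d" for x c d
    using mult_right_mono[OF less_imp_le[OF conjunct2[OF sector_norm[OF that(1)]]] that(2)] that(3) by linarith
  have pt: "(x, th, mu) \<in> D0" "0 < cmod x" "cmod x < rh" "mu \<in> L" "mu \<in> \<Lambda>C" "th \<in> cstrip sg1"
    if "x \<in> sector bt rh" "th \<in> strip sg" "mu \<in> LC'" for x th mu
  proof -
    show "0 < cmod x" "cmod x < rh" using sector_norm[OF that(1)] by auto
    show "mu \<in> L" "mu \<in> \<Lambda>C" using that(3) LC'(3) L(2) by auto
    have "x \<in> sector \<beta>0 \<rho>0" using sector_mono[OF c2(3), of rh \<rho>0] rh(2) that(1) by auto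
    moreover have "\<bar>Im (th $ i)\<bar> < sg" for i using that(2) by (simp add: strip_def)
    moreover from this have "\<bar>Im (th $ i)\<bar> < \<sigma>0" "\<bar>Im (th $ i)\<bar> <= sg1" for i using sg1 by (meson less_trans less_imp_le)+
    ultimately show "(x, th, mu) \<in> D0" "th \<in> cstrip sg1" using \<open>mu \<in> \<Lambda>C\<close> by (auto simp: D0_def strip_def cstrip_def)
  qed
  let ?D = "sector bt rh \<times> (strip sg :: (complex ^ 'd) set) \<times> LC'"
  have tD: "torus_domain (sector bt rh' \<times> (strip sg :: (complex ^ 'd) set) \<times> LC')" for rh' by (rule torus_domain_sector[OF c2(4) LC'(1)])
  have oD: "open ?D" using tD[of rh] unfolding torus_domain_def by (rule conjunct1)
  have DD0: "?D \<subseteq> D0" using pt(1) by auto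
  have epal: "ep < al0"
  proof -
    have "ep * 5 <= ep * (real Q + 5)" using c1(2) by (intro mult_left_mono) auto
    then show ?thesis using c1(1-3) by linarith
  qed
  have Cc0: "0 <= Cc" using c1(7) by linarith
  have rad: "fst (R (x, th, mu)) \<in> sector bt rh'"
      "cmod (fst (R (x, th, mu))) <= cmod x * (1 - (Re (torus_average a mu) - ep) * cmod x ^ (N - 1))"
      "cmod x <= (1 + (real N * Re (torus_average a mu) + ep) * cmod x ^ (N - 1)) * cmod (fst (R (x, th, mu)))"
      "cmod (fst (R (x, th, mu)) ^ (N - 1) - x ^ (N - 1)) <= Cc * cmod x * cmod (x ^ (N - 1))"
    if rh': "rh' <= rh" and x: "x \<in> sector bt rh'" and q: "th \<in> strip sg" "mu \<in> LC'" for x th mu rh'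
  proof -
    have x': "x \<in> sector bt rh" using sector_mono[OF order_refl rh'] x by blast
    note p = pt[OF x' q]
    have A: "al0 <= Re (torus_average a mu)" "\<bar>Im (torus_average a mu)\<bar> <= et" "Re (torus_average a mu) * dl + 3 * et <= ep"
      "real N * (Re (torus_average a mu) + 2 * et) <= Cc" "real N * Re (torus_average a mu) + ep <= Cc" using av q(2) by auto
    have r: "cmod (fst (R (x, th, mu)) - (x - torus_average a mu * x ^ N)) <= CR * cmod x ^ (N + 1)"
      using p(3) rh(9) by (intro CR(3) p(1)) simp
    have x1: "cmod x <= 1" using p(3) rh(1) by linarith
    note rs = radial_step[OF x NP(1) c2(5,6,1) c1(1) A(1,2) c2(8) A(3) epal r A(4,5) x1 scale[OF x' less_imp_le[OF CR(1)] rh(13)]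
        scale[OF x' zero_le_power[OF Cc0] rh(14)] scale[OF x' Cc0 rh(15)] scale[OF x' _ rh(16)]]
    show "fst (R (x, th, mu)) \<in> sector bt rh'"
      "cmod (fst (R (x, th, mu))) <= cmod x * (1 - (Re (torus_average a mu) - ep) * cmod x ^ (N - 1))"
      "cmod x <= (1 + (real N * Re (torus_average a mu) + ep) * cmod x ^ (N - 1)) * cmod (fst (R (x, th, mu)))"
      "cmod (fst (R (x, th, mu)) ^ (N - 1) - x ^ (N - 1)) <= Cc * cmod x * cmod (x ^ (N - 1))"
      using rs Cc0 by simp_all
  qed
  have Kf: "analytic_fun D0 (%z. fst (K z))" and Kt: "analytic_torus_valued D0 (%z. snd (K z))"
    and Rf: "analytic_fun D0 (%z. fst (R z))" using K(1) R(1) by (simp_all add: analytic_map_def)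
  have lK: "analytic_torus_valued ?D (%z. snd (K z) - fst (snd z))"
    by (intro analytic_torus_valued_diff_angle analytic_torus_valued_subset[OF Kt tD DD0])
  have lKs: "torus_norm (snd (K z) - fst (snd z)) <= C * cmod (fst z)" "C * cmod (fst z) <= 1 / 8" if "z \<in> ?D" for z
    using that K_\<theta>[of "fst z" "fst (snd z)" "snd (snd z)"] subsetD[OF DD0 that] scale[of "fst z" C "1 / 8"] C rh(3) by (auto simp: mult.commute)
  \<comment> \<open>\<open>k\<close> lifts the displacement of the angle of \<open>K\<close> from
    the identity.\<close>
  have "\<exists>k. analytic_fun ?D k & (\<forall>z\<in>?D. k z \<doteq> snd (K z) - fst (snd z) & norm (k z) = torus_norm (snd (K z) - fst (snd z)))"
    using lKs by (intro lift_small[OF lK]) force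
  then obtain k where k: "analytic_fun ?D k" and k': "\<forall>z\<in>?D. k z \<doteq> snd (K z) - fst (snd z) & norm (k z) = torus_norm (snd (K z) - fst (snd z))"
    by (elim exE conjE)
  have kn: "norm (k z) <= C * cmod (fst z)" "norm (k z) <= 1 / 8" if "z \<in> ?D" for z
    using lKs[OF that] bspec[OF k' that] by auto
  have kK: "snd (K z) \<doteq> fst (snd z) + k z" if "z \<in> ?D" for z
  proof -
    have "(snd (K z) - fst (snd z)) + fst (snd z) \<doteq> k z + fst (snd z)"
      using torus_eq_add[OF torus_eq_sym[OF conjunct1[OF bspec[OF k' that]]] torus_eq_refl] .
    then show ?thesis by (simp add: add.commute)
  qed
  define rr where "rr z = (fst (R z), fst (snd z) + cvec \<omega>, snd (snd z))" for z
  have rrD: "rr z \<in> ?D" if "z \<in> ?D" for z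
    using that rad(1)[OF order_refl, of "fst z" "fst (snd z)" "snd (snd z)"] by (auto simp: rr_def cvec_in_strip)
  \<comment> \<open>The lifted equation: \<open>rr\<close> replaces \<open>R\<close> by its
    representative with angle exactly \<open>\<theta> + \<omega>\<close>, and this rotation cancels
    between the two sides.\<close>
  define \<Phi> where "\<Phi> z d = MD.Fl (fst (K z) + fst d, fst (snd z) + k z + snd d, snd (snd z)) - (fst (K (rr z)), k (rr z)) + (0, k z + snd d)" for z d
  have pos_thin: "thin C0 x (fst (K (x, th, mu)) + fst d)" "norm (fst (K (x, th, mu)) + fst d) <= (1 + 2 * C0) * cmod x"
      "norm (th + k (x, th, mu) + snd d - th) <= C0 * cmod x" "th + k (x, th, mu) + snd d \<in> cstrip sg1"
      "(fst (K (x, th, mu)) + fst d, th + k (x, th, mu) + snd d, mu) \<in> W"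
    if q: "x \<in> sector bt rh" "th \<in> strip sg" "mu \<in> LC'" and d: "thin 1 x (fst d + (x, 0))" "norm (snd d) <= cmod x" for x th mu and d :: "('m, 'd) xy_angle"
  proof -
    note p = pt[OF q]
    let ?u = "fst (K (x, th, mu)) + fst d" and ?t = "cmod x"
    have z: "(x, th, mu) \<in> ?D" using q by simp
    have d': "cmod (fst (fst d)) <= ?t ^ 2" "norm (snd (fst d)) <= ?t ^ 2" using d(1) by (auto simp: thin_def)
    have "fst ?u - x = (fst (fst (K (x, th, mu))) - x) + fst (fst d)" by simp
    then have "cmod (fst ?u - x) <= C * ?t ^ 2 + ?t ^ 2" using norm_triangle_le[OF add_mono[OF K_x[OF p(1)] d'(1)]] by metis
    then have 1: "cmod (fst ?u - x) <= C0 * ?t ^ 2" by (simp add: C0_def algebra_simps)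
    have "norm (snd ?u) <= C * ?t ^ 2 + ?t ^ 2" using norm_triangle_le[OF add_mono[OF K_y[OF p(1)] d'(2)]] by simp
    then have 2: "norm (snd ?u) <= C0 * ?t ^ 2" by (simp add: C0_def algebra_simps)
    show "thin C0 x ?u" using 1 2 by (simp add: thin_def)
    have "?t ^ 2 <= ?t" using p(2,3) rh(1) by (simp add: power2_eq_square mult_left_le)
    then have t2: "C0 * ?t ^ 2 <= C0 * ?t" using C0 by (intro mult_left_mono) auto
    have "norm ?u <= cmod (fst ?u) + norm (snd ?u)" using norm_Pair_le[of "fst ?u" "snd ?u"] unfolding prod.collapse .
    also have "cmod (fst ?u) <= ?t + cmod (fst ?u - x)" using norm_triangle_sub[of "fst ?u" x] .
    finally have "norm ?u <= ?t + C0 * ?t + C0 * ?t" using 1 2 t2 by linarith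
    then show nu: "norm ?u <= (1 + 2 * C0) * ?t" by (simp add: algebra_simps)
    have "norm (k (x, th, mu) + snd d) <= C * ?t + ?t" using kn(1)[OF z] d(2) norm_triangle_ineq[of "k (x, th, mu)" "snd d"] by simp
    then have kd: "norm (k (x, th, mu) + snd d) <= C0 * ?t" by (simp add: C0_def algebra_simps)
    then show "norm (th + k (x, th, mu) + snd d - th) <= C0 * ?t" by (simp add: add.assoc)
    have C0t: "C0 * ?t <= sg1 - sg" using scale[OF q(1) _ rh(8)] C0 by (simp add: mult.commute)
    show cs: "th + k (x, th, mu) + snd d \<in> cstrip sg1"
      unfolding cstrip_def
    proof (intro CollectI allI)
      fix i
      have "\<bar>Im ((k (x, th, mu) + snd d) $ i)\<bar> <= norm (k (x, th, mu) + snd d)"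
        using abs_Im_le_cmod Finite_Cartesian_Product.norm_nth_le order_trans by blast
      moreover have "\<bar>Im (th $ i)\<bar> < sg" using q(2) by (simp add: strip_def)
      ultimately show "\<bar>Im ((th + k (x, th, mu) + snd d) $ i)\<bar> <= sg1" using kd C0t by simp
    qed
    have "norm ?u <= rw" using nu scale[OF q(1) _ rh(7)] C0 by (simp add: mult.commute)
    then show "(?u, th + k (x, th, mu) + snd d, mu) \<in> W" using rw(2) cs p(4) by auto
  qed
  \<comment> \<open>The image, the two values of \<open>k\<close> and the correction have angle
    parts of size at most \<open>1 / 8\<close>, \<open>1 / 8\<close>, \<open>1 / 8\<close> and
    \<open>1 / 16\<close>, which sum to less than \<open>1 / 2\<close>.\<close>
  have \<Phi>_small: "norm (snd (\<Phi> (x, th, mu) d)) < 1 / 2"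
    if q: "x \<in> sector bt rh" "th \<in> strip sg" "mu \<in> LC'" and d: "thin 1 x (fst d + (x, 0))" "norm (snd d) <= cmod x" for x th mu and d :: "('m, 'd) xy_angle"
  proof -
    note p = pt[OF q] and pp = pos_thin[OF q d]
    have z: "(x, th, mu) \<in> ?D" using q by simp
    let ?u = "fst (K (x, th, mu)) + fst d"
    have "(1 + 2 * C0) * cmod x < (1 + 2 * C0) * rh" using p(3) C0 by (intro mult_strict_left_mono) auto
    then have "norm ?u < rt" using pp(2) rh(5) by (simp add: mult.commute)
    then have "norm (snd (MD.Fl (?u, th + k (x, th, mu) + snd d, mu))) <= Mt * norm ?u" using Mt(3) pp(4) p(4) by blast
    also have "... <= Mt * ((1 + 2 * C0) * cmod x)" using Mt(1) pp(2) by (intro mult_left_mono) auto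
    also have "... = cmod x * (Mt * (1 + 2 * C0))" by simp
    also have "... <= 1 / 8" using Mt(1) C0 by (intro scale[OF q(1) _ rh(6)]) auto
    finally have 1: "norm (snd (MD.Fl (?u, th + k (x, th, mu) + snd d, mu))) <= 1 / 8" .
    have "norm (snd (\<Phi> (x, th, mu) d)) <= norm (snd (MD.Fl (?u, th + k (x, th, mu) + snd d, mu))) + norm (k (rr (x, th, mu))) + (norm (k (x, th, mu)) + norm (snd d))"
      unfolding \<Phi>_def snd_add snd_diff snd_conv fst_conv
      by (intro order_trans[OF norm_triangle_ineq] add_mono norm_triangle_ineq4 norm_triangle_ineq)
    moreover have "norm (snd d) <= 1 / 16" using d(2) p(3) rh(23) by linarith
    ultimately show ?thesis using 1 kn(2)[OF z] kn(2)[OF rrD[OF z]] by linarith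
  qed
  \<comment> \<open>The angle of \<open>R\<close> is known only modulo the lattice; periodicity of
    \<open>K\<close> absorbs the difference.\<close>
  have KR: "fst (K (?Rz z)) = fst (K (rr z))"
      "snd (K (?Rz z)) \<doteq> fst (snd z) + cvec \<omega> + k (rr z)"
      "\<exists>l\<in>lattice_pts. snd (R z) = fst (snd z) + cvec \<omega> + l" if z: "z \<in> ?D" for z
  proof -
    have zD: "(fst z, fst (snd z), snd (snd z)) \<in> D0" using subsetD[OF DD0 z] by simp
    define l where "l = snd (R z) - (fst (snd z) + cvec \<omega>)"
    have l: "l \<in> lattice_pts" using R_\<theta>[OF zD] by (simp add: torus_eq_def l_def)
    have Rl: "snd (R z) = fst (snd z) + cvec \<omega> + l" by (simp add: l_def)
    then show "\<exists>l\<in>lattice_pts. snd (R z) = fst (snd z) + cvec \<omega> + l" using l by blast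
    have rD: "(fst (R z), fst (snd z) + cvec \<omega>, snd (snd z)) \<in> D0" using subsetD[OF DD0 rrD[OF z]] by (simp add: rr_def)
    show "fst (K (?Rz z)) = fst (K (rr z))"
      using Kf rD l unfolding analytic_fun_def Rl rr_def by blast
    have "snd (K (?Rz z)) \<doteq> snd (K (rr z))"
      using Kt rD l unfolding analytic_torus_valued_def Rl rr_def by blast
    then show "snd (K (?Rz z)) \<doteq> fst (snd z) + cvec \<omega> + k (rr z)"
      using kK[OF rrD[OF z]] torus_eq_trans by (simp add: rr_def) blast
  qed
  \<comment> \<open>The dictionary between the two equations: \<open>d\<close> is a lifted
    correction and \<open>e\<close> a torus-valued one congruent to it.\<close>
  have main: "(fst (K (x, th, mu) + e), snd (K (x, th, mu) + e), mu) \<in> W"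
      "fst (F (fst (K (x, th, mu) + e), snd (K (x, th, mu) + e), mu)) - fst (K (fst (R (x, th, mu)), snd (R (x, th, mu)), mu)) = fst (\<Phi> (x, th, mu) d)"
      "snd (F (fst (K (x, th, mu) + e), snd (K (x, th, mu) + e), mu)) - snd (K (fst (R (x, th, mu)), snd (R (x, th, mu)), mu)) \<doteq> snd (\<Phi> (x, th, mu) d)"
    if q: "x \<in> sector bt rh" "th \<in> strip sg" "mu \<in> LC'" and d: "thin 1 x (fst d + (x, 0))" "norm (snd d) <= cmod x"
      and e: "fst e = fst d" "snd e \<doteq> snd d" for x th mu and d e :: "('m, 'd) xy_angle"
  proof -
    have z: "(x, th, mu) \<in> ?D" using q by simp
    note pp = pos_thin(5)[OF q d]
    define u where "u = fst (K (x, th, mu)) + fst d"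
    define th' where "th' = th + k (x, th, mu) + snd d"
    define l where "l = snd (K (x, th, mu) + e) - th'"
    have "snd (K (x, th, mu)) + snd e \<doteq> (th + k (x, th, mu)) + snd d" using torus_eq_add[OF kK[OF z] e(2)] by simp
    then have l: "l \<in> lattice_pts" by (simp add: torus_eq_def l_def th'_def)
    have eq: "snd (K (x, th, mu) + e) = th' + l" "fst (K (x, th, mu) + e) = u" by (simp_all add: l_def u_def e(1))
    have uW: "(u, th', mu) \<in> W" using pp by (simp add: u_def th'_def)
    then have uW': "(u, th' + l, mu) \<in> W" using torus_W l unfolding torus_domain_def by blast
    then show "(fst (K (x, th, mu) + e), snd (K (x, th, mu) + e), mu) \<in> W" by (simp only: eq)
    have FF: "fst (F (u, th' + l, mu)) = fst (MD.Fl (u, th' + l, mu))"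
      using F_x[of "fst u" "snd u" "th' + l" mu] F_y[of "fst u" "snd u" "th' + l" mu] uW'
      by (simp add: MD.Fl_def prod_eq_iff)
    have Ft: "snd (F (u, th' + l, mu)) \<doteq> th' + l + cvec \<omega> + snd (MD.Fl (u, th' + l, mu))"
      using F_\<theta>[of "fst u" "snd u" "th' + l" mu] uW' by (simp add: MD.Fl_def add.assoc)
    have per: "MD.Fl (u, th' + l, mu) = MD.Fl (u, th', mu)" by (rule MD.Fl_periodic[OF uW l])
    have \<Phi>e: "\<Phi> (x, th, mu) d = MD.Fl (u, th', mu) - (fst (K (rr (x, th, mu))), k (rr (x, th, mu))) + (0, k (x, th, mu) + snd d)"
      by (simp add: \<Phi>_def u_def th'_def)
    note kr = KR(1,2)[OF z, unfolded fst_conv snd_conv]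
    show "fst (F (fst (K (x, th, mu) + e), snd (K (x, th, mu) + e), mu)) - fst (K (fst (R (x, th, mu)), snd (R (x, th, mu)), mu)) = fst (\<Phi> (x, th, mu) d)"
      unfolding eq FF per kr(1) \<Phi>e by simp
    have "th' + l + cvec \<omega> + snd (MD.Fl (u, th', mu)) \<doteq> th' + cvec \<omega> + snd (MD.Fl (u, th', mu))"
      using l by (simp add: torus_eq_def)
    then have "snd (F (u, th' + l, mu)) \<doteq> th' + cvec \<omega> + snd (MD.Fl (u, th', mu))"
      using torus_eq_trans[OF Ft[unfolded per]] by blast
    from torus_eq_diff[OF this kr(2)]
    show "snd (F (fst (K (x, th, mu) + e), snd (K (x, th, mu) + e), mu)) - snd (K (fst (R (x, th, mu)), snd (R (x, th, mu)), mu)) \<doteq> snd (\<Phi> (x, th, mu) d)"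
      unfolding eq \<Phi>e by (simp add: th'_def algebra_simps)
  qed
  have adm0: "thin 1 x (fst (0 :: ('m, 'd) xy_angle) + (x, 0))" "norm (snd (0 :: ('m, 'd) xy_angle)) <= cmod x" for x :: complex
    by (simp_all add: thin_def)
  have err: "cmod (fst (fst (\<Phi> (x, th, mu) 0))) <= CE * cmod x ^ (Q + N) &
      norm (snd (fst (\<Phi> (x, th, mu) 0))) <= CE * cmod x ^ (Q + N) & norm (snd (\<Phi> (x, th, mu) 0)) <= CE * cmod x ^ (Q + N - 1)"
    if q: "x \<in> sector bt rh" "th \<in> strip sg" "mu \<in> LC'" for x th mu
  proof -
    note p = pt[OF q]
    have pc: "(F \<circ>\<^sub>\<mu> K) (x, th, mu) = F (fst (K (x, th, mu) + 0), snd (K (x, th, mu) + 0), mu)"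
      "(K \<circ>\<^sub>\<mu> R) (x, th, mu) = K (fst (R (x, th, mu)), snd (R (x, th, mu)), mu)" by (simp_all add: param_comp_def)
    note mn = main[OF q adm0 refl torus_eq_refl, folded pc]
    have f: "fst ((F \<circ>\<^sub>\<mu> K) (x, th, mu) - (K \<circ>\<^sub>\<mu> R) (x, th, mu)) = fst (\<Phi> (x, th, mu) 0)" using mn(2) by simp
    \<comment> \<open>The lifted error is shorter than \<open>1 / 2\<close>, so its norm equals the
      torus norm estimated in the hypothesis.\<close>
    have s: "torus_norm (snd ((F \<circ>\<^sub>\<mu> K) (x, th, mu) - (K \<circ>\<^sub>\<mu> R) (x, th, mu))) = norm (snd (\<Phi> (x, th, mu) 0))"
      using torus_norm_cong[OF mn(3)] torus_norm_small[OF \<Phi>_small[OF q adm0]] by simp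
    have le: "c * cmod x ^ j <= CE * cmod x ^ j" if "c <= CE" for c j using that by (intro mult_right_mono) auto
    have "cmod x < rx" "cmod x < ry" "cmod x < rth" using p(3) rh(10-12) by linarith+
    then show ?thesis
      using order_trans[OF Ex(3)[OF p(1)] le[OF CE(2)]] order_trans[OF Ey(3)[OF p(1)] le[OF CE(3)]] order_trans[OF Et(3)[OF p(1)] le[OF CE(4)]]
      unfolding f s by blast
  qed
  have incr: "near_linear N (a (th, mu)) (B (th, mu)) (x ^ (N - 1)) (cmod x) Ki (dl1 - dl2) (\<Phi> (x, th, mu) dl1 - \<Phi> (x, th, mu) dl2)"
    if q: "x \<in> sector bt rh" "th \<in> strip sg" "mu \<in> LC'" and d: "thin 1 x (fst dl1 + (x, 0))" "norm (snd dl1) <= cmod x"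
      "thin 1 x (fst dl2 + (x, 0))" "norm (snd dl2) <= cmod x" for x th mu and dl1 dl2 :: "('m, 'd) xy_angle"
  proof -
    note p = pt[OF q] and p1 = pos_thin[OF q d(1,2)] and p2 = pos_thin[OF q d(3,4)]
    have xx: "cmod x < x0" using p(3) rh(4) by linarith
    note nl = Ki(3)[rule_format, OF p(2) xx p1(1) p2(1) p(6) p1(4) p2(4) p2(3) p(4)]
    have e1: "(fst (K (x, th, mu)) + fst dl1 - (fst (K (x, th, mu)) + fst dl2), th + k (x, th, mu) + snd dl1 - (th + k (x, th, mu) + snd dl2)) = dl1 - dl2"
      by (simp add: prod_eq_iff)
    have e2: "MD.Fl (fst (K (x, th, mu)) + fst dl1, th + k (x, th, mu) + snd dl1, mu) - MD.Fl (fst (K (x, th, mu)) + fst dl2, th + k (x, th, mu) + snd dl2, mu) +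
      (0, th + k (x, th, mu) + snd dl1 - (th + k (x, th, mu) + snd dl2)) = \<Phi> (x, th, mu) dl1 - \<Phi> (x, th, mu) dl2"
      by (simp add: \<Phi>_def prod_eq_iff algebra_simps)
    show ?thesis using nl unfolding e1 e2 .
  qed
  have KfD: "(%z. fst (K z)) cholomorphic_on ?D" and RfD: "(%z. fst (R z)) cholomorphic_on ?D" and kD: "k cholomorphic_on ?D"
    using Kf Rf k DD0 oD by (auto simp: analytic_fun_def intro: chol_subset)
  have hol: "(%z. \<Phi> z (g z)) cholomorphic_on ?D"
    if g: "g cholomorphic_on ?D" and adm: "!!z. z \<in> ?D ==> thin 1 (fst z) (fst (g z) + (fst z, 0)) & norm (snd (g z)) <= cmod (fst z)" for g
  proof -
    have rrh: "rr cholomorphic_on ?D" unfolding rr_def by (intro cholomorphic_intros RfD oD)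
    have im: "rr ` ?D \<subseteq> ?D" using rrD by (rule image_subsetI)
    have Krr: "(%z. fst (K (rr z))) cholomorphic_on ?D" "(%z. k (rr z)) cholomorphic_on ?D"
      by (rule chol_compose[OF rrh KfD im], rule chol_compose[OF rrh kD im])
    have "(%z. (fst (K z) + fst (g z), fst (snd z) + k z + snd (g z), snd (snd z))) cholomorphic_on ?D"
      by (intro cholomorphic_intros KfD kD oD g)
    then have "(%z. MD.Fl (fst (K z) + fst (g z), fst (snd z) + k z + snd (g z), snd (snd z))) cholomorphic_on ?D"
    proof (rule chol_compose[OF _ MD.Fl_cholomorphic], intro image_subsetI)
      fix z assume z: "z \<in> ?D"
      then have q: "fst z \<in> sector bt rh" "fst (snd z) \<in> strip sg" "snd (snd z) \<in> LC'" by auto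
      show "(fst (K z) + fst (g z), fst (snd z) + k z + snd (g z), snd (snd z)) \<in> W"
        using pos_thin(5)[OF q conjunct1[OF adm[OF z]] conjunct2[OF adm[OF z]]] by simp
    qed
    then show ?thesis unfolding \<Phi>_def by (intro cholomorphic_intros Krr kD g oD)
  qed
  have rrl: "rr (x, th + l, mu) = (fst (R (x, th, mu)), th + cvec \<omega> + l, mu)"
    if q: "x \<in> sector bt rh" "th \<in> strip sg" "mu \<in> LC'" and l: "l \<in> lattice_pts" for x th mu l
  proof -
    have "fst (R (x, th + l, mu)) = fst (R (x, th, mu))" using Rf pt(1)[OF q] l by (simp add: analytic_fun_def)
    then show ?thesis by (simp add: rr_def add_ac)
  qed
  have per: "\<Phi> (x, th + l, mu) d = \<Phi> (x, th, mu) d"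
    if q: "x \<in> sector bt rh" "th \<in> strip sg" "mu \<in> LC'" and l: "l \<in> lattice_pts" and d: "thin 1 x (fst d + (x, 0))" "norm (snd d) <= cmod x"
    for x th mu l and d :: "('m, 'd) xy_angle"
  proof -
    have z: "(x, th, mu) \<in> ?D" using q by simp
    have r: "(fst (R (x, th, mu)), th + cvec \<omega>, mu) \<in> ?D" using rrD[OF z] by (simp add: rr_def)
    have 1: "fst (K (x, th + l, mu)) = fst (K (x, th, mu))" using Kf pt(1)[OF q] l by (simp add: analytic_fun_def)
    have 2: "k (x, th + l, mu) = k (x, th, mu)" using k z l unfolding analytic_fun_def by blast
    have 3: "k (rr (x, th + l, mu)) = k (rr (x, th, mu))"
      using k r l unfolding analytic_fun_def rrl[OF q l] by (simp add: rr_def)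
    have 4: "fst (K (rr (x, th + l, mu))) = fst (K (rr (x, th, mu)))"
      using Kf subsetD[OF DD0 r] l unfolding analytic_fun_def rrl[OF q l] by (simp add: rr_def)
    have 5: "MD.Fl (fst (K (x, th, mu)) + fst d, th + k (x, th, mu) + snd d + l, mu) = MD.Fl (fst (K (x, th, mu)) + fst d, th + k (x, th, mu) + snd d, mu)"
      by (rule MD.Fl_periodic[OF pos_thin(5)[OF q d] l])
    have 6: "th + l + k (x, th, mu) + snd d = th + k (x, th, mu) + snd d + l" by (simp add: add_ac)
    show ?thesis unfolding \<Phi>_def 3 4 fst_conv snd_conv 1 2 6 5 by (rule refl)
  qed
  have radD: "analytic_fun ?D (%z. fst (R z))" by (rule analytic_fun_subset[OF Rf tD DD0])
  have coeffD: "analytic_coeff sg LC' f" if "analytic_coeff \<sigma>0 \<Lambda>C f" for f :: "('d, 'p) angle_param => 'x::complex_normed_space"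
  proof -
    have sub: "strip sg \<subseteq> (strip \<sigma>0 :: (complex ^ 'd) set)" "LC' \<subseteq> \<Lambda>C" using LC'(3) L(2) sg by (auto simp: strip_def intro: less_trans)
    have "f cholomorphic_on strip sg \<times> LC'"
    proof (rule chol_subset)
      show "f cholomorphic_on strip \<sigma>0 \<times> \<Lambda>C" using that by (simp add: analytic_coeff_def)
      show "open ((strip sg :: (complex ^ 'd) set) \<times> LC')" by (rule open_Times[OF open_strip LC'(1)])
      show "(strip sg :: (complex ^ 'd) set) \<times> LC' \<subseteq> strip \<sigma>0 \<times> \<Lambda>C" using sub by (rule Sigma_mono)
    qed
    moreover have "f (th + l, mu) = f (th, mu)" if "th \<in> strip sg" "mu \<in> LC'" "l \<in> lattice_pts" for th mu l
      using \<open>analytic_coeff \<sigma>0 \<Lambda>C f\<close> subsetD[OF sub(1) that(1)] subsetD[OF sub(2) that(2)] that(3) unfolding analytic_coeff_def by blast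
    ultimately show ?thesis unfolding analytic_coeff_def by blast
  qed
  have nrm2: "nrm mu (v - x ^ (N - 1) *\<^sub>C (torus_average B mu *v v)) <= nrm mu v" if mu: "mu \<in> LC'" and x: "x \<in> sector bt rh" for mu x v
  proof -
    have t: "cmod x <= 1" "cmod x <= dl" using sector_norm[OF x] rh(1,24) by linarith+
    have "cmod x ^ (N - 1) <= cmod x" using power_decreasing[of 1 "N - 1" "cmod x"] t NP(1) by simp
    then have "cmod (x ^ (N - 1)) <= dl" using t(2) by (simp add: norm_power)
    then show ?thesis using nrm mu sector_power_angle(1)[OF x c2(6)] by (simp add: adapted_def)
  qed
  have f1: "rh <= 1" "al0 * rh <= 1" "0 <= Ki" "4 * rh * ((2 * Cc ^ 2 + 4 * Ki) * (Cn + 1) + Ki) <= ep * kp"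
    using rh(1,17,18) Ki(1) by (simp_all add: mult_ac)
  have f2: "fst (R (x, th, mu)) \<in> sector bt rh'" if "rh' <= rh" "x \<in> sector bt rh'" "th \<in> strip sg" "mu \<in> LC'" for x th mu rh'
    by (rule rad(1)[OF that])
  have f3: "cmod (fst (R (x, th, mu))) <= cmod x * (1 - (Re (torus_average a mu) - ep) * cmod x ^ (N - 1)) &
        cmod x <= (1 + (real N * Re (torus_average a mu) + ep) * cmod x ^ (N - 1)) * cmod (fst (R (x, th, mu))) &
        cmod (fst (R (x, th, mu)) ^ (N - 1) - x ^ (N - 1)) <= Cc * cmod x * cmod (x ^ (N - 1))"
    if "x \<in> sector bt rh" "th \<in> strip sg" "mu \<in> LC'" for x th mu
    using rad(2-4)[OF order_refl that] by blast
  interpret AI: averaging_iteration N Q bt rh sg LC' \<omega> "%z. fst (R z)" \<Phi> a m "torus_average a" B M "torus_average B" nrm al0 ep ep' kp Cn Cc Ki CE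
    by unfold_locales (fact NP(1) Q \<rho>0 f1 f2 radD f3 c1 CE(1) kp kpK rh(19,20,21) coeffD[OF coeffs(1)] coeffD[OF coeffs(2)]
      av[rule_format, THEN conjunct1] bspec[OF av, THEN conjunct2, THEN conjunct2, THEN conjunct2, THEN conjunct1] bd1[rule_format] bd2[rule_format]
      avg1[rule_format] avg2[rule_format] nrm[rule_format, THEN conjunct1] nrm2 incr err hol per)+
  have rr_eq: "AI.rr = rr" by (rule ext) (simp add: AI.rr_def rr_def)
  have adm_iff: "d \<in> AI.admissible z \<longleftrightarrow> thin 1 (fst z) (fst d + (fst z, 0)) & norm (snd d) <= cmod (fst z)" for d z
    by (simp add: AI.admissible_def)
  obtain u where u: "analytic_fun ?D u" and u': "\<forall>z\<in>?D. \<Phi> z (u z) = u (rr z) & u z \<in> AI.admissible z & AI.wn z (u z) <= AI.Mw * AI.w2 z"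
    using AI.solution unfolding rr_eq by (elim exE conjE)
  have ueq: "\<Phi> z (u z) = u (rr z)" "u z \<in> AI.admissible z" "AI.wn z (u z) <= AI.Mw * AI.w2 z" if "z \<in> ?D" for z
    using bspec[OF u' that] by auto
  define M1 where "M1 = 2 * AI.Mw / kp + 2 * AI.Mw + AI.Mw + 1"
  have Mw0: "0 <= AI.Mw" using c1 CE(1) by (simp add: AI.Mw_def)
  have M1: "0 < M1" "2 * AI.Mw / kp <= M1" "2 * AI.Mw <= M1" "AI.Mw <= M1" using Mw0 kp(1) by (auto simp: M1_def add_nonneg_pos)
  have ubd: "cmod (fst (fst (u z))) <= M1 * cmod (fst z) ^ (Q + 1)" "norm (snd (fst (u z))) <= M1 * cmod (fst z) ^ (Q + 1)"
    "norm (snd (u z)) <= M1 * cmod (fst z) ^ Q" if "z \<in> ?D" for z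
    using AI.ball_admissible(2-4)[OF that ueq(3)[OF that]] M1 mult_right_mono[OF M1(2), of "cmod (fst z) ^ (Q + 1)"]
      mult_right_mono[OF M1(3), of "cmod (fst z) ^ (Q + 1)"] mult_right_mono[OF M1(4), of "cmod (fst z) ^ Q"] by auto
  have correction_u: "correction W F K R Q sg ?D u"
    unfolding correction_def
  proof (intro conjI ballI allI impI)
    have "analytic_fun ?D (%z. fst (u z))" "analytic_fun ?D (%z. snd (u z))"
      using u by (auto simp: analytic_fun_def intro: chol_fst chol_snd)
    then show "analytic_map ?D u" by (simp add: analytic_map_def analytic_fun_torus_valued)
    show "order_O ?D (Q + 1) (%z. cmod (fst (fst (u z))))" "order_O ?D (Q + 1) (%z. norm (snd (fst (u z))))"
      unfolding order_O_def using ubd(1,2) M1(1) \<rho>0 by (intro exI[of _ M1] conjI exI[of _ rh]; force)+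
    show "order_O ?D Q (%z. torus_norm (snd (u z)))"
      unfolding order_O_def using order_trans[OF torus_norm_le_norm ubd(3)] M1(1) \<rho>0 by (intro exI[of _ M1] conjI exI[of _ rh]; force)
  next
    fix z assume z: "z \<in> ?D"
    then have q: "fst z \<in> sector bt rh" "fst (snd z) \<in> strip sg" "snd (snd z) \<in> LC'" by auto
    have "norm (snd (u z)) <= cmod (fst z)" using ueq(2)[OF z] by (simp add: adm_iff)
    then have "norm (snd (u z)) < sg" using pt(3)[OF q] rh(22) sg by linarith
    then have "\<bar>Im (snd (u z) $ i)\<bar> < sg" for i
      by (rule le_less_trans[OF order_trans[OF abs_Im_le_cmod Finite_Cartesian_Product.norm_nth_le]])
    then show "snd (u z) \<in> strip sg" by (simp add: strip_def)
    have d: "thin 1 (fst z) (fst (u z) + (fst z, 0))" "norm (snd (u z)) <= cmod (fst z)" using ueq(2)[OF z] by (auto simp: adm_iff)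
    note mn = main[OF q d refl torus_eq_refl, unfolded prod.collapse]
    obtain l where l: "l \<in> lattice_pts" "snd (R z) = fst (snd z) + cvec \<omega> + l" using KR(3)[OF z] by blast
    have "(fst (R z), fst (snd z) + cvec \<omega>, snd (snd z)) \<in> ?D" using rrD[OF z] by (simp add: rr_def)
    then have uR: "u (?Rz z) = u (rr z)"
      using u l(1) unfolding analytic_fun_def l(2) rr_def by blast
    have pc: "(F \<circ>\<^sub>\<mu> (%w. K w + u w)) z = F (fst (K z + u z), snd (K z + u z), snd (snd z))"
      "((%w. K w + u w) \<circ>\<^sub>\<mu> R) z = K (?Rz z) + u (?Rz z)"
      by (simp_all add: param_comp_def split_def)
    show "fst ((F \<circ>\<^sub>\<mu> (%w. K w + u w)) z) = fst (((%w. K w + u w) \<circ>\<^sub>\<mu> R) z)"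
      unfolding pc uR fst_add using mn(2) ueq(1)[OF z] by (simp add: algebra_simps)
    have "snd (F (fst (K z + u z), snd (K z + u z), snd (snd z))) - snd (K (?Rz z)) \<doteq> snd (u (rr z))"
      using mn(3) ueq(1)[OF z] by simp
    then have "snd (F (fst (K z + u z), snd (K z + u z), snd (snd z))) \<doteq> snd (K (?Rz z)) + snd (u (rr z))"
      by (simp add: torus_eq_def diff_diff_eq)
    then show "snd ((F \<circ>\<^sub>\<mu> (%w. K w + u w)) z) \<doteq> snd (((%w. K w + u w) \<circ>\<^sub>\<mu> R) z)"
      unfolding pc uR snd_add[symmetric] .
  next
    fix x th mu assume z: "(x, th, mu) \<in> ?D"
    then have q: "x \<in> sector bt rh" "th \<in> strip sg" "mu \<in> LC'" by auto
    have d: "thin 1 x (fst (u (x, th, mu)) + (x, 0))" "norm (snd (u (x, th, mu))) <= cmod x" using ueq(2)[OF z] by (auto simp: adm_iff)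
    show "(fst (K (x, th, mu) + u (x, th, mu)), snd (K (x, th, mu) + u (x, th, mu)), mu) \<in> W"
      by (rule main(1)[OF q d refl torus_eq_refl])
  qed
  \<comment> \<open>A competing correction obeys its order bounds only near the vertex. There it is
    lifted, shown to be admissible and compared with \<open>u\<close>; the equality is then
    continued in \<open>x\<close> to the whole sector.\<close>
  have unique: "fst (\<Delta>' z) = fst (u z) & snd (\<Delta>' z) \<doteq> snd (u z)" if c: "correction W F K R Q sg ?D \<Delta>'" and z: "z \<in> ?D" for \<Delta>' z
  proof -
    note c' = c[unfolded correction_def]
    have am: "analytic_fun ?D (%z. fst (\<Delta>' z))" "analytic_torus_valued ?D (%z. snd (\<Delta>' z))" using c' by (auto simp: analytic_map_def)
    have eqs: "\<forall>z\<in>?D. fst ((F \<circ>\<^sub>\<mu> (%w. K w + \<Delta>' w)) z) = fst (((%w. K w + \<Delta>' w) \<circ>\<^sub>\<mu> R) z) &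
      snd ((F \<circ>\<^sub>\<mu> (%w. K w + \<Delta>' w)) z) \<doteq> snd (((%w. K w + \<Delta>' w) \<circ>\<^sub>\<mu> R) z)"
      using c' by (elim conjE)
    obtain C1 r1 where C1: "C1 > 0" "r1 > 0" "!!x th mu. (x, th, mu) \<in> ?D ==> cmod x < r1 ==> cmod (fst (fst (\<Delta>' (x, th, mu)))) <= C1 * cmod x ^ (Q + 1)"
      by (rule order_O_obtain[of ?D "Q + 1" "%z. cmod (fst (fst (\<Delta>' z)))"]) (use c' in auto)
    obtain C2 r2 where C2: "C2 > 0" "r2 > 0" "!!x th mu. (x, th, mu) \<in> ?D ==> cmod x < r2 ==> norm (snd (fst (\<Delta>' (x, th, mu)))) <= C2 * cmod x ^ (Q + 1)"
      by (rule order_O_obtain[of ?D "Q + 1" "%z. norm (snd (fst (\<Delta>' z)))"]) (use c' in auto)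
    obtain C3 r3 where C3: "C3 > 0" "r3 > 0" "!!x th mu. (x, th, mu) \<in> ?D ==> cmod x < r3 ==> torus_norm (snd (\<Delta>' (x, th, mu))) <= C3 * cmod x ^ Q"
      by (rule order_O_obtain[of ?D Q "%z. torus_norm (snd (\<Delta>' z))"]) (use c' in auto)
    \<comment> \<open>On the smaller sector the order constants of the competitor are absorbed by a
      factor \<open>|x|\<close>; the entry with \<open>1 / 8\<close> also makes its angle
      liftable.\<close>
    have "\<exists>rh'>0. \<forall>p\<in>set [(1, rh), (1, r1), (1, r2), (1, r3), (C1, 1), (C2, 1), (C3, 1 / 8)]. rh' * fst p <= snd p"
      by (rule small_radius) (use \<rho>0 C1 C2 C3 in simp)
    then obtain rh' where rh'0: "0 < rh'" and rh': "rh' * 1 <= rh" "rh' * 1 <= r1" "rh' * 1 <= r2" "rh' * 1 <= r3" "rh' * C1 <= 1" "rh' * C2 <= 1" "rh' * C3 <= 1 / 8"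
      unfolding list.set ball_simps fst_conv snd_conv by (elim exE conjE) (rule that)
    let ?D' = "sector bt rh' \<times> (strip sg :: (complex ^ 'd) set) \<times> LC'"
    have le: "rh' <= rh" using rh'(1) by simp
    have sub: "?D' \<subseteq> ?D" using sector_mono[OF order_refl le] by blast
    have bd: "cmod (fst (fst (\<Delta>' z))) <= C1 * cmod (fst z) ^ (Q + 1)" "norm (snd (fst (\<Delta>' z))) <= C2 * cmod (fst z) ^ (Q + 1)"
      "torus_norm (snd (\<Delta>' z)) <= C3 * cmod (fst z) ^ Q" "cmod (fst (fst (\<Delta>' z))) <= cmod (fst z) ^ 2" "norm (snd (fst (\<Delta>' z))) <= cmod (fst z) ^ 2"
      "torus_norm (snd (\<Delta>' z)) <= 1 / 8" "torus_norm (snd (\<Delta>' z)) <= cmod (fst z)" if z: "z \<in> ?D'" for z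
    proof -
      let ?t = "cmod (fst z)"
      have t: "0 < ?t" "?t < rh'" using sector_norm[of "fst z" bt rh'] z by auto
      have t1: "?t <= 1" using t le f1(1) by linarith
      have zD: "(fst z, fst (snd z), snd (snd z)) \<in> ?D" using subsetD[OF sub z] by simp
      show b: "cmod (fst (fst (\<Delta>' z))) <= C1 * ?t ^ (Q + 1)" "norm (snd (fst (\<Delta>' z))) <= C2 * ?t ^ (Q + 1)" "torus_norm (snd (\<Delta>' z)) <= C3 * ?t ^ Q"
        using C1(3)[OF zD] C2(3)[OF zD] C3(3)[OF zD] t rh'(2-4) by auto
      have tQ: "?t ^ Q <= ?t ^ 2" using t t1 NP(1) Q by (intro power_decreasing) auto
      have ct: "c * ?t ^ (Q + 1) <= ?t ^ 2" if "0 < c" "rh' * c <= 1" for c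
      proof -
        have "?t * c <= 1" using mult_right_mono[of ?t rh' c] t that by linarith
        then have "(?t * c) * ?t ^ Q <= 1 * ?t ^ Q" by (intro mult_right_mono) auto
        then show ?thesis using tQ by (simp add: mult_ac)
      qed
      show "cmod (fst (fst (\<Delta>' z))) <= ?t ^ 2" "norm (snd (fst (\<Delta>' z))) <= ?t ^ 2"
        using b(1,2) ct[OF C1(1) rh'(5)] ct[OF C2(1) rh'(6)] by linarith+
      have c3: "?t * C3 <= 1 / 8" using mult_right_mono[of ?t rh' C3] t C3(1) rh'(7) by linarith
      have "C3 * ?t ^ Q <= C3 * ?t ^ 2" using tQ C3(1) by (intro mult_left_mono) auto
      also have "... = (?t * C3) * ?t" by (simp add: power2_eq_square)
      also have "... <= 1 / 8 * ?t" using c3 by (intro mult_right_mono) auto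
      finally have "torus_norm (snd (\<Delta>' z)) <= 1 / 8 * ?t" using b(3) by linarith
      then show "torus_norm (snd (\<Delta>' z)) <= 1 / 8" "torus_norm (snd (\<Delta>' z)) <= ?t" using t t1 by linarith+
    qed
    have "\<exists>h. analytic_fun ?D' h & (\<forall>z\<in>?D'. h z \<doteq> snd (\<Delta>' z) & norm (h z) = torus_norm (snd (\<Delta>' z)))"
      using bd(6) by (intro lift_small analytic_torus_valued_subset[OF am(2) tD sub]) force
    then obtain h where h: "\<forall>z\<in>?D'. h z \<doteq> snd (\<Delta>' z) & norm (h z) = torus_norm (snd (\<Delta>' z))" by (elim exE conjE)
    define v where "v z = (fst (\<Delta>' z), h z)" for z
    have vadm: "v z \<in> AI.admissible z" if "z \<in> ?D'" for z
      using bd(4,5,7)[OF that] bspec[OF h that] by (simp add: AI.in_admissible_iff v_def)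
    have rrD': "rr z \<in> ?D'" if "z \<in> ?D'" for z using AI.rr_D[OF le that] by (simp add: rr_eq)
    have veq: "\<Phi> z (v z) = v (rr z)" if z: "z \<in> ?D'" for z
    proof -
      have zD: "z \<in> ?D" using subsetD[OF sub z] .
      then have q: "fst z \<in> sector bt rh" "fst (snd z) \<in> strip sg" "snd (snd z) \<in> LC'" by auto
      have d: "thin 1 (fst z) (fst (v z) + (fst z, 0))" "norm (snd (v z)) <= cmod (fst z)" using vadm[OF z] by (auto simp: adm_iff)
      have e: "fst (\<Delta>' z) = fst (v z)" "snd (\<Delta>' z) \<doteq> snd (v z)" using torus_eq_sym[OF conjunct1[OF bspec[OF h z]]] by (simp_all add: v_def)
      note mn = main[OF q d e[unfolded prod.collapse], unfolded prod.collapse]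
      obtain l where l: "l \<in> lattice_pts" "snd (R z) = fst (snd z) + cvec \<omega> + l" using KR(3)[OF zD] by blast
      have rD: "(fst (R z), fst (snd z) + cvec \<omega>, snd (snd z)) \<in> ?D" using rrD[OF zD] by (simp add: rr_def)
      have f: "fst (\<Delta>' (?Rz z)) = fst (\<Delta>' (rr z))"
        using am(1) rD l(1) unfolding analytic_fun_def l(2) rr_def by blast
      have s: "snd (\<Delta>' (?Rz z)) \<doteq> snd (\<Delta>' (rr z))"
        using am(2) rD l(1) unfolding analytic_torus_valued_def l(2) rr_def by blast
      have pc: "(F \<circ>\<^sub>\<mu> (%w. K w + \<Delta>' w)) z = F (fst (K z + \<Delta>' z), snd (K z + \<Delta>' z), snd (snd z))"
        "((%w. K w + \<Delta>' w) \<circ>\<^sub>\<mu> R) z = K (?Rz z) + \<Delta>' (?Rz z)"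
        by (simp_all add: param_comp_def split_def)
      have ce: "fst (F (fst (K z + \<Delta>' z), snd (K z + \<Delta>' z), snd (snd z))) = fst (K (?Rz z)) + fst (\<Delta>' (?Rz z))"
        "snd (F (fst (K z + \<Delta>' z), snd (K z + \<Delta>' z), snd (snd z))) \<doteq> snd (K (?Rz z)) + snd (\<Delta>' (?Rz z))"
        using bspec[OF eqs zD] unfolding pc by simp_all
      have "fst (\<Phi> z (v z)) = fst (v (rr z))" using mn(2) ce(1) f by (simp add: v_def)
      \<comment> \<open>Both sides are shorter than \<open>1 / 2\<close> and congruent, hence
        equal.\<close>
      moreover have "snd (\<Phi> z (v z)) = snd (v (rr z))"
      proof (rule small_torus_eq)
        have "snd (F (fst (K z + \<Delta>' z), snd (K z + \<Delta>' z), snd (snd z))) - snd (K (?Rz z)) \<doteq> snd (\<Delta>' (?Rz z))"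
          using ce(2) by (simp add: torus_eq_def diff_diff_eq)
        from torus_eq_trans[OF torus_eq_sym[OF mn(3)] this] torus_eq_trans[OF s torus_eq_sym[OF conjunct1[OF bspec[OF h rrD'[OF z]]]]]
        show "snd (\<Phi> z (v z)) \<doteq> snd (v (rr z))" unfolding v_def snd_conv by (rule torus_eq_trans)
        show "norm (snd (\<Phi> z (v z))) < 1 / 2" using \<Phi>_small[OF q d] by simp
        show "norm (snd (v (rr z))) < 1 / 2" using bd(6)[OF rrD'[OF z]] bspec[OF h rrD'[OF z]] by (simp add: v_def)
      qed
      ultimately show ?thesis by (simp add: prod_eq_iff)
    qed
    define M2 where "M2 = M1 + C1 + C2 + C3"
    have M2: "0 <= M2" "M1 + C1 <= M2" "M1 + C2 <= M2" "M1 + C3 <= M2" using M1(1) C1(1) C2(1) C3(1) by (auto simp: M2_def)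
    have uv: "u z = v z" if z: "z \<in> ?D'" for z
    proof (rule AI.unique[OF le, of u v M2 z, unfolded rr_eq])
      fix w assume w: "w \<in> ?D'"
      let ?t = "cmod (fst w)"
      have wD: "w \<in> ?D" using subsetD[OF sub w] .
      show "\<Phi> w (u w) = u (rr w)" "u w \<in> AI.admissible w" using ueq[OF wD] by auto
      show "\<Phi> w (v w) = v (rr w)" "v w \<in> AI.admissible w" using veq[OF w] vadm[OF w] by auto
      have "cmod (fst (fst (u w - v w))) <= M1 * ?t ^ (Q + 1) + C1 * ?t ^ (Q + 1)"
        unfolding fst_diff v_def fst_conv by (rule order_trans[OF norm_triangle_ineq4 add_mono[OF ubd(1)[OF wD] bd(1)[OF w]]])
      also have "... <= M2 * ?t ^ (Q + 1)" unfolding distrib_right[symmetric] by (intro mult_right_mono M2) auto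
      finally have 1: "cmod (fst (fst (u w - v w))) <= M2 * ?t ^ (Q + 1)" .
      have "norm (snd (fst (u w - v w))) <= M1 * ?t ^ (Q + 1) + C2 * ?t ^ (Q + 1)"
        unfolding fst_diff snd_diff v_def fst_conv by (rule order_trans[OF norm_triangle_ineq4 add_mono[OF ubd(2)[OF wD] bd(2)[OF w]]])
      also have "... <= M2 * ?t ^ (Q + 1)" unfolding distrib_right[symmetric] by (intro mult_right_mono M2) auto
      finally have 2: "norm (snd (fst (u w - v w))) <= M2 * ?t ^ (Q + 1)" .
      have "norm (h w) <= C3 * ?t ^ Q" using bd(3)[OF w] bspec[OF h w] by simp
      then have "norm (snd (u w - v w)) <= M1 * ?t ^ Q + C3 * ?t ^ Q"
        unfolding snd_diff v_def snd_conv by (rule order_trans[OF norm_triangle_ineq4 add_mono[OF ubd(3)[OF wD]]])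
      also have "... <= M2 * ?t ^ Q" unfolding distrib_right[symmetric] by (intro mult_right_mono M2) auto
      finally show "cmod (fst (fst (u w - v w))) <= M2 * ?t ^ (Q + 1) & norm (snd (fst (u w - v w))) <= M2 * ?t ^ (Q + 1) & norm (snd (u w - v w)) <= M2 * ?t ^ Q"
        using 1 2 by blast
    qed (fact M2(1) z)+
    have near: "fst (\<Delta>' (x, q)) = fst (u (x, q))" "snd (\<Delta>' (x, q)) \<doteq> snd (u (x, q))" if "x \<in> sector bt rh'" "q \<in> strip sg \<times> LC'" for x q
    proof -
      have w: "(x, q) \<in> ?D'" using that by simp
      show "fst (\<Delta>' (x, q)) = fst (u (x, q))" "snd (\<Delta>' (x, q)) \<doteq> snd (u (x, q))"
        using uv[OF w] torus_eq_sym[OF conjunct1[OF bspec[OF h w]]] by (simp_all add: v_def)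
    qed
    obtain x q where zq: "z = (x, q)" "x \<in> sector bt rh" "q \<in> strip sg \<times> LC'" using z by (cases z) auto
    have h1: "(%z. fst (\<Delta>' z)) cholomorphic_on ?D" "(%z. fst (u z)) cholomorphic_on ?D"
      using am(1) u by (auto simp: analytic_fun_def intro: chol_fst)
    have "fst (fst (\<Delta>' (x, q))) = fst (fst (u (x, q)))"
      by (rule sector_continuation[OF chol_fst[OF h1(1)] chol_fst[OF h1(2)] c2(2,4) rh'0 le _ zq(2,3)]) (simp add: near(1))
    moreover have "snd (fst (\<Delta>' (x, q))) $ i = snd (fst (u (x, q))) $ i" for i
      by (rule sector_continuation[OF chol_vec_nth[OF chol_snd[OF h1(1)]] chol_vec_nth[OF chol_snd[OF h1(2)]]
            c2(2,4) rh'0 le _ zq(2,3)]) (simp add: near(1))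
    \<comment> \<open>The lift of the competitor exists only near the vertex, so on the whole sector
      its angle is continued as a congruence.\<close>
    moreover have "analytic_torus_valued ?D (%z. snd (u z))"
      by (rule analytic_fun_torus_valued) (use u in \<open>auto simp: analytic_fun_def intro: chol_snd\<close>)
    then have "snd (\<Delta>' (x, q)) \<doteq> snd (u (x, q))"
      by (rule sector_continuation_torus[OF am(2) _ c2(2,4) rh'0 le near(2) zq(2,3)])
    ultimately show ?thesis by (simp add: zq(1) prod_eq_iff vec_eq_iff)
  qed
  show "\<exists>bt rh \<Lambda>C'. 0 < bt & bt <= \<beta>0 & 0 < rh & rh <= \<rho>0 &
      open \<Lambda>C' & cvec ` \<Lambda>0 \<subseteq> \<Lambda>C' & \<Lambda>C' \<subseteq> \<Lambda>C &
      (\<forall>z \<in> sector bt rh \<times> strip sg \<times> \<Lambda>C'. fst (R z) \<in> sector bt rh) &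
      (\<exists>\<Delta>. correction W F K R Q sg (sector bt rh \<times> strip sg \<times> \<Lambda>C') \<Delta> &
        (\<forall>\<Delta>'. correction W F K R Q sg (sector bt rh \<times> strip sg \<times> \<Lambda>C') \<Delta>' -->
          (\<forall>z \<in> sector bt rh \<times> strip sg \<times> \<Lambda>C'.
            fst (\<Delta>' z) = fst (\<Delta> z) & snd (\<Delta>' z) \<doteq> snd (\<Delta> z))))"
  proof (rule exI[of _ bt], rule exI[of _ rh], rule exI[of _ LC'], intro conjI)
    show "0 < bt" "bt <= \<beta>0" "0 < rh" "open LC'" "cvec ` \<Lambda>0 \<subseteq> LC'" by (fact c2 \<rho>0 LC')+
    show "rh <= \<rho>0" using rh(2) by simp
    show "LC' \<subseteq> \<Lambda>C" using LC'(3) L(2) by blast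
    show "\<forall>z\<in>?D. fst (R z) \<in> sector bt rh" using rad(1)[OF order_refl] by auto
    show "\<exists>\<Delta>. correction W F K R Q sg ?D \<Delta> & (\<forall>\<Delta>'. correction W F K R Q sg ?D \<Delta>' --> (\<forall>z\<in>?D. fst (\<Delta>' z) = fst (\<Delta> z) & snd (\<Delta>' z) \<doteq> snd (\<Delta> z)))"
      by (rule exI[of _ u]) (intro conjI allI impI ballI correction_u conjunct1[OF unique] conjunct2[OF unique])
  qed
qed

end
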